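(* Let $\psi\colon G\twoheadrightarrow H$ be an epimorphism of groups, and let $R$ be a $G$-graded ring. a) If $M$ is a $G$-graded $R$-module, then $\mathrm{dp}(M)=\mathrm{dp}(M_{[\psi]})$ and $\mathrm{dpl}(M)=\mathrm{dpl}(M_{[\psi]})$. b) $\ker(\psi)$ is finite if and only if $\mathrm{di}(M)=\mathrm{di}(M_{[\psi]})$ for every $G$-graded $R$-module $M$.
   Context: Groups are commutative and written additively; rings are commutative with $1$. A $G$-graded ring is a ring $R$ with a family $(R_g)_{g\in G}$ of additive subgroups whose direct sum is $R$ and with $R_gR_h\subseteq R_{g+h}$. A $G$-graded $R$-module is an $R$-module $M$ with a family $(M_g)_{g\in G}$ of additive subgroups whose direct sum is $M$ and with $R_gM_h\subseteq M_{g+h}$. $\mathsf{Mod}(R)$ is the (abelian) category of $G$-graded $R$-modules, with morphisms the $R$-linear maps $u\colon M\to N$ with $u(M_g)\subseteq N_g$ for all $g$. For an epimorphism of groups $\psi\colon G\twoheadrightarrow H$, the $\psi$-coarsening $R_{[\psi]}$ (resp. $M_{[\psi]}$) is the $H$-graded ring (resp. $H$-graded $R_{[\psi]}$-module) with the same underlying ring (resp. module) and with component of degree $h\in H$ equal to $\bigoplus_{g\in\psi^{-1}(h)}R_g$ (resp. $\bigoplus_{g\in\psi^{-1}(h)}M_g$). A $G$-graded $R$-module $M$ is flat if $\bullet\otimes_RM\colon\mathsf{Mod}(R)\to\mathsf{Mod}(R)$ is exact, where tensor products carry their usual graduation. For a graded module $M$, the projective dimension $\mathrm{dp}(M)$,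 injective dimension $\mathrm{di}(M)$, and flat dimension $\mathrm{dpl}(M)$ are the infima in $\mathbb N\cup\{\infty\}$ (with $0\in\mathbb N$, $\inf\emptyset=\infty$) of the lengths $n\in\mathbb N$ of, respectively, projective, injective and flat resolutions of $M$ of finite length, taken in the category of graded modules to which $M$ belongs ($\mathsf{Mod}(R)$ for $M$, $\mathsf{Mod}(R_{[\psi]})$ for $M_{[\psi]}$).
   Formalization: In b) R is not fixed: the condition reads "for every G-graded ring R and every G-graded R-module M" (for R = 0 the fixed-R claim fails). Resolutions and test modules range over a type large enough to give the usual dimensions; in b) the carrier types are infinite. *)

theory Defs
  imports "HOL-Library.Extended_Nat" "HOL-Algebra.Free_Abelian_Groups" "HOL-Algebra.Module"
    "HOL-Algebra.AbelCoset"
begin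

text \<open>
  The groups of degrees are commutative groups of HOL-Algebra, hence written multiplicatively:
  the degree \<open>g + h\<close> of the mathematical text is \<open>g \<otimes>\<^bsub>G\<^esub> h\<close>. Only the values of a graduation at
  elements of \<open>carrier G\<close> are meaningful.
\<close>

section \<open>Graded rings and modules\<close>

record ('g, 'r) gring = "'r ring" +
  rcomp :: "'g \<Rightarrow> 'r set"

record ('g, 'r, 'm) gmodule = "('r, 'm) module" +
  mcomp :: "'g \<Rightarrow> 'm set"

definition sum_of_family ::
    "('a, 'z) ring_scheme \<Rightarrow> 'i set \<Rightarrow> ('i \<Rightarrow> 'a set) \<Rightarrow> 'a set" where
  "sum_of_family A I B = {finsum A x F | x F. finite F \<and> F \<subseteq> I \<and> x \<in> (\<Pi> i\<in>F. B i)}"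

definition is_direct_sum ::
    "('a, 'z) ring_scheme \<Rightarrow> 'i set \<Rightarrow> ('i \<Rightarrow> 'a set) \<Rightarrow> bool" where
  "is_direct_sum A I B \<longleftrightarrow>
     (\<forall>i\<in>I. additive_subgroup (B i) A) \<and>
     sum_of_family A I B = carrier A \<and>
     (\<forall>F x. finite F \<and> F \<subseteq> I \<and> x \<in> (\<Pi> i\<in>F. B i) \<and> finsum A x F = \<zero>\<^bsub>A\<^esub>
        \<longrightarrow> (\<forall>i\<in>F. x i = \<zero>\<^bsub>A\<^esub>))"

locale graded_ring = G: comm_group G + R: cring R
  for G :: "('g, 'x) monoid_scheme" and R :: "('g, 'r) gring" +
  assumes ring_direct_sum: "is_direct_sum R (carrier G) (rcomp R)"
    and rcomp_mult: "\<lbrakk>g \<in> carrier G; h \<in> carrier G; a \<in> rcomp R g; b \<in> rcomp R h\<rbrakk>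
      \<Longrightarrow> a \<otimes>\<^bsub>R\<^esub> b \<in> rcomp R (g \<otimes>\<^bsub>G\<^esub> h)"

locale graded_module = graded_ring G R + module R M
  for G :: "('g, 'x) monoid_scheme" and R :: "('g, 'r) gring" and M :: "('g, 'r, 'm) gmodule" +
  assumes module_direct_sum: "is_direct_sum M (carrier G) (mcomp M)"
    and mcomp_smult: "\<lbrakk>g \<in> carrier G; h \<in> carrier G; a \<in> rcomp R g; x \<in> mcomp M h\<rbrakk>
      \<Longrightarrow> a \<odot>\<^bsub>M\<^esub> x \<in> mcomp M (g \<otimes>\<^bsub>G\<^esub> h)"

definition graded_hom ::
    "('g, 'x) monoid_scheme \<Rightarrow> ('g, 'r) gring \<Rightarrow> ('g, 'r, 'a) gmodule \<Rightarrow> ('g, 'r, 'b) gmodule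
      \<Rightarrow> ('a \<Rightarrow> 'b) set" where
  "graded_hom G R M N =
     {u \<in> carrier M \<rightarrow> carrier N.
        (\<forall>x\<in>carrier M. \<forall>y\<in>carrier M. u (x \<oplus>\<^bsub>M\<^esub> y) = u x \<oplus>\<^bsub>N\<^esub> u y) \<and>
        (\<forall>a\<in>carrier R. \<forall>x\<in>carrier M. u (a \<odot>\<^bsub>M\<^esub> x) = a \<odot>\<^bsub>N\<^esub> u x) \<and>
        (\<forall>g\<in>carrier G. u ` mcomp M g \<subseteq> mcomp N g)}"


section \<open>Coarsening\<close>

definition coarsen_ring ::
    "('g, 'x) monoid_scheme \<Rightarrow> ('g \<Rightarrow> 'h) \<Rightarrow> ('g, 'r) gring \<Rightarrow> ('h, 'r) gring" where
  "coarsen_ring G \<psi> R =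
     \<lparr>carrier = carrier R, monoid.mult = monoid.mult R, monoid.one = monoid.one R,
      ring.zero = ring.zero R, ring.add = ring.add R,
      rcomp = (\<lambda>h. sum_of_family R {g \<in> carrier G. \<psi> g = h} (rcomp R))\<rparr>"

definition coarsen_module ::
    "('g, 'x) monoid_scheme \<Rightarrow> ('g \<Rightarrow> 'h) \<Rightarrow> ('g, 'r, 'm) gmodule \<Rightarrow> ('h, 'r, 'm) gmodule" where
  "coarsen_module G \<psi> M =
     \<lparr>carrier = carrier M, monoid.mult = monoid.mult M, monoid.one = monoid.one M,
      ring.zero = ring.zero M, ring.add = ring.add M, module.smult = module.smult M,
      mcomp = (\<lambda>h. sum_of_family M {g \<in> carrier G. \<psi> g = h} (mcomp M))\<rparr>"


section \<open>Projective and injective graded modules\<close>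

text \<open>
  In the category of graded modules, the epimorphisms and monomorphisms are the surjective and
  the injective morphisms. In this and the next section the test objects are modules with elements
  in the same type \<open>'u\<close> as the module under consideration; below, \<open>'u\<close> is always the
  type \<open>univ\<close>, which is large enough for this not to be a restriction.
\<close>

definition projective ::
    "('g, 'x) monoid_scheme \<Rightarrow> ('g, 'r) gring \<Rightarrow> ('g, 'r, 'u) gmodule \<Rightarrow> bool" where
  "projective G R P \<longleftrightarrow> graded_module G R P \<and>
     (\<forall>(A :: ('g, 'r, 'u) gmodule) (B :: ('g, 'r, 'u) gmodule).
        \<forall>p \<in> graded_hom G R A B. \<forall>f \<in> graded_hom G R P B.
          graded_module G R A \<longrightarrow> graded_module G R B \<longrightarrow> p ` carrier A = carrier B \<longrightarrow>
          (\<exists>w \<in> graded_hom G R P A. \<forall>x\<in>carrier P. p (w x) = f x))"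

definition injective ::
    "('g, 'x) monoid_scheme \<Rightarrow> ('g, 'r) gring \<Rightarrow> ('g, 'r, 'u) gmodule \<Rightarrow> bool" where
  "injective G R J \<longleftrightarrow> graded_module G R J \<and>
     (\<forall>(A :: ('g, 'r, 'u) gmodule) (B :: ('g, 'r, 'u) gmodule).
        \<forall>j \<in> graded_hom G R A B. \<forall>f \<in> graded_hom G R A J.
          graded_module G R A \<longrightarrow> graded_module G R B \<longrightarrow> inj_on j (carrier A) \<longrightarrow>
          (\<exists>w \<in> graded_hom G R B J. \<forall>x\<in>carrier A. w (j x) = f x))"


section \<open>Tensor products and flat graded modules\<close>

text \<open>
  The tensor product is the quotient of the free abelian group on \<open>carrier A \<times> carrier M\<close> by the
  subgroup \<open>tensor_rel R A M\<close>; its elements are cosets.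
\<close>

definition tensor_free ::
    "('g, 'r, 'a) gmodule \<Rightarrow> ('g, 'r, 'm) gmodule \<Rightarrow> ('a \<times> 'm \<Rightarrow>\<^sub>0 int) monoid" where
  "tensor_free A M = free_Abelian_group (carrier A \<times> carrier M)"

definition tensor_rel ::
    "('g, 'r) gring \<Rightarrow> ('g, 'r, 'a) gmodule \<Rightarrow> ('g, 'r, 'm) gmodule \<Rightarrow> ('a \<times> 'm \<Rightarrow>\<^sub>0 int) set" where
  "tensor_rel R A M = generate (tensor_free A M)
     ({frag_of (x \<oplus>\<^bsub>A\<^esub> x', y) - frag_of (x, y) - frag_of (x', y) | x x' y.
         x \<in> carrier A \<and> x' \<in> carrier A \<and> y \<in> carrier M} \<union>
      {frag_of (x, y \<oplus>\<^bsub>M\<^esub> y') - frag_of (x, y) - frag_of (x, y') | x y y'.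
         x \<in> carrier A \<and> y \<in> carrier M \<and> y' \<in> carrier M} \<union>
      {frag_of (r \<odot>\<^bsub>A\<^esub> x, y) - frag_of (x, r \<odot>\<^bsub>M\<^esub> y) | r x y.
         r \<in> carrier R \<and> x \<in> carrier A \<and> y \<in> carrier M})"

definition pure_tensor ::
    "('g, 'r) gring \<Rightarrow> ('g, 'r, 'a) gmodule \<Rightarrow> ('g, 'r, 'm) gmodule \<Rightarrow> 'a \<Rightarrow> 'm
      \<Rightarrow> ('a \<times> 'm \<Rightarrow>\<^sub>0 int) set" where
  "pure_tensor R A M x y = tensor_rel R A M #>\<^bsub>tensor_free A M\<^esub> frag_of (x, y)"

text \<open>
  For a homomorphism \<open>f\<close> from \<open>A\<close> to \<open>B\<close>, the map \<open>tensor_map R B M f\<close> is the homomorphism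
  induced by \<open>f\<close> from the tensor product of \<open>A\<close> and \<open>M\<close> to the one of \<open>B\<close> and \<open>M\<close>: a coset \<open>Z\<close> is
  mapped to the coset that contains the image of \<open>Z\<close> under the map of free groups.
\<close>

definition tensor_map ::
    "('g, 'r) gring \<Rightarrow> ('g, 'r, 'b) gmodule \<Rightarrow> ('g, 'r, 'm) gmodule \<Rightarrow> ('a \<Rightarrow> 'b)
      \<Rightarrow> ('a \<times> 'm \<Rightarrow>\<^sub>0 int) set \<Rightarrow> ('b \<times> 'm \<Rightarrow>\<^sub>0 int) set" where
  "tensor_map R B M f Z =
     tensor_rel R B M <#>\<^bsub>tensor_free B M\<^esub> (frag_extend (\<lambda>(x, y). frag_of (f x, y)) ` Z)"

text \<open>The locale \<open>module\<close> does not constrain the fields \<open>mult\<close> and \<open>one\<close> of a module record.\<close>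

definition tensor ::
    "('g, 'x) monoid_scheme \<Rightarrow> ('g, 'r) gring \<Rightarrow> ('g, 'r, 'a) gmodule \<Rightarrow> ('g, 'r, 'm) gmodule
      \<Rightarrow> ('g, 'r, ('a \<times> 'm \<Rightarrow>\<^sub>0 int) set) gmodule" where
  "tensor G R A M =
     (let T = tensor_free A M Mod tensor_rel R A M in
      \<lparr>carrier = carrier T, monoid.mult = undefined, monoid.one = undefined,
       ring.zero = monoid.one T, ring.add = monoid.mult T,
       module.smult = (\<lambda>r. tensor_map R A M (\<lambda>x. r \<odot>\<^bsub>A\<^esub> x)),
       mcomp = (\<lambda>g. generate T
         {pure_tensor R A M x y | x y h k.
            h \<in> carrier G \<and> k \<in> carrier G \<and> h \<otimes>\<^bsub>G\<^esub> k = g \<and> x \<in> mcomp A h \<and> y \<in> mcomp M k})\<rparr>)"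

definition short_exact ::
    "('g, 'x) monoid_scheme \<Rightarrow> ('g, 'r) gring \<Rightarrow> ('g, 'r, 'a) gmodule \<Rightarrow> ('g, 'r, 'b) gmodule
      \<Rightarrow> ('g, 'r, 'c) gmodule \<Rightarrow> ('a \<Rightarrow> 'b) \<Rightarrow> ('b \<Rightarrow> 'c) \<Rightarrow> bool" where
  "short_exact G R A B C f g \<longleftrightarrow>
     graded_module G R A \<and> graded_module G R B \<and> graded_module G R C \<and>
     f \<in> graded_hom G R A B \<and> g \<in> graded_hom G R B C \<and>
     inj_on f (carrier A) \<and> f ` carrier A = a_kernel B C g \<and> g ` carrier B = carrier C"

definition flat ::
    "('g, 'x) monoid_scheme \<Rightarrow> ('g, 'r) gring \<Rightarrow> ('g, 'r, 'u) gmodule \<Rightarrow> bool" where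
  "flat G R M \<longleftrightarrow> graded_module G R M \<and>
     (\<forall>(A :: ('g, 'r, 'u) gmodule) (B :: ('g, 'r, 'u) gmodule) (C :: ('g, 'r, 'u) gmodule) f g.
        short_exact G R A B C f g \<longrightarrow>
        short_exact G R (tensor G R A M) (tensor G R B M) (tensor G R C M)
          (tensor_map R B M f) (tensor_map R C M g))"


section \<open>Resolutions and dimensions\<close>

text \<open>
  The members of the resolutions of a module with elements in \<open>'m\<close> over a ring with elements in
  \<open>'r\<close> live in the following type, and so do the test objects for projectivity, injectivity and
  flatness. The cardinality \<open>c\<close> of this type is infinite, at least those of \<open>'r\<close> and \<open>'m\<close>, and
  satisfies \<open>c ^ (card 'r * aleph_0) = c\<close>. Hence, up to isomorphism, the graded modules with
  elements in this type contain the given module, the ring and all its shifts, and are closed under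
  submodules, quotients, free covers and embeddings into injectives (coinduced from divisible
  groups). In particular Baer's criterion and its analogue for flatness can be tested there, and
  restriction to this type changes neither the three properties nor the dimensions.
\<close>

type_synonym ('r, 'm) univ = "('r \<times> nat \<times> 'm) set"

text \<open>
  Resolutions are infinite exact sequences; those of length at most \<open>n\<close> vanish beyond position \<open>n\<close>.
\<close>

definition left_resolution ::
    "('g, 'x) monoid_scheme \<Rightarrow> ('g, 'r) gring \<Rightarrow> ('g, 'r, 'm) gmodule
      \<Rightarrow> (nat \<Rightarrow> ('g, 'r, 'u) gmodule) \<Rightarrow> (nat \<Rightarrow> 'u \<Rightarrow> 'u) \<Rightarrow> ('u \<Rightarrow> 'm) \<Rightarrow> bool" where
  "left_resolution G R M P d e \<longleftrightarrow>
     (\<forall>i. graded_module G R (P i)) \<and>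
     (\<forall>i. d i \<in> graded_hom G R (P (Suc i)) (P i)) \<and>
     e \<in> graded_hom G R (P 0) M \<and>
     e ` carrier (P 0) = carrier M \<and>
     d 0 ` carrier (P (Suc 0)) = a_kernel (P 0) M e \<and>
     (\<forall>i. d (Suc i) ` carrier (P (Suc (Suc i))) = a_kernel (P (Suc i)) (P i) (d i))"

definition right_resolution ::
    "('g, 'x) monoid_scheme \<Rightarrow> ('g, 'r) gring \<Rightarrow> ('g, 'r, 'm) gmodule
      \<Rightarrow> (nat \<Rightarrow> ('g, 'r, 'u) gmodule) \<Rightarrow> (nat \<Rightarrow> 'u \<Rightarrow> 'u) \<Rightarrow> ('m \<Rightarrow> 'u) \<Rightarrow> bool" where
  "right_resolution G R M J d e \<longleftrightarrow>
     (\<forall>i. graded_module G R (J i)) \<and>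
     (\<forall>i. d i \<in> graded_hom G R (J i) (J (Suc i))) \<and>
     e \<in> graded_hom G R M (J 0) \<and>
     inj_on e (carrier M) \<and>
     e ` carrier M = a_kernel (J 0) (J (Suc 0)) (d 0) \<and>
     (\<forall>i. d i ` carrier (J i) = a_kernel (J (Suc i)) (J (Suc (Suc i))) (d (Suc i)))"

definition vanishes_beyond :: "nat \<Rightarrow> (nat \<Rightarrow> ('g, 'r, 'u) gmodule) \<Rightarrow> bool" where
  "vanishes_beyond n P \<longleftrightarrow> (\<forall>i>n. carrier (P i) = {\<zero>\<^bsub>P i\<^esub>})"

definition dp :: "('g, 'x) monoid_scheme \<Rightarrow> ('g, 'r) gring \<Rightarrow> ('g, 'r, 'm) gmodule \<Rightarrow> enat" where
  "dp G R M = Inf {enat n | n. \<exists>(P :: nat \<Rightarrow> ('g, 'r, ('r, 'm) univ) gmodule) d e.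
     left_resolution G R M P d e \<and> (\<forall>i. projective G R (P i)) \<and> vanishes_beyond n P}"

definition dpl :: "('g, 'x) monoid_scheme \<Rightarrow> ('g, 'r) gring \<Rightarrow> ('g, 'r, 'm) gmodule \<Rightarrow> enat" where
  "dpl G R M = Inf {enat n | n. \<exists>(P :: nat \<Rightarrow> ('g, 'r, ('r, 'm) univ) gmodule) d e.
     left_resolution G R M P d e \<and> (\<forall>i. flat G R (P i)) \<and> vanishes_beyond n P}"

definition di :: "('g, 'x) monoid_scheme \<Rightarrow> ('g, 'r) gring \<Rightarrow> ('g, 'r, 'm) gmodule \<Rightarrow> enat" where
  "di G R M = Inf {enat n | n. \<exists>(J :: nat \<Rightarrow> ('g, 'r, ('r, 'm) univ) gmodule) d e.
     right_resolution G R M J d e \<and> (\<forall>i. injective G R (J i)) \<and> vanishes_beyond n J}"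

end

theory Submission
 imports Defs "HOL-Library.Nat_Bijection"
begin

text \<open>
  Coarsening is exact, and it has an exact right adjoint: it sends \<open>A\<close> to the finitely supported
  families \<open>x\<close> with \<open>x g\<close> of degree \<open>\<psi> g\<close> in \<open>A\<close>. Hence coarsening preserves projective modules; it
  preserves flat modules since tensoring with a coarsened module is, degree by degree, a retract of
  tensoring with the module itself after the right adjoint. Both properties are also reflected.
  Kernels of epimorphisms between projective (flat) modules are projective (flat), so by dimension
  shifting along a free cover the lengths of left resolutions agree.

  If \<open>ker \<psi>\<close> is finite, the right adjoint is also left adjoint to coarsening. Then both functors
  preserve injective modules, and \<open>M\<close> is a retract of the module obtained by coarsening and applying
  the adjoint; since modules of injective dimension at most \<open>n\<close> are closed under retracts, the
  injective dimensions agree. If \<open>ker \<psi>\<close> is infinite, take countably many injective modules whose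
  direct sum is not injective and place them in pairwise distinct degrees of the kernel: the graded
  module obtained is injective, its coarsening is not.
\<close>

text \<open>Projectivity, injectivity and flatness are tested on modules with elements in a single
  type \<open>'u\<close>, and this shapes the constructions. Families indexed by degrees may be too
  many for \<open>'u\<close>, as \<open>'g\<close> is unrelated to it. So the right adjoint is cut
  down to a set \<open>S\<close> of degrees: the subgroup generated by the degrees in which the ring
  or the module is nonzero. Such a degree is named by a nonzero homogeneous element, so
  \<open>S\<close> embeds into \<open>'u\<close>. For injectives all degrees are kept, and finite
  fibres of \<psi> give the bound. Sums, free modules and families are moved into \<open>'u\<close>
  along injections; cokernels consist of representatives.

  No derived functors occur: resolutions are cut into short exact sequences and lengths are compared
  by induction with explicit pullbacks and sums, so that projective and flat modules share one
  argument. Since tensor products are right exact, flatness is a matter of injectivity.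

  In the counterexample the injective modules are the groups of order two attached to the natural
  numbers, over a countable Boolean ring that fits into every infinite type.\<close>

notation graded_module ("gmod") and graded_hom ("ghom")

abbreviation (input) zero_at ("\<zero>\<^sub>_" [1000] 1000) where "\<zero>\<^sub>A \<equiv> ring.zero A"
abbreviation (input) one_at ("\<one>\<^sub>_" [1000] 1000) where "\<one>\<^sub>A \<equiv> monoid.one A"
abbreviation (input) add_at ("(_ \<oplus>\<^sub>_ _)" [65, 1000, 66] 65) where "x \<oplus>\<^sub>A y \<equiv> ring.add A x y"
abbreviation (input) minus_at ("(_ \<ominus>\<^sub>_ _)" [65, 1000, 66] 65) where "x \<ominus>\<^sub>A y \<equiv> a_minus A x y"
abbreviation (input) uminus_at ("(\<ominus>\<^sub>_ _)" [1000, 81] 80) where "\<ominus>\<^sub>A x \<equiv> a_inv A x"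
abbreviation (input) mult_at ("(_ \<otimes>\<^sub>_ _)" [70, 1000, 71] 70) where "x \<otimes>\<^sub>A y \<equiv> monoid.mult A x y"
abbreviation (input) smult_at ("(_ \<odot>\<^sub>_ _)" [70, 1000, 71] 70) where "r \<odot>\<^sub>A x \<equiv> module.smult A r x"

section \<open>Direct sums\<close>

text \<open>Additivity is separated from linearity because most identities below are checked in one
  variable at a time on generators, where the maps in question (components, scalar actions, partial
  tensors) are merely additive.\<close>

definition addhom :: "('a,'y) ring_scheme => ('b,'z) ring_scheme => ('a => 'b) set" where
 "addhom A B = {h \<in> carrier A \<rightarrow> carrier B.
   \<forall>x\<in>carrier A. \<forall>y\<in>carrier A. h (x \<oplus>\<^sub>A y) = h x \<oplus>\<^sub>B h y}"

lemma addhomI: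
 assumes "\<And>x. x \<in> carrier A ==> h x \<in> carrier B"
  and "\<And>x y. [|x \<in> carrier A; y \<in> carrier A|] ==> h (x \<oplus>\<^sub>A y) = h x \<oplus>\<^sub>B h y"
 shows "h \<in> addhom A B"
 using assms by (auto simp: addhom_def)

lemma addhom_closed: "[|h \<in> addhom A B; x \<in> carrier A|] ==> h x \<in> carrier B"
 by (auto simp: addhom_def)

lemma addhom_add:
 "[|h \<in> addhom A B; x \<in> carrier A; y \<in> carrier A|] ==> h (x \<oplus>\<^sub>A y) = h x \<oplus>\<^sub>B h y"
 by (auto simp: addhom_def)

lemma addhom_zero:
 assumes "abelian_group A" "abelian_group B" "h \<in> addhom A B"
 shows "h \<zero>\<^sub>A = \<zero>\<^sub>B"
proof -
 interpret A: abelian_group A by fact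
 interpret B: abelian_group B by fact
 have "h \<zero>\<^sub>A \<oplus>\<^sub>B h \<zero>\<^sub>A = h \<zero>\<^sub>A"
  using addhom_add[OF assms(3), of "\<zero>\<^sub>A" "\<zero>\<^sub>A"] by simp
 thus ?thesis
  using addhom_closed[OF assms(3)] by (metis A.zero_closed B.add.r_cancel_one')
qed

lemma addhom_minus:
 assumes "abelian_group A" "abelian_group B" "h \<in> addhom A B" "x \<in> carrier A"
 shows "h (\<ominus>\<^bsub>A\<^esub> x) = \<ominus>\<^sub>B h x"
proof -
 interpret A: abelian_group A by fact
 interpret B: abelian_group B by fact
 have "h (\<ominus>\<^bsub>A\<^esub> x) \<oplus>\<^sub>B h x = \<zero>\<^sub>B"
  using addhom_add[OF assms(3), of "\<ominus>\<^sub>A x" x] assms addhom_zero[OF assms(1-3)]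
  by (simp add: A.l_neg)
 thus ?thesis
  using addhom_closed[OF assms(3)] assms by (metis A.a_inv_closed B.minus_equality)
qed

lemma addhom_diff:
 assumes "abelian_group A" "abelian_group B" "h \<in> addhom A B" "x \<in> carrier A" "y \<in> carrier A"
 shows "h (x \<ominus>\<^sub>A y) = h x \<ominus>\<^sub>B h y"
proof -
 interpret A: abelian_group A by fact
 show ?thesis
  using assms by (simp add: a_minus_def addhom_add[OF assms(3)] addhom_minus[OF assms(1-3)])
qed

lemma addhom_finsum:
 assumes "abelian_group A" "abelian_group B" "h \<in> addhom A B" "c \<in> F \<rightarrow> carrier A"
 shows "h (finsum A c F) = finsum B (\<lambda>i. h (c i)) F"
proof -
 interpret A: abelian_group A by fact
 interpret B: abelian_group B by fact
 show ?thesis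
  using assms(4)
 proof (induction F rule: infinite_finite_induct)
  case (infinite F)
  thus ?case using addhom_zero[OF assms(1-3)] by simp
 next
  case empty
  thus ?case using addhom_zero[OF assms(1-3)] by simp
 next
  case (insert i F)
  hence "c i \<in> carrier A" "c \<in> F \<rightarrow> carrier A" by auto
  hence "(\<lambda>i. h (c i)) \<in> F \<rightarrow> carrier B" "h (c i) \<in> carrier B"
   using addhom_closed[OF assms(3)] by auto
  thus ?case
   using insert \<open>c i \<in> carrier A\<close> \<open>c \<in> F \<rightarrow> carrier A\<close>
   by (simp add: addhom_add[OF assms(3)])
 qed
qed

lemma addhom_comp: "[|f \<in> addhom A B; g \<in> addhom B C|] ==> (\<lambda>x. g (f x)) \<in> addhom A C"
 by (auto simp: addhom_def Pi_iff)

text \<open>The family is a total function that vanishes off \<open>I\<close>. This makes it unique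
  as a function, so components are compared by extensionality and supports need not be intersected
  with \<open>I\<close>.\<close>

definition dcomp :: "('a,'z) ring_scheme => 'i set => ('i => 'a set) => 'a => 'i => 'a" where
 "dcomp A I B x = (SOME c. (\<forall>i\<in>I. c i \<in> B i) \<and> (\<forall>i. i \<notin> I \<longrightarrow> c i = \<zero>\<^sub>A) \<and>
   finite {i. c i \<noteq> \<zero>\<^sub>A} \<and> x = finsum A c {i. c i \<noteq> \<zero>\<^sub>A})"

lemma (in abelian_monoid) finsum_support:
 assumes "finite F" "\<And>i. i \<notin> F ==> c i = \<zero>" "c \<in> F \<rightarrow> carrier G"
 shows "finsum G c F = finsum G c {i. c i \<noteq> \<zero>}"
 by (rule add.finprod_mono_neutral_cong_right) (use assms in auto)

lemma (in abelian_group) diff_zero_iff: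
 "[|x \<in> carrier G; y \<in> carrier G|] ==> x \<ominus> y = \<zero> \<longleftrightarrow> x = y"
 using add.right_cancel[of y "x \<ominus> y" \<zero>] by (auto simp: a_minus_def a_assoc l_neg r_neg)

section \<open>Components in an internal direct sum\<close>

locale direct_sum = abelian_group A for A (structure) +
 fixes I :: "'i set" and B :: "'i => 'a set"
 assumes ds: "is_direct_sum A I B"
begin

lemma B_subgroup: "i \<in> I ==> additive_subgroup (B i) A"
 using ds by (auto simp: is_direct_sum_def)

lemma B_carr: "[|x \<in> B i; i \<in> I|] ==> x \<in> carrier A"
 using additive_subgroup.a_Hcarr[OF B_subgroup] by blast

lemma B_zero: "i \<in> I ==> \<zero> \<in> B i"
 using additive_subgroup.zero_closed[OF B_subgroup] by blast

lemma B_add: "[|x \<in> B i; y \<in> B i; i \<in> I|] ==> x \<oplus> y \<in> B i"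
 using additive_subgroup.a_closed[OF B_subgroup] by blast

lemma B_minus: "[|x \<in> B i; i \<in> I|] ==> \<ominus> x \<in> B i"
 by (metis B_subgroup abelian_group_axioms additive_subgroup.a_subgroup a_inv_def
   group.m_inv_consistent subgroup.m_inv_closed add.group_axioms a_group)

lemma B_diff: "[|x \<in> B i; y \<in> B i; i \<in> I|] ==> x \<ominus> y \<in> B i"
 by (simp add: a_minus_def B_add B_minus)

lemma sum_unique:
 assumes "finite F" "F \<subseteq> I" "c \<in> (\<Pi> i\<in>F. B i)" "finsum A c F = \<zero>" "i \<in> F"
 shows "c i = \<zero>"
 using ds assms unfolding is_direct_sum_def by blast

lemma dcomp_unique:
 assumes c: "\<forall>i\<in>I. c i \<in> B i" "\<forall>i. i \<notin> I \<longrightarrow> c i = \<zero>" "finite {i. c i \<noteq> \<zero>}"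
  and d: "\<forall>i\<in>I. d i \<in> B i" "\<forall>i. i \<notin> I \<longrightarrow> d i = \<zero>" "finite {i. d i \<noteq> \<zero>}"
  and eq: "finsum A c {i. c i \<noteq> \<zero>} = finsum A d {i. d i \<noteq> \<zero>}"
 shows "c = d"
proof -
 let ?F = "{i. c i \<noteq> \<zero>} \<union> {i. d i \<noteq> \<zero>}"
 \<comment> \<open>Both families are padded to the union of their supports, where the difference is
   a single vanishing sum to which independence applies.\<close>
 have F: "finite ?F" "?F \<subseteq> I" using c d by auto
 have carr: "c i \<in> carrier A" "d i \<in> carrier A" for i
  using c d B_carr by (metis zero_closed)+
 have "finsum A c ?F = finsum A c {i. c i \<noteq> \<zero>}" "finsum A d ?F = finsum A d {i. d i \<noteq> \<zero>}"
  by (rule finsum_support; use F carr in auto)+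
 hence "finsum A c ?F = finsum A d ?F" using eq by simp
 moreover have "finsum A (\<lambda>i. c i \<ominus> d i) ?F \<oplus> finsum A d ?F = finsum A c ?F"
  using carr by (subst finsum_addf[symmetric])
   (auto intro!: finsum_cong simp: a_minus_def a_assoc l_neg)
 moreover have "finsum A (\<lambda>i. c i \<ominus> d i) ?F \<in> carrier A" "finsum A d ?F \<in> carrier A"
  by (rule finsum_closed, simp add: carr Pi_iff)+
 ultimately have *: "finsum A (\<lambda>i. c i \<ominus> d i) ?F = \<zero>"
  using add.right_cancel[of "finsum A d ?F" "finsum A (\<lambda>i. c i \<ominus> d i) ?F" \<zero>] by simp
 have "c i \<ominus> d i = \<zero>" if "i \<in> ?F" for i
  by (rule sum_unique[OF F _ * that]) (use F c d in \<open>auto intro!: B_diff\<close>)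
 hence "c i = d i" if "i \<in> ?F" for i
  using that carr diff_zero_iff by blast
 hence "c i = d i" for i by (cases "i \<in> ?F") auto
 thus ?thesis by (rule ext)
qed

lemma dcomp_ex:
 assumes "x \<in> carrier A"
 shows "\<exists>c. (\<forall>i\<in>I. c i \<in> B i) \<and> (\<forall>i. i \<notin> I \<longrightarrow> c i = \<zero>) \<and>
   finite {i. c i \<noteq> \<zero>} \<and> x = finsum A c {i. c i \<noteq> \<zero>}"
proof -
 obtain F c where F: "finite F" "F \<subseteq> I" "c \<in> (\<Pi> i\<in>F. B i)" "x = finsum A c F"
  using assms ds unfolding is_direct_sum_def sum_of_family_def by blast
 define d where "d = (\<lambda>i. if i \<in> F then c i else \<zero>)"
 have dF: "d \<in> F \<rightarrow> carrier A" using F(2,3) B_carr by (fastforce simp: d_def)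
 have "x = finsum A d F"
  unfolding F(4) by (rule finsum_cong') (use dF in \<open>auto simp: d_def\<close>)
 also have "\<dots> = finsum A d {i. d i \<noteq> \<zero>}"
  by (rule finsum_support[OF F(1) _ dF]) (auto simp: d_def)
 finally have "x = finsum A d {i. d i \<noteq> \<zero>}" .
 moreover have "finite {i. d i \<noteq> \<zero>}"
  by (rule finite_subset[OF _ F(1)]) (auto simp: d_def)
 moreover have "\<forall>i\<in>I. d i \<in> B i" "\<forall>i. i \<notin> I \<longrightarrow> d i = \<zero>"
  using F B_zero by (auto simp: d_def)
 ultimately show ?thesis by blast
qed

abbreviation "\<pi> \<equiv> dcomp A I B"

lemma dcomp_props:
 assumes "x \<in> carrier A"
 shows "\<forall>i\<in>I. \<pi> x i \<in> B i" "\<forall>i. i \<notin> I \<longrightarrow> \<pi> x i = \<zero>"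
  "finite {i. \<pi> x i \<noteq> \<zero>}" "x = finsum A (\<pi> x) {i. \<pi> x i \<noteq> \<zero>}"
 using someI_ex[OF dcomp_ex[OF assms]] unfolding dcomp_def[symmetric] by auto

lemma dcomp_in: "[|x \<in> carrier A; i \<in> I|] ==> \<pi> x i \<in> B i"
 using dcomp_props by blast

lemma dcomp_out: "[|x \<in> carrier A; i \<notin> I|] ==> \<pi> x i = \<zero>"
 using dcomp_props by blast

lemma dcomp_closed [simp]: "x \<in> carrier A ==> \<pi> x i \<in> carrier A"
 by (metis B_carr dcomp_in dcomp_out zero_closed)

lemma dcomp_finite: "x \<in> carrier A ==> finite {i. \<pi> x i \<noteq> \<zero>}"
 using dcomp_props by blast

lemma dcomp_sum: "[|x \<in> carrier A; finite F; \<And>i. i \<notin> F ==> \<pi> x i = \<zero>|] ==> finsum A (\<pi> x) F = x"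
 using dcomp_props(4) finsum_support[of F "\<pi> x"] by auto

lemma dcomp_eqI:
 assumes "\<And>i. i \<in> I ==> c i \<in> B i" "\<And>i. i \<notin> I ==> c i = \<zero>"
  "finite F" "\<And>i. i \<notin> F ==> c i = \<zero>" "x = finsum A c F"
 shows "\<pi> x = c"
proof -
 have carr: "c i \<in> carrier A" for i using assms B_carr by (metis zero_closed)
 have x: "x = finsum A c {i. c i \<noteq> \<zero>}"
  unfolding assms(5) by (rule finsum_support) (use assms carr in auto)
 hence xc: "x \<in> carrier A"
  using finsum_closed[of c "{i. c i \<noteq> \<zero>}"] carr by (simp add: Pi_iff)
 have "finite {i. c i \<noteq> \<zero>}" by (rule finite_subset[OF _ assms(3)]) (use assms in auto)
 moreover have "\<forall>i\<in>I. c i \<in> B i" "\<forall>i. i \<notin> I \<longrightarrow> c i = \<zero>" using assms(1,2) by auto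
 moreover have "finsum A (\<pi> x) {i. \<pi> x i \<noteq> \<zero>} = finsum A c {i. c i \<noteq> \<zero>}"
  by (simp only: dcomp_props(4)[OF xc, symmetric] x[symmetric])
 ultimately show ?thesis by (intro dcomp_unique dcomp_props(1-3)[OF xc])
qed

lemma dcomp_hom: "[|x \<in> B i; i \<in> I|] ==> \<pi> x = (\<lambda>j. if j = i then x else \<zero>)"
 by (rule dcomp_eqI[where F = "{i}"]) (use B_carr B_zero in \<open>auto intro!: finsum_singleton\<close>)

lemma dcomp_hom': "[|x \<in> B i; i \<in> I|] ==> \<pi> x j = (if j = i then x else \<zero>)"
 using dcomp_hom by metis

lemma dcomp_zero: "\<pi> \<zero> i = \<zero>"
 by (subst dcomp_eqI[where F = "{}" and c = "\<lambda>_. \<zero>"]) (auto simp: B_zero)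

lemma dcomp_add:
 assumes "x \<in> carrier A" "y \<in> carrier A"
 shows "\<pi> (x \<oplus> y) i = \<pi> x i \<oplus> \<pi> y i"
proof -
 have "\<pi> (x \<oplus> y) = (\<lambda>i. \<pi> x i \<oplus> \<pi> y i)"
 proof (rule dcomp_eqI)
  let ?F = "{i. \<pi> x i \<noteq> \<zero>} \<union> {i. \<pi> y i \<noteq> \<zero>}"
  show "finite ?F" using assms dcomp_finite by auto
  have "finsum A (\<pi> x) ?F = x" "finsum A (\<pi> y) ?F = y"
   by (rule dcomp_sum; use assms dcomp_finite in auto)+
  thus "x \<oplus> y = (\<Oplus>i\<in>?F. \<pi> x i \<oplus> \<pi> y i)"
   using assms by (subst finsum_addf) auto
 qed (use assms in \<open>auto simp: dcomp_in dcomp_out intro!: B_add\<close>)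
 thus ?thesis by simp
qed

lemma dcomp_addhom: "(\<lambda>x. \<pi> x i) \<in> addhom A A"
 by (rule addhomI) (auto simp: dcomp_add)

lemma dcomp_ext:
 assumes "x \<in> carrier A" "y \<in> carrier A" "\<And>i. i \<in> I ==> \<pi> x i = \<pi> y i"
 shows "x = y"
proof -
 have "\<pi> x = \<pi> y" using assms dcomp_out by (metis ext)
 thus ?thesis using dcomp_props(4) assms by metis
qed

lemma sum_induct [consumes 1, case_names zero hom add]:
 assumes "x \<in> carrier A" "P \<zero>" "\<And>i x. [|i \<in> I; x \<in> B i|] ==> P x"
  "\<And>x y. [|x \<in> carrier A; y \<in> carrier A; P x; P y|] ==> P (x \<oplus> y)"
 shows "P x"
proof -
 have "P (finsum A (\<pi> x) F)" if "finite F" for F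
  using that
 proof (induction F)
  case empty
  thus ?case using assms(2) by simp
 next
  case (insert i F)
  have "P (\<pi> x i)" using assms(1-3) dcomp_in dcomp_out by metis
  moreover have "\<pi> x \<in> F \<rightarrow> carrier A" using assms(1) by auto
  ultimately show ?case using insert assms(1,4) by simp
 qed
 thus ?thesis using dcomp_props(3,4)[OF assms(1)] by metis
qed

lemma addhom_eqI:
 assumes "abelian_group X" "f \<in> addhom A X" "g \<in> addhom A X" "\<And>i x. [|i \<in> I; x \<in> B i|] ==> f x = g x"
  and "x \<in> carrier A"
 shows "f x = g x"
 using assms(5)
proof (induction rule: sum_induct)
 case zero
 thus ?case using addhom_zero[OF abelian_group_axioms assms(1)] assms by metis
qed (use assms in \<open>auto simp: addhom_add\<close>)

text \<open>The universal property of the direct sum as a coproduct: the maps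
  \<open>\<phi> i\<close> matter on \<open>B i\<close> and are glued to one additive map.\<close>

definition hsum :: "('c,'y) ring_scheme => ('i => 'a => 'c) => 'a => 'c" where
 "hsum X \<phi> x = finsum X (\<lambda>i. \<phi> i (\<pi> x i)) {i. \<pi> x i \<noteq> \<zero>}"

lemma hsum_props:
 assumes X: "abelian_group X"
  and \<phi>: "\<And>i x. [|i \<in> I; x \<in> B i|] ==> \<phi> i x \<in> carrier X"
   "\<And>i x y. [|i \<in> I; x \<in> B i; y \<in> B i|] ==> \<phi> i (x \<oplus> y) = \<phi> i x \<oplus>\<^sub>X \<phi> i y"
 shows "hsum X \<phi> \<in> addhom A X" "\<And>i x. [|i \<in> I; x \<in> B i|] ==> hsum X \<phi> x = \<phi> i x"
  "\<And>F x. [|x \<in> carrier A; finite F; F \<subseteq> I; \<And>i. i \<notin> F ==> \<pi> x i = \<zero>|]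
   ==> hsum X \<phi> x = finsum X (\<lambda>i. \<phi> i (\<pi> x i)) F"
proof -
 interpret X: abelian_group X by fact
 \<comment> \<open>Zero goes to zero, so summing over a set larger than the support changes nothing.
   This is needed because the support of a sum can be smaller than the union of the
   supports.\<close>
 have \<phi>0: "\<phi> i \<zero> = \<zero>\<^sub>X" if "i \<in> I" for i
  using \<phi>[OF that B_zero[OF that]] B_zero[OF that]
  by (metis X.add.r_cancel_one' l_zero zero_closed)
 show big: "hsum X \<phi> x = finsum X (\<lambda>i. \<phi> i (\<pi> x i)) F"
  if "x \<in> carrier A" "finite F" "F \<subseteq> I" "\<And>i. i \<notin> F ==> \<pi> x i = \<zero>" for F x
  unfolding hsum_def
  by (rule X.add.finprod_mono_neutral_cong_left)
   (use that \<phi>0 \<phi>(1) dcomp_in in \<open>auto simp: subset_iff\<close>)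
 show "hsum X \<phi> x = \<phi> i x" if "i \<in> I" "x \<in> B i" for i x
  by (subst big[of x "{i}"])
   (use that B_carr \<phi>(1) dcomp_hom in \<open>auto intro!: X.finsum_singleton simp: dcomp_hom[OF that(2,1)]\<close>)
 show "hsum X \<phi> \<in> addhom A X"
 proof (rule addhomI)
  fix x assume x: "x \<in> carrier A"
  show "hsum X \<phi> x \<in> carrier X"
   unfolding hsum_def
   by (rule X.finsum_closed) (use \<phi>(1) x dcomp_in dcomp_out in blast)
 next
  fix x y assume x: "x \<in> carrier A" and y: "y \<in> carrier A"
  let ?F = "{i. \<pi> x i \<noteq> \<zero>} \<union> {i. \<pi> y i \<noteq> \<zero>}"
  have F: "finite ?F" "?F \<subseteq> I" using x y dcomp_finite dcomp_out by auto
  have "hsum X \<phi> (x \<oplus> y) = finsum X (\<lambda>i. \<phi> i (\<pi> (x \<oplus> y) i)) ?F"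
   by (rule big) (use x y F dcomp_add in auto)
  also have "\<dots> = finsum X (\<lambda>i. \<phi> i (\<pi> x i) \<oplus>\<^sub>X \<phi> i (\<pi> y i)) ?F"
   by (rule X.finsum_cong')
    (use x y F \<phi> dcomp_in in \<open>auto simp: dcomp_add subset_iff\<close>)
  also have "\<dots> = finsum X (\<lambda>i. \<phi> i (\<pi> x i)) ?F \<oplus>\<^sub>X finsum X (\<lambda>i. \<phi> i (\<pi> y i)) ?F"
   by (rule X.finsum_addf) (use x y F \<phi> dcomp_in in \<open>auto simp: subset_iff\<close>)
  also have "\<dots> = hsum X \<phi> x \<oplus>\<^sub>X hsum X \<phi> y"
   by (subst (1 2) big[of _ ?F]) (use x y F in auto)
  finally show "hsum X \<phi> (x \<oplus> y) = hsum X \<phi> x \<oplus>\<^sub>X hsum X \<phi> y" .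
 qed
qed

end

lemma (in abelian_group) sum_of_family_carrier:
 "(\<And>i. i \<in> I ==> B i \<subseteq> carrier G) ==> sum_of_family G I B \<subseteq> carrier G"
 by (auto simp: sum_of_family_def intro!: finsum_closed)

text \<open>Applying \<open>p i\<close> to a vanishing sum of homogeneous terms isolates the term of
  index \<open>i\<close>, which gives independence. Generation has to be supplied; this suits
  quotients and tensor products, which come with generators.\<close>

lemma direct_sum_projI:
 fixes A (structure)
 assumes A: "abelian_group A"
  and B: "\<And>i. i \<in> I ==> additive_subgroup (B i) A"
  and p: "\<And>i. i \<in> I ==> p i \<in> addhom A A"
  and pid: "\<And>i j x. [|i \<in> I; j \<in> I; x \<in> B i|] ==> p j x = (if j = i then x else \<zero>)"
  and span: "carrier A \<subseteq> sum_of_family A I B"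
 shows "direct_sum A I B" "\<And>i x. [|x \<in> carrier A; i \<in> I|] ==> dcomp A I B x i = p i x"
proof -
 interpret abelian_group A by fact
 have Bc: "x \<in> carrier A" if "x \<in> B i" "i \<in> I" for i x
  using additive_subgroup.a_Hcarr[OF B] that by blast
 show ds: "direct_sum A I B"
 proof (intro direct_sum.intro direct_sum_axioms.intro A)
  have "c i = \<zero>" if F: "finite F" "F \<subseteq> I" "c \<in> (\<Pi> i\<in>F. B i)" "finsum A c F = \<zero>" "i \<in> F" for F c i
  proof -
   have i: "i \<in> I" using F by auto
   have c: "c \<in> F \<rightarrow> carrier A" using F Bc by blast
   have "\<zero> = p i (finsum A c F)" using addhom_zero[OF A A p[OF i]] F by simp
   also have "\<dots> = finsum A (\<lambda>j. p i (c j)) F"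
    by (rule addhom_finsum[OF A A p[OF i] c])
   also have "\<dots> = finsum A (\<lambda>j. if i = j then c j else \<zero>) F"
    by (rule finsum_cong') (use F pid i c in \<open>auto simp: subset_iff Pi_iff\<close>)
   also have "\<dots> = c i"
    by (rule add.finprod_singleton) (use F c in auto)
   finally show ?thesis by simp
  qed
  thus "is_direct_sum A I B"
   unfolding is_direct_sum_def using B span sum_of_family_carrier[of I B] Bc by blast
 qed
 interpret direct_sum A I B by fact
 show "dcomp A I B x i = p i x" if x: "x \<in> carrier A" and i: "i \<in> I" for i x
  by (rule addhom_eqI[OF A dcomp_addhom p[OF i] _ x]) (use pid i dcomp_hom' in auto)
qed

lemma (in abelian_group) sum_of_familyI:
 assumes "finite F" "F \<subseteq> I" "\<And>i. i \<in> F ==> c i \<in> B i" "x = finsum G c F"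
 shows "x \<in> sum_of_family G I B"
 using assms unfolding sum_of_family_def by blast

text \<open>Generation follows from separation: the difference of \<open>x\<close> and the finite
  sum of its projections is killed by every projection. This suits modules of functions, whose
  projections are explicit.\<close>

lemma direct_sum_sepI:
 fixes A (structure)
 assumes A: "abelian_group A"
  and B: "\<And>i. i \<in> I ==> additive_subgroup (B i) A"
  and p: "\<And>i. i \<in> I ==> p i \<in> addhom A A"
  and pid: "\<And>i j x. [|i \<in> I; j \<in> I; x \<in> B i|] ==> p j x = (if j = i then x else \<zero>)"
  and pB: "\<And>i x. [|i \<in> I; x \<in> carrier A|] ==> p i x \<in> B i"
  and fin: "\<And>x. x \<in> carrier A ==> finite {i\<in>I. p i x \<noteq> \<zero>}"
  and sep: "\<And>x. [|x \<in> carrier A; \<And>i. i \<in> I ==> p i x = \<zero>|] ==> x = \<zero>"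
 shows "direct_sum A I B" "\<And>i x. [|x \<in> carrier A; i \<in> I|] ==> dcomp A I B x i = p i x"
proof -
 interpret abelian_group A by fact
 have "carrier A \<subseteq> sum_of_family A I B"
 proof
  fix x assume x: "x \<in> carrier A"
  let ?F = "{i\<in>I. p i x \<noteq> \<zero>}" let ?y = "finsum A (\<lambda>i. p i x) ?F"
  have c: "(\<lambda>i. p i x) \<in> ?F \<rightarrow> carrier A" using addhom_closed[OF p x] by auto
  have y: "?y \<in> carrier A" using c by simp
  have "x \<ominus> ?y = \<zero>"
  proof (rule sep)
   fix j assume j: "j \<in> I"
   have "p j ?y = finsum A (\<lambda>i. p j (p i x)) ?F"
    by (rule addhom_finsum[OF A A p[OF j] c])
   also have "\<dots> = finsum A (\<lambda>i. if j = i then p i x else \<zero>) ?F"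
    by (rule finsum_cong') (use pid pB j x c in auto)
   also have "\<dots> = p j x"
   proof (cases "j \<in> ?F")
    case True
    thus ?thesis using add.finprod_singleton[OF True fin[OF x] c] by simp
   next
    case False
    hence "p j x = \<zero>" using j by simp
    moreover have "finsum A (\<lambda>i. if j = i then p i x else \<zero>) ?F = finsum A (\<lambda>i. \<zero>) ?F"
     by (rule finsum_cong') (use False in auto)
    ultimately show ?thesis by simp
   qed
   finally have "p j ?y = p j x" .
   thus "p j (x \<ominus> ?y) = \<zero>"
    using addhom_diff[OF A A p[OF j] x y] addhom_closed[OF p[OF j] x]
    by (simp add: a_minus_def r_neg)
  qed (use x y in simp)
  hence "x = ?y" using diff_zero_iff[OF x y] by simp
  thus "x \<in> sum_of_family A I B"
   by (intro sum_of_familyI[OF fin[OF x] _ _ \<open>x = ?y\<close>]) (use x pB in auto)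
 qed
 from direct_sum_projI[OF A B p pid this]
 show "direct_sum A I B" "\<And>i x. [|x \<in> carrier A; i \<in> I|] ==> dcomp A I B x i = p i x" by auto
qed

section \<open>Graded modules and their homomorphisms\<close>

lemma a_kernel_iff: "x \<in> a_kernel M N u \<longleftrightarrow> x \<in> carrier M \<and> u x = \<zero>\<^sub>N"
 by (simp add: a_kernel_def kernel_def)

lemma additive_subgroupI':
 assumes "abelian_group A" "B \<subseteq> carrier A" "\<zero>\<^sub>A \<in> B"
  "\<And>x y. [|x \<in> B; y \<in> B|] ==> x \<oplus>\<^sub>A y \<in> B" "\<And>x. x \<in> B ==> \<ominus>\<^sub>A x \<in> B"
 shows "additive_subgroup B A"
proof -
 interpret A: abelian_group A by fact
 show ?thesis
  by (intro additive_subgroup.intro A.add.subgroupI) (use assms in auto)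
qed

lemma (in abelian_group) diff_add_diff:
 "[|x \<in> carrier G; y \<in> carrier G; z \<in> carrier G|] ==> (x \<ominus> y) \<oplus> (y \<ominus> z) = x \<ominus> z"
 by (simp add: a_minus_def a_assoc r_neg1)

lemma (in abelian_group) minus_diff:
 "[|x \<in> carrier G; y \<in> carrier G|] ==> \<ominus> (x \<ominus> y) = y \<ominus> x"
 by (simp add: a_minus_def minus_add a_comm)

sublocale graded_ring \<subseteq> RD: direct_sum R "carrier G" "rcomp R"
 by unfold_locales (rule ring_direct_sum)

sublocale graded_module \<subseteq> MD: direct_sum M "carrier G" "mcomp M"
 by unfold_locales (rule module_direct_sum)

abbreviation gc :: "('g,'x) monoid_scheme => ('g,'r,'m) gmodule => 'm => 'g => 'm" where
 "gc G M \<equiv> dcomp M (carrier G) (mcomp M)"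

abbreviation rc :: "('g,'x) monoid_scheme => ('g,'r) gring => 'r => 'g => 'r" where
 "rc G R \<equiv> dcomp R (carrier G) (rcomp R)"

section \<open>Homogeneous scalars and the shift of degrees\<close>

lemma (in graded_ring) mult_addhom: "r \<in> carrier R ==> (\<lambda>x. r \<otimes>\<^sub>R x) \<in> addhom R R"
 by (rule addhomI) (auto simp: R.r_distr)

lemma (in graded_module) smult_addhom: "r \<in> carrier R ==> (\<lambda>x. r \<odot>\<^sub>M x) \<in> addhom M M"
 by (rule addhomI) (auto simp: smult_r_distr)

lemma (in graded_module) smult_addhom_left: "x \<in> carrier M ==> (\<lambda>r. r \<odot>\<^sub>M x) \<in> addhom R M"
 by (rule addhomI) (auto simp: smult_l_distr)

lemma (in graded_ring) rc_mult:
 assumes "r \<in> rcomp R s" "s \<in> carrier G" "x \<in> carrier R" "g \<in> carrier G"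
 shows "rc G R (r \<otimes>\<^sub>R x) (s \<otimes>\<^sub>G g) = r \<otimes>\<^sub>R rc G R x g"
proof (rule RD.addhom_eqI[OF R.abelian_group_axioms _ _ _ assms(3)])
 have r: "r \<in> carrier R" using assms RD.B_carr by blast
 show "(\<lambda>x. rc G R (r \<otimes>\<^sub>R x) (s \<otimes>\<^sub>G g)) \<in> addhom R R"
  by (rule addhom_comp[OF mult_addhom[OF r] RD.dcomp_addhom])
 show "(\<lambda>x. r \<otimes>\<^sub>R rc G R x g) \<in> addhom R R"
  by (rule addhom_comp[OF RD.dcomp_addhom mult_addhom[OF r]])
 fix h x assume h: "h \<in> carrier G" and x: "x \<in> rcomp R h"
 have "r \<otimes>\<^sub>R x \<in> rcomp R (s \<otimes>\<^sub>G h)" using rcomp_mult assms h x by blast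
 thus "rc G R (r \<otimes>\<^sub>R x) (s \<otimes>\<^sub>G g) = r \<otimes>\<^sub>R rc G R x g"
  using assms h x r by (simp add: RD.dcomp_hom'[OF x h] RD.dcomp_hom'[of _ "s \<otimes>\<^sub>G h"])
qed

text \<open>The degree zero component of the unit is a unit for homogeneous elements, hence is the unit.\<close>

lemma (in graded_ring) one_homogeneous: "\<one>\<^sub>R \<in> rcomp R \<one>\<^sub>G"
proof -
 let ?e = "rc G R \<one>\<^sub>R \<one>\<^sub>G"
 have e: "?e \<in> rcomp R \<one>\<^sub>G" by (simp add: RD.dcomp_in)
 have "x \<otimes>\<^sub>R ?e = x" if "x \<in> carrier R" for x
 proof (rule RD.addhom_eqI[OF R.abelian_group_axioms _ _ _ that])
  show "(\<lambda>x. x \<otimes>\<^sub>R ?e) \<in> addhom R R" by (rule addhomI) (auto simp: R.l_distr)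
  show "(\<lambda>x. x) \<in> addhom R R" by (rule addhomI) auto
  fix h x assume h: "h \<in> carrier G" and x: "x \<in> rcomp R h"
  have xR: "x \<in> carrier R" using RD.B_carr x h by blast
  have "rc G R (x \<otimes>\<^sub>R \<one>\<^sub>R) (h \<otimes>\<^sub>G \<one>\<^sub>G) = x \<otimes>\<^sub>R ?e"
   using x h by (intro rc_mult) auto
  thus "x \<otimes>\<^sub>R ?e = x"
   using xR h by (simp add: RD.dcomp_hom'[OF x h])
 qed
 from this[of "\<one>\<^sub>R"] show ?thesis using e by simp
qed

lemma (in graded_module) gc_smult:
 assumes "r \<in> rcomp R s" "s \<in> carrier G" "x \<in> carrier M" "g \<in> carrier G"
 shows "gc G M (r \<odot>\<^sub>M x) (s \<otimes>\<^sub>G g) = r \<odot>\<^sub>M gc G M x g"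
proof (rule MD.addhom_eqI[OF M.abelian_group_axioms _ _ _ assms(3)])
 have r: "r \<in> carrier R" using assms RD.B_carr by blast
 show "(\<lambda>x. gc G M (r \<odot>\<^sub>M x) (s \<otimes>\<^sub>G g)) \<in> addhom M M"
  by (rule addhom_comp[OF smult_addhom[OF r] MD.dcomp_addhom])
 show "(\<lambda>x. r \<odot>\<^sub>M gc G M x g) \<in> addhom M M"
  by (rule addhom_comp[OF MD.dcomp_addhom smult_addhom[OF r]])
 fix h x assume h: "h \<in> carrier G" and x: "x \<in> mcomp M h"
 have "r \<odot>\<^sub>M x \<in> mcomp M (s \<otimes>\<^sub>G h)" using mcomp_smult assms h x by blast
 thus "gc G M (r \<odot>\<^sub>M x) (s \<otimes>\<^sub>G g) = r \<odot>\<^sub>M gc G M x g"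
  using assms h x r by (simp add: MD.dcomp_hom'[OF x h] MD.dcomp_hom'[of _ "s \<otimes>\<^sub>G h"])
qed

lemma (in graded_module) gc_smult':
 assumes "r \<in> rcomp R s" "s \<in> carrier G" "x \<in> carrier M" "g \<in> carrier G"
 shows "gc G M (r \<odot>\<^sub>M x) g = r \<odot>\<^sub>M gc G M x (inv\<^bsub>G\<^esub> s \<otimes>\<^sub>G g)"
proof -
 have "s \<otimes>\<^sub>G (inv\<^bsub>G\<^esub> s \<otimes>\<^sub>G g) = g"
  using assms by (simp add: G.m_assoc[symmetric])
 thus ?thesis using gc_smult[OF assms(1-3), of "inv\<^bsub>G\<^esub> s \<otimes>\<^sub>G g"] assms by simp
qed

text \<open>Both sides are additive in the scalar and in the vector, so two nested reductions to
  homogeneous elements suffice.\<close>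

lemma (in graded_module) addhom_smult_homogeneous:
 fixes N :: "('r,'n,'z) module_scheme"
 assumes N: "module R N" and u: "u \<in> addhom M N"
  and sm: "\<And>s g r x. [|s \<in> carrier G; g \<in> carrier G; r \<in> rcomp R s; x \<in> mcomp M g|]
   ==> u (r \<odot>\<^sub>M x) = r \<odot>\<^sub>N u x"
  and r: "r \<in> carrier R" and x: "x \<in> carrier M"
 shows "u (r \<odot>\<^sub>M x) = r \<odot>\<^sub>N u x"
proof -
 interpret N: module R N by fact
 show ?thesis
 proof (rule RD.addhom_eqI[OF N.M.abelian_group_axioms _ _ _ r])
  show "(\<lambda>r. u (r \<odot>\<^sub>M x)) \<in> addhom R N"
   by (rule addhom_comp[OF smult_addhom_left[OF x] u])
  show "(\<lambda>r. r \<odot>\<^sub>N u x) \<in> addhom R N"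
   by (rule addhomI) (use addhom_closed[OF u x] N.smult_l_distr in auto)
  fix s r assume s: "s \<in> carrier G" and r: "r \<in> rcomp R s"
  hence rR: "r \<in> carrier R" using RD.B_carr by blast
  have rN: "(\<lambda>x. r \<odot>\<^sub>N x) \<in> addhom N N"
   by (rule addhomI) (use rR N.smult_r_distr in auto)
  show "u (r \<odot>\<^sub>M x) = r \<odot>\<^sub>N u x"
  proof (rule MD.addhom_eqI[OF N.M.abelian_group_axioms _ _ _ x])
   show "(\<lambda>x. u (r \<odot>\<^sub>M x)) \<in> addhom M N" "(\<lambda>x. r \<odot>\<^sub>N u x) \<in> addhom M N"
    by (rule addhom_comp[OF smult_addhom[OF rR] u] addhom_comp[OF u rN])+
  qed (use sm s r in auto)
 qed
qed

section \<open>Homomorphisms of graded modules\<close>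

lemma gh_addhom: "u \<in> ghom G R M N ==> u \<in> addhom M N"
 by (auto simp: graded_hom_def addhom_def)

lemma gh_closed: "[|u \<in> ghom G R M N; x \<in> carrier M|] ==> u x \<in> carrier N"
 by (auto simp: graded_hom_def)

lemma gh_add: "[|u \<in> ghom G R M N; x \<in> carrier M; y \<in> carrier M|] ==> u (x \<oplus>\<^sub>M y) = u x \<oplus>\<^sub>N u y"
 by (auto simp: graded_hom_def)

lemma gh_smult: "[|u \<in> ghom G R M N; r \<in> carrier R; x \<in> carrier M|] ==> u (r \<odot>\<^sub>M x) = r \<odot>\<^sub>N u x"
 by (auto simp: graded_hom_def)

lemma gh_mcomp: "[|u \<in> ghom G R M N; g \<in> carrier G; x \<in> mcomp M g|] ==> u x \<in> mcomp N g"
 unfolding graded_hom_def by blast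

lemma graded_homI0:
 assumes "\<And>x. x \<in> carrier M ==> u x \<in> carrier N"
  "\<And>x y. [|x \<in> carrier M; y \<in> carrier M|] ==> u (x \<oplus>\<^sub>M y) = u x \<oplus>\<^sub>N u y"
  "\<And>r x. [|r \<in> carrier R; x \<in> carrier M|] ==> u (r \<odot>\<^sub>M x) = r \<odot>\<^sub>N u x"
  "\<And>g x. [|g \<in> carrier G; x \<in> mcomp M g|] ==> u x \<in> mcomp N g"
 shows "u \<in> ghom G R M N"
 using assms by (auto simp: graded_hom_def)

lemma gh_comp:
 "[|u \<in> ghom G R M N; v \<in> ghom G R N P|] ==> (\<lambda>x. v (u x)) \<in> ghom G R M P"
 by (rule graded_homI0) (simp_all add: gh_closed gh_add gh_smult gh_mcomp)

lemma gh_id: "(\<lambda>x. x) \<in> ghom G R M M"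
 by (rule graded_homI0) auto

context
 fixes G :: "('g,'x) monoid_scheme" and R :: "('g,'r) gring"
  and M :: "('g,'r,'m) gmodule" and N :: "('g,'r,'n) gmodule"
 assumes M: "gmod G R M" and N: "gmod G R N"
begin

interpretation M: graded_module G R M by fact
interpretation N: graded_module G R N by fact

lemma gh_zero: "u \<in> ghom G R M N ==> u \<zero>\<^sub>M = \<zero>\<^sub>N"
 by (intro addhom_zero gh_addhom M.M.abelian_group_axioms N.M.abelian_group_axioms)

lemma gh_minus: "[|u \<in> ghom G R M N; x \<in> carrier M|] ==> u (\<ominus>\<^bsub>M\<^esub> x) = \<ominus>\<^sub>N u x"
 by (intro addhom_minus gh_addhom M.M.abelian_group_axioms N.M.abelian_group_axioms)

lemma gh_diff: "[|u \<in> ghom G R M N; x \<in> carrier M; y \<in> carrier M|] ==> u (x \<ominus>\<^sub>M y) = u x \<ominus>\<^sub>N u y"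
 by (intro addhom_diff gh_addhom M.M.abelian_group_axioms N.M.abelian_group_axioms)

lemma gh_gc:
 assumes "u \<in> ghom G R M N" "x \<in> carrier M" "g \<in> carrier G"
 shows "gc G N (u x) g = u (gc G M x g)"
proof (rule M.MD.addhom_eqI[OF N.M.abelian_group_axioms _ _ _ assms(2)])
 show "(\<lambda>x. gc G N (u x) g) \<in> addhom M N" "(\<lambda>x. u (gc G M x g)) \<in> addhom M N"
  using assms by (auto intro: addhom_comp gh_addhom M.MD.dcomp_addhom N.MD.dcomp_addhom)
 fix h x assume h: "h \<in> carrier G" and x: "x \<in> mcomp M h"
 thus "gc G N (u x) g = u (gc G M x g)"
  using N.MD.dcomp_hom'[OF gh_mcomp[OF assms(1) h x] h] gh_zero[OF assms(1)]
  by (simp add: M.MD.dcomp_hom'[OF x h])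
qed

lemma graded_homI:
 assumes u: "u \<in> addhom M N"
  and sm: "\<And>s g r x. [|s \<in> carrier G; g \<in> carrier G; r \<in> rcomp R s; x \<in> mcomp M g|]
   ==> u (r \<odot>\<^sub>M x) = r \<odot>\<^sub>N u x"
  and "\<And>g x. [|g \<in> carrier G; x \<in> mcomp M g|] ==> u x \<in> mcomp N g"
 shows "u \<in> ghom G R M N"
 by (rule graded_homI0)
  (use assms M.addhom_smult_homogeneous[OF N.module_axioms u sm] in \<open>auto simp: addhom_closed addhom_add\<close>)

lemma graded_hom_zero: "(\<lambda>x. \<zero>\<^sub>N) \<in> ghom G R M N"
 by (rule graded_homI0) (auto simp: N.MD.B_zero)

lemma graded_hom_add:
 assumes "u \<in> ghom G R M N" "v \<in> ghom G R M N"
 shows "(\<lambda>x. u x \<oplus>\<^sub>N v x) \<in> ghom G R M N"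
 by (rule graded_homI0)
  (use assms in \<open>auto simp: gh_closed gh_add gh_smult gh_mcomp N.smult_r_distr N.MD.B_add N.M.a_ac\<close>)

lemma graded_hom_uminus:
 assumes "u \<in> ghom G R M N"
 shows "(\<lambda>x. \<ominus>\<^sub>N u x) \<in> ghom G R M N"
 by (rule graded_homI0)
  (use assms in \<open>auto simp: gh_closed gh_add gh_smult gh_mcomp N.smult_r_minus N.MD.B_minus N.M.minus_add\<close>)

lemma graded_hom_diff:
 assumes "u \<in> ghom G R M N" "v \<in> ghom G R M N"
 shows "(\<lambda>x. u x \<ominus>\<^sub>N v x) \<in> ghom G R M N"
 unfolding a_minus_def by (intro graded_hom_add graded_hom_uminus assms)

lemma gh_inj_iff:
 assumes u: "u \<in> ghom G R M N"
 shows "inj_on u (carrier M) \<longleftrightarrow> (\<forall>x\<in>carrier M. u x = \<zero>\<^sub>N \<longrightarrow> x = \<zero>\<^sub>M)"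
proof
 assume "inj_on u (carrier M)"
 thus "\<forall>x\<in>carrier M. u x = \<zero>\<^sub>N \<longrightarrow> x = \<zero>\<^sub>M"
  using gh_zero[OF u] by (metis inj_onD M.M.zero_closed)
next
 assume *: "\<forall>x\<in>carrier M. u x = \<zero>\<^sub>N \<longrightarrow> x = \<zero>\<^sub>M"
 show "inj_on u (carrier M)"
 proof (rule inj_onI)
  fix x y assume xy: "x \<in> carrier M" "y \<in> carrier M" "u x = u y"
  hence "u (x \<ominus>\<^sub>M y) = \<zero>\<^sub>N"
   using gh_diff[OF u xy(1,2)] gh_closed[OF u xy(2)] by (simp add: N.M.diff_zero_iff)
  thus "x = y" using * xy M.M.diff_zero_iff[OF xy(1,2)] M.M.minus_closed by blast
 qed
qed

text \<open>Homomorphisms commute with taking components, so the component of degree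
  \<open>g\<close> of any preimage is again a preimage. Hence surjections are surjective in every
  degree.\<close>

lemma gh_homogeneous_preimage:
 assumes u: "u \<in> ghom G R M N" and y: "y \<in> mcomp N g" "y \<in> u ` carrier M" and g: "g \<in> carrier G"
 obtains x where "x \<in> mcomp M g" "u x = y"
proof -
 obtain x where x: "x \<in> carrier M" "y = u x" using y by blast
 have "u (gc G M x g) = y"
  using gh_gc[OF u x(1) g] N.MD.dcomp_hom'[OF y(1) g] x by simp
 thus ?thesis using that M.MD.dcomp_in[OF x(1) g] by blast
qed

text \<open>The rule \<open>\<phi>\<close> may depend on the degree itself and not just on the
  element. All degreewise projections and extensions below are constructed in this way.\<close>

lemma gh_glue:
 assumes "\<And>g x. [|g \<in> carrier G; x \<in> mcomp M g|] ==> \<phi> g x \<in> mcomp N g"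
  and "\<And>g x y. [|g \<in> carrier G; x \<in> mcomp M g; y \<in> mcomp M g|] ==> \<phi> g (x \<oplus>\<^sub>M y) = \<phi> g x \<oplus>\<^sub>N \<phi> g y"
  and "\<And>s g r x. [|s \<in> carrier G; g \<in> carrier G; r \<in> rcomp R s; x \<in> mcomp M g|]
   ==> \<phi> (s \<otimes>\<^sub>G g) (r \<odot>\<^sub>M x) = r \<odot>\<^sub>N \<phi> g x"
 obtains u where "u \<in> ghom G R M N" "\<And>g x. [|g \<in> carrier G; x \<in> mcomp M g|] ==> u x = \<phi> g x"
proof
 have *: "\<phi> g x \<in> carrier N" if "g \<in> carrier G" "x \<in> mcomp M g" for g x
  using assms(1) N.MD.B_carr that by blast
 have h: "M.MD.hsum N \<phi> \<in> addhom M N" "\<And>g x. [|g \<in> carrier G; x \<in> mcomp M g|] ==> M.MD.hsum N \<phi> x = \<phi> g x"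
  by (rule M.MD.hsum_props[OF N.M.abelian_group_axioms]; use * assms(2) in blast)+
 show "M.MD.hsum N \<phi> \<in> ghom G R M N"
 proof (rule graded_homI[OF h(1)])
  fix s g r x assume as: "s \<in> carrier G" "g \<in> carrier G" "r \<in> rcomp R s" "x \<in> mcomp M g"
  hence "r \<odot>\<^sub>M x \<in> mcomp M (s \<otimes>\<^sub>G g)" using M.mcomp_smult by blast
  thus "M.MD.hsum N \<phi> (r \<odot>\<^sub>M x) = r \<odot>\<^sub>N M.MD.hsum N \<phi> x"
   using as h(2)[OF _ \<open>r \<odot>\<^sub>M x \<in> mcomp M (s \<otimes>\<^sub>G g)\<close>] assms(3)[OF as] h(2)[OF as(2,4)]
    M.G.m_closed by simp
 qed (use h(2) assms(1) in auto)
 show "M.MD.hsum N \<phi> x = \<phi> g x" if "g \<in> carrier G" "x \<in> mcomp M g" for g x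
  using h(2) that .
qed

end

lemma graded_moduleI:
 assumes R: "graded_ring G R" and M: "module R M"
  and B: "\<And>g. g \<in> carrier G ==> mcomp M g \<subseteq> carrier M"
   "\<And>g. g \<in> carrier G ==> \<zero>\<^sub>M \<in> mcomp M g"
   "\<And>g x y. [|g \<in> carrier G; x \<in> mcomp M g; y \<in> mcomp M g|] ==> x \<oplus>\<^sub>M y \<in> mcomp M g"
  and p: "\<And>g. g \<in> carrier G ==> p g \<in> addhom M M"
  and pid: "\<And>g h x. [|g \<in> carrier G; h \<in> carrier G; x \<in> mcomp M g|] ==> p h x = (if h = g then x else \<zero>\<^sub>M)"
  and pB: "\<And>g x. [|g \<in> carrier G; x \<in> carrier M|] ==> p g x \<in> mcomp M g"
  and fin: "\<And>x. x \<in> carrier M ==> finite {g\<in>carrier G. p g x \<noteq> \<zero>\<^sub>M}"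
  and sep: "\<And>x. [|x \<in> carrier M; \<And>g. g \<in> carrier G ==> p g x = \<zero>\<^sub>M|] ==> x = \<zero>\<^sub>M"
  and sm: "\<And>s g r x. [|s \<in> carrier G; g \<in> carrier G; r \<in> rcomp R s; x \<in> mcomp M g|]
   ==> r \<odot>\<^sub>M x \<in> mcomp M (s \<otimes>\<^sub>G g)"
 shows "gmod G R M"
  "\<And>x g. [|x \<in> carrier M; g \<in> carrier G|] ==> gc G M x g = p g x"
proof -
 interpret R: graded_ring G R by fact
 interpret M: module R M by fact
 \<comment> \<open>Negation is multiplication by minus one, which is homogeneous of degree zero, so
   the components are stable under it.\<close>
 have minus: "\<ominus>\<^sub>M x \<in> mcomp M g" if "g \<in> carrier G" "x \<in> mcomp M g" for g x
 proof -
  have x: "x \<in> carrier M" using B that by blast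
  have "\<ominus>\<^sub>R \<one>\<^sub>R \<in> rcomp R \<one>\<^sub>G" by (simp add: R.RD.B_minus R.one_homogeneous)
  from sm[OF _ that(1) this that(2)] show ?thesis
   using M.smult_l_minus[of "\<one>\<^sub>R" x] x that by simp
 qed
 have sub: "additive_subgroup (mcomp M g) M" if "g \<in> carrier G" for g
  by (rule additive_subgroupI'[OF M.abelian_group_axioms]) (use B minus that in auto)
 note ds = direct_sum_sepI[OF M.abelian_group_axioms sub p pid pB fin sep]
 show "gmod G R M"
 proof (intro graded_module.intro graded_module_axioms.intro R M)
  show "is_direct_sum M (carrier G) (mcomp M)"
   by (rule direct_sum.ds[OF ds(1)])
 qed (use sm in auto)
 show "gc G M x g = p g x" if "x \<in> carrier M" "g \<in> carrier G" for x g
  using ds(2) that by blast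
qed

section \<open>Image modules, submodules, and quotients\<close>

text \<open>One construction serves for relabelling along an injection and for quotients: for a
  quotient, \<open>q\<close> picks a representative of each class. The operations are computed on
  preimages selected by \<open>inv_into\<close>.\<close>

definition image_module :: "('a => 'b) => ('g,'r,'a) gmodule => ('g,'r,'b) gmodule" where
 "image_module q M = (let s = inv_into (carrier M) q in
   \<lparr>carrier = q ` carrier M, monoid.mult = undefined, monoid.one = undefined,
   ring.zero = q \<zero>\<^sub>M, ring.add = (\<lambda>u v. q (s u \<oplus>\<^sub>M s v)),
   module.smult = (\<lambda>r u. q (r \<odot>\<^sub>M s u)), mcomp = (\<lambda>g. q ` mcomp M g)\<rparr>)"

context
 fixes G :: "('g,'x) monoid_scheme" and R :: "('g,'r) gring"
  and M :: "('g,'r,'m) gmodule" and q :: "'m => 'n"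
 assumes M: "gmod G R M"
  and q_add: "\<And>x x' y y'. [|x \<in> carrier M; x' \<in> carrier M; y \<in> carrier M; y' \<in> carrier M; q x = q x'; q y = q y'|]
   ==> q (x \<oplus>\<^sub>M y) = q (x' \<oplus>\<^sub>M y')"
  and q_smult: "\<And>r x x'. [|r \<in> carrier R; x \<in> carrier M; x' \<in> carrier M; q x = q x'|]
   ==> q (r \<odot>\<^sub>M x) = q (r \<odot>\<^sub>M x')"
  and q_gc: "\<And>g x x'. [|g \<in> carrier G; x \<in> carrier M; x' \<in> carrier M; q x = q x'|]
   ==> q (gc G M x g) = q (gc G M x' g)"
begin

interpretation M: graded_module G R M by fact

lemma image_module_graded: "gmod G R (image_module q M)"
 and image_module_hom: "q \<in> ghom G R M (image_module q M)"
proof -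
 let ?Q = "image_module q M" let ?s = "inv_into (carrier M) q"
 have s: "?s (q x) \<in> carrier M" "q (?s (q x)) = q x" if "x \<in> carrier M" for x
  using that by (auto simp: inv_into_into f_inv_into_f)
 have Qc: "carrier ?Q = q ` carrier M" and Q0: "\<zero>\<^bsub>?Q\<^esub> = q \<zero>\<^sub>M"
  and Qm: "mcomp ?Q g = q ` mcomp M g" for g
  by (simp_all add: image_module_def Let_def)
 have Qa: "q x \<oplus>\<^bsub>?Q\<^esub> q y = q (x \<oplus>\<^sub>M y)" if "x \<in> carrier M" "y \<in> carrier M" for x y
  using q_add[OF s(1)[OF that(1)] that(1) s(1)[OF that(2)] that(2) s(2)[OF that(1)] s(2)[OF that(2)]]
  by (simp add: image_module_def Let_def)
 have Qs: "r \<odot>\<^bsub>?Q\<^esub> q x = q (r \<odot>\<^sub>M x)" if "x \<in> carrier M" "r \<in> carrier R" for x r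
  using q_smult[OF that(2) s(1)[OF that(1)] that(1) s(2)[OF that(1)]]
  by (simp add: image_module_def Let_def)
 have ag: "abelian_group ?Q"
 proof (rule abelian_groupI)
  fix x assume "x \<in> carrier ?Q"
  then obtain a where "a \<in> carrier M" "x = q a" by (auto simp: Qc)
  thus "\<exists>y\<in>carrier ?Q. y \<oplus>\<^bsub>?Q\<^esub> x = \<zero>\<^bsub>?Q\<^esub>"
   by (intro bexI[of _ "q (\<ominus>\<^bsub>M\<^esub> a)"]) (auto simp: Qc Qa Q0 M.M.l_neg)
 qed (auto simp: Qc Qa Q0 M.M.a_ac)
 have mod: "module R ?Q"
  by (rule moduleI[OF M.R.is_cring ag])
   (auto simp: Qc Qa Qs M.smult_l_distr M.smult_r_distr M.smult_assoc1)
 interpret Q: module R ?Q by (rule mod)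
 have qa: "q \<in> addhom M ?Q" by (rule addhomI) (auto simp: Qc Qa)
 have Mc: "x \<in> carrier M" if "x \<in> mcomp M g" "g \<in> carrier G" for x g
  using that M.MD.B_carr by blast
 \<comment> \<open>The component map of the image, computed on the selected preimage; compatibility
   of \<open>q\<close> with components makes it independent of that selection.\<close>
 define p where "p g u = q (gc G M (?s u) g)" for g u
 have p: "p g (q x) = q (gc G M x g)" if "x \<in> carrier M" "g \<in> carrier G" for x g
  unfolding p_def using that s q_gc by blast
 show "gmod G R ?Q"
 proof (intro graded_module.intro graded_module_axioms.intro M.graded_ring_axioms mod)
  have "direct_sum ?Q (carrier G) (mcomp ?Q)"
  proof (rule direct_sum_projI(1)[OF ag])
   show "additive_subgroup (mcomp ?Q g) ?Q" if g: "g \<in> carrier G" for g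
   proof (rule additive_subgroupI'[OF ag])
    fix x assume "x \<in> mcomp ?Q g"
    then obtain a where a: "a \<in> mcomp M g" "x = q a" by (auto simp: Qm)
    have "\<ominus>\<^bsub>?Q\<^esub> x = q (\<ominus>\<^bsub>M\<^esub> a)"
     using addhom_minus[OF M.M.abelian_group_axioms ag qa Mc[OF a(1) g]] a by simp
    thus "\<ominus>\<^bsub>?Q\<^esub> x \<in> mcomp ?Q g" using M.MD.B_minus[OF a(1) g] by (simp add: Qm)
   qed (use g Mc M.MD.B_zero M.MD.B_add in \<open>auto simp: Qm Qc Q0 Qa\<close>)
   show "p g \<in> addhom ?Q ?Q" if "g \<in> carrier G" for g
    by (rule addhomI) (use that p in \<open>auto simp: Qc Qa M.MD.dcomp_add\<close>)
   show "p h x = (if h = g then x else \<zero>\<^bsub>?Q\<^esub>)"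
    if "g \<in> carrier G" "h \<in> carrier G" "x \<in> mcomp ?Q g" for g h x
    using that p Mc M.MD.dcomp_hom' by (auto simp: Qm Q0)
   show "carrier ?Q \<subseteq> sum_of_family ?Q (carrier G) (mcomp ?Q)"
   proof
    fix y assume "y \<in> carrier ?Q"
    then obtain x where x: "x \<in> carrier M" "y = q x" by (auto simp: Qc)
    let ?F = "{g. gc G M x g \<noteq> \<zero>\<^sub>M}"
    show "y \<in> sum_of_family ?Q (carrier G) (mcomp ?Q)"
    proof (rule Q.M.sum_of_familyI)
     show "finite ?F" using M.MD.dcomp_finite x by blast
     show F: "?F \<subseteq> carrier G" using M.MD.dcomp_out x by blast
     show "q (gc G M x g) \<in> mcomp ?Q g" if "g \<in> ?F" for g
      using M.MD.dcomp_in[OF x(1)] F that by (auto simp: Qm)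
     have "q (finsum M (gc G M x) ?F) = finsum ?Q (\<lambda>g. q (gc G M x g)) ?F"
      by (rule addhom_finsum[OF M.M.abelian_group_axioms ag qa]) (use x in auto)
     thus "y = finsum ?Q (\<lambda>g. q (gc G M x g)) ?F"
      using M.MD.dcomp_props(4)[OF x(1)] x by simp
    qed
   qed
  qed
  thus "is_direct_sum ?Q (carrier G) (mcomp ?Q)" by (simp add: direct_sum.ds)
 next
  fix g h a x assume *: "g \<in> carrier G" "h \<in> carrier G" "a \<in> rcomp R g" "x \<in> mcomp ?Q h"
  then obtain b where b: "b \<in> mcomp M h" "x = q b" by (auto simp: Qm)
  thus "a \<odot>\<^bsub>?Q\<^esub> x \<in> mcomp ?Q (g \<otimes>\<^sub>G h)"
   using * Qs Mc M.RD.B_carr M.mcomp_smult by (auto simp: Qm)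
 qed
 show "q \<in> ghom G R M ?Q"
  by (rule graded_homI0) (auto simp: Qc Qa Qs Qm)
qed

end

lemma image_module_simps:
 "carrier (image_module q M) = q ` carrier M" "\<zero>\<^bsub>image_module q M\<^esub> = q \<zero>\<^sub>M"
 by (simp_all add: image_module_def Let_def)

section \<open>Isomorphisms, factorizations and cokernels\<close>

definition giso :: "('g,'x) monoid_scheme => ('g,'r) gring => ('g,'r,'a) gmodule => ('g,'r,'b) gmodule
  => ('a => 'b) => ('b => 'a) => bool" where
 "giso G R M N u v \<longleftrightarrow> u \<in> ghom G R M N \<and> v \<in> ghom G R N M \<and>
   (\<forall>x\<in>carrier M. v (u x) = x) \<and> (\<forall>y\<in>carrier N. u (v y) = y)"

lemma gisoD:
 assumes "giso G R M N u v"
 shows "u \<in> ghom G R M N" "v \<in> ghom G R N M"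
  "\<And>x. x \<in> carrier M ==> v (u x) = x" "\<And>y. y \<in> carrier N ==> u (v y) = y"
  "inj_on u (carrier M)" "u ` carrier M = carrier N"
proof -
 show *: "u \<in> ghom G R M N" "v \<in> ghom G R N M"
  "\<And>x. x \<in> carrier M ==> v (u x) = x" "\<And>y. y \<in> carrier N ==> u (v y) = y"
  using assms by (auto simp: giso_def)
 show "inj_on u (carrier M)" by (rule inj_on_inverseI[of _ v]) (rule *)
 show "u ` carrier M = carrier N"
  using gh_closed[OF *(1)] gh_closed[OF *(2)] *(4) by (metis image_eqI image_subsetI subsetI subset_antisym)
qed

lemma giso_sym: "giso G R M N u v ==> giso G R N M v u"
 by (auto simp: giso_def)

text \<open>The set-theoretic factorization respects degrees because a homogeneous element in the
  image of \<open>f\<close> has a homogeneous preimage, which injectivity identifies with the chosen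
  one.\<close>

lemma factor_mono:
 assumes A: "gmod G R A" and B: "gmod G R B" and Z: "gmod G R Z"
  and f: "f \<in> ghom G R A B" "inj_on f (carrier A)"
  and h: "h \<in> ghom G R Z B" "h ` carrier Z \<subseteq> f ` carrier A"
 obtains k where "k \<in> ghom G R Z A" "\<And>z. z \<in> carrier Z ==> f (k z) = h z"
proof
 interpret A: graded_module G R A by fact
 interpret Z: graded_module G R Z by fact
 let ?k = "\<lambda>z. inv_into (carrier A) f (h z)"
 have k: "?k z \<in> carrier A" "f (?k z) = h z" if "z \<in> carrier Z" for z
  using h(2) that by (auto simp: inv_into_into f_inv_into_f image_subset_iff)
 have u: "?k z = a" if "z \<in> carrier Z" "a \<in> carrier A" "f a = h z" for z a
  using f(2) that k by (metis inj_onD)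
 show "?k \<in> ghom G R Z A"
 proof (rule graded_homI0)
  fix x y assume xy: "x \<in> carrier Z" "y \<in> carrier Z"
  show "?k (x \<oplus>\<^sub>Z y) = ?k x \<oplus>\<^sub>A ?k y"
   by (rule u) (use xy k in \<open>simp_all add: gh_add[OF f(1)] gh_add[OF h(1)]\<close>)
 next
  fix r x assume xy: "r \<in> carrier R" "x \<in> carrier Z"
  show "?k (r \<odot>\<^sub>Z x) = r \<odot>\<^sub>A ?k x"
   by (rule u) (use xy k in \<open>simp_all add: gh_smult[OF f(1)] gh_smult[OF h(1)]\<close>)
 next
  fix g x assume g: "g \<in> carrier G" and x: "x \<in> mcomp Z g"
  have xZ: "x \<in> carrier Z" using x g Z.MD.B_carr by blast
  have "h x \<in> mcomp B g" "h x \<in> f ` carrier A" using gh_mcomp[OF h(1) g x] h(2) xZ by auto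
  then obtain a where a: "a \<in> mcomp A g" "f a = h x"
   using gh_homogeneous_preimage[OF A B f(1) _ _ g] by metis
  hence "?k x = a" using u xZ g A.MD.B_carr by blast
  thus "?k x \<in> mcomp A g" using a by simp
 qed (rule k)
 show "\<And>z. z \<in> carrier Z ==> f (?k z) = h z" by (rule k)
qed

lemma factor_epi:
 assumes B: "gmod G R B" and Y: "gmod G R Y" and Z: "gmod G R Z"
  and q: "q \<in> ghom G R B Y" "q ` carrier B = carrier Y"
  and h: "h \<in> ghom G R B Z" "\<And>x. [|x \<in> carrier B; q x = \<zero>\<^sub>Y|] ==> h x = \<zero>\<^sub>Z"
 obtains k where "k \<in> ghom G R Y Z" "\<And>x. x \<in> carrier B ==> k (q x) = h x"
proof
 interpret B: graded_module G R B by fact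
 interpret Y: graded_module G R Y by fact
 interpret Z: graded_module G R Z by fact
 let ?k = "\<lambda>y. h (inv_into (carrier B) q y)"
 have *: "h x = h x'" if "x \<in> carrier B" "x' \<in> carrier B" "q x = q x'" for x x'
 proof -
  have "q (x \<ominus>\<^sub>B x') = \<zero>\<^sub>Y"
   using gh_diff[OF B Y q(1) that(1,2)] gh_closed[OF q(1)] that Y.M.diff_zero_iff by simp
  hence "h x \<ominus>\<^sub>Z h x' = \<zero>\<^sub>Z"
   using h(2) that gh_diff[OF B Z h(1) that(1,2)] by simp
  thus ?thesis using gh_closed[OF h(1)] that Z.M.diff_zero_iff by simp
 qed
 show k: "?k (q x) = h x" if "x \<in> carrier B" for x
  by (rule *) (use that in \<open>auto simp: inv_into_into f_inv_into_f\<close>)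
 show "?k \<in> ghom G R Y Z"
 proof (rule graded_homI0)
  fix y assume "y \<in> carrier Y"
  thus "?k y \<in> carrier Z" using k gh_closed[OF h(1)] q(2) by (metis imageE)
 next
  fix y z assume yz: "y \<in> carrier Y" "z \<in> carrier Y"
  then obtain a b where ab: "a \<in> carrier B" "y = q a" "b \<in> carrier B" "z = q b" using q(2) by blast
  have "?k (q (a \<oplus>\<^sub>B b)) = ?k (q a) \<oplus>\<^sub>Z ?k (q b)"
   using k[of a] k[of b] k[of "a \<oplus>\<^sub>B b"] ab gh_add[OF h(1)] by simp
  thus "?k (y \<oplus>\<^sub>Y z) = ?k y \<oplus>\<^sub>Z ?k z" using ab gh_add[OF q(1)] by simp
 next
  fix r y assume yz: "r \<in> carrier R" "y \<in> carrier Y"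
  then obtain a where ab: "a \<in> carrier B" "y = q a" using q(2) by blast
  have "?k (q (r \<odot>\<^sub>B a)) = r \<odot>\<^sub>Z ?k (q a)"
   using k[of a] k[of "r \<odot>\<^sub>B a"] yz ab gh_smult[OF h(1)] by simp
  thus "?k (r \<odot>\<^sub>Y y) = r \<odot>\<^sub>Z ?k y" using ab yz gh_smult[OF q(1)] by simp
 next
  fix g y assume g: "g \<in> carrier G" and y: "y \<in> mcomp Y g"
  have "y \<in> q ` carrier B" using q(2) Y.MD.B_carr y g by blast
  then obtain a where a: "a \<in> mcomp B g" "q a = y"
   using gh_homogeneous_preimage[OF B Y q(1) y _ g] by metis
  thus "?k y \<in> mcomp Z g" using k g gh_mcomp[OF h(1) g] B.MD.B_carr by metis
 qed
qed

text \<open>This brings modules of pairs, of finitely supported families or of functions into the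
  fixed element type of the test objects.\<close>

lemma transport:
 fixes M :: "('g,'r,'a) gmodule" and q :: "'a => 'b"
 assumes M: "gmod G R M" and q: "inj_on q (carrier M)"
 obtains N :: "('g,'r,'b) gmodule" and v where "gmod G R N" "giso G R M N q v"
proof -
 let ?Q = "image_module q M"
 have Q: "gmod G R ?Q" "q \<in> ghom G R M ?Q"
  by (intro image_module_graded image_module_hom M; metis q inj_onD)+
 obtain v where v: "v \<in> ghom G R ?Q M" "\<And>z. z \<in> carrier ?Q ==> q (v z) = z"
  using factor_mono[OF M Q(1) Q(1) Q(2) q gh_id] by (metis image_module_simps(1) image_ident order_refl)
 have "v (q x) = x" if "x \<in> carrier M" for x
  using v(2)[of "q x"] that q gh_closed[OF v(1)] gh_closed[OF Q(2)] by (metis inj_onD)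
 thus ?thesis using that[OF Q(1), of v] Q v by (auto simp: giso_def)
qed

lemma cokernel_exists:
 fixes B :: "('g,'r,'b) gmodule"
 assumes A: "gmod G R A" and B: "gmod G R B" and f: "f \<in> ghom G R A B"
 obtains Y :: "('g,'r,'b) gmodule" and q where "gmod G R Y" "q \<in> ghom G R B Y"
  "q ` carrier B = carrier Y" "a_kernel B Y q = f ` carrier A"
proof -
 interpret A: graded_module G R A by fact
 interpret B: graded_module G R B by fact
 let ?N = "f ` carrier A"
 have N0: "\<zero>\<^sub>B \<in> ?N" using gh_zero[OF A B f] by (metis A.M.zero_closed image_eqI)
 have Nadd: "x \<oplus>\<^sub>B y \<in> ?N" if "x \<in> ?N" "y \<in> ?N" for x y
  using that gh_add[OF f] by (metis (no_types, lifting) A.M.a_closed imageE image_eqI)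
 have Nminus: "\<ominus>\<^sub>B x \<in> ?N" if "x \<in> ?N" for x
  using that gh_minus[OF A B f] by (metis (no_types, lifting) A.M.a_inv_closed imageE image_eqI)
 have Nsm: "r \<odot>\<^sub>B x \<in> ?N" if "x \<in> ?N" "r \<in> carrier R" for x r
  using that gh_smult[OF f] by (metis (no_types, lifting) A.smult_closed imageE image_eqI)
 have Ngc: "gc G B x g \<in> ?N" if "x \<in> ?N" "g \<in> carrier G" for x g
 proof -
  obtain a where a: "a \<in> carrier A" "x = f a" using \<open>x \<in> ?N\<close> by blast
  hence "gc G B x g = f (gc G A a g)" using gh_gc[OF A B f a(1) that(2)] by simp
  thus ?thesis using A.MD.dcomp_closed[OF a(1)] by blast
 qed
 \<comment> \<open>Classes modulo the image are represented by one of their members, so the cokernel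
   has the element type of \<open>B\<close> and stays among the test objects. Congruent elements
   satisfy the same condition under \<open>SOME\<close> and hence receive the same
   representative.\<close>
 define q where "q x = (SOME y. y \<in> carrier B \<and> y \<ominus>\<^sub>B x \<in> ?N)" for x
 have eq: "q x = q x' \<longleftrightarrow> x \<ominus>\<^sub>B x' \<in> ?N" if "x \<in> carrier B" "x' \<in> carrier B" for x x'
 proof
  have q: "q x \<in> carrier B \<and> q x \<ominus>\<^sub>B x \<in> ?N" if "x \<in> carrier B" for x
   unfolding q_def by (rule someI[of _ x]) (use that N0 B.M.diff_zero_iff[of x x] in auto)
  assume "q x = q x'"
  hence "\<ominus>\<^sub>B (q x \<ominus>\<^sub>B x) \<oplus>\<^sub>B (q x \<ominus>\<^sub>B x') \<in> ?N"
   using q that Nadd Nminus by metis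
  also have "\<ominus>\<^sub>B (q x \<ominus>\<^sub>B x) \<oplus>\<^sub>B (q x \<ominus>\<^sub>B x') = x \<ominus>\<^sub>B x'"
   using q[OF that(1)] that by (simp add: B.M.minus_diff B.M.diff_add_diff)
  finally show "x \<ominus>\<^sub>B x' \<in> ?N" .
 next
  assume d: "x \<ominus>\<^sub>B x' \<in> ?N"
  hence d': "\<ominus>\<^sub>B (x \<ominus>\<^sub>B x') \<in> ?N" using Nminus by blast
  have "y \<ominus>\<^sub>B x \<in> ?N \<longleftrightarrow> y \<ominus>\<^sub>B x' \<in> ?N" if y: "y \<in> carrier B" for y
  proof -
   have "(y \<ominus>\<^sub>B x) \<oplus>\<^sub>B (x \<ominus>\<^sub>B x') = y \<ominus>\<^sub>B x'" "(y \<ominus>\<^sub>B x') \<oplus>\<^sub>B \<ominus>\<^sub>B (x \<ominus>\<^sub>B x') = y \<ominus>\<^sub>B x"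
    using that y \<open>x \<in> carrier B\<close> \<open>x' \<in> carrier B\<close>
    by (simp_all add: B.M.minus_diff B.M.diff_add_diff)
   thus ?thesis using Nadd d d' by metis
  qed
  thus "q x = q x'" unfolding q_def by (metis (no_types, lifting))
 qed
 let ?Q = "image_module q B"
 have qa: "q (x \<oplus>\<^sub>B y) = q (x' \<oplus>\<^sub>B y')"
  if "x \<in> carrier B" "x' \<in> carrier B" "y \<in> carrier B" "y' \<in> carrier B" "q x = q x'" "q y = q y'" for x x' y y'
 proof -
  have "(x \<ominus>\<^sub>B x') \<oplus>\<^sub>B (y \<ominus>\<^sub>B y') = (x \<oplus>\<^sub>B y) \<ominus>\<^sub>B (x' \<oplus>\<^sub>B y')"
   using that by (simp add: a_minus_def B.M.minus_add B.M.a_ac)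
  thus ?thesis using that eq Nadd by (metis B.M.a_closed)
 qed
 have qs: "q (r \<odot>\<^sub>B x) = q (r \<odot>\<^sub>B x')"
  if "r \<in> carrier R" "x \<in> carrier B" "x' \<in> carrier B" "q x = q x'" for r x x'
 proof -
  have "r \<odot>\<^sub>B (x \<ominus>\<^sub>B x') = r \<odot>\<^sub>B x \<ominus>\<^sub>B r \<odot>\<^sub>B x'"
   using that by (simp add: a_minus_def B.smult_r_distr B.smult_r_minus)
  thus ?thesis using that eq Nsm by (metis B.smult_closed)
 qed
 have qg: "q (gc G B x g) = q (gc G B x' g)"
  if "g \<in> carrier G" "x \<in> carrier B" "x' \<in> carrier B" "q x = q x'" for g x x'
 proof -
  have "gc G B (x \<ominus>\<^sub>B x') g = gc G B x g \<ominus>\<^sub>B gc G B x' g"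
   by (rule addhom_diff[OF B.M.abelian_group_axioms B.M.abelian_group_axioms B.MD.dcomp_addhom that(2,3)])
  thus ?thesis using that eq Ngc by (metis B.MD.dcomp_closed)
 qed
 have Q: "gmod G R ?Q" "q \<in> ghom G R B ?Q"
  by (rule image_module_graded[OF B qa qs qg] image_module_hom[OF B qa qs qg]; assumption)+
 have "a_kernel B ?Q q = ?N"
 proof (rule Set.set_eqI)
  fix x
  have "x \<ominus>\<^sub>B \<zero>\<^sub>B = x" if "x \<in> carrier B" using that by (simp add: a_minus_def)
  thus "x \<in> a_kernel B ?Q q \<longleftrightarrow> x \<in> ?N"
   using eq[of x "\<zero>\<^sub>B"] gh_closed[OF f] by (auto simp: a_kernel_iff image_module_simps)
 qed
 thus ?thesis using that Q by (metis image_module_simps(1))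
qed

section \<open>Graded submodules and kernels\<close>

definition submod :: "('g,'r,'m) gmodule => 'm set => ('g,'r,'m) gmodule" where
 "submod M N = M\<lparr>carrier := N, mcomp := (\<lambda>g. mcomp M g \<inter> N)\<rparr>"

lemma submod_simps [simp]:
 "carrier (submod M N) = N" "add (submod M N) = add M" "zero (submod M N) = zero M"
 "smult (submod M N) = smult M" "mcomp (submod M N) g = mcomp M g \<inter> N"
 by (simp_all add: submod_def)

lemma submod_graded:
 assumes M: "gmod G R M"
  and N: "N \<subseteq> carrier M" "\<zero>\<^sub>M \<in> N" "\<And>x y. [|x \<in> N; y \<in> N|] ==> x \<oplus>\<^sub>M y \<in> N"
   "\<And>r x. [|r \<in> carrier R; x \<in> N|] ==> r \<odot>\<^sub>M x \<in> N"
   "\<And>g x. [|g \<in> carrier G; x \<in> N|] ==> gc G M x g \<in> N"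
 shows "gmod G R (submod M N)"
  and "(\<lambda>x. x) \<in> ghom G R (submod M N) M"
proof -
 interpret M: graded_module G R M by fact
 have Nc: "x \<in> carrier M" if "x \<in> N" for x using N that by blast
 have Nm: "\<ominus>\<^sub>M x \<in> N" if "x \<in> N" for x
  using M.smult_l_minus[of "\<one>\<^sub>R" x] N(4)[of "\<ominus>\<^sub>R \<one>\<^sub>R" x] that Nc by simp
 have ag: "abelian_group (submod M N)"
 proof (rule abelian_groupI)
  fix x assume "x \<in> carrier (submod M N)"
  thus "\<exists>y\<in>carrier (submod M N). y \<oplus>\<^bsub>submod M N\<^esub> x = \<zero>\<^bsub>submod M N\<^esub>"
   using Nm Nc M.M.l_neg by (metis submod_simps(1-3))
 qed (use N Nc M.M.a_ac in auto)
 have mod: "module R (submod M N)"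
  by (rule moduleI[OF M.R.is_cring ag])
   (use N Nc in \<open>auto simp: M.smult_l_distr M.smult_r_distr M.smult_assoc1\<close>)
 show "gmod G R (submod M N)"
 proof (rule graded_moduleI(1)[OF M.graded_ring_axioms mod, where p = "\<lambda>g x. gc G M x g"])
  show "(\<lambda>x. gc G M x g) \<in> addhom (submod M N) (submod M N)" if "g \<in> carrier G" for g
   by (rule addhomI) (use N Nc that in \<open>auto simp: M.MD.dcomp_add\<close>)
  show "finite {g \<in> carrier G. gc G M x g \<noteq> \<zero>\<^bsub>submod M N\<^esub>}" if "x \<in> carrier (submod M N)" for x
   using M.MD.dcomp_finite[of x] Nc that by simp
  show "x = \<zero>\<^bsub>submod M N\<^esub>"
   if x: "x \<in> carrier (submod M N)" and 0: "\<And>g. g \<in> carrier G ==> gc G M x g = \<zero>\<^bsub>submod M N\<^esub>" for x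
   by (simp, rule M.MD.dcomp_ext) (use x 0 Nc[of x] in \<open>simp_all add: M.MD.dcomp_zero\<close>)
  show "r \<odot>\<^bsub>submod M N\<^esub> x \<in> mcomp (submod M N) (s \<otimes>\<^sub>G g)"
   if "s \<in> carrier G" "g \<in> carrier G" "r \<in> rcomp R s" "x \<in> mcomp (submod M N) g" for s g r x
   using that N(4) M.mcomp_smult M.RD.B_carr[OF that(3,1)] by simp
  show "gc G M x h = (if h = g then x else \<zero>\<^bsub>submod M N\<^esub>)"
   if "g \<in> carrier G" "h \<in> carrier G" "x \<in> mcomp (submod M N) g" for g h x
   using that M.MD.dcomp_hom'[of x g h] by simp
  show "gc G M x g \<in> mcomp (submod M N) g" if "g \<in> carrier G" "x \<in> carrier (submod M N)" for g x
   using that N(5) M.MD.dcomp_in[OF Nc] by simp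
 qed (use N M.MD.B_zero M.MD.B_add in auto)
 show "(\<lambda>x. x) \<in> ghom G R (submod M N) M"
  by (rule graded_homI0) (use Nc in auto)
qed

lemma kernel_submod:
 assumes M: "gmod G R M" and N: "gmod G R N" and u: "u \<in> ghom G R M N"
 shows "gmod G R (submod M (a_kernel M N u))"
  and "(\<lambda>x. x) \<in> ghom G R (submod M (a_kernel M N u)) M"
proof -
 interpret M: graded_module G R M by fact
 interpret N: graded_module G R N by fact
 note facts = gh_zero[OF M N u] gh_add[OF u] gh_smult[OF u] gh_gc[OF M N u, symmetric] N.MD.dcomp_zero
 show "gmod G R (submod M (a_kernel M N u))"
  and "(\<lambda>x. x) \<in> ghom G R (submod M (a_kernel M N u)) M"
  by (intro submod_graded[OF M]; auto simp: a_kernel_iff facts)+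
qed

lemma zero_submod:
 assumes M: "gmod G R M"
 shows "gmod G R (submod M {\<zero>\<^sub>M})"
proof -
 interpret M: graded_module G R M by fact
 show ?thesis by (rule submod_graded[OF M]) (auto simp: M.MD.dcomp_zero)
qed

section \<open>Biproducts\<close>

definition prodm :: "('g,'r,'a) gmodule => ('g,'r,'b) gmodule => ('g,'r,'a \<times> 'b) gmodule" where
 "prodm M N = \<lparr>carrier = carrier M \<times> carrier N, monoid.mult = undefined, monoid.one = undefined,
   ring.zero = (\<zero>\<^sub>M, \<zero>\<^sub>N), ring.add = (\<lambda>u v. (fst u \<oplus>\<^sub>M fst v, snd u \<oplus>\<^sub>N snd v)),
   module.smult = (\<lambda>r u. (r \<odot>\<^sub>M fst u, r \<odot>\<^sub>N snd u)), mcomp = (\<lambda>g. mcomp M g \<times> mcomp N g)\<rparr>"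

lemma prodm_simps [simp]:
 "carrier (prodm M N) = carrier M \<times> carrier N" "\<zero>\<^bsub>prodm M N\<^esub> = (\<zero>\<^sub>M, \<zero>\<^sub>N)"
 "u \<oplus>\<^bsub>prodm M N\<^esub> v = (fst u \<oplus>\<^sub>M fst v, snd u \<oplus>\<^sub>N snd v)"
 "r \<odot>\<^bsub>prodm M N\<^esub> u = (r \<odot>\<^sub>M fst u, r \<odot>\<^sub>N snd u)" "mcomp (prodm M N) g = mcomp M g \<times> mcomp N g"
 by (simp_all add: prodm_def)

context
 fixes G :: "('g,'x) monoid_scheme" and R :: "('g,'r) gring"
  and M :: "('g,'r,'m) gmodule" and N :: "('g,'r,'n) gmodule"
 assumes M: "gmod G R M" and N: "gmod G R N"
begin

interpretation M: graded_module G R M by fact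
interpretation N: graded_module G R N by fact

lemma prodm_graded: "gmod G R (prodm M N)"
proof -
 let ?P = "prodm M N"
 have ag: "abelian_group ?P"
 proof (rule abelian_groupI)
  fix x assume "x \<in> carrier ?P"
  thus "\<exists>y\<in>carrier ?P. y \<oplus>\<^bsub>?P\<^esub> x = \<zero>\<^bsub>?P\<^esub>"
   by (intro bexI[of _ "(\<ominus>\<^bsub>M\<^esub> fst x, \<ominus>\<^sub>N snd x)"]) (auto simp: M.M.l_neg N.M.l_neg)
 qed (auto simp: M.M.a_assoc N.M.a_assoc intro: M.M.a_comm N.M.a_comm)
 have mod: "module R ?P"
  by (rule moduleI[OF M.R.is_cring ag])
   (auto simp: M.smult_l_distr N.smult_l_distr M.smult_r_distr N.smult_r_distr M.smult_assoc1 N.smult_assoc1)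
 show ?thesis
 proof (rule graded_moduleI(1)[OF M.graded_ring_axioms mod, where p = "\<lambda>g x. (gc G M (fst x) g, gc G N (snd x) g)"])
  show "(\<lambda>x. (gc G M (fst x) g, gc G N (snd x) g)) \<in> addhom ?P ?P" if "g \<in> carrier G" for g
   by (rule addhomI) (auto simp: M.MD.dcomp_add N.MD.dcomp_add)
  show "finite {g \<in> carrier G. (gc G M (fst x) g, gc G N (snd x) g) \<noteq> \<zero>\<^bsub>?P\<^esub>}" if "x \<in> carrier ?P" for x
   by (rule finite_subset[of _ "{g. gc G M (fst x) g \<noteq> \<zero>\<^sub>M} \<union> {g. gc G N (snd x) g \<noteq> \<zero>\<^sub>N}"])
    (use that M.MD.dcomp_finite N.MD.dcomp_finite in auto)
  show "x = \<zero>\<^bsub>?P\<^esub>" if x: "x \<in> carrier ?P"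
   and 0: "\<And>g. g \<in> carrier G ==> (gc G M (fst x) g, gc G N (snd x) g) = \<zero>\<^bsub>?P\<^esub>" for x
  proof -
   have "fst x = \<zero>\<^sub>M" by (rule M.MD.dcomp_ext) (use x 0 M.MD.dcomp_zero in auto)
   moreover have "snd x = \<zero>\<^sub>N" by (rule N.MD.dcomp_ext) (use x 0 N.MD.dcomp_zero in auto)
   ultimately show ?thesis by (simp add: prod_eq_iff)
  qed
 qed (auto simp: M.MD.B_zero N.MD.B_zero M.MD.B_add N.MD.B_add M.MD.dcomp_hom' N.MD.dcomp_hom'
   M.MD.dcomp_in N.MD.dcomp_in M.mcomp_smult N.mcomp_smult M.MD.B_carr N.MD.B_carr)
qed

lemma fst_hom: "fst \<in> ghom G R (prodm M N) M" and snd_hom: "snd \<in> ghom G R (prodm M N) N"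
 by (rule graded_homI0; auto)+

lemma inl_hom: "(\<lambda>x. (x, \<zero>\<^sub>N)) \<in> ghom G R M (prodm M N)"
 and inr_hom: "(\<lambda>y. (\<zero>\<^sub>M, y)) \<in> ghom G R N (prodm M N)"
 by (rule graded_homI0; auto simp: M.MD.B_zero N.MD.B_zero)+

lemma pair_hom:
 assumes "u \<in> ghom G R Z M" "v \<in> ghom G R Z N"
 shows "(\<lambda>z. (u z, v z)) \<in> ghom G R Z (prodm M N)"
 by (rule graded_homI0) (use assms in \<open>auto simp: gh_closed gh_add gh_smult gh_mcomp\<close>)

end

section \<open>Resolutions by iterated short exact sequences\<close>

lemma gh_inj_zero:
 assumes M: "gmod G R M" and N: "gmod G R N"
  and u: "u \<in> ghom G R M N" "inj_on u (carrier M)" "x \<in> carrier M"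
 shows "u x = \<zero>\<^sub>N \<longleftrightarrow> x = \<zero>\<^sub>M"
 using gh_inj_iff[OF M N u(1)] gh_zero[OF M N u(1)] u by auto

lemma short_exactD:
 assumes "short_exact G R A B C f g"
 shows "gmod G R A" "gmod G R B" "gmod G R C"
  "f \<in> ghom G R A B" "g \<in> ghom G R B C" "inj_on f (carrier A)"
  "f ` carrier A = a_kernel B C g" "g ` carrier B = carrier C"
  "\<And>x. x \<in> carrier A ==> g (f x) = \<zero>\<^sub>C"
  "\<And>y. [|y \<in> carrier B; g y = \<zero>\<^sub>C|] ==> \<exists>x\<in>carrier A. f x = y"
proof -
 show *: "gmod G R A" "gmod G R B" "gmod G R C"
  "f \<in> ghom G R A B" "g \<in> ghom G R B C" "inj_on f (carrier A)"
  "f ` carrier A = a_kernel B C g" "g ` carrier B = carrier C"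
  using assms by (auto simp: short_exact_def)
 show "g (f x) = \<zero>\<^sub>C" if "x \<in> carrier A" for x
  using *(7) that a_kernel_iff by (metis imageI)
 show "\<exists>x\<in>carrier A. f x = y" if "y \<in> carrier B" "g y = \<zero>\<^sub>C" for y
  using *(7) that a_kernel_iff by (metis imageE)
qed

lemma short_exactI:
 assumes "gmod G R A" "gmod G R B" "gmod G R C"
  "f \<in> ghom G R A B" "g \<in> ghom G R B C" "inj_on f (carrier A)"
  "\<And>x. x \<in> carrier A ==> g (f x) = \<zero>\<^sub>C"
  "\<And>y. [|y \<in> carrier B; g y = \<zero>\<^sub>C|] ==> \<exists>x\<in>carrier A. f x = y"
  "g ` carrier B = carrier C"
 shows "short_exact G R A B C f g"
proof -
 have "f ` carrier A = a_kernel B C g"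
  using assms(7,8) gh_closed[OF assms(4)] by (force simp: a_kernel_iff)
 thus ?thesis using assms by (auto simp: short_exact_def)
qed

lemma short_exact_of_epi:
 assumes P: "gmod G R P" and X: "gmod G R X"
  and p: "p \<in> ghom G R P X" "p ` carrier P = carrier X"
 shows "short_exact G R (submod P (a_kernel P X p)) P X (\<lambda>x. x) p"
 by (rule short_exactI[OF kernel_submod(1)[OF P X p(1)] P X kernel_submod(2)[OF P X p(1)] p(1) _ _ _ p(2)])
  (auto simp: a_kernel_iff)

lemma short_exact_of_mono:
 fixes B :: "('g,'r,'b) gmodule"
 assumes A: "gmod G R A" and B: "gmod G R B"
  and f: "f \<in> ghom G R A B" "inj_on f (carrier A)"
 obtains Y :: "('g,'r,'b) gmodule" and q where "short_exact G R A B Y f q"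
proof -
 obtain Y :: "('g,'r,'b) gmodule" and q where "gmod G R Y" "q \<in> ghom G R B Y"
  "q ` carrier B = carrier Y" "a_kernel B Y q = f ` carrier A"
  using cokernel_exists[OF A B f(1)] by blast
 hence "short_exact G R A B Y f q" using A B f by (simp add: short_exact_def)
 thus ?thesis using that by blast
qed

lemma short_exact_giso:
 assumes e: "short_exact G R A B C f g"
  and A': "gmod G R A'" "giso G R A A' uA vA"
  and B': "gmod G R B'" "giso G R B B' uB vB"
  and C': "gmod G R C'" "giso G R C C' uC vC"
 shows "short_exact G R A' B' C' (\<lambda>x. uB (f (vA x))) (\<lambda>x. uC (g (vB x)))"
proof -
 note e = short_exactD[OF e]
 note a = gisoD[OF A'(2)] and b = gisoD[OF B'(2)] and c = gisoD[OF C'(2)]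
 have cl: "vA x \<in> carrier A" if "x \<in> carrier A'" for x using gh_closed[OF a(2)] that .
 have clB: "vB x \<in> carrier B" if "x \<in> carrier B'" for x using gh_closed[OF b(2)] that .
 have fcl: "f x \<in> carrier B" if "x \<in> carrier A" for x using gh_closed[OF e(4)] that .
 show ?thesis
 proof (rule short_exactI[OF A'(1) B'(1) C'(1)])
  show "(\<lambda>x. uB (f (vA x))) \<in> ghom G R A' B'"
   by (rule gh_comp[OF gh_comp[OF a(2) e(4)] b(1)])
  show "(\<lambda>x. uC (g (vB x))) \<in> ghom G R B' C'"
   by (rule gh_comp[OF gh_comp[OF b(2) e(5)] c(1)])
  show "inj_on (\<lambda>x. uB (f (vA x))) (carrier A')"
  proof (rule inj_onI)
   fix x y assume xy: "x \<in> carrier A'" "y \<in> carrier A'" "uB (f (vA x)) = uB (f (vA y))"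
   hence "f (vA x) = f (vA y)" using b(5) fcl cl by (meson inj_onD)
   hence "vA x = vA y" using e(6) cl xy by (meson inj_onD)
   thus "x = y" using a(4) xy by metis
  qed
  show "uC (g (vB (uB (f (vA x))))) = \<zero>\<^bsub>C'\<^esub>" if "x \<in> carrier A'" for x
   using that b(3) fcl cl e(9) gh_zero[OF e(3) C'(1) c(1)] by simp
  show "\<exists>x\<in>carrier A'. uB (f (vA x)) = y" if y: "y \<in> carrier B'" "uC (g (vB y)) = \<zero>\<^bsub>C'\<^esub>" for y
  proof -
   have gy: "g (vB y) \<in> carrier C" using gh_closed[OF e(5)] clB y by blast
   hence "g (vB y) = \<zero>\<^sub>C" using y c(3)[OF gy] gh_zero[OF C'(1) e(3) c(2)] by simp
   then obtain x where x: "x \<in> carrier A" "f x = vB y" using e(10) clB y by blast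
   thus ?thesis
    using a(3)[OF x(1)] b(4) y gh_closed[OF a(1) x(1)] by (intro bexI[of _ "uA x"]) auto
  qed
  show "(\<lambda>x. uC (g (vB x))) ` carrier B' = carrier C'"
  proof -
   have "vB ` carrier B' = carrier B" using gisoD(6)[OF giso_sym[OF B'(2)]] .
   hence "uC ` g ` vB ` carrier B' = carrier C'" using e(8) c(6) by simp
   thus ?thesis by (simp add: image_image)
  qed
 qed
qed

text \<open>An infinite resolution that vanishes beyond \<open>n\<close> is traded for
  \<open>n\<close> short exact sequences, so that lengths can be handled by induction on
  \<open>n\<close>. All modules involved have elements in the one type \<open>'u\<close>.\<close>

primrec ldim :: "('g,'x) monoid_scheme => ('g,'r) gring => (('g,'r,'u) gmodule => bool) => nat
  => ('g,'r,'u) gmodule => bool" where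
 "ldim G R Q 0 X = Q X"
| "ldim G R Q (Suc n) X = (\<exists>K P f p. short_exact G R K P X f p \<and> Q P \<and> ldim G R Q n K)"

primrec rdim :: "('g,'x) monoid_scheme => ('g,'r) gring => (('g,'r,'u) gmodule => bool) => nat
  => ('g,'r,'u) gmodule => bool" where
 "rdim G R Q 0 X = Q X"
| "rdim G R Q (Suc n) X = (\<exists>J Y f p. short_exact G R X J Y f p \<and> Q J \<and> rdim G R Q n Y)"

text \<open>What projective, injective and flat modules share for the bookkeeping of resolutions.
  Zero modules must belong to the class because they fill the positions beyond the length.\<close>

locale module_class =
 fixes G :: "('g,'x) monoid_scheme" and R :: "('g,'r) gring"
  and Q :: "('g,'r,'u) gmodule => bool"
 assumes Q_graded: "Q X ==> gmod G R X"
  and Q_iso: "[|Q X; gmod G R Y; giso G R X Y u v|] ==> Q Y"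
  and Q_zero: "[|gmod G R X; carrier X = {\<zero>\<^sub>X}|] ==> Q X"
begin

lemma Q_bijective:
 assumes "Q X" "gmod G R Y" "u \<in> ghom G R X Y"
  "inj_on u (carrier X)" "u ` carrier X = carrier Y"
 shows "Q Y"
proof -
 obtain v where v: "v \<in> ghom G R Y X" "\<And>z. z \<in> carrier Y ==> u (v z) = z"
  using factor_mono[OF Q_graded[OF assms(1)] assms(2,2,3,4) gh_id[of G R Y]] assms(5) by auto
 have "v (u x) = x" if "x \<in> carrier X" for x
  using v gh_closed[OF v(1)] gh_closed[OF assms(3)] assms(4) that by (meson inj_onD)
 hence "giso G R X Y u v" using v assms by (auto simp: giso_def)
 thus ?thesis using Q_iso assms by blast
qed

lemma Q_bijective':
 assumes "Q Y" "gmod G R X" "u \<in> ghom G R X Y"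
  "inj_on u (carrier X)" "u ` carrier X = carrier Y"
 shows "Q X"
proof -
 obtain v where v: "v \<in> ghom G R Y X" "\<And>z. z \<in> carrier Y ==> u (v z) = z"
  using factor_mono[OF assms(2) Q_graded[OF assms(1)] Q_graded[OF assms(1)] assms(3,4) gh_id[of G R Y]]
   assms(5) by auto
 have "v (u x) = x" if "x \<in> carrier X" for x
  using v gh_closed[OF v(1)] gh_closed[OF assms(3)] assms(4) that by (meson inj_onD)
 hence "giso G R Y X v u" using v assms by (auto simp: giso_def)
 thus ?thesis using Q_iso assms by blast
qed

definition has_lres :: "nat => ('g,'r,'m) gmodule => bool" where
 "has_lres n M \<longleftrightarrow> (\<exists>P d e. left_resolution G R M P d e \<and> (\<forall>i. Q (P i)) \<and> vanishes_beyond n P)"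

definition has_rres :: "nat => ('g,'r,'m) gmodule => bool" where
 "has_rres n M \<longleftrightarrow> (\<exists>J d e. right_resolution G R M J d e \<and> (\<forall>i. Q (J i)) \<and> vanishes_beyond n J)"

lemma has_lres_0:
 fixes X :: "('g,'r,'u) gmodule"
 assumes X: "gmod G R X"
 shows "has_lres 0 X \<longleftrightarrow> Q X"
proof
 assume "has_lres 0 X"
 then obtain P d e where r: "left_resolution G R X P d e" "\<forall>i. Q (P i)" "vanishes_beyond 0 P"
  by (auto simp: has_lres_def)
 have e: "e \<in> ghom G R (P 0) X" "e ` carrier (P 0) = carrier X" "d 0 \<in> ghom G R (P (Suc 0)) (P 0)"
  "d 0 ` carrier (P (Suc 0)) = a_kernel (P 0) X e"
  using r(1) by (auto simp: left_resolution_def)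
 have g: "gmod G R (P i)" for i using r Q_graded by blast
 have "carrier (P (Suc 0)) = {\<zero>\<^bsub>P (Suc 0)\<^esub>}" using r(3) by (simp add: vanishes_beyond_def)
 hence "a_kernel (P 0) X e = {\<zero>\<^bsub>P 0\<^esub>}" using e(4) gh_zero[OF g g e(3)] by simp
 hence "inj_on e (carrier (P 0))"
  unfolding gh_inj_iff[OF g X e(1)] using a_kernel_iff by (metis singletonD)
 thus "Q X" using Q_bijective[OF _ X e(1) _ e(2)] r(2) by blast
next
 assume Q: "Q X"
 interpret X: graded_module G R X by fact
 \<comment> \<open>The zero submodule fills all later positions. It has the same zero element as
   \<open>X\<close>, so one constant map serves as every differential.\<close>
 define Z where "Z = submod X {\<zero>\<^sub>X}"
 have Z: "gmod G R Z" "carrier Z = {\<zero>\<^sub>Z}" "\<zero>\<^sub>Z = \<zero>\<^sub>X"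
  unfolding Z_def using zero_submod[OF X] by auto
 hence QZ: "Q Z" using Q_zero by blast
 let ?P = "case_nat X (\<lambda>_. Z)" let ?d = "\<lambda>(i::nat) (x::'u). \<zero>\<^sub>X"
 have "left_resolution G R X ?P ?d (\<lambda>x. x)"
  unfolding left_resolution_def
 proof (intro conjI allI)
  fix i
  show "gmod G R (?P i)" by (cases i) (auto simp: X Z)
  show "?d i \<in> ghom G R (?P (Suc i)) (?P i)"
   using graded_hom_zero[OF Z(1) X] graded_hom_zero[OF Z(1) Z(1)] by (cases i) (auto simp: Z(3))
  show "?d (Suc i) ` carrier (?P (Suc (Suc i))) = a_kernel (?P (Suc i)) (?P i) (?d i)"
   by (cases i) (auto simp: a_kernel_iff Z(2,3) set_eq_iff)
 qed (auto simp: gh_id a_kernel_iff Z(2,3))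
 moreover have "\<forall>i. Q (?P i)" using Q QZ by (auto split: nat.split)
 moreover have "vanishes_beyond 0 ?P" using Z(2) by (auto simp: vanishes_beyond_def split: nat.split)
 ultimately show "has_lres 0 X" unfolding has_lres_def by blast
qed

text \<open>A resolution is cut at the kernel of its augmentation. Conversely, a resolution of
  \<open>K\<close> is spliced on by composing its augmentation with the injection \<open>f\<close>,
  which leaves the kernel of that augmentation unchanged.\<close>

lemma has_lres_Suc:
 fixes X :: "('g,'r,'u) gmodule"
 assumes X: "gmod G R X"
 shows "has_lres (Suc n) X \<longleftrightarrow> (\<exists>(K :: ('g,'r,'u) gmodule) P f p. short_exact G R K P X f p \<and> Q P \<and> has_lres n K)"
proof
 assume "has_lres (Suc n) X"
 then obtain P d e where r: "left_resolution G R X P d e" "\<forall>i. Q (P i)" "vanishes_beyond (Suc n) P"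
  by (auto simp: has_lres_def)
 have e: "e \<in> ghom G R (P 0) X" "e ` carrier (P 0) = carrier X" "\<And>i. d i \<in> ghom G R (P (Suc i)) (P i)"
  "d 0 ` carrier (P (Suc 0)) = a_kernel (P 0) X e"
  "\<And>i. d (Suc i) ` carrier (P (Suc (Suc i))) = a_kernel (P (Suc i)) (P i) (d i)"
  using r(1) by (auto simp: left_resolution_def)
 have g: "gmod G R (P i)" for i using r Q_graded by blast
 let ?K = "submod (P 0) (a_kernel (P 0) X e)"
 have se: "short_exact G R ?K (P 0) X (\<lambda>x. x) e" by (rule short_exact_of_epi[OF g X e(1,2)])
 obtain e' where e': "e' \<in> ghom G R (P (Suc 0)) ?K" "\<And>x. x \<in> carrier (P (Suc 0)) ==> e' x = d 0 x"
  using factor_mono[OF short_exactD(1,2)[OF se] g short_exactD(4,6)[OF se] e(3)] e(4) by auto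
 have "left_resolution G R ?K (\<lambda>i. P (Suc i)) (\<lambda>i. d (Suc i)) e'"
  unfolding left_resolution_def
 proof (intro conjI allI g e e')
  show "e' ` carrier (P (Suc 0)) = carrier ?K" using e' e(4) by simp
  show "d (Suc 0) ` carrier (P (Suc (Suc 0))) = a_kernel (P (Suc 0)) ?K e'"
   using e(5)[of 0] e'(2) by (auto simp: a_kernel_iff set_eq_iff)
 qed
 moreover have "vanishes_beyond n (\<lambda>i. P (Suc i))" using r(3) by (simp add: vanishes_beyond_def)
 ultimately have "has_lres n ?K"
  using r(2) unfolding has_lres_def by (intro exI[of _ "\<lambda>i. P (Suc i)"]) auto
 thus "\<exists>(K :: ('g,'r,'u) gmodule) P f p. short_exact G R K P X f p \<and> Q P \<and> has_lres n K"
  using se r(2) by blast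
next
 assume "\<exists>(K :: ('g,'r,'u) gmodule) P f p. short_exact G R K P X f p \<and> Q P \<and> has_lres n K"
 then obtain P f p P' d' e' and K :: "('g,'r,'u) gmodule" where se: "short_exact G R K P X f p" and P: "Q P"
  and r: "left_resolution G R K P' d' e'" "\<forall>i. Q (P' i)" "vanishes_beyond n P'"
  unfolding has_lres_def by blast
 note e = short_exactD[OF se]
 have l: "e' \<in> ghom G R (P' 0) K" "e' ` carrier (P' 0) = carrier K"
  "\<And>i. d' i \<in> ghom G R (P' (Suc i)) (P' i)"
  "d' 0 ` carrier (P' (Suc 0)) = a_kernel (P' 0) K e'"
  "\<And>i. d' (Suc i) ` carrier (P' (Suc (Suc i))) = a_kernel (P' (Suc i)) (P' i) (d' i)"
  using r(1) by (auto simp: left_resolution_def)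
 have g: "gmod G R (P' i)" for i using r Q_graded by blast
 let ?P = "case_nat P P'" let ?d = "case_nat (\<lambda>x. f (e' x)) d'"
 have "left_resolution G R X ?P ?d p"
  unfolding left_resolution_def
 proof (intro conjI allI)
  fix i
  show "gmod G R (?P i)" by (cases i) (auto simp: e g)
  show "?d i \<in> ghom G R (?P (Suc i)) (?P i)"
   using gh_comp[OF l(1) e(4)] l(3) by (cases i) auto
  have "f (e' x) = \<zero>\<^sub>P \<longleftrightarrow> e' x = \<zero>\<^sub>K" if "x \<in> carrier (P' 0)" for x
   by (rule gh_inj_zero[OF e(1,2,4,6) gh_closed[OF l(1) that]])
  hence "a_kernel (P' 0) K e' = a_kernel (P' 0) P (\<lambda>x. f (e' x))"
   by (auto simp: a_kernel_iff gh_zero[OF e(1,2,4)])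
  thus "?d (Suc i) ` carrier (?P (Suc (Suc i))) = a_kernel (?P (Suc i)) (?P i) (?d i)"
   using l(4,5) by (cases i) auto
  have "(\<lambda>x. f (e' x)) ` carrier (P' 0) = f ` carrier K" using l(2) by (metis image_image)
  thus "?d 0 ` carrier (?P (Suc 0)) = a_kernel (?P 0) X p" using e(7) by simp
 qed (simp_all add: e)
 moreover have "\<forall>i. Q (?P i)" using P r by (auto split: nat.split)
 moreover have "vanishes_beyond (Suc n) ?P"
  using r(3) by (auto simp: vanishes_beyond_def split: nat.split)
 ultimately show "has_lres (Suc n) X" unfolding has_lres_def by blast
qed

lemma has_lres_iff:
 fixes X :: "('g,'r,'u) gmodule"
 shows "gmod G R X ==> has_lres n X \<longleftrightarrow> ldim G R Q n X"
proof (induction n arbitrary: X)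
 case (Suc n)
 have "(short_exact G R K P X f p \<and> Q P \<and> has_lres n K) \<longleftrightarrow> (short_exact G R K P X f p \<and> Q P \<and> ldim G R Q n K)"
  for P f p and K :: "('g,'r,'u) gmodule" using Suc.IH[of K] short_exactD(1) by blast
 thus ?case unfolding has_lres_Suc[OF Suc.prems] ldim.simps by (simp only:)
qed (use has_lres_0 in simp)

lemma has_lres_giso:
 assumes M: "gmod G R M" and N: "gmod G R N" and i: "giso G R M N u v" and r: "has_lres n M"
 shows "has_lres n N"
proof -
 obtain P d e where r: "left_resolution G R M P d e" "\<forall>i. Q (P i)" "vanishes_beyond n P"
  using r by (auto simp: has_lres_def)
 note i = gisoD[OF i]
 have e: "e \<in> ghom G R (P 0) M" "e ` carrier (P 0) = carrier M"
  using r(1) by (auto simp: left_resolution_def)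
 have "u (e x) = \<zero>\<^sub>N \<longleftrightarrow> e x = \<zero>\<^sub>M" if "x \<in> carrier (P 0)" for x
  by (rule gh_inj_zero[OF M N i(1,5) gh_closed[OF e(1) that]])
 hence "a_kernel (P 0) N (\<lambda>x. u (e x)) = a_kernel (P 0) M e"
  by (auto simp: a_kernel_iff gh_zero[OF M N i(1)])
 moreover have "(\<lambda>x. u (e x)) ` carrier (P 0) = carrier N" using e(2) i(6) by (metis image_image)
 ultimately have "left_resolution G R N P d (\<lambda>x. u (e x))"
  using r(1) gh_comp[OF e(1) i(1)] by (simp add: left_resolution_def)
 thus ?thesis using r by (auto simp: has_lres_def)
qed

lemma has_rres_0:
 fixes X :: "('g,'r,'u) gmodule"
 assumes X: "gmod G R X"
 shows "has_rres 0 X \<longleftrightarrow> Q X"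
proof
 assume "has_rres 0 X"
 then obtain J d e where r: "right_resolution G R X J d e" "\<forall>i. Q (J i)" "vanishes_beyond 0 J"
  by (auto simp: has_rres_def)
 have e: "e \<in> ghom G R X (J 0)" "inj_on e (carrier X)" "d 0 \<in> ghom G R (J 0) (J (Suc 0))"
  "e ` carrier X = a_kernel (J 0) (J (Suc 0)) (d 0)"
  using r(1) by (auto simp: right_resolution_def)
 have "carrier (J (Suc 0)) = {\<zero>\<^bsub>J (Suc 0)\<^esub>}" using r(3) by (simp add: vanishes_beyond_def)
 hence "a_kernel (J 0) (J (Suc 0)) (d 0) = carrier (J 0)"
  using gh_closed[OF e(3)] by (auto simp: a_kernel_iff)
 hence "e ` carrier X = carrier (J 0)" using e(4) by simp
 thus "Q X" using Q_bijective'[OF _ X e(1,2)] r(2) by blast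
next
 assume Q: "Q X"
 interpret X: graded_module G R X by fact
 define Z where "Z = submod X {\<zero>\<^sub>X}"
 have Z: "gmod G R Z" "carrier Z = {\<zero>\<^sub>Z}" "\<zero>\<^sub>Z = \<zero>\<^sub>X"
  unfolding Z_def using zero_submod[OF X] by auto
 hence QZ: "Q Z" using Q_zero by blast
 let ?J = "case_nat X (\<lambda>_. Z)" let ?d = "\<lambda>(i::nat) (x::'u). \<zero>\<^sub>X"
 have "right_resolution G R X ?J ?d (\<lambda>x. x)"
  unfolding right_resolution_def
 proof (intro conjI allI)
  fix i
  show "gmod G R (?J i)" by (cases i) (auto simp: X Z)
  show "?d i \<in> ghom G R (?J i) (?J (Suc i))"
   using graded_hom_zero[OF X Z(1)] graded_hom_zero[OF Z(1) Z(1)] by (cases i) (auto simp: Z(3))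
  have "carrier X \<noteq> {}" using X.M.zero_closed by blast
  moreover have "a_kernel Z Z (\<lambda>x. \<zero>\<^sub>X) = {\<zero>\<^sub>X}" by (simp add: a_kernel_def kernel_def Z(2,3))
  ultimately show "?d i ` carrier (?J i) = a_kernel (?J (Suc i)) (?J (Suc (Suc i))) (?d (Suc i))"
   using Z(2,3) by (cases i) (simp_all add: image_constant_conv)
 qed (auto simp: gh_id a_kernel_iff Z(2,3))
 moreover have "\<forall>i. Q (?J i)" using Q QZ by (auto split: nat.split)
 moreover have "vanishes_beyond 0 ?J" using Z(2) by (auto simp: vanishes_beyond_def split: nat.split)
 ultimately show "has_rres 0 X" unfolding has_rres_def by blast
qed

text \<open>Here the cut is made at the cokernel \<open>Y\<close> of the coaugmentation: since its
  image is the kernel of \<open>d 0\<close>, that differential factors through an injection of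
  \<open>Y\<close>.\<close>

lemma has_rres_Suc:
 fixes X :: "('g,'r,'u) gmodule"
 assumes X: "gmod G R X"
 shows "has_rres (Suc n) X \<longleftrightarrow> (\<exists>J (Y :: ('g,'r,'u) gmodule) f p. short_exact G R X J Y f p \<and> Q J \<and> has_rres n Y)"
proof
 assume "has_rres (Suc n) X"
 then obtain J d e where r: "right_resolution G R X J d e" "\<forall>i. Q (J i)" "vanishes_beyond (Suc n) J"
  by (auto simp: has_rres_def)
 have e: "e \<in> ghom G R X (J 0)" "inj_on e (carrier X)" "\<And>i. d i \<in> ghom G R (J i) (J (Suc i))"
  "e ` carrier X = a_kernel (J 0) (J (Suc 0)) (d 0)"
  "\<And>i. d i ` carrier (J i) = a_kernel (J (Suc i)) (J (Suc (Suc i))) (d (Suc i))"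
  using r(1) by (auto simp: right_resolution_def)
 have g: "gmod G R (J i)" for i using r Q_graded by blast
 obtain q and Y :: "('g,'r,'u) gmodule" where se: "short_exact G R X (J 0) Y e q" using short_exact_of_mono[OF X g e(1,2)] by blast
 note s = short_exactD[OF se]
 have k: "q x = \<zero>\<^sub>Y \<longleftrightarrow> d 0 x = \<zero>\<^bsub>J (Suc 0)\<^esub>" if "x \<in> carrier (J 0)" for x
  using s(7) e(4) that by (metis a_kernel_iff)
 obtain e' where e': "e' \<in> ghom G R Y (J (Suc 0))" "\<And>x. x \<in> carrier (J 0) ==> e' (q x) = d 0 x"
  using factor_epi[OF s(2,3) g s(5,8) e(3)] k by metis
 have "right_resolution G R Y (\<lambda>i. J (Suc i)) (\<lambda>i. d (Suc i)) e'"
  unfolding right_resolution_def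
 proof (intro conjI allI g e e')
  show "inj_on e' (carrier Y)"
   unfolding gh_inj_iff[OF s(3) g e'(1)]
  proof (intro ballI impI)
   fix y assume y: "y \<in> carrier Y" "e' y = \<zero>\<^bsub>J (Suc 0)\<^esub>"
   then obtain x where "x \<in> carrier (J 0)" "y = q x" using s(8) by blast
   thus "y = \<zero>\<^sub>Y" using k e' y by simp
  qed
  have "e' ` carrier Y = d 0 ` carrier (J 0)"
   unfolding s(8)[symmetric] image_image using e'(2) by (intro image_cong) auto
  thus "e' ` carrier Y = a_kernel (J (Suc 0)) (J (Suc (Suc 0))) (d (Suc 0))" using e(5) by simp
 qed
 moreover have "vanishes_beyond n (\<lambda>i. J (Suc i))" using r(3) by (simp add: vanishes_beyond_def)
 ultimately have "has_rres n Y"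
  using r(2) unfolding has_rres_def by (intro exI[of _ "\<lambda>i. J (Suc i)"]) auto
 thus "\<exists>J (Y :: ('g,'r,'u) gmodule) f p. short_exact G R X J Y f p \<and> Q J \<and> has_rres n Y"
  using se r(2) by blast
next
 assume "\<exists>J (Y :: ('g,'r,'u) gmodule) f p. short_exact G R X J Y f p \<and> Q J \<and> has_rres n Y"
 then obtain J f p J' d' e' and Y :: "('g,'r,'u) gmodule" where se: "short_exact G R X J Y f p" and J: "Q J"
  and r: "right_resolution G R Y J' d' e'" "\<forall>i. Q (J' i)" "vanishes_beyond n J'"
  unfolding has_rres_def by blast
 note e = short_exactD[OF se]
 have l: "e' \<in> ghom G R Y (J' 0)" "inj_on e' (carrier Y)"
  "\<And>i. d' i \<in> ghom G R (J' i) (J' (Suc i))"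
  "e' ` carrier Y = a_kernel (J' 0) (J' (Suc 0)) (d' 0)"
  "\<And>i. d' i ` carrier (J' i) = a_kernel (J' (Suc i)) (J' (Suc (Suc i))) (d' (Suc i))"
  using r(1) by (auto simp: right_resolution_def)
 have g: "gmod G R (J' i)" for i using r Q_graded by blast
 let ?J = "case_nat J J'" let ?d = "case_nat (\<lambda>x. e' (p x)) d'"
 have "right_resolution G R X ?J ?d f"
  unfolding right_resolution_def
 proof (intro conjI allI)
  fix i
  show "gmod G R (?J i)" by (cases i) (auto simp: e g)
  show "?d i \<in> ghom G R (?J i) (?J (Suc i))"
   using gh_comp[OF e(5) l(1)] l(3) by (cases i) auto
  have "e' (p x) = \<zero>\<^bsub>J' 0\<^esub> \<longleftrightarrow> p x = \<zero>\<^sub>Y" if "x \<in> carrier J" for x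
   by (rule gh_inj_zero[OF e(3) g l(1,2) gh_closed[OF e(5) that]])
  hence "a_kernel J Y p = a_kernel J (J' 0) (\<lambda>x. e' (p x))"
   by (auto simp: a_kernel_iff gh_zero[OF e(3) g l(1)])
  thus "f ` carrier X = a_kernel (?J 0) (?J (Suc 0)) (?d 0)" using e(7) by simp
  have "(\<lambda>x. e' (p x)) ` carrier J = e' ` carrier Y" using e(8) by (metis image_image)
  thus "?d i ` carrier (?J i) = a_kernel (?J (Suc i)) (?J (Suc (Suc i))) (?d (Suc i))"
   using l(4,5) by (cases i) auto
 qed (simp_all add: e)
 moreover have "\<forall>i. Q (?J i)" using J r by (auto split: nat.split)
 moreover have "vanishes_beyond (Suc n) ?J"
  using r(3) by (auto simp: vanishes_beyond_def split: nat.split)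
 ultimately show "has_rres (Suc n) X" unfolding has_rres_def by blast
qed

lemma has_rres_iff:
 fixes X :: "('g,'r,'u) gmodule"
 shows "gmod G R X ==> has_rres n X \<longleftrightarrow> rdim G R Q n X"
proof (induction n arbitrary: X)
 case (Suc n)
 have "(short_exact G R X J Y f p \<and> Q J \<and> has_rres n Y) \<longleftrightarrow> (short_exact G R X J Y f p \<and> Q J \<and> rdim G R Q n Y)"
  for J f p and Y :: "('g,'r,'u) gmodule" using Suc.IH[of Y] short_exactD(3) by blast
 thus ?case unfolding has_rres_Suc[OF Suc.prems] rdim.simps by (simp only:)
qed (use has_rres_0 in simp)

lemma has_rres_giso:
 assumes M: "gmod G R M" and N: "gmod G R N" and i: "giso G R M N u v" and r: "has_rres n M"
 shows "has_rres n N"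
proof -
 obtain J d e where r: "right_resolution G R M J d e" "\<forall>i. Q (J i)" "vanishes_beyond n J"
  using r by (auto simp: has_rres_def)
 note i = gisoD[OF giso_sym[OF i]]
 have e: "e \<in> ghom G R M (J 0)" "inj_on e (carrier M)"
  using r(1) by (auto simp: right_resolution_def)
 have "inj_on (\<lambda>x. e (v x)) (carrier N)"
  using comp_inj_on[OF i(5)] e(2) i(6) by (simp add: comp_def)
 moreover have "(\<lambda>x. e (v x)) ` carrier N = e ` carrier M" using i(6) by (metis image_image)
 ultimately have "right_resolution G R N J d (\<lambda>x. e (v x))"
  using r(1) gh_comp[OF i(1) e(1)] by (simp add: right_resolution_def)
 thus ?thesis using r by (auto simp: has_rres_def)
qed

end

section \<open>Coarsening of direct sums\<close>

lemma (in abelian_group) sum_of_family_induct [consumes 1, case_names sub zero hom add]: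
 assumes "x \<in> sum_of_family G I B" and B: "\<And>i. i \<in> I ==> B i \<subseteq> carrier G"
  and "P \<zero>" "\<And>i x. [|i \<in> I; x \<in> B i|] ==> P x"
  "\<And>x y. [|x \<in> carrier G; y \<in> carrier G; P x; P y|] ==> P (x \<oplus> y)"
 shows "P x"
proof -
 obtain F c where F: "finite F" "F \<subseteq> I" "c \<in> (\<Pi> i\<in>F. B i)" "x = finsum G c F"
  using assms(1) by (auto simp: sum_of_family_def)
 have "P (finsum G c F)"
  using F(1-3)
 proof (induction F)
  case empty
  thus ?case using assms(3) by simp
 next
  case (insert i F)
  have c: "c i \<in> B i" "i \<in> I" using insert.prems by auto
  have cF: "c \<in> F \<rightarrow> carrier G" using insert.prems B by (auto simp: Pi_iff subset_iff)
  have "P (c i)" "P (finsum G c F)" using insert c assms(4) by auto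
  moreover have "c i \<in> carrier G" "finsum G c F \<in> carrier G" using c B cF by auto
  ultimately show ?case using insert.hyps cF assms(5) by simp
 qed
 thus ?thesis using F by simp
qed

context direct_sum
begin

context
 fixes \<phi> :: "'i => 'j" and J :: "'j set"
 assumes \<phi>: "\<And>i. i \<in> I ==> \<phi> i \<in> J"
begin

abbreviation "fibre j \<equiv> {i \<in> I. \<phi> i = j}"
abbreviation "fibcomp j \<equiv> sum_of_family A (fibre j) B"
abbreviation "fibproj j \<equiv> hsum A (\<lambda>i a. if \<phi> i = j then a else \<zero>)"

lemma fibproj_props: "fibproj j \<in> addhom A A" "[|i \<in> I; x \<in> B i|] ==> fibproj j x = (if \<phi> i = j then x else \<zero>)"
proof -
 have a: "(if \<phi> i = j then x else \<zero>) \<in> carrier A" if "i \<in> I" "x \<in> B i" for i x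
  using that B_carr[OF that(2,1)] by simp
 have b: "(if \<phi> i = j then x \<oplus> y else \<zero>) = (if \<phi> i = j then x else \<zero>) \<oplus> (if \<phi> i = j then y else \<zero>)" for i x y
  by simp
 show "fibproj j \<in> addhom A A" "[|i \<in> I; x \<in> B i|] ==> fibproj j x = (if \<phi> i = j then x else \<zero>)"
  by (rule hsum_props[OF abelian_group_axioms]; (erule (1) a | rule b | assumption))+
qed

lemma dcomp_fibproj:
 assumes "x \<in> carrier A" "k \<in> I"
 shows "\<pi> (fibproj j x) k = (if \<phi> k = j then \<pi> x k else \<zero>)"
proof (rule addhom_eqI[OF abelian_group_axioms _ _ _ assms(1)])
 show "(\<lambda>x. \<pi> (fibproj j x) k) \<in> addhom A A"
  by (rule addhom_comp[OF fibproj_props(1) dcomp_addhom])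
 show "(\<lambda>x. if \<phi> k = j then \<pi> x k else \<zero>) \<in> addhom A A"
  by (rule addhomI) (auto simp: dcomp_add)
 fix i x assume "i \<in> I" "x \<in> B i"
 thus "\<pi> (fibproj j x) k = (if \<phi> k = j then \<pi> x k else \<zero>)"
  using dcomp_hom'[of x i k] dcomp_zero[of k] fibproj_props(2)[of i x j] by auto
qed

text \<open>Coarse components are described by vanishing of fine components instead of by finite
  sums; this is the form in which they are used from here on.\<close>

lemma fibcomp_iff: "x \<in> fibcomp j \<longleftrightarrow> x \<in> carrier A \<and> (\<forall>i\<in>I. \<phi> i \<noteq> j \<longrightarrow> \<pi> x i = \<zero>)"
proof
 assume x: "x \<in> fibcomp j"
 have Bc: "B i \<subseteq> carrier A" if "i \<in> fibre j" for i using that B_carr by blast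
 have "x \<in> carrier A" using subsetD[OF sum_of_family_carrier[OF Bc] x] .
 moreover have "\<forall>i\<in>I. \<phi> i \<noteq> j \<longrightarrow> \<pi> x i = \<zero>"
  using x
 proof (induction rule: sum_of_family_induct)
  case zero
  thus ?case using dcomp_zero by simp
 next
  case (hom i x)
  thus ?case by (auto simp: dcomp_hom')
 next
  case (add x y)
  thus ?case by (auto simp: dcomp_add)
 qed (rule Bc)
 ultimately show "x \<in> carrier A \<and> (\<forall>i\<in>I. \<phi> i \<noteq> j \<longrightarrow> \<pi> x i = \<zero>)" by simp
next
 assume x: "x \<in> carrier A \<and> (\<forall>i\<in>I. \<phi> i \<noteq> j \<longrightarrow> \<pi> x i = \<zero>)"
 show "x \<in> fibcomp j"
 proof (rule sum_of_familyI)
  show "finite {i. \<pi> x i \<noteq> \<zero>}" using x dcomp_finite by blast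
  show "x = finsum A (\<pi> x) {i. \<pi> x i \<noteq> \<zero>}" using x dcomp_props(4) by blast
  show "{i. \<pi> x i \<noteq> \<zero>} \<subseteq> fibre j" using x dcomp_out by blast
  thus "\<pi> x i \<in> B i" if "i \<in> {i. \<pi> x i \<noteq> \<zero>}" for i using that x dcomp_in by blast
 qed
qed

text \<open>The projections keep the fine components over one index \<open>j\<close>. Only the
  images under \<open>\<phi>\<close> of the support of \<open>x\<close> can give a nonzero value,
  whence finiteness, and an element killed by all of them has no fine component left.\<close>

lemma coarsen_direct_sum:
 "direct_sum A J fibcomp"
 "[|x \<in> carrier A; j \<in> J|] ==> dcomp A J fibcomp x j = fibproj j x"
proof -
 have cl: "fibproj j x \<in> carrier A" if "x \<in> carrier A" for x j
  by (rule addhom_closed[OF fibproj_props(1) that])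
 have sub: "additive_subgroup (fibcomp j) A" for j
 proof (rule additive_subgroupI'[OF abelian_group_axioms])
  fix x assume "x \<in> fibcomp j"
  thus "\<ominus> x \<in> fibcomp j"
   using addhom_minus[OF abelian_group_axioms abelian_group_axioms dcomp_addhom, of x]
   unfolding fibcomp_iff by simp
 next
  fix x y assume "x \<in> fibcomp j" "y \<in> fibcomp j"
  thus "x \<oplus> y \<in> fibcomp j" unfolding fibcomp_iff by (simp add: dcomp_add)
 qed (auto simp: fibcomp_iff dcomp_zero)
 have pid: "fibproj k x = (if k = j then x else \<zero>)" if "x \<in> fibcomp j" for j k x
 proof (rule dcomp_ext)
  have x: "x \<in> carrier A" "\<And>i. [|i \<in> I; \<phi> i \<noteq> j|] ==> \<pi> x i = \<zero>" using that unfolding fibcomp_iff by auto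
  show "fibproj k x \<in> carrier A" "(if k = j then x else \<zero>) \<in> carrier A" using cl x by auto
  show "\<pi> (fibproj k x) i = \<pi> (if k = j then x else \<zero>) i" if "i \<in> I" for i
   using dcomp_fibproj[OF x(1) that] x(2)[OF that] dcomp_zero by auto
 qed
 have pB: "fibproj j x \<in> fibcomp j" if "x \<in> carrier A" for j x
  unfolding fibcomp_iff using cl that dcomp_fibproj by simp
 have z: "fibproj j x = \<zero>" if x: "x \<in> carrier A" and "\<And>i. [|i \<in> I; \<phi> i = j|] ==> \<pi> x i = \<zero>" for j x
  by (rule dcomp_ext[OF cl[OF x] zero_closed]) (use that dcomp_zero dcomp_fibproj[OF x] in simp)
 have fin: "finite {j \<in> J. fibproj j x \<noteq> \<zero>}" if x: "x \<in> carrier A" for x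
 proof (rule finite_subset)
  show "finite (\<phi> ` {i. \<pi> x i \<noteq> \<zero>})" using dcomp_finite[OF x] by simp
  have "j \<in> \<phi> ` {i. \<pi> x i \<noteq> \<zero>}" if "fibproj j x \<noteq> \<zero>" for j
   using z[OF x, of j] that by blast
  thus "{j \<in> J. fibproj j x \<noteq> \<zero>} \<subseteq> \<phi> ` {i. \<pi> x i \<noteq> \<zero>}" by blast
 qed
 have sep: "x = \<zero>" if x: "x \<in> carrier A" and 0: "\<And>j. j \<in> J ==> fibproj j x = \<zero>" for x
 proof (rule dcomp_ext[OF x zero_closed])
  fix i assume i: "i \<in> I"
  show "\<pi> x i = \<pi> \<zero> i" using dcomp_fibproj[OF x i, of "\<phi> i"] 0[OF \<phi>[OF i]] dcomp_zero by simp
 qed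
 note * = direct_sum_sepI[where p = fibproj and B = fibcomp and I = J,
   OF abelian_group_axioms sub fibproj_props(1) pid pB fin sep]
 show "direct_sum A J fibcomp" by (rule *(1))
 show "[|x \<in> carrier A; j \<in> J|] ==> dcomp A J fibcomp x j = fibproj j x" by (rule *(2))
qed

end

end

section \<open>Coarsening of graded rings and modules\<close>

lemma coarsen_simps [simp]:
 "carrier (coarsen_ring G \<psi> R) = carrier R" "mult (coarsen_ring G \<psi> R) = mult R"
 "one (coarsen_ring G \<psi> R) = one R" "zero (coarsen_ring G \<psi> R) = zero R" "add (coarsen_ring G \<psi> R) = add R"
 "rcomp (coarsen_ring G \<psi> R) h = sum_of_family R {g \<in> carrier G. \<psi> g = h} (rcomp R)"
 "carrier (coarsen_module G \<psi> M) = carrier M" "zero (coarsen_module G \<psi> M) = zero M"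
 "add (coarsen_module G \<psi> M) = add M" "smult (coarsen_module G \<psi> M) = smult M"
 "mcomp (coarsen_module G \<psi> M) h = sum_of_family M {g \<in> carrier G. \<psi> g = h} (mcomp M)"
 by (simp_all add: coarsen_ring_def coarsen_module_def)

text \<open>A coarsened structure is a record of another type with the same additive group.
  Everything that depends on the group alone is literally equal, and these equations carry it from
  one record to the other.\<close>

lemma finsum_cong_record:
 fixes A :: "('a,'y) ring_scheme" and B :: "('a,'z) ring_scheme"
 assumes "carrier A = carrier B" "add A = add B" "zero A = zero B"
 shows "finsum A = finsum B" "a_inv A = a_inv B" "additive_subgroup C A = additive_subgroup C B"
  "abelian_group A = abelian_group B" "is_direct_sum A I D = is_direct_sum B I D"
  "sum_of_family A I D = sum_of_family B I D" "dcomp A = dcomp B"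
proof -
 show f: "finsum A = finsum B"
  by (intro ext) (simp add: finsum_def finprod_def assms)
 show "a_inv A = a_inv B" by (intro ext) (simp add: a_inv_def m_inv_def assms)
 show s: "additive_subgroup C A = additive_subgroup C B" for C
  by (simp add: additive_subgroup_def subgroup_def m_inv_def assms)
 show "abelian_group A = abelian_group B"
  by (simp add: abelian_group_def abelian_group_axioms_def abelian_monoid_def comm_group_def
    comm_monoid_def monoid_def comm_monoid_axioms_def group_def group_axioms_def Units_def assms)
 show f': "sum_of_family A I D = sum_of_family B I D" by (simp add: sum_of_family_def f)
 show "is_direct_sum A I D = is_direct_sum B I D"
  unfolding is_direct_sum_def f f' s assms ..
 show "dcomp A = dcomp B" by (intro ext) (simp add: dcomp_def f assms)
qed

lemmas coarsen_ring_cong = finsum_cong_record[of "coarsen_ring G \<psi> R" R for G \<psi> R,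
 OF coarsen_simps(1) coarsen_simps(5) coarsen_simps(4)]
lemmas coarsen_module_cong = finsum_cong_record[of "coarsen_module G \<psi> M" M for G \<psi> M,
 OF coarsen_simps(7) coarsen_simps(9) coarsen_simps(8)]

lemma cring_cong_record:
 fixes A :: "('a,'y) ring_scheme" and B :: "('a,'z) ring_scheme"
 assumes B: "cring B" and e: "carrier A = carrier B" "add A = add B" "zero A = zero B" "mult A = mult B" "one A = one B"
 shows "cring A"
proof -
 interpret B: cring B by fact
 show ?thesis
 proof (rule cringI)
  show "abelian_group A" using finsum_cong_record(4)[OF e(1-3)] B.abelian_group_axioms by simp
  show "Group.comm_monoid A" by (rule comm_monoidI) (simp_all add: e B.m_ac)
 qed (simp add: e B.l_distr)
qed

lemma module_cong_record:
 fixes A :: "('a,'y) ring_scheme" and B :: "('a,'z) ring_scheme"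
  and M :: "('a,'m,'w) module_scheme" and N :: "('a,'m,'v) module_scheme"
 assumes "module B N" and e: "carrier A = carrier B" "add A = add B" "zero A = zero B" "mult A = mult B" "one A = one B"
  and f: "carrier M = carrier N" "add M = add N" "zero M = zero N" "smult M = smult N"
 shows "module A M"
proof -
 interpret N: module B N by fact
 show ?thesis
 proof (rule moduleI)
  show "cring A" by (rule cring_cong_record[OF N.R.is_cring e])
  show "abelian_group M" using finsum_cong_record(4)[OF f(1-3)] N.M.abelian_group_axioms by simp
 qed (simp_all add: e f N.smult_l_distr N.smult_r_distr N.smult_assoc1)
qed

locale coarsening = graded_ring G R + H: comm_group H
 for G :: "('g,'x) monoid_scheme" and R :: "('g,'r) gring" and H :: "('h,'y) monoid_scheme" +
 fixes \<psi> :: "'g => 'h"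
 assumes psi: "\<psi> \<in> epi G H"
begin

abbreviation "cR \<equiv> coarsen_ring G \<psi> R"
abbreviation cM :: "('g,'r,'m) gmodule => ('h,'r,'m) gmodule" where "cM \<equiv> coarsen_module G \<psi>"

lemma psi_closed [simp]: "g \<in> carrier G ==> \<psi> g \<in> carrier H"
 using psi by (auto simp: epi_def hom_def)

lemma psi_mult: "[|g \<in> carrier G; k \<in> carrier G|] ==> \<psi> (g \<otimes>\<^sub>G k) = \<psi> g \<otimes>\<^sub>H \<psi> k"
 using psi by (auto simp: epi_def hom_def)

lemma psi_surj: "h \<in> carrier H ==> \<exists>g\<in>carrier G. \<psi> g = h"
proof -
 assume h: "h \<in> carrier H"
 have "carrier H = \<psi> ` carrier G" using psi by (simp add: epi_def)
 with h have "h \<in> \<psi> ` carrier G" by simp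
 thus "\<exists>g\<in>carrier G. \<psi> g = h" by (metis imageE)
qed

lemma psi_group_hom: "group_hom G H \<psi>"
 using psi by (intro group_hom.intro group_hom_axioms.intro G.group_axioms H.group_axioms) (auto simp: epi_def)

lemma psi_one: "\<psi> \<one>\<^sub>G = \<one>\<^sub>H"
 by (rule group_hom.hom_one[OF psi_group_hom])

lemma psi_inv: "g \<in> carrier G ==> \<psi> (inv\<^bsub>G\<^esub> g) = inv\<^bsub>H\<^esub> \<psi> g"
 by (rule group_hom.hom_inv[OF psi_group_hom])

lemmas cR_iff = RD.fibcomp_iff[where \<phi> = \<psi> and J = "carrier H", OF psi_closed]

lemma cR_comp_carr: "r \<in> rcomp cR h ==> r \<in> carrier R"
 using cR_iff by simp

lemma rcomp_cR: "[|r \<in> rcomp R s; s \<in> carrier G|] ==> r \<in> rcomp cR (\<psi> s)"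
 using RD.B_carr by (auto simp: cR_iff RD.dcomp_hom')

lemma cR_add: "[|x \<in> rcomp cR h; y \<in> rcomp cR h|] ==> x \<oplus>\<^sub>R y \<in> rcomp cR h"
 by (simp add: cR_iff RD.dcomp_add)

lemma rcomp_carr: "s \<in> carrier G ==> rcomp R s \<subseteq> carrier R"
 using RD.B_carr by blast

lemma cR_graded: "graded_ring H cR"
proof (intro graded_ring.intro graded_ring_axioms.intro H.comm_group_axioms)
 show "cring cR" by (rule cring_cong_record[OF R.is_cring]) simp_all
 have "rcomp cR = (\<lambda>h. sum_of_family R {g \<in> carrier G. \<psi> g = h} (rcomp R))" by (rule ext) simp
 thus "is_direct_sum cR (carrier H) (rcomp cR)"
  using direct_sum.ds[OF RD.coarsen_direct_sum(1)[where \<phi> = \<psi> and J = "carrier H", OF psi_closed]]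
  by (simp only: coarsen_ring_cong)
 fix h k a b assume hk: "h \<in> carrier H" "k \<in> carrier H" and a: "a \<in> rcomp cR h" and b: "b \<in> rcomp cR k"
 have bR: "b \<in> carrier R" by (rule cR_comp_carr[OF b])
 have z: "\<zero>\<^sub>R \<in> rcomp cR j" for j by (simp add: cR_iff RD.dcomp_zero)
 from a have "a \<in> sum_of_family R {g \<in> carrier G. \<psi> g = h} (rcomp R)" by simp
 hence "a \<otimes>\<^sub>R b \<in> rcomp cR (h \<otimes>\<^sub>H k)"
 proof (induction rule: R.sum_of_family_induct)
  case (hom g a)
  have aR: "a \<in> carrier R" using hom RD.B_carr by blast
  from b have "b \<in> sum_of_family R {g \<in> carrier G. \<psi> g = k} (rcomp R)" by simp
  thus ?case
  proof (induction rule: R.sum_of_family_induct)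
   case zero
   thus ?case using z aR by simp
  next
   case (hom g' b)
   hence "a \<otimes>\<^sub>R b \<in> rcomp cR (\<psi> (g \<otimes>\<^sub>G g'))"
    using \<open>g \<in> _\<close> \<open>a \<in> rcomp R g\<close> by (intro rcomp_cR rcomp_mult) auto
   thus ?case using hom \<open>g \<in> _\<close> psi_mult by simp
  next
   case (add x y)
   thus ?case using aR cR_add by (simp add: R.r_distr)
  qed (use rcomp_carr in auto)
 next
  case zero
  thus ?case using z bR by simp
 next
  case (add x y)
  thus ?case using bR cR_add by (simp add: R.l_distr)
 qed (use rcomp_carr in auto)
 thus "a \<otimes>\<^bsub>cR\<^esub> b \<in> rcomp cR (h \<otimes>\<^sub>H k)" by simp
qed

lemma cM_iff:
 assumes "gmod G R M"
 shows "x \<in> mcomp (cM M) h \<longleftrightarrow> x \<in> carrier M \<and> (\<forall>g\<in>carrier G. \<psi> g \<noteq> h \<longrightarrow> gc G M x g = \<zero>\<^sub>M)"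
proof -
 interpret M: graded_module G R M by fact
 show ?thesis using M.MD.fibcomp_iff[where \<phi> = \<psi> and J = "carrier H", OF psi_closed] by simp
qed

lemma mcomp_cM:
 assumes "gmod G R M" "x \<in> mcomp M g" "g \<in> carrier G"
 shows "x \<in> mcomp (cM M) (\<psi> g)"
proof -
 interpret M: graded_module G R M by fact
 show ?thesis using assms M.MD.B_carr by (auto simp: cM_iff[OF assms(1)] M.MD.dcomp_hom' simp del: coarsen_simps)
qed

lemma module_cR_iff: "module cR (M :: ('r,'m,'z) module_scheme) \<longleftrightarrow> module R M"
 by (rule iffI; rule module_cong_record; assumption?) auto

lemma mcomp_cM_fun: "mcomp (cM M) = (\<lambda>h. sum_of_family M {g \<in> carrier G. \<psi> g = h} (mcomp M))"
 by (rule ext) simp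

lemma cM_graded:
 assumes M: "gmod G R M"
 shows "gmod H cR (cM M)"
proof -
 interpret M: graded_module G R M by fact
 note cds = M.MD.coarsen_direct_sum[where \<phi> = \<psi> and J = "carrier H", OF psi_closed]
 note carr = M.MD.B_carr
 have add: "x \<oplus>\<^sub>M y \<in> mcomp (cM M) h" if "x \<in> mcomp (cM M) h" "y \<in> mcomp (cM M) h" for x y h
  using that by (simp add: cM_iff[OF M] M.MD.dcomp_add del: coarsen_simps(11))
 have z: "\<zero>\<^sub>M \<in> mcomp (cM M) j" for j by (simp add: cM_iff[OF M] M.MD.dcomp_zero del: coarsen_simps(11))
 have mc: "mcomp M g \<subseteq> carrier M" if "g \<in> carrier G" for g using that carr by blast
 have mod: "module cR (cM M)"
  by (rule module_cong_record[OF M.module_axioms]) simp_all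
 show "gmod H cR (cM M)"
 proof (intro graded_module.intro graded_module_axioms.intro cR_graded mod)
  show "is_direct_sum (cM M) (carrier H) (mcomp (cM M))"
   using direct_sum.ds[OF cds(1)] by (simp only: coarsen_module_cong mcomp_cM_fun)
 next
  fix h k a b assume hk: "h \<in> carrier H" "k \<in> carrier H" and a: "a \<in> rcomp cR h" and b: "b \<in> mcomp (cM M) k"
  have bM: "b \<in> carrier M" using b cM_iff[OF M] by blast
  from a have "a \<in> sum_of_family R {g \<in> carrier G. \<psi> g = h} (rcomp R)" by simp
  hence "a \<odot>\<^sub>M b \<in> mcomp (cM M) (h \<otimes>\<^sub>H k)"
  proof (induction rule: R.sum_of_family_induct)
   case (hom g a)
   have aR: "a \<in> carrier R" using hom RD.B_carr by blast
   from b have "b \<in> sum_of_family M {g \<in> carrier G. \<psi> g = k} (mcomp M)" by simp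
   thus ?case
   proof (induction rule: M.M.sum_of_family_induct)
    case zero
    thus ?case using z aR by simp
   next
    case (hom g' b)
    hence "a \<odot>\<^sub>M b \<in> mcomp (cM M) (\<psi> (g \<otimes>\<^sub>G g'))"
     using \<open>g \<in> _\<close> \<open>a \<in> rcomp R g\<close> by (intro mcomp_cM[OF M] M.mcomp_smult) auto
    thus ?case using hom \<open>g \<in> _\<close> psi_mult by simp
   next
    case (add x y)
    thus ?case using aR \<open>\<And>x y h. _ ==> _ ==> x \<oplus>\<^sub>M y \<in> mcomp (cM M) h\<close>
     by (simp add: M.smult_r_distr del: coarsen_simps(11))
   qed (use mc in auto)
  next
   case zero
   thus ?case using z bM by simp
  next
   case (add x y)
   thus ?case using bM \<open>\<And>x y h. _ ==> _ ==> x \<oplus>\<^sub>M y \<in> mcomp (cM M) h\<close>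
    by (simp add: M.smult_l_distr del: coarsen_simps(11))
  qed (use rcomp_carr in auto)
  thus "a \<odot>\<^bsub>cM M\<^esub> b \<in> mcomp (cM M) (h \<otimes>\<^sub>H k)" by simp
 qed
qed

lemma hom_cM:
 assumes M: "gmod G R M" and N: "gmod G R N" and u: "u \<in> ghom G R M N"
 shows "u \<in> ghom H cR (cM M) (cM N)"
proof (rule graded_homI0)
 fix h x assume "h \<in> carrier H" "x \<in> mcomp (cM M) h"
 hence x: "x \<in> carrier M" "\<And>g. [|g \<in> carrier G; \<psi> g \<noteq> h|] ==> gc G M x g = \<zero>\<^sub>M" using cM_iff[OF M] by auto
 thus "u x \<in> mcomp (cM N) h"
  unfolding cM_iff[OF N] using gh_closed[OF u] gh_gc[OF M N u x(1)] gh_zero[OF M N u] by simp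
qed (use u in \<open>auto simp: gh_closed gh_add gh_smult\<close>)

lemma short_exact_cM:
 assumes "short_exact G R A B C f g"
 shows "short_exact H cR (cM A) (cM B) (cM C) f g"
proof -
 note e = short_exactD[OF assms]
 show ?thesis
  by (rule short_exactI) (use e hom_cM cM_graded in auto)
qed

lemma giso_cM:
 assumes "gmod G R M" "gmod G R N" "giso G R M N u v"
 shows "giso H cR (cM M) (cM N) u v"
 using assms hom_cM[OF assms(1,2), of u] hom_cM[OF assms(2,1), of v] unfolding giso_def by simp

end

section \<open>The right adjoint of coarsening\<close>

text \<open>
  The right adjoint of coarsening maps an \<open>H\<close>-graded module \<open>A\<close> to the \<open>G\<close>-graded module with
  component \<open>A_(\<psi> g)\<close> in degree \<open>g\<close>. To keep it small we restrict it to a set \<open>S\<close> of degrees that is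
  stable under translation by the degrees of nonzero elements of \<open>R\<close>.
\<close>

context coarsening
begin

definition cind :: "'g set => ('h,'r,'a) gmodule => ('g,'r,'g => 'a) gmodule" where
 "cind S A = (let C = {x. finite {g. x g \<noteq> \<zero>\<^sub>A} \<and> (\<forall>g\<in>S. x g \<in> mcomp A (\<psi> g)) \<and> (\<forall>g. g \<notin> S \<longrightarrow> x g = \<zero>\<^sub>A)} in
   \<lparr>carrier = C, monoid.mult = undefined, monoid.one = undefined,
   ring.zero = (\<lambda>_. \<zero>\<^sub>A), ring.add = (\<lambda>x y g. x g \<oplus>\<^sub>A y g),
   module.smult = (\<lambda>r x g. if g \<in> carrier G
    then RD.hsum A (\<lambda>s r. r \<odot>\<^sub>A x (inv\<^bsub>G\<^esub> s \<otimes>\<^sub>G g)) r else \<zero>\<^sub>A),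
   mcomp = (\<lambda>g. {x \<in> C. \<forall>k. k \<noteq> g \<longrightarrow> x k = \<zero>\<^sub>A})\<rparr>)"

definition stable :: "'g set => bool" where
 "stable S \<longleftrightarrow> S \<subseteq> carrier G \<and>
   (\<forall>s\<in>carrier G. \<forall>g\<in>S. rcomp R s \<noteq> {\<zero>\<^sub>R} \<longrightarrow> s \<otimes>\<^sub>G g \<in> S)"

definition single :: "('h,'r,'a) gmodule => 'g => 'a => 'g => 'a" where
 "single A g a = (\<lambda>k. if k = g then a else \<zero>\<^sub>A)"

lemma stable_UNIV: "stable (carrier G)"
 by (simp add: stable_def)

lemma stableD: "[|stable S; s \<in> carrier G; g \<in> S; r \<in> rcomp R s; r \<noteq> \<zero>\<^sub>R|] ==> s \<otimes>\<^sub>G g \<in> S"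
 unfolding stable_def by blast

lemma cind_simps:
 "carrier (cind S A) = {x. finite {g. x g \<noteq> \<zero>\<^sub>A} \<and> (\<forall>g\<in>S. x g \<in> mcomp A (\<psi> g)) \<and> (\<forall>g. g \<notin> S \<longrightarrow> x g = \<zero>\<^sub>A)}"
 "\<zero>\<^bsub>cind S A\<^esub> = (\<lambda>_. \<zero>\<^sub>A)" "x \<oplus>\<^bsub>cind S A\<^esub> y = (\<lambda>g. x g \<oplus>\<^sub>A y g)"
 "r \<odot>\<^bsub>cind S A\<^esub> x = (\<lambda>g. if g \<in> carrier G
    then RD.hsum A (\<lambda>s r. r \<odot>\<^sub>A x (inv\<^bsub>G\<^esub> s \<otimes>\<^sub>G g)) r else \<zero>\<^sub>A)"
 "mcomp (cind S A) g = {x \<in> carrier (cind S A). \<forall>k. k \<noteq> g \<longrightarrow> x k = \<zero>\<^sub>A}"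
 by (simp_all add: cind_def Let_def)

context
 fixes S :: "'g set" and A :: "('h,'r,'a) gmodule"
 assumes S: "stable S" and A: "gmod H cR A"
begin

interpretation A: graded_module H cR A by fact
interpretation AR: module R A by (rule module_cR_iff[THEN iffD1, OF A.module_axioms])

lemma S_carr: "g \<in> S ==> g \<in> carrier G"
 using S by (auto simp: stable_def)

lemma cind_val: "x \<in> carrier (cind S A) ==> x g \<in> carrier A"
 using A.MD.B_carr S_carr psi_closed by (cases "g \<in> S") (auto simp: cind_simps)

text \<open>The action is a convolution: a scalar of degree \<open>s\<close> moves the entry at a
  degree to its translate by \<open>s\<close>, and a general scalar acts through its homogeneous
  components.\<close>

lemma cind_act:
 assumes x: "\<And>k. x k \<in> carrier A"
 shows "(\<lambda>r. (r \<odot>\<^bsub>cind S A\<^esub> x) g) \<in> addhom R A"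
  and "[|r \<in> rcomp R s; s \<in> carrier G; g \<in> carrier G|] ==> (r \<odot>\<^bsub>cind S A\<^esub> x) g = r \<odot>\<^sub>A x (inv\<^bsub>G\<^esub> s \<otimes>\<^sub>G g)"
proof -
 have h: "RD.hsum A (\<lambda>s r. r \<odot>\<^sub>A x (inv\<^bsub>G\<^esub> s \<otimes>\<^sub>G g)) \<in> addhom R A"
  "\<And>s r. [|s \<in> carrier G; r \<in> rcomp R s|]
   ==> RD.hsum A (\<lambda>s r. r \<odot>\<^sub>A x (inv\<^bsub>G\<^esub> s \<otimes>\<^sub>G g)) r = r \<odot>\<^sub>A x (inv\<^bsub>G\<^esub> s \<otimes>\<^sub>G g)" for g
  by (rule RD.hsum_props[OF A.M.abelian_group_axioms];
    use x AR.smult_l_distr RD.B_carr in blast)+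
 show "(\<lambda>r. (r \<odot>\<^bsub>cind S A\<^esub> x) g) \<in> addhom R A"
 proof (cases "g \<in> carrier G")
  case False
  thus ?thesis by (intro addhomI) (auto simp: cind_simps)
 qed (use h(1) in \<open>simp add: cind_simps\<close>)
 show "[|r \<in> rcomp R s; s \<in> carrier G; g \<in> carrier G|] ==> (r \<odot>\<^bsub>cind S A\<^esub> x) g = r \<odot>\<^sub>A x (inv\<^bsub>G\<^esub> s \<otimes>\<^sub>G g)"
  using h(2) by (simp add: cind_simps)
qed

lemma cind_act_out: "g \<notin> carrier G ==> (r \<odot>\<^bsub>cind S A\<^esub> x) g = \<zero>\<^sub>A"
 by (simp add: cind_simps)

lemma inv_cancel: "[|s \<in> carrier G; g \<in> carrier G|] ==> s \<otimes>\<^sub>G (inv\<^bsub>G\<^esub> s \<otimes>\<^sub>G g) = g"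
 by (simp add: G.m_assoc[symmetric])

lemma inv_cancel': "[|s \<in> carrier G; g \<in> carrier G|] ==> inv\<^bsub>G\<^esub> s \<otimes>\<^sub>G (s \<otimes>\<^sub>G g) = g"
 by (simp add: G.m_assoc[symmetric])

lemma cind_add_closed:
 assumes "x \<in> carrier (cind S A)" "y \<in> carrier (cind S A)"
 shows "(\<lambda>g. x g \<oplus>\<^sub>A y g) \<in> carrier (cind S A)"
proof -
 have "finite {g. x g \<oplus>\<^sub>A y g \<noteq> \<zero>\<^sub>A}"
  by (rule finite_subset[of _ "{g. x g \<noteq> \<zero>\<^sub>A} \<union> {g. y g \<noteq> \<zero>\<^sub>A}"])
   (use assms in \<open>auto simp: cind_simps\<close>)
 thus ?thesis using assms A.MD.B_add S_carr by (auto simp: cind_simps)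
qed

lemma cind_smult_hom:
 assumes r: "r \<in> rcomp R s" and s: "s \<in> carrier G" and x: "x \<in> carrier (cind S A)"
 shows "r \<odot>\<^bsub>cind S A\<^esub> x \<in> carrier (cind S A)"
proof -
 let ?y = "r \<odot>\<^bsub>cind S A\<^esub> x"
 have rR: "r \<in> carrier R" using RD.B_carr r s by blast
 have y: "?y g = r \<odot>\<^sub>A x (inv\<^bsub>G\<^esub> s \<otimes>\<^sub>G g)" if "g \<in> carrier G" for g
  by (rule cind_act(2)[OF cind_val[OF x] r s that])
 have "finite {g. ?y g \<noteq> \<zero>\<^sub>A}"
 proof (rule finite_subset)
  show "finite ((\<otimes>\<^bsub>G\<^esub>) s ` {k. x k \<noteq> \<zero>\<^sub>A})" using x by (simp add: cind_simps)
  show "{g. ?y g \<noteq> \<zero>\<^sub>A} \<subseteq> (\<otimes>\<^bsub>G\<^esub>) s ` {k. x k \<noteq> \<zero>\<^sub>A}"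
  proof
   fix g assume "g \<in> {g. ?y g \<noteq> \<zero>\<^sub>A}"
   hence g: "g \<in> carrier G" "?y g \<noteq> \<zero>\<^sub>A" using cind_act_out by auto
   hence "x (inv\<^bsub>G\<^esub> s \<otimes>\<^sub>G g) \<noteq> \<zero>\<^sub>A" using y rR by auto
   thus "g \<in> (\<otimes>\<^bsub>G\<^esub>) s ` {k. x k \<noteq> \<zero>\<^sub>A}" using inv_cancel[OF s g(1)] by force
  qed
 qed
 moreover have "?y g \<in> mcomp A (\<psi> g)" if "g \<in> S" for g
 proof -
  have g: "g \<in> carrier G" using S_carr that .
  show ?thesis
  proof (cases "inv\<^bsub>G\<^esub> s \<otimes>\<^sub>G g \<in> S")
   case True
   hence "x (inv\<^bsub>G\<^esub> s \<otimes>\<^sub>G g) \<in> mcomp A (\<psi> (inv\<^bsub>G\<^esub> s \<otimes>\<^sub>G g))" using x by (simp add: cind_simps)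
   hence "r \<odot>\<^sub>A x (inv\<^bsub>G\<^esub> s \<otimes>\<^sub>G g) \<in> mcomp A (\<psi> s \<otimes>\<^sub>H \<psi> (inv\<^bsub>G\<^esub> s \<otimes>\<^sub>G g))"
    using s g rcomp_cR[OF r s] by (intro A.mcomp_smult) auto
   thus ?thesis using y[OF g] inv_cancel[OF s g] s g psi_mult[of s "inv\<^bsub>G\<^esub> s \<otimes>\<^sub>G g"] by simp
  next
   case False
   hence "?y g = \<zero>\<^sub>A" using x y[OF g] rR by (simp add: cind_simps(1))
   thus ?thesis using A.MD.B_zero g by simp
  qed
 qed
 \<comment> \<open>For nonzero \<open>r\<close> and \<open>g\<close> outside \<open>S\<close>,
   stability keeps the translate of \<open>g\<close> by the inverse of \<open>s\<close> outside
   \<open>S\<close>, where \<open>x\<close> vanishes.\<close>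
 moreover have "?y g = \<zero>\<^sub>A" if "g \<notin> S" for g
 proof (cases "g \<in> carrier G \<and> r \<noteq> \<zero>\<^sub>R")
  case True
  hence "inv\<^bsub>G\<^esub> s \<otimes>\<^sub>G g \<notin> S" using stableD[OF S s _ r, of "inv\<^bsub>G\<^esub> s \<otimes>\<^sub>G g"] inv_cancel[OF s] that by auto
  hence "x (inv\<^bsub>G\<^esub> s \<otimes>\<^sub>G g) = \<zero>\<^sub>A" using x by (simp add: cind_simps(1))
  thus ?thesis using y True rR by simp
 next
  case False
  thus ?thesis using y cind_act_out cind_val[OF x] by (cases "g \<in> carrier G") auto
 qed
 ultimately show ?thesis by (simp add: cind_simps(1))
qed

lemma zero_in_cind: "(\<lambda>_. \<zero>\<^sub>A) \<in> carrier (cind S A)"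
 using A.MD.B_zero S_carr by (simp add: cind_simps(1))

lemma cind_smult_closed:
 assumes r: "r \<in> carrier R" and x: "x \<in> carrier (cind S A)"
 shows "r \<odot>\<^bsub>cind S A\<^esub> x \<in> carrier (cind S A)"
 using r
proof (induction rule: RD.sum_induct)
 case zero
 have "\<zero>\<^sub>R \<odot>\<^bsub>cind S A\<^esub> x = (\<lambda>_. \<zero>\<^sub>A)"
  using addhom_zero[OF R.abelian_group_axioms A.M.abelian_group_axioms cind_act(1)[OF cind_val[OF x]]] by auto
 thus ?case using zero_in_cind by simp
next
 case (hom s r)
 thus ?case using cind_smult_hom x by blast
next
 case (add r r')
 have "(r \<oplus>\<^sub>R r') \<odot>\<^bsub>cind S A\<^esub> x = (\<lambda>g. (r \<odot>\<^bsub>cind S A\<^esub> x) g \<oplus>\<^sub>A (r' \<odot>\<^bsub>cind S A\<^esub> x) g)"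
  using addhom_add[OF cind_act(1)[OF cind_val[OF x]] add(1,2)] by auto
 thus ?case using cind_add_closed add by simp
qed

lemma cind_module: "module R (cind S A)"
proof (rule moduleI[OF R.is_cring])
 let ?U = "cind S A"
 show "abelian_group ?U"
 proof (rule abelian_groupI)
  fix x assume x: "x \<in> carrier ?U"
  have "(\<lambda>g. \<ominus>\<^sub>A x g) \<in> carrier ?U"
  proof -
   have "{g. \<ominus>\<^sub>A x g \<noteq> \<zero>\<^sub>A} \<subseteq> {g. x g \<noteq> \<zero>\<^sub>A}" by auto
   hence "finite {g. \<ominus>\<^sub>A x g \<noteq> \<zero>\<^sub>A}" using x finite_subset by (auto simp: cind_simps(1))
   thus ?thesis using x A.MD.B_minus S_carr by (simp add: cind_simps(1))
  qed
  thus "\<exists>y\<in>carrier ?U. y \<oplus>\<^bsub>?U\<^esub> x = \<zero>\<^bsub>?U\<^esub>"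
   using cind_val[OF x] by (intro bexI) (auto simp: cind_simps(2,3) A.M.l_neg)
 qed (use zero_in_cind cind_add_closed in
   \<open>auto simp: cind_simps(2,3) cind_val A.M.a_assoc intro!: ext A.M.a_comm\<close>)
 fix r r' x y assume r: "r \<in> carrier R" and r': "r' \<in> carrier R" and x: "x \<in> carrier ?U" and y: "y \<in> carrier ?U"
 show "r \<odot>\<^bsub>?U\<^esub> x \<in> carrier ?U" using cind_smult_closed r x by blast
 show "(r \<oplus>\<^sub>R r') \<odot>\<^bsub>?U\<^esub> x = r \<odot>\<^bsub>?U\<^esub> x \<oplus>\<^bsub>?U\<^esub> r' \<odot>\<^bsub>?U\<^esub> x"
  using addhom_add[OF cind_act(1)[OF cind_val[OF x]] r r'] by (auto simp: cind_simps(3))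
 show "r \<odot>\<^bsub>?U\<^esub> (x \<oplus>\<^bsub>?U\<^esub> y) = r \<odot>\<^bsub>?U\<^esub> x \<oplus>\<^bsub>?U\<^esub> r \<odot>\<^bsub>?U\<^esub> y"
 proof
  fix g
  have xy: "x \<oplus>\<^bsub>?U\<^esub> y \<in> carrier ?U" using cind_add_closed[OF x y] by (simp add: cind_simps(3))
  have s: "(\<lambda>r. (r \<odot>\<^bsub>?U\<^esub> x) g \<oplus>\<^sub>A (r \<odot>\<^bsub>?U\<^esub> y) g) \<in> addhom R A"
   using addhom_add[OF cind_act(1)[OF cind_val[OF x]]] addhom_add[OF cind_act(1)[OF cind_val[OF y]]]
    cind_val[OF cind_smult_closed[OF _ x]] cind_val[OF cind_smult_closed[OF _ y]]
   by (intro addhomI) (auto simp: A.M.a_ac)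
  have "(r \<odot>\<^bsub>?U\<^esub> (x \<oplus>\<^bsub>?U\<^esub> y)) g = (r \<odot>\<^bsub>?U\<^esub> x) g \<oplus>\<^sub>A (r \<odot>\<^bsub>?U\<^esub> y) g"
  proof (rule RD.addhom_eqI[OF A.M.abelian_group_axioms cind_act(1)[OF cind_val[OF xy]] s _ r])
   fix s r assume s: "s \<in> carrier G" and r: "r \<in> rcomp R s"
   show "(r \<odot>\<^bsub>?U\<^esub> (x \<oplus>\<^bsub>?U\<^esub> y)) g = (r \<odot>\<^bsub>?U\<^esub> x) g \<oplus>\<^sub>A (r \<odot>\<^bsub>?U\<^esub> y) g"
   proof (cases "g \<in> carrier G")
    case True
    have "r \<in> carrier R" using r s RD.B_carr by blast
    thus ?thesis
     unfolding cind_act(2)[OF cind_val[OF xy] r s True] cind_act(2)[OF cind_val[OF x] r s True]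
      cind_act(2)[OF cind_val[OF y] r s True]
     using cind_val x y by (simp add: cind_simps(3) AR.smult_r_distr)
   qed (simp add: cind_act_out)
  qed
  thus "(r \<odot>\<^bsub>?U\<^esub> (x \<oplus>\<^bsub>?U\<^esub> y)) g = (r \<odot>\<^bsub>?U\<^esub> x \<oplus>\<^bsub>?U\<^esub> r \<odot>\<^bsub>?U\<^esub> y) g" by (simp add: cind_simps(3))
 qed
 \<comment> \<open>Both sides are additive in each scalar. For homogeneous scalars of degrees
   \<open>s\<close> and \<open>t\<close> the claim is that translating back by the product of
   \<open>s\<close> and \<open>t\<close> is translating back by each in turn.\<close>
 show "(r \<otimes>\<^sub>R r') \<odot>\<^bsub>?U\<^esub> x = r \<odot>\<^bsub>?U\<^esub> (r' \<odot>\<^bsub>?U\<^esub> x)"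
 proof
  fix g
  note v = cind_val[OF x]
  have xr: "t \<odot>\<^bsub>?U\<^esub> x \<in> carrier ?U" if "t \<in> carrier R" for t using cind_smult_closed x that by blast
  have multl: "(\<lambda>a. a \<otimes>\<^sub>R t) \<in> addhom R R" if "t \<in> carrier R" for t
   by (rule addhomI) (use that R.l_distr in auto)
  show "((r \<otimes>\<^sub>R r') \<odot>\<^bsub>?U\<^esub> x) g = (r \<odot>\<^bsub>?U\<^esub> (r' \<odot>\<^bsub>?U\<^esub> x)) g"
  proof (rule RD.addhom_eqI[OF A.M.abelian_group_axioms
     addhom_comp[OF multl[OF r'] cind_act(1)[OF v]] cind_act(1)[OF cind_val[OF xr[OF r']]] _ r])
   fix s a assume s: "s \<in> carrier G" and a: "a \<in> rcomp R s"
   have aR: "a \<in> carrier R" using a s RD.B_carr by blast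
   show "((a \<otimes>\<^sub>R r') \<odot>\<^bsub>?U\<^esub> x) g = (a \<odot>\<^bsub>?U\<^esub> (r' \<odot>\<^bsub>?U\<^esub> x)) g"
   proof (cases "g \<in> carrier G")
    case g: True
    hence sg: "inv\<^bsub>G\<^esub> s \<otimes>\<^sub>G g \<in> carrier G" using s by simp
    have am: "(\<lambda>y. a \<odot>\<^sub>A y) \<in> addhom A A"
     by (rule addhomI) (use aR AR.smult_r_distr in auto)
    have "((a \<otimes>\<^sub>R r') \<odot>\<^bsub>?U\<^esub> x) g = a \<odot>\<^sub>A (r' \<odot>\<^bsub>?U\<^esub> x) (inv\<^bsub>G\<^esub> s \<otimes>\<^sub>G g)"
    proof (rule RD.addhom_eqI[OF A.M.abelian_group_axioms
       addhom_comp[OF mult_addhom[OF aR] cind_act(1)[OF v]] addhom_comp[OF cind_act(1)[OF v] am] _ r'])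
     fix t b assume t: "t \<in> carrier G" and b: "b \<in> rcomp R t"
     have bR: "b \<in> carrier R" using b t RD.B_carr by blast
     have "a \<otimes>\<^sub>R b \<in> rcomp R (s \<otimes>\<^sub>G t)" using rcomp_mult s t a b by blast
     moreover have "inv\<^bsub>G\<^esub> (s \<otimes>\<^sub>G t) \<otimes>\<^sub>G g = inv\<^bsub>G\<^esub> t \<otimes>\<^sub>G (inv\<^bsub>G\<^esub> s \<otimes>\<^sub>G g)"
      using s t g by (simp add: G.inv_mult_group G.m_assoc)
     ultimately show "((a \<otimes>\<^sub>R b) \<odot>\<^bsub>?U\<^esub> x) g = a \<odot>\<^sub>A (b \<odot>\<^bsub>?U\<^esub> x) (inv\<^bsub>G\<^esub> s \<otimes>\<^sub>G g)"
      using cind_act(2)[OF v _ _ g, of "a \<otimes>\<^sub>R b" "s \<otimes>\<^sub>G t"] cind_act(2)[OF v b t sg] s t aR bR v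
       AR.smult_assoc1[OF aR bR] by simp
    qed
    thus ?thesis using cind_act(2)[OF cind_val[OF xr[OF r']] a s g] by simp
   qed (simp add: cind_act_out)
  qed
 qed
next
 fix x assume x: "x \<in> carrier (cind S A)"
 show "\<one>\<^sub>R \<odot>\<^bsub>cind S A\<^esub> x = x"
 proof
  fix g
  show "(\<one>\<^sub>R \<odot>\<^bsub>cind S A\<^esub> x) g = x g"
  proof (cases "g \<in> carrier G")
   case True
   thus ?thesis using cind_act(2)[OF cind_val[OF x] one_homogeneous _ True] cind_val[OF x] by simp
  next
   case False
   hence "x g = \<zero>\<^sub>A" using x S_carr by (auto simp: cind_simps(1))
   thus ?thesis using False by (simp add: cind_act_out)
  qed
 qed
qed

lemma cind_graded: "gmod G R (cind S A)"
 and cind_gc: "[|x \<in> carrier (cind S A); g \<in> carrier G|] ==> gc G (cind S A) x g = single A g (x g)"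
proof -
 let ?U = "cind S A"
 let ?p = "\<lambda>g x. single A g (x g)"
 have p: "?p g x \<in> mcomp ?U g" if "x \<in> carrier ?U" for g x
 proof -
  have "finite {k. single A g (x g) k \<noteq> \<zero>\<^sub>A}"
   by (rule finite_subset[of _ "{g}"]) (auto simp: single_def)
  thus ?thesis using that A.MD.B_zero S_carr by (auto simp: cind_simps(1,5) single_def)
 qed
 note * = graded_moduleI[OF graded_ring_axioms cind_module, where p = ?p]
 have 1: "mcomp ?U g \<subseteq> carrier ?U" "\<zero>\<^bsub>?U\<^esub> \<in> mcomp ?U g" for g
  using zero_in_cind by (auto simp: cind_simps(5,2))
 have 2: "x \<oplus>\<^bsub>?U\<^esub> y \<in> mcomp ?U g" if "x \<in> mcomp ?U g" "y \<in> mcomp ?U g" for x y g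
  using that cind_add_closed by (simp add: cind_simps(3,5))
 have 3: "?p g \<in> addhom ?U ?U" for g
  by (rule addhomI) (use p in \<open>auto simp: cind_simps(3,5) single_def\<close>)
 have 4: "?p h x = (if h = g then x else \<zero>\<^bsub>?U\<^esub>)" if "x \<in> mcomp ?U g" for g h x
  using that by (auto simp: cind_simps(2,5) single_def)
 have 5: "finite {g \<in> carrier G. ?p g x \<noteq> \<zero>\<^bsub>?U\<^esub>}" if "x \<in> carrier ?U" for x
 proof (rule finite_subset)
  show "finite {g. x g \<noteq> \<zero>\<^sub>A}" using that by (simp add: cind_simps(1))
 qed (auto simp: single_def cind_simps(2))
 have 6: "x = \<zero>\<^bsub>?U\<^esub>" if x: "x \<in> carrier ?U" and 0: "\<And>g. g \<in> carrier G ==> ?p g x = \<zero>\<^bsub>?U\<^esub>" for x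
 proof
  fix g
  show "x g = \<zero>\<^bsub>?U\<^esub> g"
  proof (cases "g \<in> S")
   case True
   thus ?thesis using fun_cong[OF 0[OF S_carr], of g g] by (simp add: single_def cind_simps(2))
  qed (use x in \<open>simp add: cind_simps(1,2)\<close>)
 qed
 have 7: "r \<odot>\<^bsub>?U\<^esub> x \<in> mcomp ?U (s \<otimes>\<^sub>G g)"
  if s: "s \<in> carrier G" and g: "g \<in> carrier G" and r: "r \<in> rcomp R s" and x: "x \<in> mcomp ?U g" for s g r x
 proof -
  have xU: "x \<in> carrier ?U" using x by (simp add: cind_simps(5))
  have "(r \<odot>\<^bsub>?U\<^esub> x) k = \<zero>\<^sub>A" if k: "k \<noteq> s \<otimes>\<^sub>G g" for k
  proof (cases "k \<in> carrier G")
   case True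
   hence "inv\<^bsub>G\<^esub> s \<otimes>\<^sub>G k \<noteq> g" using k inv_cancel[OF s True] by auto
   hence "x (inv\<^bsub>G\<^esub> s \<otimes>\<^sub>G k) = \<zero>\<^sub>A" using x by (simp add: cind_simps(5))
   moreover have "r \<in> carrier R" using r s RD.B_carr by blast
   ultimately show ?thesis using cind_act(2)[OF cind_val[OF xU] r s True] by simp
  qed (simp add: cind_act_out)
  thus ?thesis using cind_smult_hom[OF r s xU] by (simp add: cind_simps(5))
 qed
 show "gmod G R ?U"
  by (rule *(1); (rule 1(1) | rule 1(2) | (rule 2; assumption) | rule 3 | (rule 4; assumption) | (rule 5; assumption)
    | (rule 6; simp) | (rule 7; assumption) | (rule p; assumption)))
 show "gc G ?U x g = single A g (x g)" if "x \<in> carrier ?U" "g \<in> carrier G"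
  by (rule *(2); (rule that | (rule 1(1) | rule 1(2) | (rule 2; assumption) | rule 3 | (rule 4; assumption) | (rule 5; assumption)
    | (rule 6; simp) | (rule 7; assumption) | (rule p; assumption))))
qed

lemma single_mem:
 assumes "g \<in> S" "a \<in> mcomp A (\<psi> g)"
 shows "single A g a \<in> mcomp (cind S A) g"
proof -
 have "finite {k. single A g a k \<noteq> \<zero>\<^sub>A}"
  by (rule finite_subset[of _ "{g}"]) (auto simp: single_def)
 thus ?thesis using assms A.MD.B_zero S_carr by (auto simp: cind_simps(1,5) single_def)
qed

lemma single_add: "single A g (a \<oplus>\<^sub>A b) = single A g a \<oplus>\<^bsub>cind S A\<^esub> single A g b"
 by (auto simp: single_def cind_simps(3))

lemma single_smult:
 assumes r: "r \<in> rcomp R s" "s \<in> carrier G" and g: "g \<in> S" and a: "a \<in> mcomp A (\<psi> g)"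
 shows "r \<odot>\<^bsub>cind S A\<^esub> single A g a = single A (s \<otimes>\<^sub>G g) (r \<odot>\<^sub>A a)"
proof
 fix k
 have aA: "a \<in> carrier A" using A.MD.B_carr a S_carr[OF g] by simp
 hence v: "single A g a k \<in> carrier A" for k by (simp add: single_def)
 have rR: "r \<in> carrier R" using r RD.B_carr by blast
 have gG: "g \<in> carrier G" using S_carr g .
 show "(r \<odot>\<^bsub>cind S A\<^esub> single A g a) k = single A (s \<otimes>\<^sub>G g) (r \<odot>\<^sub>A a) k"
 proof (cases "k \<in> carrier G")
  case True
  have "inv\<^bsub>G\<^esub> s \<otimes>\<^sub>G k = g \<longleftrightarrow> k = s \<otimes>\<^sub>G g"
   using inv_cancel[OF r(2) True] inv_cancel'[OF r(2) gG] by auto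
  thus ?thesis using cind_act(2)[OF v r True] rR by (simp add: single_def)
 next
  case False
  hence "k \<noteq> s \<otimes>\<^sub>G g" using r gG by auto
  thus ?thesis using False by (simp add: cind_act_out single_def)
 qed
qed

lemma cind_mem_val: "[|x \<in> mcomp (cind S A) g; g \<in> carrier G|] ==> x g \<in> mcomp A (\<psi> g)"
 using A.MD.B_zero by (cases "g \<in> S") (auto simp: cind_simps(1,5))

text \<open>The counit of the adjunction: it adds up the entries of a family.\<close>

lemma counit_exists:
 obtains c where "c \<in> ghom H cR (cM (cind S A)) A"
  "\<And>g x. [|g \<in> carrier G; x \<in> mcomp (cind S A) g|] ==> c x = x g"
proof -
 interpret U: graded_module G R "cind S A" by (rule cind_graded)
 let ?c = "U.MD.hsum A (\<lambda>g x. x g)"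
 have m: "x \<in> carrier (cind S A)" if "x \<in> mcomp (cind S A) g" for x g
  using that by (simp add: cind_simps(5))
 have c: "?c \<in> addhom (cind S A) A" "\<And>g x. [|g \<in> carrier G; x \<in> mcomp (cind S A) g|] ==> ?c x = x g"
  by (rule U.MD.hsum_props[OF A.M.abelian_group_axioms];
    use m cind_val in \<open>simp add: cind_simps(3)\<close>)+
 have sm: "?c (r \<odot>\<^bsub>cind S A\<^esub> x) = r \<odot>\<^sub>A ?c x" if "r \<in> carrier R" "x \<in> carrier (cind S A)" for r x
 proof (rule U.addhom_smult_homogeneous[OF AR.module_axioms c(1) _ that])
  fix s g r x assume *: "s \<in> carrier G" "g \<in> carrier G" "r \<in> rcomp R s" "x \<in> mcomp (cind S A) g"
  have "r \<odot>\<^bsub>cind S A\<^esub> x \<in> mcomp (cind S A) (s \<otimes>\<^sub>G g)" using U.mcomp_smult * by blast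
  hence "?c (r \<odot>\<^bsub>cind S A\<^esub> x) = (r \<odot>\<^bsub>cind S A\<^esub> x) (s \<otimes>\<^sub>G g)" using c(2) * by simp
  also have "\<dots> = r \<odot>\<^sub>A x g"
   using cind_act(2)[OF cind_val[OF m[OF *(4)]] *(3,1), of "s \<otimes>\<^sub>G g"] inv_cancel'[OF *(1,2)] * by simp
  finally show "?c (r \<odot>\<^bsub>cind S A\<^esub> x) = r \<odot>\<^sub>A ?c x" using c(2) * by simp
 qed
 have "?c \<in> ghom H cR (cM (cind S A)) A"
 proof (rule graded_homI0)
  fix h x assume h: "h \<in> carrier H" and x: "x \<in> mcomp (cM (cind S A)) h"
  from x have "x \<in> sum_of_family (cind S A) {g \<in> carrier G. \<psi> g = h} (mcomp (cind S A))" by simp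
  thus "?c x \<in> mcomp A h"
  proof (induction rule: U.M.sum_of_family_induct)
   case zero
   thus ?case
    using addhom_zero[OF U.M.abelian_group_axioms A.M.abelian_group_axioms c(1)] A.MD.B_zero[OF h] by simp
  next
   case (hom g x)
   thus ?case using c(2) cind_mem_val by auto
  next
   case (add x y)
   thus ?case using A.MD.B_add[OF _ _ h] addhom_add[OF c(1)] by simp
  qed (use m in auto)
 qed (use c(1) sm in \<open>simp_all add: addhom_closed addhom_add\<close>)
 thus ?thesis using that c(2) by blast
qed

text \<open>The transpose of \<open>f\<close> under the adjunction: an element goes to the family of
  the images of its components. The condition on \<open>P\<close> makes these families vanish
  outside \<open>S\<close>.\<close>

lemma unit_hom:
 assumes P: "gmod G R P" and f: "f \<in> ghom H cR (cM P) A"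
  and supp: "\<And>g. [|g \<in> carrier G; g \<notin> S|] ==> mcomp P g = {\<zero>\<^sub>P}"
 shows "(\<lambda>x g. f (gc G P x g)) \<in> ghom G R P (cind S A)"
proof -
 interpret P: graded_module G R P by fact
 have f0: "f \<zero>\<^sub>P = \<zero>\<^sub>A" using gh_zero[OF cM_graded(1)[OF P] A f] by simp
 have cl: "(\<lambda>g. f (gc G P x g)) \<in> carrier (cind S A)" if x: "x \<in> carrier P" for x
 proof -
  have "finite {g. f (gc G P x g) \<noteq> \<zero>\<^sub>A}"
  proof (rule finite_subset)
   show "finite {g. gc G P x g \<noteq> \<zero>\<^sub>P}" by (rule P.MD.dcomp_finite[OF x])
  qed (use f0 in auto)
  moreover have "f (gc G P x g) \<in> mcomp A (\<psi> g)" if "g \<in> S" for g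
   using gh_mcomp[OF f _ mcomp_cM[OF P P.MD.dcomp_in[OF x]]] S_carr[OF that] by simp
  moreover have "f (gc G P x g) = \<zero>\<^sub>A" if "g \<notin> S" for g
   using P.MD.dcomp_in[OF x, of g] P.MD.dcomp_out[OF x, of g] supp[of g] that f0 by (cases "g \<in> carrier G") auto
  ultimately show ?thesis by (simp add: cind_simps(1))
 qed
 have fm: "f (gc G P x g) = (if g = k then f x else \<zero>\<^sub>A)" if "k \<in> carrier G" "x \<in> mcomp P k" for x k g
  using f0 P.MD.dcomp_hom'[OF that(2,1)] by simp
 show ?thesis
 proof (rule graded_homI[OF P cind_graded])
  show "(\<lambda>x g. f (gc G P x g)) \<in> addhom P (cind S A)"
   by (rule addhomI) (use cl gh_add[OF f] in \<open>simp_all add: P.MD.dcomp_add cind_simps(3)\<close>)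
  fix s k r x assume *: "s \<in> carrier G" "k \<in> carrier G" "r \<in> rcomp R s" "x \<in> mcomp P k"
  have xP: "x \<in> carrier P" using * P.MD.B_carr by blast
  have rR: "r \<in> carrier R" using * RD.B_carr by blast
  have rx: "r \<odot>\<^sub>P x \<in> mcomp P (s \<otimes>\<^sub>G k)" using P.mcomp_smult * by blast
  show "(\<lambda>g. f (gc G P (r \<odot>\<^sub>P x) g)) = r \<odot>\<^bsub>cind S A\<^esub> (\<lambda>g. f (gc G P x g))"
  proof
   fix g
   show "f (gc G P (r \<odot>\<^sub>P x) g) = (r \<odot>\<^bsub>cind S A\<^esub> (\<lambda>g. f (gc G P x g))) g"
   proof (cases "g \<in> carrier G")
    case True
    have "(r \<odot>\<^bsub>cind S A\<^esub> (\<lambda>g. f (gc G P x g))) g = r \<odot>\<^sub>A f (gc G P x (inv\<^bsub>G\<^esub> s \<otimes>\<^sub>G g))"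
     using cind_act(2)[OF cind_val[OF cl[OF xP]] *(3,1) True] by simp
    also have "\<dots> = f (r \<odot>\<^sub>P gc G P x (inv\<^bsub>G\<^esub> s \<otimes>\<^sub>G g))"
     using gh_smult[OF f, of r] rR xP by simp
    also have "\<dots> = f (gc G P (r \<odot>\<^sub>P x) g)" using P.gc_smult'[OF *(3,1) xP True] by simp
    finally show ?thesis by simp
   next
    case False
    thus ?thesis using P.MD.dcomp_out f0 xP rR by (simp add: cind_act_out)
   qed
  qed
 next
  fix g x assume *: "g \<in> carrier G" "x \<in> mcomp P g"
  thus "(\<lambda>g. f (gc G P x g)) \<in> mcomp (cind S A) g"
   using cl[of x] P.MD.B_carr fm[OF *] by (simp add: cind_simps(5))
 qed
qed

end

section \<open>Functoriality and exactness of the right adjoint\<close>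

lemma cind_map:
 assumes S: "stable S" and A: "gmod H cR A" and B: "gmod H cR B"
  and f: "f \<in> ghom H cR A B"
 shows "(\<lambda>x g. f (x g)) \<in> ghom G R (cind S A) (cind S B)"
proof -
 interpret A: graded_module H cR A by fact
 interpret B: graded_module H cR B by fact
 have f0: "f \<zero>\<^sub>A = \<zero>\<^sub>B" by (rule gh_zero[OF A B f])
 have cl: "(\<lambda>g. f (x g)) \<in> carrier (cind S B)" if x: "x \<in> carrier (cind S A)" for x
 proof -
  have "finite {g. f (x g) \<noteq> \<zero>\<^sub>B}"
  proof (rule finite_subset)
   show "finite {g. x g \<noteq> \<zero>\<^sub>A}" using x by (simp add: cind_simps(1))
  qed (use f0 in auto)
  thus ?thesis using x gh_mcomp[OF f] f0 S_carr[OF S A] by (auto simp: cind_simps(1))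
 qed
 show ?thesis
 proof (rule graded_homI[OF cind_graded[OF S A] cind_graded[OF S B]])
  show "(\<lambda>x g. f (x g)) \<in> addhom (cind S A) (cind S B)"
   by (rule addhomI) (use cl gh_add[OF f] cind_val[OF S A] in \<open>simp_all add: cind_simps(3)\<close>)
  fix s k r x assume *: "s \<in> carrier G" "k \<in> carrier G" "r \<in> rcomp R s" "x \<in> mcomp (cind S A) k"
  hence x: "x \<in> carrier (cind S A)" by (simp add: cind_simps(5))
  have rR: "r \<in> carrier R" using * RD.B_carr by blast
  show "(\<lambda>g. f ((r \<odot>\<^bsub>cind S A\<^esub> x) g)) = r \<odot>\<^bsub>cind S B\<^esub> (\<lambda>g. f (x g))"
  proof
   fix g
   show "f ((r \<odot>\<^bsub>cind S A\<^esub> x) g) = (r \<odot>\<^bsub>cind S B\<^esub> (\<lambda>g. f (x g))) g"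
   proof (cases "g \<in> carrier G")
    case True
    show ?thesis
     unfolding cind_act(2)[OF S A cind_val[OF S A x] *(3,1) True]
      cind_act(2)[OF S B cind_val[OF S B cl[OF x]] *(3,1) True]
     using gh_smult[OF f, of r] rR cind_val[OF S A x] by simp
   qed (use f0 in \<open>simp add: cind_act_out[OF S A] cind_act_out[OF S B]\<close>)
  qed
 next
  fix g x assume "g \<in> carrier G" "x \<in> mcomp (cind S A) g"
  thus "(\<lambda>g. f (x g)) \<in> mcomp (cind S B) g" using cl f0 by (simp add: cind_simps(5))
 qed
qed

lemma cind_map_inj:
 assumes S: "stable S" and A: "gmod H cR A" and f: "inj_on f (carrier A)"
 shows "inj_on (\<lambda>x g. f (x g)) (carrier (cind S A))"
proof (rule inj_onI, rule ext)
 fix x y g assume "x \<in> carrier (cind S A)" "y \<in> carrier (cind S A)" "(\<lambda>g. f (x g)) = (\<lambda>g. f (y g))"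
 thus "x g = y g" using f cind_val[OF S A] by (metis inj_onD)
qed

lemma cind_map_image:
 assumes S: "stable S" and A: "gmod H cR A" and B: "gmod H cR B"
  and f: "f \<in> ghom H cR A B" and y: "y \<in> carrier (cind S B)" "\<And>g. y g \<in> f ` carrier A"
 shows "\<exists>x\<in>carrier (cind S A). (\<lambda>g. f (x g)) = y"
proof -
 interpret A: graded_module H cR A by fact
 have "\<exists>a. a \<in> mcomp A (\<psi> g) \<and> f a = y g" if g: "g \<in> S" for g
 proof -
  have "y g \<in> mcomp B (\<psi> g)" using y g by (simp add: cind_simps(1))
  thus ?thesis
   using gh_homogeneous_preimage[OF A B f _ y(2)] S_carr[OF S A g] psi_closed by metis
 qed
 then obtain a where a: "\<And>g. g \<in> S ==> a g \<in> mcomp A (\<psi> g) \<and> f (a g) = y g" by metis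
 \<comment> \<open>Zero is lifted to zero, and not to an arbitrary homogeneous preimage, in order to
   keep the support finite.\<close>
 define x where "x g = (if y g = \<zero>\<^sub>B then \<zero>\<^sub>A else a g)" for g
 have "finite {g. x g \<noteq> \<zero>\<^sub>A}"
 proof (rule finite_subset)
  show "finite {g. y g \<noteq> \<zero>\<^sub>B}" using y by (simp add: cind_simps(1))
 qed (auto simp: x_def)
 moreover have "x g \<in> mcomp A (\<psi> g)" if "g \<in> S" for g
  using a that A.MD.B_zero S_carr[OF S A that] by (simp add: x_def)
 moreover have "x g = \<zero>\<^sub>A" if "g \<notin> S" for g using y that by (simp add: x_def cind_simps(1))
 ultimately have "x \<in> carrier (cind S A)" by (simp add: cind_simps(1))
 moreover have "f (x g) = y g" for g
 proof (cases "y g = \<zero>\<^sub>B")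
  case True
  thus ?thesis using gh_zero[OF A B f] by (simp add: x_def)
 next
  case False
  hence "g \<in> S" using y(1) by (auto simp: cind_simps(1))
  thus ?thesis using a False by (simp add: x_def)
 qed
 ultimately show ?thesis by blast
qed

lemma cind_short_exact:
 assumes S: "stable S" and e: "short_exact H cR A B C f g"
 shows "short_exact G R (cind S A) (cind S B) (cind S C) (\<lambda>x k. f (x k)) (\<lambda>x k. g (x k))"
proof -
 note e = short_exactD[OF e]
 show ?thesis
 proof (rule short_exactI[OF cind_graded[OF S e(1)] cind_graded[OF S e(2)] cind_graded[OF S e(3)]
    cind_map[OF S e(1,2,4)] cind_map[OF S e(2,3,5)] cind_map_inj[OF S e(1,6)]])
  show "(\<lambda>k. g (f (x k))) = \<zero>\<^bsub>cind S C\<^esub>" if "x \<in> carrier (cind S A)" for x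
   using e(9) cind_val[OF S e(1) that] by (auto simp: cind_simps(2))
  show "\<exists>x\<in>carrier (cind S A). (\<lambda>k. f (x k)) = y"
   if y: "y \<in> carrier (cind S B)" "(\<lambda>k. g (y k)) = \<zero>\<^bsub>cind S C\<^esub>" for y
  proof (rule cind_map_image[OF S e(1,2,4) y(1)])
   fix k
   have "g (y k) = \<zero>\<^sub>C" using fun_cong[OF y(2), of k] by (simp add: cind_simps(2))
   then obtain x where "x \<in> carrier A" "f x = y k" using e(10)[OF cind_val[OF S e(2) y(1)]] by blast
   thus "y k \<in> f ` carrier A" by (metis imageI)
  qed
  show "(\<lambda>x k. g (x k)) ` carrier (cind S B) = carrier (cind S C)"
  proof (rule equalityI)
   show "(\<lambda>x k. g (x k)) ` carrier (cind S B) \<subseteq> carrier (cind S C)"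
    using gh_closed[OF cind_map[OF S e(2,3,5)]] by blast
   show "carrier (cind S C) \<subseteq> (\<lambda>x k. g (x k)) ` carrier (cind S B)"
   proof
    fix y assume y: "y \<in> carrier (cind S C)"
    have "y k \<in> g ` carrier B" for k using cind_val[OF S e(3) y] e(8) by simp
    thus "y \<in> (\<lambda>x k. g (x k)) ` carrier (cind S B)"
     using cind_map_image[OF S e(2,3,5) y] by blast
   qed
  qed
 qed
qed

end

section \<open>Projective and injective graded modules\<close>

lemma projective_graded: "projective G R P ==> gmod G R P"
 by (simp add: projective_def)

lemma injective_graded: "injective G R J ==> gmod G R J"
 by (simp add: injective_def)

lemma projectiveD:
 fixes P A B :: "('g,'r,'u) gmodule"
 assumes "projective G R P" "p \<in> ghom G R A B" "f \<in> ghom G R P B" "gmod G R A"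
  "gmod G R B" "p ` carrier A = carrier B"
 shows "\<exists>w\<in>ghom G R P A. \<forall>x\<in>carrier P. p (w x) = f x"
 using assms by (simp add: projective_def)

lemma injectiveD:
 fixes J A B :: "('g,'r,'u) gmodule"
 assumes "injective G R J" "j \<in> ghom G R A B" "f \<in> ghom G R A J" "gmod G R A"
  "gmod G R B" "inj_on j (carrier A)"
 shows "\<exists>w\<in>ghom G R B J. \<forall>x\<in>carrier A. w (j x) = f x"
 using assms by (simp add: injective_def)

text \<open>Lifting against modules of any element type, provided that they are small enough to be
  copied into \<open>'u\<close>. This is how modules of families become admissible as test
  objects.\<close>

lemma projective_lift:
 fixes P :: "('g,'r,'u) gmodule" and A :: "('g,'r,'a) gmodule" and B :: "('g,'r,'b) gmodule"
 assumes P: "projective G R P" and A: "gmod G R A" and B: "gmod G R B"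
  and p: "p \<in> ghom G R A B" "p ` carrier A = carrier B" and f: "f \<in> ghom G R P B"
  and a: "inj_on (\<alpha> :: 'a => 'u) (carrier A)" and b: "inj_on (\<beta> :: 'b => 'u) (carrier B)"
 obtains w where "w \<in> ghom G R P A" "\<And>x. x \<in> carrier P ==> p (w x) = f x"
proof -
 obtain A' :: "('g,'r,'u) gmodule" and v where A': "gmod G R A'" "giso G R A A' \<alpha> v"
  using transport[OF A a] by blast
 obtain B' :: "('g,'r,'u) gmodule" and v' where B': "gmod G R B'" "giso G R B B' \<beta> v'"
  using transport[OF B b] by blast
 note i = gisoD[OF A'(2)] and i' = gisoD[OF B'(2)]
 have "(\<lambda>x. \<beta> (p (v x))) \<in> ghom G R A' B'" "(\<lambda>x. \<beta> (f x)) \<in> ghom G R P B'"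
  by (intro gh_comp[OF gh_comp[OF i(2) p(1)] i'(1)] gh_comp[OF f i'(1)])+
 moreover have "(\<lambda>x. \<beta> (p (v x))) ` carrier A' = carrier B'"
  using gisoD(6)[OF giso_sym[OF A'(2)]] p(2) i'(6) by (metis image_image)
 ultimately obtain w where w: "w \<in> ghom G R P A'" "\<forall>x\<in>carrier P. \<beta> (p (v (w x))) = \<beta> (f x)"
  using projectiveD[OF P _ _ A'(1) B'(1), of "\<lambda>x. \<beta> (p (v x))" "\<lambda>x. \<beta> (f x)"] by auto
 show ?thesis
 proof
  show "(\<lambda>x. v (w x)) \<in> ghom G R P A" by (rule gh_comp[OF w(1) i(2)])
  show "p (v (w x)) = f x" if x: "x \<in> carrier P" for x
  proof -
   have "p (v (w x)) \<in> carrier B" "f x \<in> carrier B"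
    using gh_closed[OF p(1)] gh_closed[OF i(2)] gh_closed[OF w(1)] gh_closed[OF f] x by auto
   thus ?thesis using w(2) x i'(5) by (metis inj_onD)
  qed
 qed
qed

lemma injective_extend:
 fixes J :: "('g,'r,'u) gmodule" and A :: "('g,'r,'a) gmodule" and B :: "('g,'r,'b) gmodule"
 assumes J: "injective G R J" and A: "gmod G R A" and B: "gmod G R B"
  and j: "j \<in> ghom G R A B" "inj_on j (carrier A)" and f: "f \<in> ghom G R A J"
  and a: "inj_on (\<alpha> :: 'a => 'u) (carrier A)" and b: "inj_on (\<beta> :: 'b => 'u) (carrier B)"
 obtains w where "w \<in> ghom G R B J" "\<And>x. x \<in> carrier A ==> w (j x) = f x"
proof -
 obtain A' :: "('g,'r,'u) gmodule" and v where A': "gmod G R A'" "giso G R A A' \<alpha> v"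
  using transport[OF A a] by blast
 obtain B' :: "('g,'r,'u) gmodule" and v' where B': "gmod G R B'" "giso G R B B' \<beta> v'"
  using transport[OF B b] by blast
 note i = gisoD[OF A'(2)] and i' = gisoD[OF B'(2)]
 have h: "(\<lambda>x. \<beta> (j (v x))) \<in> ghom G R A' B'" "(\<lambda>x. f (v x)) \<in> ghom G R A' J"
  by (intro gh_comp[OF gh_comp[OF i(2) j(1)] i'(1)] gh_comp[OF i(2) f])+
 have inj: "inj_on (\<lambda>x. \<beta> (j (v x))) (carrier A')"
 proof (rule inj_onI)
  fix x y assume xy: "x \<in> carrier A'" "y \<in> carrier A'" "\<beta> (j (v x)) = \<beta> (j (v y))"
  have "v x \<in> carrier A" "v y \<in> carrier A" using gh_closed[OF i(2)] xy by auto
  hence "v x = v y" using xy(3) i'(5) j gh_closed[OF j(1)] by (metis inj_onD)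
  thus "x = y" using i(4) xy by metis
 qed
 obtain w where w: "w \<in> ghom G R B' J" "\<forall>x\<in>carrier A'. w (\<beta> (j (v x))) = f (v x)"
  using injectiveD[OF J h A'(1) B'(1) inj] by auto
 show ?thesis
 proof
  show "(\<lambda>x. w (\<beta> x)) \<in> ghom G R B J" by (rule gh_comp[OF i'(1) w(1)])
  show "w (\<beta> (j x)) = f x" if x: "x \<in> carrier A" for x
   using w(2) i(3)[OF x] gh_closed[OF i(1) x] by force
 qed
qed

section \<open>Closure under retracts, sums and kernels\<close>

lemma projective_retract:
 fixes P Z :: "('g,'r,'u) gmodule"
 assumes P: "projective G R P" and Z: "gmod G R Z"
  and i: "i \<in> ghom G R Z P" and r: "r \<in> ghom G R P Z" and ri: "\<And>z. z \<in> carrier Z ==> r (i z) = z"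
 shows "projective G R Z"
 unfolding projective_def
proof (intro conjI allI ballI impI Z)
 fix A B :: "('g,'r,'u) gmodule" and p f
 assume *: "p \<in> ghom G R A B" "f \<in> ghom G R Z B" "gmod G R A" "gmod G R B"
  "p ` carrier A = carrier B"
 obtain w where w: "w \<in> ghom G R P A" "\<And>x. x \<in> carrier P ==> p (w x) = f (r x)"
  using projective_lift[OF P *(3,4,1,5) gh_comp[OF r *(2)] inj_on_id inj_on_id] by auto
 show "\<exists>w\<in>ghom G R Z A. \<forall>x\<in>carrier Z. p (w x) = f x"
  using w ri gh_closed[OF i] by (intro bexI[OF _ gh_comp[OF i w(1)]]) simp
qed

lemma injective_retract:
 fixes J Z :: "('g,'r,'u) gmodule"
 assumes J: "injective G R J" and Z: "gmod G R Z"
  and i: "i \<in> ghom G R Z J" and r: "r \<in> ghom G R J Z" and ri: "\<And>z. z \<in> carrier Z ==> r (i z) = z"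
 shows "injective G R Z"
 unfolding injective_def
proof (intro conjI allI ballI impI Z)
 fix A B :: "('g,'r,'u) gmodule" and j f
 assume *: "j \<in> ghom G R A B" "f \<in> ghom G R A Z" "gmod G R A" "gmod G R B"
  "inj_on j (carrier A)"
 obtain w where w: "w \<in> ghom G R B J" "\<And>x. x \<in> carrier A ==> w (j x) = i (f x)"
  using injective_extend[OF J *(3,4,1,5) gh_comp[OF *(2) i] inj_on_id inj_on_id] by auto
 show "\<exists>w\<in>ghom G R B Z. \<forall>x\<in>carrier A. w (j x) = f x"
  using w ri gh_closed[OF *(2)] by (intro bexI[OF _ gh_comp[OF w(1) r]]) simp
qed

lemma projective_sum:
 fixes P Q X :: "('g,'r,'u) gmodule"
 assumes P: "projective G R P" and Q: "projective G R Q"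
  and X: "gmod G R X" "giso G R (prodm P Q) X u v"
 shows "projective G R X"
 unfolding projective_def
proof (intro conjI allI ballI impI X)
 fix A B :: "('g,'r,'u) gmodule" and p f
 assume *: "p \<in> ghom G R A B" "f \<in> ghom G R X B" "gmod G R A" "gmod G R B"
  "p ` carrier A = carrier B"
 note g = projective_graded[OF P] projective_graded[OF Q]
 note i = gisoD[OF X(2)]
 interpret P: graded_module G R P by (rule g)
 interpret Q: graded_module G R Q by (rule g)
 have h: "(\<lambda>x. f (u (x, \<zero>\<^sub>Q))) \<in> ghom G R P B" "(\<lambda>x. f (u (\<zero>\<^sub>P, x))) \<in> ghom G R Q B"
  by (rule gh_comp[OF gh_comp[OF inl_hom[OF g] i(1)] *(2)]
    gh_comp[OF gh_comp[OF inr_hom[OF g] i(1)] *(2)])+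
 obtain w1 where w1: "w1 \<in> ghom G R P A" "\<And>x. x \<in> carrier P ==> p (w1 x) = f (u (x, \<zero>\<^sub>Q))"
  using projective_lift[OF P *(3,4,1,5) h(1) inj_on_id inj_on_id] by auto
 obtain w2 where w2: "w2 \<in> ghom G R Q A" "\<And>x. x \<in> carrier Q ==> p (w2 x) = f (u (\<zero>\<^sub>P, x))"
  using projective_lift[OF Q *(3,4,1,5) h(2) inj_on_id inj_on_id] by auto
 let ?w = "\<lambda>x. w1 (fst (v x)) \<oplus>\<^sub>A w2 (snd (v x))"
 have w: "?w \<in> ghom G R X A"
  by (rule graded_hom_add[OF X(1) *(3) gh_comp[OF gh_comp[OF i(2) fst_hom[OF g]] w1(1)]
    gh_comp[OF gh_comp[OF i(2) snd_hom[OF g]] w2(1)]])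
 have "p (?w x) = f x" if x: "x \<in> carrier X" for x
 proof -
  obtain a b where ab: "v x = (a, b)" "a \<in> carrier P" "b \<in> carrier Q" using gh_closed[OF i(2) x] by auto
  have "p (?w x) = f (u (a, \<zero>\<^sub>Q)) \<oplus>\<^sub>B f (u (\<zero>\<^sub>P, b))"
   using ab w1 w2 gh_add[OF *(1)] gh_closed[OF w1(1)] gh_closed[OF w2(1)] by simp
  also have "\<dots> = f (u ((a, \<zero>\<^sub>Q) \<oplus>\<^bsub>prodm P Q\<^esub> (\<zero>\<^sub>P, b)))"
   using ab gh_add[OF *(2)] gh_add[OF i(1)] gh_closed[OF i(1)] by (simp del: prodm_simps(3))
  also have "\<dots> = f x" using ab i(4)[OF x] by simp
  finally show ?thesis .
 qed
 thus "\<exists>w\<in>ghom G R X A. \<forall>x\<in>carrier X. p (w x) = f x"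
  by (intro bexI[OF _ w] ballI)
qed

lemma injective_sum:
 fixes P Q X :: "('g,'r,'u) gmodule"
 assumes P: "injective G R P" and Q: "injective G R Q"
  and X: "gmod G R X" "giso G R (prodm P Q) X u v"
 shows "injective G R X"
 unfolding injective_def
proof (intro conjI allI ballI impI X)
 fix A B :: "('g,'r,'u) gmodule" and j f
 assume *: "j \<in> ghom G R A B" "f \<in> ghom G R A X" "gmod G R A" "gmod G R B"
  "inj_on j (carrier A)"
 note g = injective_graded[OF P] injective_graded[OF Q]
 note i = gisoD[OF X(2)]
 have h: "(\<lambda>x. fst (v (f x))) \<in> ghom G R A P" "(\<lambda>x. snd (v (f x))) \<in> ghom G R A Q"
  by (rule gh_comp[OF gh_comp[OF *(2) i(2)] fst_hom[OF g]]
    gh_comp[OF gh_comp[OF *(2) i(2)] snd_hom[OF g]])+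
 obtain w1 where w1: "w1 \<in> ghom G R B P" "\<And>x. x \<in> carrier A ==> w1 (j x) = fst (v (f x))"
  using injective_extend[OF P *(3,4,1,5) h(1) inj_on_id inj_on_id] by auto
 obtain w2 where w2: "w2 \<in> ghom G R B Q" "\<And>x. x \<in> carrier A ==> w2 (j x) = snd (v (f x))"
  using injective_extend[OF Q *(3,4,1,5) h(2) inj_on_id inj_on_id] by auto
 have w: "(\<lambda>x. u (w1 x, w2 x)) \<in> ghom G R B X"
  by (rule gh_comp[OF pair_hom[OF g w1(1) w2(1)] i(1)])
 have "u (w1 (j x), w2 (j x)) = f x" if "x \<in> carrier A" for x
  using that w1 w2 i(4) gh_closed[OF *(2)] by simp
 thus "\<exists>w\<in>ghom G R B X. \<forall>x\<in>carrier A. w (j x) = f x"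
  by (intro bexI[OF _ w] ballI)
qed

text \<open>Projectivity of \<open>Q\<close> gives a section \<open>s\<close> of \<open>g\<close>;
  then the identity minus \<open>s\<close> after \<open>g\<close> maps into the image of
  \<open>f\<close> and makes \<open>Z\<close> a retract of \<open>P\<close>.\<close>

lemma projective_kernel:
 fixes Z P Q :: "('g,'r,'u) gmodule"
 assumes e: "short_exact G R Z P Q f g" and P: "projective G R P" and Q: "projective G R Q"
 shows "projective G R Z"
proof -
 note e = short_exactD[OF e]
 interpret P: graded_module G R P by (rule e)
 interpret Q: graded_module G R Q by (rule e)
 obtain s where s: "s \<in> ghom G R Q P" "\<And>x. x \<in> carrier Q ==> g (s x) = x"
  using projective_lift[OF Q e(2,3,5,8) gh_id inj_on_id inj_on_id] by auto
 let ?h = "\<lambda>x. x \<ominus>\<^sub>P s (g x)"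
 have h: "?h \<in> ghom G R P P"
  by (rule graded_hom_diff[OF e(2,2) gh_id gh_comp[OF e(5) s(1)]])
 have "g (?h x) = \<zero>\<^sub>Q" if x: "x \<in> carrier P" for x
  using gh_diff[OF e(2,3,5) x] gh_closed[OF e(5) x] gh_closed[OF s(1)] s(2) Q.M.diff_zero_iff by simp
 hence "?h ` carrier P \<subseteq> f ` carrier Z"
  using e(7) gh_closed[OF h] by (auto simp: a_kernel_iff)
 then obtain k where k: "k \<in> ghom G R P Z" "\<And>x. x \<in> carrier P ==> f (k x) = ?h x"
  using factor_mono[OF e(1,2,2,4,6) h] by blast
 show ?thesis
 proof (rule projective_retract[OF P e(1,4) k(1)])
  fix z assume z: "z \<in> carrier Z"
  have fz: "f z \<in> carrier P" using gh_closed[OF e(4) z] .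
  have "f (k (f z)) = f z"
   using k(2)[OF fz] e(9)[OF z] gh_zero[OF e(3,2) s(1)] fz by (simp add: a_minus_def)
  thus "k (f z) = z" using e(6) z gh_closed[OF k(1) fz] by (meson inj_onD)
 qed
qed

lemma projective_zero:
 fixes X :: "('g,'r,'u) gmodule"
 assumes X: "gmod G R X" "carrier X = {\<zero>\<^sub>X}"
 shows "projective G R X"
 unfolding projective_def
proof (intro conjI allI ballI impI X)
 fix A B :: "('g,'r,'u) gmodule" and p f
 assume *: "p \<in> ghom G R A B" "f \<in> ghom G R X B" "gmod G R A" "gmod G R B"
 show "\<exists>w\<in>ghom G R X A. \<forall>x\<in>carrier X. p (w x) = f x"
  by (intro bexI[OF _ graded_hom_zero[OF X(1) *(3)]])
   (simp add: X(2) gh_zero[OF *(3,4,1)] gh_zero[OF X(1) *(4,2)])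
qed

lemma injective_zero:
 fixes X :: "('g,'r,'u) gmodule"
 assumes X: "gmod G R X" "carrier X = {\<zero>\<^sub>X}"
 shows "injective G R X"
 unfolding injective_def
proof (intro conjI allI ballI impI X)
 fix A B :: "('g,'r,'u) gmodule" and j f
 assume *: "j \<in> ghom G R A B" "f \<in> ghom G R A X" "gmod G R A" "gmod G R B"
 have "f x = \<zero>\<^sub>X" if "x \<in> carrier A" for x using gh_closed[OF *(2) that] X(2) by simp
 thus "\<exists>w\<in>ghom G R B X. \<forall>x\<in>carrier A. w (j x) = f x"
  by (intro bexI[OF _ graded_hom_zero[OF *(4) X(1)]]) simp
qed

lemma module_class_projective: "module_class G R (projective G R :: ('g,'r,'u) gmodule => bool)"
proof (rule module_class.intro)
 show "projective G R Y" if "projective G R X" "gmod G R Y" "giso G R X Y u v"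
  for X Y :: "('g,'r,'u) gmodule" and u v
  by (rule projective_retract[OF that(1,2) gisoD(2,1,4)[OF that(3)]])
qed (auto simp: projective_graded projective_zero)

lemma module_class_injective: "module_class G R (injective G R :: ('g,'r,'u) gmodule => bool)"
proof (rule module_class.intro)
 show "injective G R Y" if "injective G R X" "gmod G R Y" "giso G R X Y u v"
  for X Y :: "('g,'r,'u) gmodule" and u v
  by (rule injective_retract[OF that(1,2) gisoD(2,1,4)[OF that(3)]])
qed (auto simp: injective_graded injective_zero)

section \<open>Dimension shifting\<close>

text \<open>The closure properties on which dimension shifting rests. The pairing \<open>en\<close>
  copies sums of two modules back into the type \<open>'u\<close>.\<close>

locale left_class = module_class G R Q
 for G :: "('g,'x) monoid_scheme" and R :: "('g,'r) gring" and Q :: "('g,'r,'u) gmodule => bool" +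
 fixes en :: "'u \<times> 'u => 'u"
 assumes en: "inj en"
  and Q_sum: "[|Q P; Q P'; gmod G R X; giso G R (prodm P P') X u v|] ==> Q X"
  and Q_kernel: "[|short_exact G R Z P P' f g; Q P; Q P'|] ==> Q Z"
begin

text \<open>Pull the beginning of a resolution of \<open>Y\<close> back along \<open>f\<close>: if
  \<open>F\<close> covers \<open>Y\<close> with kernel \<open>K\<close>, the kernel \<open>W\<close>
  of the composite from \<open>F\<close> to \<open>P\<close> covers \<open>Z\<close> with the same
  kernel \<open>K\<close>. As a kernel between members of the class, \<open>W\<close> is in the
  class.\<close>

lemma ldim_kernel:
 assumes e: "short_exact G R Z Y P f g" and Y: "ldim G R Q n Y" and P: "Q P"
 shows "ldim G R Q n Z"
proof (cases n)
 case 0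
 thus ?thesis using Q_kernel[OF e] Y P by simp
next
 case (Suc m)
 then obtain K F a b where *: "short_exact G R K F Y a b" "Q F" "ldim G R Q m K" using Y by auto
 note e = short_exactD[OF e] and k = short_exactD[OF *(1)]
 let ?gb = "\<lambda>x. g (b x)"
 have gb: "?gb \<in> ghom G R F P" by (rule gh_comp[OF k(5) e(5)])
 have gbs: "?gb ` carrier F = carrier P" using e(8) k(8) by (metis image_image)
 let ?W = "submod F (a_kernel F P ?gb)"
 have se: "short_exact G R ?W F P (\<lambda>x. x) ?gb" by (rule short_exact_of_epi[OF k(2) e(3) gb gbs])
 hence W: "Q ?W" using Q_kernel *(2) P by blast
 note w = short_exactD[OF se]
 have wF: "x \<in> carrier F" "g (b x) = \<zero>\<^sub>P" if "x \<in> carrier ?W" for x using that by (auto simp: a_kernel_iff)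
 obtain a' where a': "a' \<in> ghom G R K ?W" "\<And>x. x \<in> carrier K ==> a' x = a x"
 proof (rule factor_mono[OF w(1,2) k(1) w(4,6) k(4)])
  show "a ` carrier K \<subseteq> (\<lambda>x. x) ` carrier ?W"
   using k(9) gh_closed[OF k(4)] gh_zero[OF e(2,3,5)] by (auto simp: a_kernel_iff)
 qed (use that in auto)
 obtain b' where b': "b' \<in> ghom G R ?W Z" "\<And>x. x \<in> carrier ?W ==> f (b' x) = b x"
 proof (rule factor_mono[OF e(1,2) w(1) e(4,6) gh_comp[OF w(4) k(5)]])
  show "(\<lambda>x. b x) ` carrier ?W \<subseteq> f ` carrier Z"
   using e(7) gh_closed[OF k(5)] by (auto simp: a_kernel_iff)
 qed (use that in auto)
 have "short_exact G R K ?W Z a' b'"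
 proof (rule short_exactI[OF k(1) w(1) e(1) a'(1) b'(1)])
  show "inj_on a' (carrier K)" using k(6) a'(2) by (metis inj_on_cong)
  show "b' (a' x) = \<zero>\<^sub>Z" if x: "x \<in> carrier K" for x
  proof -
   have "f (b' (a' x)) = \<zero>\<^sub>Y" using b'(2)[OF gh_closed[OF a'(1) x]] a'(2)[OF x] k(9)[OF x] by simp
   thus ?thesis using gh_inj_zero[OF e(1,2,4,6) gh_closed[OF b'(1) gh_closed[OF a'(1) x]]] by simp
  qed
  show "\<exists>x\<in>carrier K. a' x = y" if y: "y \<in> carrier ?W" "b' y = \<zero>\<^sub>Z" for y
  proof -
   have "b y = \<zero>\<^sub>Y" using b'(2)[OF y(1)] y(2) gh_zero[OF e(1,2,4)] by simp
   thus ?thesis using k(10)[OF wF(1)[OF y(1)]] a'(2) by metis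
  qed
  show "b' ` carrier ?W = carrier Z"
  proof (rule equalityI)
   show "b' ` carrier ?W \<subseteq> carrier Z" using gh_closed[OF b'(1)] by blast
   show "carrier Z \<subseteq> b' ` carrier ?W"
   proof
    fix z assume z: "z \<in> carrier Z"
    then obtain x where x: "x \<in> carrier F" "b x = f z" using k(8) gh_closed[OF e(4) z] by (metis imageE)
    hence xW: "x \<in> carrier ?W" using e(9)[OF z] by (simp add: a_kernel_iff)
    have "b' x = z" using e(6) b'(2)[OF xW] x(2) z gh_closed[OF b'(1) xW] by (metis inj_onD)
    thus "z \<in> b' ` carrier ?W" using xW by blast
   qed
  qed
 qed
 thus ?thesis using Suc W *(3) by auto
qed

text \<open>Adding \<open>P\<close> to the first term of a resolution of \<open>Y\<close> leaves the
  kernel, and hence the rest of the resolution, unchanged.\<close>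

lemma ldim_sum:
 assumes Y: "ldim G R Q n Y" and P: "Q P" and X: "gmod G R X" "giso G R (prodm Y P) X u v"
 shows "ldim G R Q n X"
proof (cases n)
 case 0
 thus ?thesis using Q_sum[OF _ P X] Y by simp
next
 case (Suc m)
 then obtain K F a b where *: "short_exact G R K F Y a b" "Q F" "ldim G R Q m K" using Y by auto
 note k = short_exactD[OF *(1)] note gP = Q_graded[OF P] note i = gisoD[OF X(2)]
 obtain F' :: "('g,'r,'u) gmodule" and v' where F': "gmod G R F'" "giso G R (prodm F P) F' en v'"
  using transport[OF prodm_graded[OF k(2) gP], of en] en inj_on_subset by blast
 note i' = gisoD[OF F'(2)]
 have QF': "Q F'" by (rule Q_sum[OF *(2) P F'])
 interpret P: graded_module G R P by (rule gP)
 have v'c: "fst (v' x) \<in> carrier F" "snd (v' x) \<in> carrier P" if "x \<in> carrier F'" for x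
  using gh_closed[OF i'(2) that] by auto
 have uz: "u (y, p) = \<zero>\<^sub>X \<longleftrightarrow> y = \<zero>\<^sub>Y \<and> p = \<zero>\<^sub>P" if "y \<in> carrier Y" "p \<in> carrier P" for y p
  using gh_inj_zero[OF prodm_graded[OF k(3) gP] X(1) i(1,5), of "(y, p)"] that by simp
 have "short_exact G R K F' X (\<lambda>x. en (a x, \<zero>\<^sub>P)) (\<lambda>x. u (b (fst (v' x)), snd (v' x)))"
 proof (rule short_exactI[OF k(1) F'(1) X(1)])
  show "(\<lambda>x. en (a x, \<zero>\<^sub>P)) \<in> ghom G R K F'"
   by (rule gh_comp[OF gh_comp[OF k(4) inl_hom[OF k(2) gP]] i'(1)])
  show "(\<lambda>x. u (b (fst (v' x)), snd (v' x))) \<in> ghom G R F' X"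
   by (rule gh_comp[OF pair_hom[OF k(3) gP
      gh_comp[OF gh_comp[OF i'(2) fst_hom[OF k(2) gP]] k(5)]
      gh_comp[OF i'(2) snd_hom[OF k(2) gP]]] i(1)])
  show "inj_on (\<lambda>x. en (a x, \<zero>\<^sub>P)) (carrier K)"
  proof (rule inj_onI)
   fix x y assume xy: "x \<in> carrier K" "y \<in> carrier K" "en (a x, \<zero>\<^sub>P) = en (a y, \<zero>\<^sub>P)"
   from injD[OF en xy(3)] have "a x = a y" by simp
   thus "x = y" by (rule inj_onD[OF k(6) _ xy(1,2)])
  qed
  show "u (b (fst (v' (en (a x, \<zero>\<^sub>P)))), snd (v' (en (a x, \<zero>\<^sub>P)))) = \<zero>\<^sub>X" if "x \<in> carrier K" for x
  proof -
   have "v' (en (a x, \<zero>\<^sub>P)) = (a x, \<zero>\<^sub>P)" using i'(3) gh_closed[OF k(4) that] by simp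
   thus ?thesis
    using k(9)[OF that] uz[of "\<zero>\<^sub>Y" "\<zero>\<^sub>P"] gh_closed[OF k(5) gh_closed[OF k(4) that]] by simp
  qed
  show "\<exists>x\<in>carrier K. en (a x, \<zero>\<^sub>P) = y"
   if y: "y \<in> carrier F'" "u (b (fst (v' y)), snd (v' y)) = \<zero>\<^sub>X" for y
  proof -
   have "b (fst (v' y)) = \<zero>\<^sub>Y" "snd (v' y) = \<zero>\<^sub>P"
    using uz[OF gh_closed[OF k(5) v'c(1)[OF y(1)]] v'c(2)[OF y(1)]] y(2) by auto
   moreover obtain x where "x \<in> carrier K" "a x = fst (v' y)" using k(10)[OF v'c(1)[OF y(1)]] calculation by blast
   ultimately show ?thesis using i'(4)[OF y(1)] by (metis prod.collapse)
  qed
  show "(\<lambda>x. u (b (fst (v' x)), snd (v' x))) ` carrier F' = carrier X"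
  proof (rule equalityI)
   show "(\<lambda>x. u (b (fst (v' x)), snd (v' x))) ` carrier F' \<subseteq> carrier X"
    using gh_closed[OF i(1)] gh_closed[OF k(5)] v'c by auto
   show "carrier X \<subseteq> (\<lambda>x. u (b (fst (v' x)), snd (v' x))) ` carrier F'"
   proof
    fix x assume x: "x \<in> carrier X"
    obtain y p where yp: "v x = (y, p)" "y \<in> carrier Y" "p \<in> carrier P" using gh_closed[OF i(2) x] by auto
    obtain c where c: "c \<in> carrier F" "b c = y" using yp(2) k(8) by (metis imageE)
    have "v' (en (c, p)) = (c, p)" "en (c, p) \<in> carrier F'"
     using i'(3) gh_closed[OF i'(1), of "(c, p)"] c yp by auto
    moreover have "u (y, p) = x" using i(4)[OF x] yp by simp
    ultimately show "x \<in> (\<lambda>x. u (b (fst (v' x)), snd (v' x))) ` carrier F'"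
     using c by (intro image_eqI[of _ _ "en (c, p)"]) auto
   qed
  qed
 qed
 thus ?thesis using Suc QF' *(3) by auto
qed

text \<open>
  If \<open>0 \<rightarrow> K \<rightarrow> F \<rightarrow> X \<rightarrow> 0\<close> begins a resolution of \<open>X\<close>, then a lift of \<open>P \<rightarrow> X\<close> to \<open>F\<close> yields an exact
  sequence \<open>0 \<rightarrow> Z \<rightarrow> K \<oplus> P \<rightarrow> F \<rightarrow> 0\<close>.
\<close>

lemma ldim_shift:
 assumes e: "short_exact G R Z P X i p" and P: "Q P" "projective G R P" and X: "ldim G R Q (Suc n) X"
 shows "ldim G R Q n Z"
proof -
 obtain K F f q where *: "short_exact G R K F X f q" "Q F" "ldim G R Q n K" using X by auto
 note e = short_exactD[OF e] and k = short_exactD[OF *(1)]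
 interpret F: graded_module G R F by (rule k)
 interpret X: graded_module G R X by (rule k)
 obtain a where a: "a \<in> ghom G R P F" "\<And>x. x \<in> carrier P ==> q (a x) = p x"
  using projective_lift[OF P(2) k(2,3,5,8) e(5) inj_on_id inj_on_id] by auto
 obtain W :: "('g,'r,'u) gmodule" and v where W: "gmod G R W" "giso G R (prodm K P) W en v"
  using transport[OF prodm_graded[OF k(1) e(2)], of en] en inj_on_subset by blast
 note w = gisoD[OF W(2)]
 have W_dim: "ldim G R Q n W" by (rule ldim_sum[OF *(3) P(1) W])
 have vc: "fst (v x) \<in> carrier K" "snd (v x) \<in> carrier P" if "x \<in> carrier W" for x
  using gh_closed[OF w(2) that] by auto
 \<comment> \<open>The sign puts the pair of \<open>c z\<close> and \<open>i z\<close> into the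
   kernel of the map given by \<open>f\<close> on \<open>K\<close> and \<open>a\<close> on
   \<open>P\<close>. The lift \<open>c\<close> exists because \<open>q\<close> after
   \<open>a\<close> is \<open>p\<close>, which vanishes on the image of \<open>i\<close>.\<close>
 have mai: "(\<lambda>z. \<ominus>\<^sub>F a (i z)) \<in> ghom G R Z F"
  by (rule graded_hom_uminus[OF e(1) k(2) gh_comp[OF e(4) a(1)]])
 obtain c where c: "c \<in> ghom G R Z K" "\<And>z. z \<in> carrier Z ==> f (c z) = \<ominus>\<^sub>F a (i z)"
 proof (rule factor_mono[OF k(1,2) e(1) k(4,6) mai])
  show "(\<lambda>z. \<ominus>\<^sub>F a (i z)) ` carrier Z \<subseteq> f ` carrier K"
  proof (rule image_subsetI)
   fix z assume z: "z \<in> carrier Z"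
   have iz: "i z \<in> carrier P" "a (i z) \<in> carrier F" using gh_closed[OF e(4) z] gh_closed[OF a(1)] by auto
   have "q (\<ominus>\<^bsub>F\<^esub> a (i z)) = \<zero>\<^sub>X" using gh_minus[OF k(2,3,5) iz(2)] a(2)[OF iz(1)] e(9)[OF z] by simp
   thus "\<ominus>\<^sub>F a (i z) \<in> f ` carrier K" using k(7) iz by (simp add: a_kernel_iff)
  qed
 qed (use that in auto)
 let ?g = "\<lambda>x. f (fst (v x)) \<oplus>\<^sub>F a (snd (v x))"
 have vv: "v (en (c z, i z)) = (c z, i z)" "en (c z, i z) \<in> carrier W" if "z \<in> carrier Z" for z
  using w(3) gh_closed[OF w(1), of "(c z, i z)"] gh_closed[OF c(1) that] gh_closed[OF e(4) that] by auto
 have "short_exact G R Z W F (\<lambda>z. en (c z, i z)) ?g"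
 proof (rule short_exactI[OF e(1) W(1) k(2)])
  show "(\<lambda>z. en (c z, i z)) \<in> ghom G R Z W"
   by (rule gh_comp[OF pair_hom[OF k(1) e(2) c(1) e(4)] w(1)])
  show "?g \<in> ghom G R W F"
   by (rule graded_hom_add[OF W(1) k(2) gh_comp[OF gh_comp[OF w(2) fst_hom[OF k(1) e(2)]] k(4)]
     gh_comp[OF gh_comp[OF w(2) snd_hom[OF k(1) e(2)]] a(1)]])
  show "inj_on (\<lambda>z. en (c z, i z)) (carrier Z)"
  proof (rule inj_onI)
   fix x y assume xy: "x \<in> carrier Z" "y \<in> carrier Z" "en (c x, i x) = en (c y, i y)"
   from injD[OF en xy(3)] have "i x = i y" by simp
   thus "x = y" by (rule inj_onD[OF e(6) _ xy(1,2)])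
  qed
  show "?g (en (c z, i z)) = \<zero>\<^sub>F" if z: "z \<in> carrier Z" for z
   using vv(1)[OF z] c(2)[OF z] gh_closed[OF a(1) gh_closed[OF e(4) z]] by (simp add: F.M.l_neg)
  show "\<exists>z\<in>carrier Z. en (c z, i z) = y" if y: "y \<in> carrier W" "?g y = \<zero>\<^sub>F" for y
  proof -
   let ?k = "fst (v y)" let ?t = "snd (v y)"
   have cl: "f ?k \<in> carrier F" "a ?t \<in> carrier F" using gh_closed[OF k(4)] gh_closed[OF a(1)] vc[OF y(1)] by auto
   hence fk: "f ?k = \<ominus>\<^sub>F a ?t" using F.M.minus_equality[OF y(2) cl(2,1)] by simp
   have "q (f ?k) = \<zero>\<^sub>X" by (rule k(9)[OF vc(1)[OF y(1)]])
   hence "\<ominus>\<^sub>X p ?t = \<zero>\<^sub>X" using fk gh_minus[OF k(2,3,5) cl(2)] a(2)[OF vc(2)[OF y(1)]] by simp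
   hence "p ?t = \<zero>\<^sub>X" using gh_closed[OF e(5) vc(2)[OF y(1)]] X.M.minus_minus[of "p ?t"] by simp
   then obtain z where z: "z \<in> carrier Z" "i z = ?t" using e(10)[OF vc(2)[OF y(1)]] by blast
   have "f (c z) = f ?k" using c(2)[OF z(1)] z(2) fk by simp
   hence "c z = ?k" using k(6) gh_closed[OF c(1) z(1)] vc(1)[OF y(1)] by (meson inj_onD)
   hence "en (c z, i z) = y" using z w(4)[OF y(1)] by simp
   thus ?thesis using z by blast
  qed
  show "?g ` carrier W = carrier F"
  proof (rule equalityI)
   show "?g ` carrier W \<subseteq> carrier F"
    using gh_closed[OF k(4)] gh_closed[OF a(1)] vc by auto
   show "carrier F \<subseteq> ?g ` carrier W"
   proof
    fix y assume y: "y \<in> carrier F"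
    obtain t where t: "t \<in> carrier P" "p t = q y" using e(8) gh_closed[OF k(5) y] by (metis imageE)
    have at: "a t \<in> carrier F" using gh_closed[OF a(1) t(1)] .
    have "q (y \<ominus>\<^sub>F a t) = \<zero>\<^sub>X"
     using gh_diff[OF k(2,3,5) y at] a(2)[OF t(1)] t(2) gh_closed[OF k(5) y] X.M.diff_zero_iff by simp
    then obtain s where s: "s \<in> carrier K" "f s = y \<ominus>\<^sub>F a t" using k(10) y at by blast
    have "v (en (s, t)) = (s, t)" "en (s, t) \<in> carrier W" using w(3) gh_closed[OF w(1), of "(s, t)"] s t by auto
    moreover have "f s \<oplus>\<^sub>F a t = y" using s(2) y at by (simp add: a_minus_def F.M.a_assoc F.M.l_neg)
    ultimately show "y \<in> ?g ` carrier W" by (intro image_eqI[of _ _ "en (s, t)"]) auto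
   qed
  qed
 qed
 \<comment> \<open>The middle term has dimension at most \<open>n\<close> as a sum of
   \<open>K\<close> and a member of the class, and passing to the kernel of its map onto
   \<open>F\<close> does not raise this bound.\<close>
 thus ?thesis by (rule ldim_kernel[OF _ W_dim *(2)])
qed

end

section \<open>Sums and retracts for right resolutions\<close>

context
 fixes G :: "('g,'x) monoid_scheme" and R :: "('g,'r) gring" and en :: "'u \<times> 'u => 'u"
 assumes en: "inj en"
begin

interpretation module_class G R "injective G R :: ('g,'r,'u) gmodule => bool"
 by (rule module_class_injective)

text \<open>As for left resolutions, \<open>J\<close> is added to the first term, and the cokernel
  stays the same.\<close>

lemma rdim_sum:
 fixes Y J X :: "('g,'r,'u) gmodule"
 assumes Y: "rdim G R (injective G R) n Y" and J: "injective G R J"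
  and X: "gmod G R X" "giso G R (prodm Y J) X u v"
 shows "rdim G R (injective G R) n X"
proof (cases n)
 case 0
 thus ?thesis using injective_sum[OF _ J X] Y by simp
next
 case (Suc m)
 then obtain F K :: "('g,'r,'u) gmodule" and a b
  where *: "short_exact G R Y F K a b" "injective G R F" "rdim G R (injective G R) m K" using Y by auto
 note k = short_exactD[OF *(1)] note gJ = injective_graded[OF J] note i = gisoD[OF X(2)]
 obtain F' :: "('g,'r,'u) gmodule" and v' where F': "gmod G R F'" "giso G R (prodm F J) F' en v'"
  using transport[OF prodm_graded[OF k(2) gJ], of en] en inj_on_subset by blast
 note i' = gisoD[OF F'(2)]
 have QF': "injective G R F'" by (rule injective_sum[OF *(2) J F'])
 have vc: "fst (v x) \<in> carrier Y" "snd (v x) \<in> carrier J" if "x \<in> carrier X" for x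
  using gh_closed[OF i(2) that] by auto
 have v'c: "fst (v' x) \<in> carrier F" "snd (v' x) \<in> carrier J" if "x \<in> carrier F'" for x
  using gh_closed[OF i'(2) that] by auto
 have vv: "v' (en (a (fst (v x)), snd (v x))) = (a (fst (v x)), snd (v x))" if "x \<in> carrier X" for x
  using i'(3) gh_closed[OF k(4) vc(1)[OF that]] vc(2)[OF that] by simp
 have "short_exact G R X F' K (\<lambda>x. en (a (fst (v x)), snd (v x))) (\<lambda>x. b (fst (v' x)))"
 proof (rule short_exactI[OF X(1) F'(1) k(3)])
  show "(\<lambda>x. en (a (fst (v x)), snd (v x))) \<in> ghom G R X F'"
   by (rule gh_comp[OF pair_hom[OF k(2) gJ
      gh_comp[OF gh_comp[OF i(2) fst_hom[OF k(1) gJ]] k(4)]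
      gh_comp[OF i(2) snd_hom[OF k(1) gJ]]] i'(1)])
  show "(\<lambda>x. b (fst (v' x))) \<in> ghom G R F' K"
   by (rule gh_comp[OF gh_comp[OF i'(2) fst_hom[OF k(2) gJ]] k(5)])
  show "inj_on (\<lambda>x. en (a (fst (v x)), snd (v x))) (carrier X)"
  proof (rule inj_onI)
   fix x y assume xy: "x \<in> carrier X" "y \<in> carrier X" "en (a (fst (v x)), snd (v x)) = en (a (fst (v y)), snd (v y))"
   hence "a (fst (v x)) = a (fst (v y))" "snd (v x) = snd (v y)" using en by (auto dest: injD)
   hence "v x = v y" using k(6) vc xy(1,2) by (metis inj_onD prod_eq_iff)
   thus "x = y" using i(4) xy by metis
  qed
  show "b (fst (v' (en (a (fst (v x)), snd (v x))))) = \<zero>\<^sub>K" if "x \<in> carrier X" for x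
   using vv[OF that] k(9) vc(1)[OF that] by simp
  show "\<exists>x\<in>carrier X. en (a (fst (v x)), snd (v x)) = y" if y: "y \<in> carrier F'" "b (fst (v' y)) = \<zero>\<^sub>K" for y
  proof -
   obtain s where s: "s \<in> carrier Y" "a s = fst (v' y)" using k(10)[OF v'c(1)[OF y(1)] y(2)] by blast
   have "v (u (s, snd (v' y))) = (s, snd (v' y))" "u (s, snd (v' y)) \<in> carrier X"
    using i(3) gh_closed[OF i(1), of "(s, snd (v' y))"] s v'c(2)[OF y(1)] by auto
   thus ?thesis using s i'(4)[OF y(1)] by (intro bexI[of _ "u (s, snd (v' y))"]) auto
  qed
  have "fst ` v' ` carrier F' = carrier F"
  proof -
   have "carrier J \<noteq> {}" using gJ by (metis empty_iff graded_module.axioms(2) module.axioms(2) abelian_groupE(2))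
   thus ?thesis using gisoD(6)[OF giso_sym[OF F'(2)]] by simp
  qed
  thus "(\<lambda>x. b (fst (v' x))) ` carrier F' = carrier K" using k(8) by (metis image_image)
 qed
 thus ?thesis using Suc QF' *(3) by auto
qed

text \<open>
  Let \<open>0 \<rightarrow> X \<rightarrow> J \<rightarrow> Y \<rightarrow> 0\<close> begin a resolution of \<open>X\<close>, let \<open>M\<close> be a retract of \<open>X\<close> and \<open>q\<close> an endomorphism
  of \<open>J\<close> that extends the idempotent \<open>1 - i r\<close> of \<open>X\<close>. Then \<open>J/M\<close> is a retract of \<open>Y \<oplus> J\<close>: send the class
  of \<open>c\<close> to the pair of its class in \<open>Y\<close> and \<open>q c\<close>, and \<open>(y, j)\<close> to the class of \<open>(1 - q) y + j\<close>.
\<close>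

lemma rdim_retract:
 fixes M X :: "('g,'r,'u) gmodule"
 assumes "rdim G R (injective G R) n X" and M: "gmod G R M"
  and i: "i \<in> ghom G R M X" and r: "r \<in> ghom G R X M" and ri: "\<And>z. z \<in> carrier M ==> r (i z) = z"
 shows "rdim G R (injective G R) n M"
 using assms
proof (induction n arbitrary: M X i r)
 case 0
 thus ?case using injective_retract by simp blast
next
 case (Suc n)
 note M = Suc.prems(2) and i = Suc.prems(3) and r = Suc.prems(4) and ri = Suc.prems(5)
 obtain J Y :: "('g,'r,'u) gmodule" and e p
  where *: "short_exact G R X J Y e p" "injective G R J" "rdim G R (injective G R) n Y"
  using Suc.prems(1) by auto
 note k = short_exactD[OF *(1)]
 interpret M: graded_module G R M by (rule M)
 interpret X: graded_module G R X by (rule k)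
 interpret J: graded_module G R J by (rule k)
 interpret Y: graded_module G R Y by (rule k)
 have ei: "(\<lambda>x. e (i x)) \<in> ghom G R M J" by (rule gh_comp[OF i k(4)])
 have "inj_on i (carrier M)" using ri by (metis inj_on_inverseI)
 hence ei_inj: "inj_on (\<lambda>x. e (i x)) (carrier M)"
  using k(6) gh_closed[OF i] by (auto simp: inj_on_def)
 obtain C :: "('g,'r,'u) gmodule" and c where se: "short_exact G R M J C (\<lambda>x. e (i x)) c"
  using short_exact_of_mono[OF M k(2) ei ei_inj] by blast
 note s = short_exactD[OF se]
 interpret C: graded_module G R C by (rule s)
 let ?f = "\<lambda>x. e (x \<ominus>\<^sub>X i (r x))"
 have f: "?f \<in> ghom G R X J"
  by (rule gh_comp[OF graded_hom_diff[OF k(1,1) gh_id gh_comp[OF r i]] k(4)])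
 obtain q where q: "q \<in> ghom G R J J" "\<And>x. x \<in> carrier X ==> q (e x) = ?f x"
  using injective_extend[OF *(2) k(1,2,4,6) f inj_on_id inj_on_id] by auto
 have cl: "i x \<in> carrier X" "e (i x) \<in> carrier J" if "x \<in> carrier M" for x
  using gh_closed[OF i that] gh_closed[OF k(4)] by auto
 \<comment> \<open>On the image of \<open>M\<close> the map \<open>q\<close> is \<open>e\<close>
   applied to the identity minus \<open>i r\<close>, which vanishes on the image of
   \<open>i\<close>; so \<open>q\<close> passes to the cokernel \<open>C\<close> of \<open>M\<close>
   in \<open>J\<close>.\<close>
 obtain q' where q': "q' \<in> ghom G R C J" "\<And>x. x \<in> carrier J ==> q' (c x) = q x"
 proof (rule factor_epi[OF k(2) s(3) k(2) s(5,8) q(1)])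
  fix x assume "x \<in> carrier J" "c x = \<zero>\<^sub>C"
  then obtain m where m: "m \<in> carrier M" "e (i m) = x" using s(10) by blast
  have "q x = e (i m \<ominus>\<^sub>X i (r (i m)))" using q(2) cl(1)[OF m(1)] m(2) by metis
  thus "q x = \<zero>\<^sub>J"
   using ri[OF m(1)] cl(1)[OF m(1)] X.M.diff_zero_iff[of "i m" "i m"] gh_zero[OF k(1,2,4)] by simp
 qed (use that in auto)
 obtain p' where p': "p' \<in> ghom G R C Y" "\<And>x. x \<in> carrier J ==> p' (c x) = p x"
 proof (rule factor_epi[OF k(2) s(3) k(3) s(5,8) k(5)])
  fix x assume "x \<in> carrier J" "c x = \<zero>\<^sub>C"
  then obtain m where m: "m \<in> carrier M" "e (i m) = x" using s(10) by blast
  thus "p x = \<zero>\<^sub>Y" using k(9) cl(1) by blast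
 qed (use that in auto)
 have d: "(\<lambda>y. c (y \<ominus>\<^sub>J q y)) \<in> ghom G R J C"
  by (rule gh_comp[OF graded_hom_diff[OF k(2,2) gh_id q(1)] s(5)])
 \<comment> \<open>For \<open>x\<close> equal to \<open>e z\<close>, subtracting \<open>q x\<close>
   leaves \<open>e (i (r z))\<close>, which comes from \<open>M\<close> and dies in
   \<open>C\<close>. Hence the map induced by the identity minus \<open>q\<close> is defined on
   \<open>Y\<close>.\<close>
 obtain \<alpha> where \<alpha>: "\<alpha> \<in> ghom G R Y C" "\<And>x. x \<in> carrier J ==> \<alpha> (p x) = c (x \<ominus>\<^sub>J q x)"
 proof (rule factor_epi[OF k(2,3) s(3) k(5,8) d])
  fix x assume "x \<in> carrier J" "p x = \<zero>\<^sub>Y"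
  then obtain z where z: "z \<in> carrier X" "e z = x" using k(10) by blast
  have rz: "r z \<in> carrier M" "i (r z) \<in> carrier X" "e z \<in> carrier J" "e (i (r z)) \<in> carrier J"
   using gh_closed[OF r z(1)] cl gh_closed[OF k(4) z(1)] by auto
  have "q x = e z \<ominus>\<^sub>J e (i (r z))" using q(2)[OF z(1)] z(2) gh_diff[OF k(1,2,4) z(1) rz(2)] by simp
  hence "x \<ominus>\<^sub>J q x = e (i (r z))"
   using z(2) rz by (simp add: a_minus_def J.M.minus_add J.M.r_neg2 J.M.minus_minus J.M.a_assoc[symmetric] J.M.r_neg)
  thus "c (x \<ominus>\<^sub>J q x) = \<zero>\<^sub>C" using s(9)[OF rz(1)] by simp
 qed (use that in auto)
 obtain W :: "('g,'r,'u) gmodule" and v where W: "gmod G R W" "giso G R (prodm Y J) W en v"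
  using transport[OF prodm_graded[OF k(3,2)], of en] en inj_on_subset by blast
 note w = gisoD[OF W(2)]
 have W_dim: "rdim G R (injective G R) n W" by (rule rdim_sum[OF *(3,2) W])
 have "rdim G R (injective G R) n C"
 proof (rule Suc.IH[OF W_dim s(3)])
  show "(\<lambda>x. en (p' x, q' x)) \<in> ghom G R C W"
   by (rule gh_comp[OF pair_hom[OF k(3,2) p'(1) q'(1)] w(1)])
  show "(\<lambda>x. \<alpha> (fst (v x)) \<oplus>\<^sub>C c (snd (v x))) \<in> ghom G R W C"
   by (rule graded_hom_add[OF W(1) s(3) gh_comp[OF gh_comp[OF w(2) fst_hom[OF k(3,2)]] \<alpha>(1)]
     gh_comp[OF gh_comp[OF w(2) snd_hom[OF k(3,2)]] s(5)]])
  fix z assume "z \<in> carrier C"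
  then obtain x where x: "x \<in> carrier J" "c x = z" using s(8) by (metis imageE)
  have qx: "q x \<in> carrier J" using gh_closed[OF q(1) x(1)] .
  have "v (en (p' z, q' z)) = (p x, q x)" using w(3) x p' q' gh_closed[OF k(5) x(1)] qx by auto
  moreover have "c (x \<ominus>\<^sub>J q x) \<oplus>\<^sub>C c (q x) = c x"
   using gh_add[OF s(5), of "x \<ominus>\<^sub>J q x" "q x"] x qx by (simp add: a_minus_def J.M.a_assoc J.M.l_neg)
  ultimately show "\<alpha> (fst (v (en (p' z, q' z)))) \<oplus>\<^sub>C c (snd (v (en (p' z, q' z)))) = z"
   using \<alpha>(2)[OF x(1)] x by simp
 qed
 hence "short_exact G R M J C (\<lambda>x. e (i x)) c \<and> injective G R J \<and> rdim G R (injective G R) n C"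
  using se *(2) by (intro conjI)
 thus ?case unfolding rdim.simps by (intro exI)
qed

end

section \<open>Coarsening of projective and injective modules\<close>

context coarsening
begin

text \<open>A left adjoint of a functor that preserves epimorphisms preserves projectives: the
  transpose of \<open>f\<close> is lifted along the map of families induced by \<open>p\<close>, and
  the counit turns the lift back into a homomorphism to \<open>A\<close>. The condition
  \<open>small\<close> admits the modules of families as test objects.\<close>

lemma projective_coarsen:
 fixes P :: "('g,'r,'u) gmodule"
 assumes P: "projective G R P" and S: "stable S"
  and supp: "\<And>g. [|g \<in> carrier G; g \<notin> S|] ==> mcomp P g = {\<zero>\<^sub>P}"
  and small: "\<And>A :: ('h,'r,'u) gmodule. gmod H cR A
   ==> \<exists>\<phi> :: ('g => 'u) => 'u. inj_on \<phi> (carrier (cind S A))"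
 shows "projective H cR (cM P)"
 unfolding projective_def
proof (intro conjI allI ballI impI)
 note gP = projective_graded[OF P]
 show "gmod H cR (cM P)" by (rule cM_graded(1)[OF gP])
 interpret P: graded_module G R P by (rule gP)
 fix A B :: "('h,'r,'u) gmodule" and p f
 assume p: "p \<in> ghom H cR A B" and f: "f \<in> ghom H cR (cM P) B" and A: "gmod H cR A"
  and B: "gmod H cR B" and surj: "p ` carrier A = carrier B"
 interpret A: graded_module H cR A by fact
 interpret B: graded_module H cR B by fact
 let ?UA = "cind S A" and ?UB = "cind S B"
 note gA = cind_graded[OF S A] and gB = cind_graded[OF S B]
 interpret UA: graded_module G R ?UA by (rule gA)
 note up = cind_map[OF S A B p]
 have "(\<lambda>x k. p (x k)) ` carrier ?UA = carrier ?UB"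
 proof (rule equalityI)
  show "(\<lambda>x k. p (x k)) ` carrier ?UA \<subseteq> carrier ?UB" using gh_closed[OF up] by blast
  show "carrier ?UB \<subseteq> (\<lambda>x k. p (x k)) ` carrier ?UA"
  proof
   fix y assume y: "y \<in> carrier ?UB"
   have "y k \<in> p ` carrier A" for k using cind_val[OF S B y] surj by simp
   thus "y \<in> (\<lambda>x k. p (x k)) ` carrier ?UA" using cind_map_image[OF S A B p y] by blast
  qed
 qed
 moreover obtain \<alpha> :: "('g => 'u) => 'u" where "inj_on \<alpha> (carrier ?UA)" using small[OF A] by blast
 moreover obtain \<beta> :: "('g => 'u) => 'u" where "inj_on \<beta> (carrier ?UB)" using small[OF B] by blast
 ultimately obtain w where w: "w \<in> ghom G R P ?UA"
  "\<And>x. x \<in> carrier P ==> (\<lambda>k. p (w x k)) = (\<lambda>g. f (gc G P x g))"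
  using projective_lift[OF P gA gB up _ unit_hom[OF S B gP f supp]] by metis
 obtain c where c: "c \<in> ghom H cR (cM ?UA) A"
  "\<And>g x. [|g \<in> carrier G; x \<in> mcomp ?UA g|] ==> c x = x g"
  using counit_exists[OF S A] by blast
 have h: "(\<lambda>x. c (w x)) \<in> ghom H cR (cM P) A"
  by (rule gh_comp[OF hom_cM[OF gP gA w(1)] c(1)])
 have "p (c (w x)) = f x" if x: "x \<in> carrier P" for x
 proof (rule P.MD.addhom_eqI[OF B.M.abelian_group_axioms _ _ _ x])
  have "(\<lambda>x. p (c (w x))) \<in> addhom (cM P) B"
   by (rule gh_addhom[OF gh_comp[OF h p]])
  thus "(\<lambda>x. p (c (w x))) \<in> addhom P B" by (simp add: addhom_def)
  show "f \<in> addhom P B" using gh_addhom[OF f] by (simp add: addhom_def)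
  fix g x assume g: "g \<in> carrier G" and x: "x \<in> mcomp P g"
  have "c (w x) = w x g" by (rule c(2)[OF g gh_mcomp[OF w(1) g x]])
  moreover have "p (w x g) = f (gc G P x g)"
   using fun_cong[OF w(2), of x g] P.MD.B_carr[OF x g] by simp
  ultimately show "p (c (w x)) = f x" using P.MD.dcomp_hom'[OF x g] by simp
 qed
 thus "\<exists>w\<in>ghom H cR (cM P) A. \<forall>x\<in>carrier (cM P). p (w x) = f x"
  by (intro bexI[OF _ h]) simp
qed

text \<open>A lift \<open>w\<close> after coarsening need not respect the fine degrees. Keeping of
  \<open>w x\<close>, for \<open>x\<close> of degree \<open>g\<close>, just the component of degree
  \<open>g\<close> gives a graded lift, because \<open>p\<close> commutes with components.\<close>

lemma projective_reflect:
 fixes P :: "('g,'r,'u) gmodule"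
 assumes gP: "gmod G R P" and P: "projective H cR (cM P)"
 shows "projective G R P"
 unfolding projective_def
proof (intro conjI allI ballI impI gP)
 interpret P: graded_module G R P by (rule gP)
 fix A B :: "('g,'r,'u) gmodule" and p f
 assume p: "p \<in> ghom G R A B" and f: "f \<in> ghom G R P B" and A: "gmod G R A"
  and B: "gmod G R B" and surj: "p ` carrier A = carrier B"
 interpret A: graded_module G R A by fact
 interpret B: graded_module G R B by fact
 have "\<exists>w\<in>ghom H cR (cM P) (cM A). \<forall>x\<in>carrier (cM P). p (w x) = f x"
  by (rule projectiveD[OF P hom_cM[OF A B p] hom_cM[OF gP B f] cM_graded(1)[OF A] cM_graded(1)[OF B]])
   (simp add: surj)
 then obtain w where w: "w \<in> ghom H cR (cM P) (cM A)" "\<And>x. x \<in> carrier P ==> p (w x) = f x"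
  by auto
 have wA: "w x \<in> carrier A" if "x \<in> carrier P" for x using gh_closed[OF w(1)] that by simp
 obtain u where u: "u \<in> ghom G R P A" "\<And>g x. [|g \<in> carrier G; x \<in> mcomp P g|] ==> u x = gc G A (w x) g"
 proof (rule gh_glue[OF gP A, of "\<lambda>g x. gc G A (w x) g"])
  show "gc G A (w x) g \<in> mcomp A g" if "g \<in> carrier G" "x \<in> mcomp P g" for g x
   using A.MD.dcomp_in[OF wA[OF P.MD.B_carr[OF that(2,1)]] that(1)] .
  show "gc G A (w (x \<oplus>\<^sub>P y)) g = gc G A (w x) g \<oplus>\<^sub>A gc G A (w y) g"
   if "g \<in> carrier G" "x \<in> mcomp P g" "y \<in> mcomp P g" for g x y
   using gh_add[OF w(1), of x y] P.MD.B_carr[OF that(2,1)] P.MD.B_carr[OF that(3,1)] A.MD.dcomp_add wA by simp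
  show "gc G A (w (r \<odot>\<^sub>P x)) (s \<otimes>\<^sub>G g) = r \<odot>\<^sub>A gc G A (w x) g"
   if "s \<in> carrier G" "g \<in> carrier G" "r \<in> rcomp R s" "x \<in> mcomp P g" for s g r x
   using gh_smult[OF w(1), of r x] P.MD.B_carr[OF that(4,2)] RD.B_carr[OF that(3,1)]
    A.gc_smult[OF that(3,1) wA that(2)] by simp
 qed (use that in blast)
 have "p (u x) = f x" if x: "x \<in> carrier P" for x
 proof (rule P.MD.addhom_eqI[OF B.M.abelian_group_axioms _ _ _ x])
  show "(\<lambda>x. p (u x)) \<in> addhom P B" by (rule gh_addhom[OF gh_comp[OF u(1) p]])
  show "f \<in> addhom P B" by (rule gh_addhom[OF f])
  fix g x assume g: "g \<in> carrier G" and x: "x \<in> mcomp P g"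
  have xP: "x \<in> carrier P" by (rule P.MD.B_carr[OF x g])
  have "p (u x) = gc G B (f x) g" using u(2)[OF g x] gh_gc[OF A B p wA[OF xP] g] w(2)[OF xP] by simp
  thus "p (u x) = f x" using B.MD.dcomp_hom'[OF gh_mcomp[OF f g x] g] by simp
 qed
 thus "\<exists>w\<in>ghom G R P A. \<forall>x\<in>carrier P. p (w x) = f x" by (intro bexI[OF _ u(1)]) simp
qed

text \<open>A right adjoint of a functor that preserves monomorphisms preserves injectives: extend
  the transpose after coarsening and transpose back.\<close>

lemma injective_cind:
 fixes X :: "('g,'r,'u) gmodule" and N :: "('h,'r,'u) gmodule"
 assumes N: "injective H cR N" and X: "gmod G R X" "giso G R (cind (carrier G) N) X u v"
 shows "injective G R X"
 unfolding injective_def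
proof (intro conjI allI ballI impI X)
 let ?U = "cind (carrier G) N"
 note gN = injective_graded[OF N] and S = stable_UNIV and i = gisoD[OF X(2)]
 interpret N: graded_module H cR N by (rule gN)
 note gU = cind_graded[OF S gN]
 interpret U: graded_module G R ?U by (rule gU)
 fix A B :: "('g,'r,'u) gmodule" and j f
 assume j: "j \<in> ghom G R A B" and f: "f \<in> ghom G R A X" and A: "gmod G R A"
  and B: "gmod G R B" and inj: "inj_on j (carrier A)"
 interpret A: graded_module G R A by fact
 interpret B: graded_module G R B by fact
 obtain c where c: "c \<in> ghom H cR (cM ?U) N" "\<And>g x. [|g \<in> carrier G; x \<in> mcomp ?U g|] ==> c x = x g"
  using counit_exists[OF S gN] by blast
 have vf: "(\<lambda>x. v (f x)) \<in> ghom G R A ?U" by (rule gh_comp[OF f i(2)])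
 have "\<exists>w\<in>ghom H cR (cM B) N. \<forall>x\<in>carrier (cM A). w (j x) = c (v (f x))"
  by (rule injectiveD[OF N hom_cM[OF A B j] gh_comp[OF hom_cM[OF A gU vf] c(1)] cM_graded(1)[OF A] cM_graded(1)[OF B]])
   (simp add: inj)
 then obtain w where w: "w \<in> ghom H cR (cM B) N" "\<And>x. x \<in> carrier A ==> w (j x) = c (v (f x))" by auto
 have wu: "(\<lambda>x g. w (gc G B x g)) \<in> ghom G R B ?U"
  by (rule unit_hom[OF S gN B w(1)]) simp
 have "(\<lambda>g. w (gc G B (j x) g)) = v (f x)" if x: "x \<in> carrier A" for x
 proof
  fix g
  have vx: "v (f x) \<in> carrier ?U" using gh_closed[OF vf x] .
  show "w (gc G B (j x) g) = v (f x) g"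
  proof (cases "g \<in> carrier G")
   case g: True
   have "w (gc G B (j x) g) = c (v (f (gc G A x g)))"
    using gh_gc[OF A B j x g] w(2) A.MD.dcomp_closed[OF x] by simp
   also have "\<dots> = v (f (gc G A x g)) g"
    using c(2)[OF g gh_mcomp[OF vf g A.MD.dcomp_in[OF x g]]] .
   also have "v (f (gc G A x g)) = gc G ?U (v (f x)) g" using gh_gc[OF A gU vf x g] by simp
   also have "gc G ?U (v (f x)) g g = v (f x) g" using cind_gc[OF S gN vx g] by (simp add: single_def)
   finally show ?thesis .
  next
   case False
   hence "v (f x) g = \<zero>\<^sub>N" using vx by (simp add: cind_simps(1))
   moreover have "w \<zero>\<^sub>B = \<zero>\<^sub>N" using gh_zero[OF cM_graded(1)[OF B] gN w(1)] by simp
   ultimately show ?thesis using B.MD.dcomp_out False gh_closed[OF j x] by simp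
  qed
 qed
 thus "\<exists>w\<in>ghom G R B X. \<forall>x\<in>carrier A. w (j x) = f x"
  using i(4) gh_closed[OF f] by (intro bexI[OF _ gh_comp[OF wu i(1)]]) simp
qed

text \<open>In degree \<open>g\<close> the module of families consists of the coarse component that
  contains the degree \<open>g\<close> part of \<open>M\<close>; the unit includes this part, and
  \<open>r\<close> projects onto it.\<close>

lemma coarsen_retract:
 assumes M: "gmod G R M"
 obtains i r where "i \<in> ghom G R M (cind (carrier G) (cM M))"
  "r \<in> ghom G R (cind (carrier G) (cM M)) M" "\<And>x. x \<in> carrier M ==> r (i x) = x"
proof -
 let ?U = "cind (carrier G) (cM M)"
 note S = stable_UNIV and gM = cM_graded(1)[OF M]
 interpret M: graded_module G R M by fact
 interpret U: graded_module G R ?U by (rule cind_graded[OF S gM])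
 have i: "(\<lambda>x g. gc G M x g) \<in> ghom G R M ?U"
  using unit_hom[OF S gM M gh_id] by simp
 have xm: "x g \<in> carrier M" if "x \<in> mcomp ?U g" for x g
  using that cind_val[OF S gM] by (simp add: cind_simps(5))
 obtain r where r: "r \<in> ghom G R ?U M" "\<And>g x. [|g \<in> carrier G; x \<in> mcomp ?U g|] ==> r x = gc G M (x g) g"
 proof (rule gh_glue[OF cind_graded[OF S gM] M, of "\<lambda>g x. gc G M (x g) g"])
  show "gc G M (x g) g \<in> mcomp M g" if "g \<in> carrier G" "x \<in> mcomp ?U g" for g x
   using M.MD.dcomp_in[OF xm that(1)] that by blast
  show "gc G M ((x \<oplus>\<^bsub>?U\<^esub> y) g) g = gc G M (x g) g \<oplus>\<^sub>M gc G M (y g) g"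
   if "g \<in> carrier G" "x \<in> mcomp ?U g" "y \<in> mcomp ?U g" for g x y
   using xm[OF that(2)] xm[OF that(3)] by (simp add: cind_simps(3) M.MD.dcomp_add)
  show "gc G M ((r \<odot>\<^bsub>?U\<^esub> x) (s \<otimes>\<^sub>G g)) (s \<otimes>\<^sub>G g) = r \<odot>\<^sub>M gc G M (x g) g"
   if *: "s \<in> carrier G" "g \<in> carrier G" "r \<in> rcomp R s" "x \<in> mcomp ?U g" for s g r x
  proof -
   have "x \<in> carrier ?U" using *(4) by (simp add: cind_simps(5))
   from cind_act(2)[OF S gM cind_val[OF S gM this] *(3,1), of "s \<otimes>\<^sub>G g"]
   have "(r \<odot>\<^bsub>?U\<^esub> x) (s \<otimes>\<^sub>G g) = r \<odot>\<^sub>M x g" using * inv_cancel'[OF S gM *(1,2)] by simp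
   thus ?thesis using M.gc_smult[OF *(3,1) xm[OF *(4)] *(2)] by simp
  qed
 qed (use that in blast)
 have "r (\<lambda>g. gc G M x g) = x" if x: "x \<in> carrier M" for x
 proof (rule M.MD.addhom_eqI[OF M.M.abelian_group_axioms _ _ _ x])
  show "(\<lambda>x. r (\<lambda>g. gc G M x g)) \<in> addhom M M" by (rule gh_addhom[OF gh_comp[OF i r(1)]])
  show "(\<lambda>x. x) \<in> addhom M M" by (rule addhomI; simp)
  fix g x assume g: "g \<in> carrier G" and x: "x \<in> mcomp M g"
  thus "r (\<lambda>g. gc G M x g) = x"
   using r(2)[OF g gh_mcomp[OF i g x]] M.MD.dcomp_hom'[OF x g] by simp
 qed
 thus ?thesis using that i r(1) by blast
qed

text \<open>If the fibres of \<open>\<psi>\<close> are finite, the functor above is also a left adjoint of coarsening.\<close>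

lemma injective_coarsen:
 fixes J :: "('g,'r,'u) gmodule"
 assumes J: "injective G R J" and fib: "\<And>h. finite {g \<in> carrier G. \<psi> g = h}"
  and small: "\<And>A :: ('h,'r,'u) gmodule. gmod H cR A
   ==> \<exists>\<phi> :: ('g => 'u) => 'u. inj_on \<phi> (carrier (cind (carrier G) A))"
 shows "injective H cR (cM J)"
 unfolding injective_def
proof (intro conjI allI ballI impI)
 note gJ = injective_graded[OF J] and S = stable_UNIV
 show "gmod H cR (cM J)" by (rule cM_graded(1)[OF gJ])
 interpret J: graded_module G R J by (rule gJ)
 interpret cJ: graded_module H cR "cM J" by (rule cM_graded(1)[OF gJ])
 fix A B :: "('h,'r,'u) gmodule" and j f
 assume j: "j \<in> ghom H cR A B" and f: "f \<in> ghom H cR A (cM J)" and A: "gmod H cR A"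
  and B: "gmod H cR B" and inj: "inj_on j (carrier A)"
 interpret A: graded_module H cR A by fact
 interpret B: graded_module H cR B by fact
 let ?UA = "cind (carrier G) A" and ?UB = "cind (carrier G) B"
 note gA = cind_graded[OF S A] and gB = cind_graded[OF S B]
 interpret UA: graded_module G R ?UA by (rule gA)
 interpret UB: graded_module G R ?UB by (rule gB)
 have fJ: "f x \<in> carrier J" if "x \<in> carrier A" for x using gh_closed[OF f that] by simp
 have xm: "x g \<in> carrier A" if "x \<in> mcomp ?UA g" for x g
  using that cind_val[OF S A] by (simp add: cind_simps(5))
 \<comment> \<open>The transpose of \<open>f\<close> for the other adjunction: the entry at
   \<open>g\<close> is mapped by \<open>f\<close> and then projected to degree
   \<open>g\<close>.\<close>
 obtain f' where f': "f' \<in> ghom G R ?UA J" "\<And>g x. [|g \<in> carrier G; x \<in> mcomp ?UA g|] ==> f' x = gc G J (f (x g)) g"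
 proof (rule gh_glue[OF gA gJ, of "\<lambda>g x. gc G J (f (x g)) g"])
  show "gc G J (f (x g)) g \<in> mcomp J g" if "g \<in> carrier G" "x \<in> mcomp ?UA g" for g x
   using J.MD.dcomp_in[OF fJ[OF xm] that(1)] that by blast
  show "gc G J (f ((x \<oplus>\<^bsub>?UA\<^esub> y) g)) g = gc G J (f (x g)) g \<oplus>\<^sub>J gc G J (f (y g)) g"
   if "g \<in> carrier G" "x \<in> mcomp ?UA g" "y \<in> mcomp ?UA g" for g x y
   using xm[OF that(2)] xm[OF that(3)] gh_add[OF f] fJ by (simp add: cind_simps(3) J.MD.dcomp_add)
  show "gc G J (f ((r \<odot>\<^bsub>?UA\<^esub> x) (s \<otimes>\<^sub>G g))) (s \<otimes>\<^sub>G g) = r \<odot>\<^sub>J gc G J (f (x g)) g"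
   if *: "s \<in> carrier G" "g \<in> carrier G" "r \<in> rcomp R s" "x \<in> mcomp ?UA g" for s g r x
  proof -
   have "x \<in> carrier ?UA" using *(4) by (simp add: cind_simps(5))
   from cind_act(2)[OF S A cind_val[OF S A this] *(3,1), of "s \<otimes>\<^sub>G g"]
   have "(r \<odot>\<^bsub>?UA\<^esub> x) (s \<otimes>\<^sub>G g) = r \<odot>\<^sub>A x g" using * inv_cancel'[OF S A *(1,2)] by simp
   moreover have "r \<in> carrier R" by (rule RD.B_carr[OF *(3,1)])
   ultimately show ?thesis
    using gh_smult[OF f, of r "x g"] xm[OF *(4)] J.gc_smult[OF *(3,1) fJ[OF xm[OF *(4)]] *(2)] by simp
  qed
 qed (use that in blast)
 obtain \<alpha> :: "('g => 'u) => 'u" where \<alpha>: "inj_on \<alpha> (carrier ?UA)" using small[OF A] by blast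
 obtain \<beta> :: "('g => 'u) => 'u" where \<beta>: "inj_on \<beta> (carrier ?UB)" using small[OF B] by blast
 obtain w where w: "w \<in> ghom G R ?UB J" "\<And>x. x \<in> carrier ?UA ==> w (\<lambda>k. j (x k)) = f' x"
  using injective_extend[OF J gA gB cind_map[OF S A B j] cind_map_inj[OF S A inj] f'(1) \<alpha> \<beta>] by blast
 let ?F = "\<lambda>h. {g \<in> carrier G. \<psi> g = h}"
 \<comment> \<open>An element of coarse degree \<open>h\<close> is placed in every fine degree above
   \<open>h\<close> and the images are added up. Finiteness of the fibre enters here.\<close>
 define \<phi> where "\<phi> h b = finsum J (\<lambda>g. w (single B g b)) (?F h)" for h b
 have sm: "single B g b \<in> mcomp ?UB g" "single B g b \<in> carrier ?UB" if "g \<in> ?F h" "b \<in> mcomp B h" for g h b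
  using single_mem[OF S B, of g b] that by (auto simp: cind_simps(5))
 have ws: "w (single B g b) \<in> mcomp J g" "w (single B g b) \<in> carrier J" if "g \<in> ?F h" "b \<in> mcomp B h" for g h b
  using gh_mcomp[OF w(1) _ sm(1)[OF that]] gh_closed[OF w(1) sm(2)[OF that]] that by auto
 have \<phi>J: "\<phi> h b \<in> carrier J" if "b \<in> mcomp B h" for h b
  unfolding \<phi>_def by (rule J.M.finsum_closed) (use ws(2) that in blast)
 have \<phi>add: "\<phi> h (b \<oplus>\<^sub>B b') = \<phi> h b \<oplus>\<^sub>J \<phi> h b'" if h: "h \<in> carrier H" and b: "b \<in> mcomp B h" "b' \<in> mcomp B h" for h b b'
 proof -
  have "\<phi> h (b \<oplus>\<^sub>B b') = finsum J (\<lambda>g. w (single B g b) \<oplus>\<^sub>J w (single B g b')) (?F h)"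
   unfolding \<phi>_def
  proof (rule J.M.finsum_cong')
   show "(\<lambda>g. w (single B g b) \<oplus>\<^sub>J w (single B g b')) \<in> ?F h \<rightarrow> carrier J" using ws(2) b by blast
   fix g assume g: "g \<in> ?F h"
   show "w (single B g (b \<oplus>\<^sub>B b')) = w (single B g b) \<oplus>\<^sub>J w (single B g b')"
    unfolding single_add[OF S B] by (rule gh_add[OF w(1) sm(2)[OF g b(1)] sm(2)[OF g b(2)]])
  qed simp
  also have "\<dots> = \<phi> h b \<oplus>\<^sub>J \<phi> h b'"
   unfolding \<phi>_def by (rule J.M.finsum_addf) (use ws(2) b in blast)+
  finally show ?thesis .
 qed
 have \<phi>hom: "\<phi> (\<psi> s \<otimes>\<^sub>H h) (r \<odot>\<^sub>B b) = r \<odot>\<^sub>J \<phi> h b"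
  if s: "s \<in> carrier G" and h: "h \<in> carrier H" and r: "r \<in> rcomp R s" and b: "b \<in> mcomp B h" for s h r b
 proof -
  let ?sh = "\<psi> s \<otimes>\<^sub>H h"
  have rR: "r \<in> carrier R" by (rule RD.B_carr[OF r s])
  have rb: "r \<odot>\<^sub>B b \<in> mcomp B ?sh" using B.mcomp_smult[OF _ h rcomp_cR[OF r s] b] s by simp
  \<comment> \<open>Translation by \<open>s\<close> is a bijection between the fibres, so the sum
    for \<open>r\<close> times \<open>b\<close> is a reindexing of the sum for
    \<open>b\<close>.\<close>
  have im: "?F ?sh = (\<otimes>\<^bsub>G\<^esub>) s ` ?F h"
  proof (intro equalityI subsetI)
   fix g assume g: "g \<in> ?F ?sh"
   have "\<psi> (inv\<^bsub>G\<^esub> s \<otimes>\<^sub>G g) = h"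
    using g s h by (simp add: psi_mult psi_inv H.m_assoc[symmetric])
   thus "g \<in> (\<otimes>\<^bsub>G\<^esub>) s ` ?F h" using g s inv_cancel[OF S B s, of g] by (intro image_eqI[of _ _ "inv\<^bsub>G\<^esub> s \<otimes>\<^sub>G g"]) auto
  qed (use s psi_mult in auto)
  have "\<phi> ?sh (r \<odot>\<^sub>B b) = finsum J (\<lambda>g. w (single B g (r \<odot>\<^sub>B b))) ((\<otimes>\<^bsub>G\<^esub>) s ` ?F h)"
   unfolding \<phi>_def im ..
  also have "\<dots> = finsum J (\<lambda>g. w (single B (s \<otimes>\<^sub>G g) (r \<odot>\<^sub>B b))) (?F h)"
  proof (rule J.M.finsum_reindex)
   show "(\<lambda>g. w (single B g (r \<odot>\<^sub>B b))) \<in> (\<otimes>\<^bsub>G\<^esub>) s ` ?F h \<rightarrow> carrier J"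
    unfolding im[symmetric] using ws(2) rb by blast
   show "inj_on ((\<otimes>\<^bsub>G\<^esub>) s) (?F h)" by (rule inj_onI) (use s in simp)
  qed
  also have "\<dots> = finsum J (\<lambda>g. r \<odot>\<^sub>J w (single B g b)) (?F h)"
  proof (rule J.M.finsum_cong')
   show "(\<lambda>g. r \<odot>\<^sub>J w (single B g b)) \<in> ?F h \<rightarrow> carrier J" using ws(2) b rR J.smult_closed by blast
   fix g assume g: "g \<in> ?F h"
   have "single B (s \<otimes>\<^sub>G g) (r \<odot>\<^sub>B b) = r \<odot>\<^bsub>?UB\<^esub> single B g b"
    using single_smult[OF S B r s, of g b] g b by simp
   thus "w (single B (s \<otimes>\<^sub>G g) (r \<odot>\<^sub>B b)) = r \<odot>\<^sub>J w (single B g b)"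
    using gh_smult[OF w(1) rR sm(2)[OF g b]] by simp
  qed simp
  also have "\<dots> = r \<odot>\<^sub>J \<phi> h b"
   unfolding \<phi>_def by (rule addhom_finsum[OF J.M.abelian_group_axioms J.M.abelian_group_axioms J.smult_addhom[OF rR], symmetric])
    (use ws(2) b in blast)
  finally show ?thesis .
 qed
 obtain W where W: "W \<in> ghom H cR B (cM J)" "\<And>h b. [|h \<in> carrier H; b \<in> mcomp B h|] ==> W b = \<phi> h b"
 proof (rule gh_glue[OF B cM_graded(1)[OF gJ], of \<phi>])
  show "\<phi> h b \<in> mcomp (cM J) h" if h: "h \<in> carrier H" and b: "b \<in> mcomp B h" for h b
  proof -
   have "\<phi> h b \<in> sum_of_family J (?F h) (mcomp J)"
   proof (rule J.M.sum_of_familyI[OF fib])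
    show "\<phi> h b = finsum J (\<lambda>g. w (single B g b)) (?F h)" by (rule \<phi>_def)
   qed (use ws(1)[OF _ b] in auto)
   thus ?thesis by simp
  qed
  show "\<phi> h (x \<oplus>\<^sub>B y) = \<phi> h x \<oplus>\<^bsub>cM J\<^esub> \<phi> h y" if "h \<in> carrier H" "x \<in> mcomp B h" "y \<in> mcomp B h" for h x y
   using \<phi>add that by simp
  show "\<phi> (k \<otimes>\<^sub>H h) (r \<odot>\<^sub>B b) = r \<odot>\<^bsub>cM J\<^esub> \<phi> h b"
   if k: "k \<in> carrier H" and h: "h \<in> carrier H" and r: "r \<in> rcomp cR k" and b: "b \<in> mcomp B h" for k h r b
  proof -
   have bB: "b \<in> carrier B" by (rule B.MD.B_carr[OF b h])
   have r': "r \<in> sum_of_family R (?F k) (rcomp R)" using r by simp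
   have c: "rcomp R i \<subseteq> carrier R" if "i \<in> ?F k" for i using that rcomp_carr by blast
   have "r \<in> rcomp cR k \<and> \<phi> (k \<otimes>\<^sub>H h) (r \<odot>\<^sub>B b) = r \<odot>\<^sub>J \<phi> h b"
    using r'
   proof (induction rule: R.sum_of_family_induct)
    case zero
    have "\<phi> (k \<otimes>\<^sub>H h) \<zero>\<^sub>B \<oplus>\<^sub>J \<phi> (k \<otimes>\<^sub>H h) \<zero>\<^sub>B = \<phi> (k \<otimes>\<^sub>H h) \<zero>\<^sub>B"
     using \<phi>add[of "k \<otimes>\<^sub>H h" "\<zero>\<^sub>B" "\<zero>\<^sub>B"] B.MD.B_zero[of "k \<otimes>\<^sub>H h"] k h by simp
    hence "\<phi> (k \<otimes>\<^sub>H h) \<zero>\<^sub>B = \<zero>\<^sub>J"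
     using \<phi>J[OF B.MD.B_zero[of "k \<otimes>\<^sub>H h"]] k h by simp
    thus ?case using bB \<phi>J[OF b] B.smult_l_null[OF bB] J.smult_l_null RD.dcomp_zero by (simp add: cR_iff)
   next
    case (hom s r)
    thus ?case using \<phi>hom[OF _ h _ b, of s r] rcomp_cR[of r s] by auto
   next
    case (add r r')
    have "r \<odot>\<^sub>B b \<in> mcomp B (k \<otimes>\<^sub>H h)" "r' \<odot>\<^sub>B b \<in> mcomp B (k \<otimes>\<^sub>H h)"
     using B.mcomp_smult[OF k h _ b] add by blast+
    hence "\<phi> (k \<otimes>\<^sub>H h) (r \<odot>\<^sub>B b \<oplus>\<^sub>B r' \<odot>\<^sub>B b) = \<phi> (k \<otimes>\<^sub>H h) (r \<odot>\<^sub>B b) \<oplus>\<^sub>J \<phi> (k \<otimes>\<^sub>H h) (r' \<odot>\<^sub>B b)"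
     using \<phi>add k h by simp
    thus ?case
     using add cR_add B.smult_l_distr[of r r' b] J.smult_l_distr[of r r' "\<phi> h b"] bB \<phi>J[OF b]
     by (simp del: coarsen_simps(6))
   qed (rule c)
   thus ?thesis by simp
  qed
 qed (use that in blast)
 have "W (j x) = f x" if x: "x \<in> carrier A" for x
 proof (rule A.MD.addhom_eqI[OF cJ.M.abelian_group_axioms _ _ _ x])
  show "(\<lambda>x. W (j x)) \<in> addhom A (cM J)" by (rule gh_addhom[OF gh_comp[OF j W(1)]])
  show "f \<in> addhom A (cM J)" by (rule gh_addhom[OF f])
  fix h x assume h: "h \<in> carrier H" and x: "x \<in> mcomp A h"
  have xA: "x \<in> carrier A" by (rule A.MD.B_carr[OF x h])
  have "W (j x) = finsum J (\<lambda>g. w (single B g (j x))) (?F h)"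
   using W(2)[OF h gh_mcomp[OF j h x]] \<phi>_def by simp
  also have "\<dots> = finsum J (gc G J (f x)) (?F h)"
  proof (rule J.M.finsum_cong')
   show "gc G J (f x) \<in> ?F h \<rightarrow> carrier J" using J.MD.dcomp_closed[OF fJ[OF xA]] by blast
   fix g assume g: "g \<in> ?F h"
   have sx: "single A g x \<in> mcomp ?UA g" using single_mem[OF S A, of g x] g x by simp
   have "single B g (j x) = (\<lambda>k. j (single A g x k))"
    using gh_zero[OF A B j] by (auto simp: single_def)
   hence "w (single B g (j x)) = f' (single A g x)"
    using w(2) sx by (simp add: cind_simps(5))
   thus "w (single B g (j x)) = gc G J (f x) g"
    using f'(2)[OF _ sx] g by (simp add: single_def)
  qed simp
  \<comment> \<open>An element of coarse degree \<open>h\<close> is the sum of its fine components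
    over the fibre of \<open>h\<close>.\<close>
  also have "\<dots> = f x"
  proof (rule J.MD.dcomp_sum[OF fJ[OF xA] fib])
   have "f x \<in> mcomp (cM J) h" by (rule gh_mcomp[OF f h x])
   thus "gc G J (f x) g = \<zero>\<^sub>J" if "g \<notin> ?F h" for g
    using that J.MD.dcomp_out[OF fJ[OF xA], of g] unfolding cM_iff[OF gJ] by blast
  qed
  finally show "W (j x) = f x" .
 qed
 thus "\<exists>w\<in>ghom H cR B (cM J). \<forall>x\<in>carrier A. w (j x) = f x" by (intro bexI[OF _ W(1)]) simp
qed

end

section \<open>Cardinality bounds\<close>

text \<open>A function is coded by the list of its pairs of index and value over the support. The
  support is enumerated in an arbitrary order, so functions are recovered from the set of list
  entries alone. The list coding \<open>le\<close> serves for pairs as well.\<close>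

lemma finsupp_small:
 fixes \<kappa> :: "'i => 'u" and \<nu> :: "'v => 'u" and le :: "'u list => 'u"
 assumes le: "inj le" and \<kappa>: "inj_on \<kappa> T" and \<nu>: "inj_on \<nu> V"
  and C: "\<And>x. x \<in> C ==> finite {i. x i \<noteq> z}" "\<And>x i. [|x \<in> C; x i \<noteq> z|] ==> i \<in> T \<and> x i \<in> V"
 shows "\<exists>\<phi> :: ('i => 'v) => 'u. inj_on \<phi> C"
proof -
 define l where "l x = (SOME l. set l = {i. x i \<noteq> z})" for x :: "'i => 'v"
 have l: "set (l x) = {i. x i \<noteq> z}" if "x \<in> C" for x
  unfolding l_def by (rule someI_ex) (rule finite_list[OF C(1)[OF that]])
 define \<phi> where "\<phi> x = le (map (\<lambda>i. le [\<kappa> i, \<nu> (x i)]) (l x))" for x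
 have *: "y i = x i" if xy: "x \<in> C" "y \<in> C" "\<phi> x = \<phi> y" and i: "x i \<noteq> z" for x y i
 proof -
  have "set (map (\<lambda>i. le [\<kappa> i, \<nu> (x i)]) (l x)) = set (map (\<lambda>i. le [\<kappa> i, \<nu> (y i)]) (l y))"
   using xy(3) injD[OF le] unfolding \<phi>_def by metis
  hence eq: "(\<lambda>i. le [\<kappa> i, \<nu> (x i)]) ` {i. x i \<noteq> z} = (\<lambda>i. le [\<kappa> i, \<nu> (y i)]) ` {i. y i \<noteq> z}"
   using l xy(1,2) by simp
  have "le [\<kappa> i, \<nu> (x i)] \<in> (\<lambda>i. le [\<kappa> i, \<nu> (y i)]) ` {i. y i \<noteq> z}"
   unfolding eq[symmetric] using i by blast
  then obtain k where k: "y k \<noteq> z" "le [\<kappa> i, \<nu> (x i)] = le [\<kappa> k, \<nu> (y k)]" by blast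
  from injD[OF le k(2)] have "\<kappa> i = \<kappa> k" "\<nu> (x i) = \<nu> (y k)" by auto
  hence "i = k" "x i = y k" using \<kappa> \<nu> C(2) xy i k(1) by (meson inj_onD)+
  thus ?thesis by simp
 qed
 have "inj_on \<phi> C"
 proof (rule inj_onI, rule ext)
  fix x y i assume xy: "x \<in> C" "y \<in> C" "\<phi> x = \<phi> y"
  show "x i = y i" using *[OF xy, of i] *[OF xy(2,1) xy(3)[symmetric], of i] by metis
 qed
 thus ?thesis by blast
qed

text \<open>Every element of the generated subgroup is the value of a word in the generators and
  their inverses; choosing one word for each element embeds the subgroup into lists.\<close>

lemma (in group) generate_small:
 fixes \<kappa> :: "'a => 'u" and le :: "'u list => 'u"
 assumes le: "inj le" and D: "D \<subseteq> carrier G" and \<kappa>: "inj_on \<kappa> D"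
 shows "\<exists>\<kappa>' :: 'a => 'u. inj_on \<kappa>' (generate G D)"
proof -
 define ev where "ev l = foldr (\<lambda>(d,b) a. (if b then d else inv d) \<otimes> a) l \<one>" for l :: "('a \<times> bool) list"
 have evc: "ev l \<in> carrier G" if "set l \<subseteq> D \<times> UNIV" for l
  using that D by (induction l) (auto simp: ev_def)
 have app: "ev (l @ l') = ev l \<otimes> ev l'" if "set l \<subseteq> D \<times> UNIV" "set l' \<subseteq> D \<times> UNIV" for l l'
  using that
 proof (induction l)
  case Nil
  thus ?case using evc by (simp add: ev_def)
 next
  case (Cons p l)
  obtain d b where p: "p = (d, b)" by fastforce
  hence "d \<in> carrier G" using Cons.prems D by auto
  hence "(if b then d else inv d) \<in> carrier G" by simp
  moreover have "ev ((d, b) # m) = (if b then d else inv d) \<otimes> ev m" for m by (simp add: ev_def)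
  ultimately show ?case using Cons evc[of l] evc[of l'] p by (simp add: m_assoc)
 qed
 have ex: "\<exists>l. set l \<subseteq> D \<times> UNIV \<and> ev l = s" if "s \<in> generate G D" for s
  using that
 proof induction
  case one
  show ?case by (rule exI[of _ "[]"]) (simp add: ev_def)
 next
  case (incl h)
  thus ?case using D by (intro exI[of _ "[(h, True)]"]) (auto simp: ev_def)
 next
  case (inv h)
  thus ?case using D by (intro exI[of _ "[(h, False)]"]) (auto simp: ev_def)
 next
  case (eng a b)
  then obtain l l' where "set l \<subseteq> D \<times> UNIV" "ev l = a" "set l' \<subseteq> D \<times> UNIV" "ev l' = b" by blast
  thus ?case using app by (intro exI[of _ "l @ l'"]) auto
 qed
 define w where "w s = (SOME l. set l \<subseteq> D \<times> UNIV \<and> ev l = s)" for s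
 have w: "set (w s) \<subseteq> D \<times> UNIV" "ev (w s) = s" if "s \<in> generate G D" for s
  using someI_ex[OF ex[OF that]] unfolding w_def by auto
 \<comment> \<open>A letter is coded by a list of length one or two, the length telling the
   generator from its inverse.\<close>
 define c where "c p = le (if snd p then [\<kappa> (fst p)] else [\<kappa> (fst p), \<kappa> (fst p)])" for p :: "'a \<times> bool"
 have c: "inj_on c (D \<times> UNIV)"
 proof (rule inj_onI)
  fix p q assume *: "p \<in> D \<times> (UNIV :: bool set)" "q \<in> D \<times> (UNIV :: bool set)" "c p = c q"
  from *(3) injD[OF le] have "(if snd p then [\<kappa> (fst p)] else [\<kappa> (fst p), \<kappa> (fst p)])
   = (if snd q then [\<kappa> (fst q)] else [\<kappa> (fst q), \<kappa> (fst q)])" unfolding c_def by blast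
  hence "snd p = snd q" "\<kappa> (fst p) = \<kappa> (fst q)" by (auto split: if_splits)
  thus "p = q" using inj_onD[OF \<kappa>, of "fst p" "fst q"] *(1,2) by (auto simp: prod_eq_iff)
 qed
 have "inj_on (\<lambda>s. le (map c (w s))) (generate G D)"
 proof (rule inj_onI)
  fix s t assume *: "s \<in> generate G D" "t \<in> generate G D" "le (map c (w s)) = le (map c (w t))"
  have "w s = w t"
   by (rule map_inj_on[OF injD[OF le *(3)]])
    (rule inj_on_subset[OF c], use w(1)[OF *(1)] w(1)[OF *(2)] in blast)
  thus "s = t" using w(2) * by metis
 qed
 thus ?thesis by blast
qed

context coarsening
begin

lemma cind_small:
 fixes A :: "('h,'r,'u) gmodule" and le :: "'u list => 'u" and \<kappa> :: "'g => 'u"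
 assumes le: "inj le" and S: "stable S" and A: "gmod H cR A"
  and \<kappa>: "inj_on \<kappa> {g \<in> S. mcomp A (\<psi> g) \<noteq> {\<zero>\<^sub>A}}"
 shows "\<exists>\<phi> :: ('g => 'u) => 'u. inj_on \<phi> (carrier (cind S A))"
proof (rule finsupp_small[OF le \<kappa> inj_on_id[of UNIV], where z = "\<zero>\<^sub>A"])
 fix x i assume "x \<in> carrier (cind S A)" "x i \<noteq> \<zero>\<^sub>A"
 hence "i \<in> S" "x i \<in> mcomp A (\<psi> i)" by (auto simp: cind_simps(1))
 thus "i \<in> {g \<in> S. mcomp A (\<psi> g) \<noteq> {\<zero>\<^sub>A}} \<and> x i \<in> UNIV" using \<open>x i \<noteq> \<zero>\<^sub>A\<close> by auto
qed (simp add: cind_simps(1))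

text \<open>The set is the subgroup generated by \<open>g0\<close> and the degrees in which
  \<open>R\<close> or \<open>M\<close> is nonzero. A nonzero homogeneous element has just one
  degree, so it names that degree within \<open>'r\<close> or \<open>'u\<close>, however large
  \<open>'g\<close> may be.\<close>

lemma stable_small_exists:
 fixes M :: "('g,'r,'u) gmodule" and le :: "'u list => 'u" and \<rho> :: "'r => 'u"
 assumes le: "inj le" and \<rho>: "inj \<rho>" and M: "gmod G R M" and g0: "g0 \<in> carrier G"
 obtains S and \<kappa> :: "'g => 'u" where "stable S" "subgroup S G" "g0 \<in> S" "inj_on \<kappa> S"
  "\<And>g. [|g \<in> carrier G; g \<notin> S|] ==> mcomp M g = {\<zero>\<^sub>M}"
proof -
 interpret M: graded_module G R M by fact
 let ?D1 = "{s \<in> carrier G. rcomp R s \<noteq> {\<zero>\<^sub>R}}" and ?D2 = "{s \<in> carrier G. mcomp M s \<noteq> {\<zero>\<^sub>M}}"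
 define a where "a s = (SOME r. r \<in> rcomp R s \<and> r \<noteq> \<zero>\<^sub>R)" for s
 define b where "b s = (SOME x. x \<in> mcomp M s \<and> x \<noteq> \<zero>\<^sub>M)" for s
 have a: "a s \<in> rcomp R s \<and> a s \<noteq> \<zero>\<^sub>R" if "s \<in> ?D1" for s
  unfolding a_def by (rule someI_ex) (use that RD.B_zero in auto)
 have b: "b s \<in> mcomp M s \<and> b s \<noteq> \<zero>\<^sub>M" if "s \<in> ?D2" for s
  unfolding b_def by (rule someI_ex) (use that M.MD.B_zero in auto)
 have ai: "s = t" if "s \<in> ?D1" "t \<in> ?D1" "a s = a t" for s t
  using a[OF that(1)] a[OF that(2)] that RD.dcomp_hom'[of "a s" s t] RD.dcomp_hom'[of "a t" t t] by auto
 have bi: "s = t" if "s \<in> ?D2" "t \<in> ?D2" "b s = b t" for s t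
  using b[OF that(1)] b[OF that(2)] that M.MD.dcomp_hom'[of "b s" s t] M.MD.dcomp_hom'[of "b t" t t] by auto
 \<comment> \<open>Lists of length zero, one and two keep apart the three sources of degrees:
   \<open>g0\<close>, the ring and the module.\<close>
 define \<kappa> where "\<kappa> s = le (if s = g0 then [] else if s \<in> ?D1 then [\<rho> (a s)] else [b s, b s])" for s
 let ?D = "?D1 \<union> ?D2 \<union> {g0}"
 have "inj_on \<kappa> ?D"
 proof (rule inj_onI)
  fix s t assume st: "s \<in> ?D" "t \<in> ?D" "\<kappa> s = \<kappa> t"
  from st(3) injD[OF le] have eq: "(if s = g0 then [] else if s \<in> ?D1 then [\<rho> (a s)] else [b s, b s])
   = (if t = g0 then [] else if t \<in> ?D1 then [\<rho> (a t)] else [b t, b t])" unfolding \<kappa>_def by blast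
  consider "s = g0" | "s \<noteq> g0" "s \<in> ?D1" | "s \<noteq> g0" "s \<notin> ?D1" "s \<in> ?D2" using st(1) by blast
  thus "s = t"
  proof cases
   case 1
   thus ?thesis using eq by (metis list.discI)
  next
   case 2
   hence "t \<in> ?D1 \<and> \<rho> (a s) = \<rho> (a t)" using eq by (simp split: if_splits)
   thus ?thesis using ai[OF 2(2)] injD[OF \<rho>] by blast
  next
   case 3
   hence t: "t \<noteq> g0" "t \<notin> ?D1" "b s = b t" using eq by (simp_all split: if_splits)
   hence "t \<in> ?D2" using st(2) by blast
   thus ?thesis using bi[OF 3(3)] t(3) by simp
  qed
 qed
 moreover have D: "?D \<subseteq> carrier G" using g0 by blast
 ultimately obtain \<kappa>' :: "'g => 'u" where \<kappa>': "inj_on \<kappa>' (generate G ?D)"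
  using G.generate_small[OF le] by blast
 have sub: "subgroup (generate G ?D) G" by (rule G.generate_is_subgroup[OF D])
 show ?thesis
 proof (rule that[of "generate G ?D" \<kappa>'])
  show "stable (generate G ?D)"
   unfolding stable_def
  proof (intro conjI ballI impI)
   show "generate G ?D \<subseteq> carrier G" by (rule subgroup.subset[OF sub])
   fix s g assume *: "s \<in> carrier G" "g \<in> generate G ?D" "rcomp R s \<noteq> {\<zero>\<^sub>R}"
   hence "s \<in> ?D" by blast
   thus "s \<otimes>\<^sub>G g \<in> generate G ?D" by (rule generate.eng[OF generate.incl *(2)])
  qed
  show "g0 \<in> generate G ?D" by (rule generate.incl) simp
  show "mcomp M g = {\<zero>\<^sub>M}" if "g \<in> carrier G" "g \<notin> generate G ?D" for g
   using that generate.incl[of g ?D G] by blast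
 qed (use sub \<kappa>' in auto)
qed

text \<open>Here no degrees are discarded. A degree that matters is determined by a nonzero element
  of the component of \<open>A\<close> at its image and by its position in its finite fibre.\<close>

lemma cind_small_finite:
 fixes A :: "('h,'r,'u) gmodule" and le :: "'u list => 'u"
 assumes le: "inj le" and fib: "\<And>h. finite {g \<in> carrier G. \<psi> g = h}" and A: "gmod H cR A"
 shows "\<exists>\<phi> :: ('g => 'u) => 'u. inj_on \<phi> (carrier (cind (carrier G) A))"
proof -
 interpret A: graded_module H cR A by fact
 have "\<exists>n :: 'g => nat. inj_on n {g \<in> carrier G. \<psi> g = h}" for h
  using finite_imp_inj_to_nat_seg[OF fib[of h]] by blast
 then obtain n where n: "\<And>h. inj_on (n h :: 'g => nat) {g \<in> carrier G. \<psi> g = h}" by metis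
 define b where "b h = (SOME x. x \<in> mcomp A h \<and> x \<noteq> \<zero>\<^sub>A)" for h
 let ?T = "{g \<in> carrier G. mcomp A (\<psi> g) \<noteq> {\<zero>\<^sub>A}}"
 have b: "b (\<psi> g) \<in> mcomp A (\<psi> g) \<and> b (\<psi> g) \<noteq> \<zero>\<^sub>A" if "g \<in> ?T" for g
  unfolding b_def by (rule someI_ex) (use that A.MD.B_zero in auto)
 \<comment> \<open>The repeated entry names the image of \<open>g\<close> and the length gives the
   position of \<open>g\<close> in the fibre; \<open>Suc\<close> ensures that the entry occurs at
   least once.\<close>
 define \<kappa> where "\<kappa> g = le (replicate (Suc (n (\<psi> g) g)) (b (\<psi> g)))" for g
 have "inj_on \<kappa> ?T"
 proof (rule inj_onI)
  fix s t assume st: "s \<in> ?T" "t \<in> ?T" "\<kappa> s = \<kappa> t"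
  have eq: "replicate (Suc (n (\<psi> s) s)) (b (\<psi> s)) = replicate (Suc (n (\<psi> t) t)) (b (\<psi> t))"
   by (rule injD[OF le]) (use st(3) in \<open>simp add: \<kappa>_def\<close>)
  hence n_eq: "n (\<psi> s) s = n (\<psi> t) t" by (metis length_replicate nat.inject)
  have "b (\<psi> s) = b (\<psi> t)" using eq by simp
  hence "\<psi> s = \<psi> t"
   using b[OF st(1)] b[OF st(2)] st(1,2) A.MD.dcomp_hom'[of "b (\<psi> s)" "\<psi> s" "\<psi> t"]
    A.MD.dcomp_hom'[of "b (\<psi> t)" "\<psi> t" "\<psi> t"] by auto
  thus "s = t" using n_eq st inj_onD[OF n[of "\<psi> s"], of s t] by auto
 qed
 from cind_small[OF le stable_UNIV A this] show ?thesis .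
qed

end

section \<open>Tensor products\<close>

lemma (in comm_group) generated_coset_eq_iff:
 assumes "subgroup N G" "x \<in> carrier G" "y \<in> carrier G"
 shows "N #> x = N #> y \<longleftrightarrow> x \<otimes> inv y \<in> N"
proof
 assume "N #> x = N #> y"
 hence "x \<in> N #> y" using rcos_self[OF assms(2,1)] by simp
 then obtain n where n: "n \<in> N" "x = n \<otimes> y" by (auto simp: r_coset_def)
 hence "n \<in> carrier G" using subgroup.mem_carrier[OF assms(1)] by blast
 thus "x \<otimes> inv y \<in> N" using n assms(3) by (simp add: m_assoc)
next
 assume n: "x \<otimes> inv y \<in> N"
 have "x = (x \<otimes> inv y) \<otimes> y" using assms by (simp add: m_assoc)
 hence "x \<in> N #> y" using n by (auto simp: r_coset_def)
 thus "N #> x = N #> y" using repr_independence[OF _ assms(3,1)] by simp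
qed

locale tensor_modules = A: module R A + M: module R M
 for R :: "('g,'r) gring" and A :: "('g,'r,'a) gmodule" and M :: "('g,'r,'m) gmodule"
begin

abbreviation "F \<equiv> tensor_free A M"
abbreviation "N \<equiv> tensor_rel R A M"
abbreviation "pt \<equiv> pure_tensor R A M"
abbreviation coset :: "('a \<times> 'm \<Rightarrow>\<^sub>0 int) => ('a \<times> 'm \<Rightarrow>\<^sub>0 int) set" where "coset z \<equiv> N #>\<^bsub>F\<^esub> z"

lemma F_comm: "comm_group F"
 by (simp add: tensor_free_def abelian_free_Abelian_group)

sublocale F: comm_group F by (rule F_comm)

lemma F_simps: "z \<in> carrier F \<longleftrightarrow> Poly_Mapping.keys z \<subseteq> carrier A \<times> carrier M" "x \<otimes>\<^sub>F y = x + y" "\<one>\<^sub>F = 0"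
 by (simp_all add: tensor_free_def)

lemma F_inv: "z \<in> carrier F ==> inv\<^bsub>F\<^esub> z = - z"
 by (simp add: tensor_free_def)

abbreviation "rels \<equiv>
   ({frag_of (x \<oplus>\<^sub>A x', y) - frag_of (x, y) - frag_of (x', y) | x x' y.
     x \<in> carrier A \<and> x' \<in> carrier A \<and> y \<in> carrier M} \<union>
   {frag_of (x, y \<oplus>\<^sub>M y') - frag_of (x, y) - frag_of (x, y') | x y y'.
     x \<in> carrier A \<and> y \<in> carrier M \<and> y' \<in> carrier M} \<union>
   {frag_of (r \<odot>\<^sub>A x, y) - frag_of (x, r \<odot>\<^sub>M y) | r x y.
     r \<in> carrier R \<and> x \<in> carrier A \<and> y \<in> carrier M})"

lemma frag_F: "[|x \<in> carrier A; y \<in> carrier M|] ==> frag_of (x, y) \<in> carrier F"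
 by (simp add: F_simps)

lemma F_diff: "[|u \<in> carrier F; v \<in> carrier F|] ==> u - v \<in> carrier F"
 using F.m_closed[OF _ F.inv_closed[of v], of u] F_inv[of v] by (simp add: F_simps(2))

lemma rels_F: "rels \<subseteq> carrier F"
 by (auto intro!: F_diff frag_F)

lemma N_subgroup: "subgroup N F"
 unfolding tensor_rel_def by (rule F.generate_is_subgroup[OF rels_F])

lemma N_normal: "N \<lhd> F"
 by (rule F.subgroup_imp_normal[OF N_subgroup])

lemma coset_eq: "[|u \<in> carrier F; v \<in> carrier F|] ==> coset u = coset v \<longleftrightarrow> u - v \<in> N"
 using F.generated_coset_eq_iff[OF N_subgroup] by (simp add: F_simps(2) F_inv)

lemma T_comm: "comm_group (F Mod N)"
 by (rule F.abelian_FactGroup[OF N_subgroup])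

lemma tensor_simps:
 "carrier (tensor G R A M) = coset ` carrier F" "add (tensor G R A M) = (<#>\<^bsub>F\<^esub>)"
 "zero (tensor G R A M) = N" "r \<odot>\<^bsub>tensor G R A M\<^esub> z = tensor_map R A M (\<lambda>x. r \<odot>\<^sub>A x) z"
 "mcomp (tensor G R A M) g = generate (F Mod N) {pt x y | x y h k.
   h \<in> carrier G \<and> k \<in> carrier G \<and> h \<otimes>\<^sub>G k = g \<and> x \<in> mcomp A h \<and> y \<in> mcomp M k}"
 by (simp_all add: tensor_def Let_def carrier_FactGroup)

lemma coset_add: "[|u \<in> carrier F; v \<in> carrier F|] ==> coset u \<oplus>\<^bsub>tensor G R A M\<^esub> coset v = coset (u + v)"
 using normal.rcos_sum[OF N_normal, of u v] by (simp add: tensor_simps F_simps(2))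

lemma tensor_abelian: "abelian_group (tensor G R A M)"
proof -
 interpret T: comm_group "F Mod N" by (rule T_comm)
 have e: "carrier (tensor G R A M) = carrier (F Mod N)" by (simp add: tensor_simps carrier_FactGroup)
 show ?thesis
 proof (rule abelian_groupI)
  fix x assume "x \<in> carrier (tensor G R A M)"
  hence "x \<in> carrier (F Mod N)" by (simp add: e)
  hence "inv\<^bsub>F Mod N\<^esub> x \<in> carrier (F Mod N)" "inv\<^bsub>F Mod N\<^esub> x <#>\<^bsub>F\<^esub> x = N"
   using T.inv_closed T.l_inv[of x] by simp_all
  thus "\<exists>y\<in>carrier (tensor G R A M). y \<oplus>\<^bsub>tensor G R A M\<^esub> x = \<zero>\<^bsub>tensor G R A M\<^esub>"
   unfolding e tensor_simps(2,3) by (rule bexI[rotated])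
 qed (use T.m_closed T.one_closed T.m_assoc T.m_comm T.l_one in \<open>simp_all add: e tensor_simps(2,3)\<close>)
qed

lemma pt_eq: "pt x y = coset (frag_of (x, y))"
 by (simp add: pure_tensor_def)

lemma pt_closed: "[|x \<in> carrier A; y \<in> carrier M|] ==> pt x y \<in> carrier (tensor G R A M)"
 by (simp add: tensor_simps pt_eq frag_F)

lemma coset_F: "[|u \<in> carrier F; v \<in> carrier F; u - v \<in> rels|] ==> coset u = coset v"
proof -
 assume *: "u \<in> carrier F" "v \<in> carrier F" "u - v \<in> rels"
 have "u - v \<in> N" unfolding tensor_rel_def by (rule generate.incl[OF *(3)])
 thus "coset u = coset v" using coset_eq[OF *(1,2)] by simp
qed

lemma F_add: "[|u \<in> carrier F; v \<in> carrier F|] ==> u + v \<in> carrier F"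
 using F.m_closed[of u v] by (simp add: F_simps(2))

lemma pt_add_left:
 assumes "x \<in> carrier A" "x' \<in> carrier A" "y \<in> carrier M"
 shows "pt (x \<oplus>\<^sub>A x') y = pt x y \<oplus>\<^bsub>tensor G R A M\<^esub> pt x' y"
 unfolding pt_eq coset_add[OF frag_F frag_F, OF assms(1,3,2,3)]
proof (rule coset_F)
 show "frag_of (x \<oplus>\<^sub>A x', y) - (frag_of (x, y) + frag_of (x', y)) \<in> rels"
  using assms unfolding diff_diff_eq[symmetric] by blast
qed (use assms in \<open>auto intro!: F_add frag_F\<close>)

lemma pt_add_right:
 assumes "x \<in> carrier A" "y \<in> carrier M" "y' \<in> carrier M"
 shows "pt x (y \<oplus>\<^sub>M y') = pt x y \<oplus>\<^bsub>tensor G R A M\<^esub> pt x y'"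
 unfolding pt_eq coset_add[OF frag_F frag_F, OF assms(1,2,1,3)]
proof (rule coset_F)
 show "frag_of (x, y \<oplus>\<^sub>M y') - (frag_of (x, y) + frag_of (x, y')) \<in> rels"
  using assms unfolding diff_diff_eq[symmetric] by blast
qed (use assms in \<open>auto intro!: F_add frag_F\<close>)

lemma pt_smult:
 assumes "r \<in> carrier R" "x \<in> carrier A" "y \<in> carrier M"
 shows "pt (r \<odot>\<^sub>A x) y = pt x (r \<odot>\<^sub>M y)"
 unfolding pt_eq
 by (rule coset_F) (use assms in \<open>auto intro!: frag_F\<close>)

lemma pt_addhom_left: "y \<in> carrier M ==> (\<lambda>x. pt x y) \<in> addhom A (tensor G R A M)"
 by (rule addhomI) (auto simp: pt_closed pt_add_left[where G = G])

lemma pt_addhom_right: "x \<in> carrier A ==> (\<lambda>y. pt x y) \<in> addhom M (tensor G R A M)"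
 by (rule addhomI) (auto simp: pt_closed pt_add_right[where G = G])

lemma coset_0: "coset 0 = \<zero>\<^bsub>tensor G R A M\<^esub>"
 using F.coset_mult_one[OF subgroup.subset[OF N_subgroup]] by (simp add: tensor_simps F_simps(3))

lemma pt_zero_left: "y \<in> carrier M ==> pt \<zero>\<^sub>A y = \<zero>\<^bsub>tensor G R A M\<^esub>"
 by (rule addhom_zero[OF A.M.abelian_group_axioms tensor_abelian pt_addhom_left])

lemma pt_zero_right: "x \<in> carrier A ==> pt x \<zero>\<^sub>M = \<zero>\<^bsub>tensor G R A M\<^esub>"
 by (rule addhom_zero[OF M.M.abelian_group_axioms tensor_abelian pt_addhom_right])

lemma pt_minus_left: "[|x \<in> carrier A; y \<in> carrier M|] ==> pt (\<ominus>\<^bsub>A\<^esub> x) y = \<ominus>\<^bsub>tensor G R A M\<^esub> pt x y"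
 by (rule addhom_minus[OF A.M.abelian_group_axioms tensor_abelian pt_addhom_left])

lemma tensor_induct [consumes 1, case_names zero pure add]:
 assumes "z \<in> carrier (tensor G R A M)" "P \<zero>\<^bsub>tensor G R A M\<^esub>"
  and pure: "\<And>x y. [|x \<in> carrier A; y \<in> carrier M|] ==> P (pt x y)"
  and add: "\<And>u v. [|u \<in> carrier (tensor G R A M); v \<in> carrier (tensor G R A M); P u; P v|] ==> P (u \<oplus>\<^bsub>tensor G R A M\<^esub> v)"
 shows "P z"
proof -
 interpret T: abelian_group "tensor G R A M" by (rule tensor_abelian)
 obtain w where w: "Poly_Mapping.keys w \<subseteq> carrier A \<times> carrier M" "z = coset w"
  using assms(1) by (auto simp: tensor_simps F_simps(1))
 have c: "coset u \<in> carrier (tensor G R A M)" if "Poly_Mapping.keys u \<subseteq> carrier A \<times> carrier M" for u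
  using that by (simp add: tensor_simps F_simps(1))
 have cm: "coset (- u) = \<ominus>\<^bsub>tensor G R A M\<^esub> coset u" if "Poly_Mapping.keys u \<subseteq> carrier A \<times> carrier M" for u
 proof -
  have u: "u \<in> carrier F" "- u \<in> carrier F" using that by (auto simp: F_simps(1))
  hence "coset (- u) \<oplus>\<^bsub>tensor G R A M\<^esub> coset u = \<zero>\<^bsub>tensor G R A M\<^esub>"
   by (simp add: coset_add coset_0)
  thus ?thesis using T.minus_equality c u by (metis F_simps(1))
 qed
 \<comment> \<open>Induction on the free abelian group goes through differences, whereas
   \<open>P\<close> is closed under sums; so an element and its negative are treated
   together.\<close>
 have "P (coset w) \<and> P (coset (- w))"
  using w(1)
 proof (induction rule: free_Abelian_group_induct[consumes 1, case_names zero diff single])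
  case zero
  thus ?case using assms(2) by (simp only: coset_0[where G = G] minus_zero simp_thms)
 next
  case (diff u v)
  have F: "u \<in> carrier F" "v \<in> carrier F" "- u \<in> carrier F" "- v \<in> carrier F"
   using diff by (simp_all add: F_simps(1))
  have "coset (u - v) = coset u \<oplus>\<^bsub>tensor G R A M\<^esub> coset (- v)" using coset_add[where G = G, OF F(1,4)] by simp
  moreover have "coset (- (u - v)) = coset (- u) \<oplus>\<^bsub>tensor G R A M\<^esub> coset v" using coset_add[where G = G, OF F(3,2)] by simp
  ultimately show ?case using add[OF c c] diff by (simp add: add c)
 next
  case (single p)
  obtain x y where p: "p = (x, y)" "x \<in> carrier A" "y \<in> carrier M" using single by auto
  hence "coset (- frag_of p) = pt (\<ominus>\<^bsub>A\<^esub> x) y"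
   using cm[of "frag_of p"] pt_minus_left[where G = G] by (simp add: pt_eq)
  thus ?case using pure p by (metis A.M.a_inv_closed pt_eq)
 qed
 thus ?thesis using w by simp
qed

lemma tensor_addhom_eqI:
 assumes X: "abelian_group X" and f: "f \<in> addhom (tensor G R A M) X" and g: "g \<in> addhom (tensor G R A M) X"
  and eq: "\<And>x y. [|x \<in> carrier A; y \<in> carrier M|] ==> f (pt x y) = g (pt x y)"
  and z: "z \<in> carrier (tensor G R A M)"
 shows "f z = g z"
 using z
proof (induction rule: tensor_induct)
 case zero
 thus ?case using addhom_zero[OF tensor_abelian X f] addhom_zero[OF tensor_abelian X g] by simp
next
 case (add u v)
 thus ?case using addhom_add[OF f add(1,2)] addhom_add[OF g add(1,2)] by simp
qed (rule eq)

text \<open>The target is any abelian group. This gives not just module maps but also the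
  projections to degrees, the exchange of the factors and the coordinates of a tensor with a free
  module.\<close>

lemma tensor_universal:
 fixes X :: "('c,'w) ring_scheme"
 assumes X: "abelian_group X"
  and \<beta>: "\<And>x y. [|x \<in> carrier A; y \<in> carrier M|] ==> \<beta> x y \<in> carrier X"
  and add_left: "\<And>x x' y. [|x \<in> carrier A; x' \<in> carrier A; y \<in> carrier M|] ==> \<beta> (x \<oplus>\<^sub>A x') y = \<beta> x y \<oplus>\<^sub>X \<beta> x' y"
  and add_right: "\<And>x y y'. [|x \<in> carrier A; y \<in> carrier M; y' \<in> carrier M|] ==> \<beta> x (y \<oplus>\<^sub>M y') = \<beta> x y \<oplus>\<^sub>X \<beta> x y'"
  and bal: "\<And>r x y. [|r \<in> carrier R; x \<in> carrier A; y \<in> carrier M|] ==> \<beta> (r \<odot>\<^sub>A x) y = \<beta> x (r \<odot>\<^sub>M y)"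
 obtains h where "h \<in> addhom (tensor G R A M) X" "\<And>x y. [|x \<in> carrier A; y \<in> carrier M|] ==> h (pt x y) = \<beta> x y"
proof -
 interpret X: abelian_group X by fact
 let ?X = "add_monoid X"
 have cX: "comm_group ?X" by (rule X.a_comm_group)
 obtain h0 where h0: "h0 \<in> hom F ?X" "\<And>p. p \<in> carrier A \<times> carrier M ==> h0 (frag_of p) = (case p of (x, y) => \<beta> x y)"
  using comm_group.free_Abelian_group_universal[OF cX, of "\<lambda>(x, y). \<beta> x y" "carrier A \<times> carrier M"] \<beta>
  unfolding tensor_free_def by (auto simp: image_subset_iff)
 have gh: "group_hom F ?X h0"
  using h0(1) by (intro group_hom.intro group_hom_axioms.intro F.group_axioms comm_group.axioms(2)[OF cX])
 have h0c: "h0 u \<in> carrier X" if "u \<in> carrier F" for u using group_hom.hom_closed[OF gh that] by simp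
 have h0p: "h0 (frag_of (x, y)) = \<beta> x y" if "x \<in> carrier A" "y \<in> carrier M" for x y using h0(2)[of "(x, y)"] that by simp
 have h0d: "h0 (u - v) = h0 u \<ominus>\<^sub>X h0 v" if "u \<in> carrier F" "v \<in> carrier F" for u v
 proof -
  have "h0 (u \<otimes>\<^sub>F inv\<^bsub>F\<^esub> v) = h0 u \<otimes>\<^bsub>?X\<^esub> inv\<^bsub>?X\<^esub> h0 v"
   using group_hom.hom_mult[OF gh that(1) F.inv_closed[OF that(2)]] group_hom.hom_inv[OF gh that(2)] by simp
  thus ?thesis using that by (simp add: F_simps(2) F_inv a_minus_def a_inv_def)
 qed
 have "rels \<subseteq> kernel F ?X h0"
 proof
  fix z assume z: "z \<in> rels"
  hence "h0 z = \<zero>\<^sub>X"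
  proof (elim UnE CollectE exE conjE)
   fix x x' y assume 1: "x \<in> carrier A" "x' \<in> carrier A" "y \<in> carrier M"
    "z = frag_of (x \<oplus>\<^sub>A x', y) - frag_of (x, y) - frag_of (x', y)"
   hence "h0 z = (\<beta> x y \<oplus>\<^sub>X \<beta> x' y) \<ominus>\<^sub>X \<beta> x y \<ominus>\<^sub>X \<beta> x' y"
    by (simp add: h0d h0p F_diff frag_F add_left)
   thus ?thesis using 1 \<beta> X.a_comm[of "\<beta> x y" "\<beta> x' y"] by (simp add: a_minus_def X.a_assoc X.r_neg)
  next
   fix x y y' assume 2: "x \<in> carrier A" "y \<in> carrier M" "y' \<in> carrier M"
    "z = frag_of (x, y \<oplus>\<^sub>M y') - frag_of (x, y) - frag_of (x, y')"
   hence "h0 z = (\<beta> x y \<oplus>\<^sub>X \<beta> x y') \<ominus>\<^sub>X \<beta> x y \<ominus>\<^sub>X \<beta> x y'"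
    by (simp add: h0d h0p F_diff frag_F add_right)
   thus ?thesis using 2 \<beta> X.a_comm[of "\<beta> x y" "\<beta> x y'"] by (simp add: a_minus_def X.a_assoc X.r_neg)
  next
   fix r x y assume "r \<in> carrier R" "x \<in> carrier A" "y \<in> carrier M"
    "z = frag_of (r \<odot>\<^sub>A x, y) - frag_of (x, r \<odot>\<^sub>M y)"
   thus ?thesis using \<beta> bal by (simp add: h0d h0p frag_F X.diff_zero_iff)
  qed
  thus "z \<in> kernel F ?X h0" using subsetD[OF rels_F z] by (simp add: kernel_def)
 qed
 hence N: "N \<subseteq> kernel F ?X h0"
  unfolding tensor_rel_def by (rule F.generate_subgroup_incl[OF _ group_hom.subgroup_kernel[OF gh]])
 obtain h where h: "h \<in> hom (F Mod N) ?X" "\<And>u. u \<in> carrier F ==> h (coset u) = h0 u"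
 proof (rule FactGroup_universal[OF h0(1) N_normal])
  fix u v assume uv: "u \<in> carrier F" "v \<in> carrier F" "coset u = coset v"
  hence "h0 (u - v) = \<zero>\<^sub>X" using N coset_eq by (auto simp: kernel_def)
  thus "h0 u = h0 v" using uv h0d h0c X.diff_zero_iff by metis
 qed (use that in auto)
 show ?thesis
 proof
  show "h \<in> addhom (tensor G R A M) X"
  proof (rule addhomI)
   fix u v assume "u \<in> carrier (tensor G R A M)" "v \<in> carrier (tensor G R A M)"
   thus "h (u \<oplus>\<^bsub>tensor G R A M\<^esub> v) = h u \<oplus>\<^sub>X h v"
    using hom_mult[OF h(1), of u v] by (simp add: tensor_simps carrier_FactGroup)
  next
   fix u assume "u \<in> carrier (tensor G R A M)"
   thus "h u \<in> carrier X" using h h0c by (auto simp: tensor_simps)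
  qed
  show "h (pt x y) = \<beta> x y" if "x \<in> carrier A" "y \<in> carrier M" for x y
   using h(2)[OF frag_F[OF that]] h0p[OF that] by (simp add: pt_eq)
 qed
qed

end

section \<open>Functoriality in the left factor\<close>

locale tensor_hom = A: tensor_modules R A M + B: tensor_modules R B M
 for R :: "('g,'r) gring" and A :: "('g,'r,'a) gmodule" and B :: "('g,'r,'b) gmodule"
  and M :: "('g,'r,'m) gmodule" +
 fixes f :: "'a => 'b"
 assumes f_add: "f \<in> addhom A B"
  and f_smult: "[|r \<in> carrier R; x \<in> carrier A|] ==> f (r \<odot>\<^sub>A x) = r \<odot>\<^sub>B f x"
begin

abbreviation "ext \<equiv> frag_extend (\<lambda>(x, y). frag_of (f x, y))"

lemma ext_F: "u \<in> carrier A.F ==> ext u \<in> carrier B.F"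
 unfolding A.F_simps(1)
proof (induction rule: free_Abelian_group_induct[consumes 1, case_names zero diff single])
 case (diff x y)
 thus ?case using B.F_diff by (simp add: frag_extend_diff)
next
 case (single p)
 thus ?case using addhom_closed[OF f_add] by (auto simp: B.F_simps(1))
qed (simp add: B.F_simps(1))

lemma ext_rels: "u \<in> A.rels ==> ext u \<in> B.rels"
proof (elim UnE CollectE exE conjE)
 note fc = addhom_closed[OF f_add]
 fix x x' y assume 1: "x \<in> carrier A" "x' \<in> carrier A" "y \<in> carrier M"
  "u = frag_of (x \<oplus>\<^sub>A x', y) - frag_of (x, y) - frag_of (x', y)"
 hence "ext u = frag_of (f x \<oplus>\<^sub>B f x', y) - frag_of (f x, y) - frag_of (f x', y)"
  by (simp add: frag_extend_diff addhom_add[OF f_add])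
 thus ?thesis using fc 1(1-3) by blast
next
 note fc = addhom_closed[OF f_add]
 fix x y y' assume 2: "x \<in> carrier A" "y \<in> carrier M" "y' \<in> carrier M"
  "u = frag_of (x, y \<oplus>\<^sub>M y') - frag_of (x, y) - frag_of (x, y')"
 hence "ext u = frag_of (f x, y \<oplus>\<^sub>M y') - frag_of (f x, y) - frag_of (f x, y')"
  by (simp add: frag_extend_diff)
 thus ?thesis using fc 2(1-3) by blast
next
 note fc = addhom_closed[OF f_add]
 fix r x y assume 3: "r \<in> carrier R" "x \<in> carrier A" "y \<in> carrier M"
  "u = frag_of (r \<odot>\<^sub>A x, y) - frag_of (x, r \<odot>\<^sub>M y)"
 hence "ext u = frag_of (r \<odot>\<^sub>B f x, y) - frag_of (f x, r \<odot>\<^sub>M y)"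
  by (simp add: frag_extend_diff f_smult)
 thus ?thesis using fc 3(1-3) by blast
qed

lemma ext_N: "u \<in> A.N ==> ext u \<in> B.N"
proof -
 interpret N: subgroup B.N B.F by (rule B.N_subgroup)
 assume "u \<in> A.N"
 hence "u \<in> generate A.F A.rels" by (simp add: tensor_rel_def)
 thus ?thesis
 proof (induction rule: generate.induct)
  case one
  thus ?case using N.one_closed by (simp add: A.F_simps(3) B.F_simps(3))
 next
  case (incl u)
  hence "ext u \<in> B.rels" by (rule ext_rels)
  thus ?case unfolding tensor_rel_def by (rule generate.incl)
 next
  case (inv u)
  from inv have "ext u \<in> B.rels" by (rule ext_rels)
  hence *: "ext u \<in> B.N" unfolding tensor_rel_def by (rule generate.incl)
  have u: "u \<in> carrier A.F" by (rule subsetD[OF A.rels_F inv])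
  show ?case using N.m_inv_closed[OF *] A.F_inv[OF u] B.F_inv[OF ext_F[OF u]] by (simp add: frag_extend_minus)
 next
  case (eng u v)
  thus ?case using N.m_closed[of "ext u" "ext v"] by (simp add: A.F_simps(2) B.F_simps(2) frag_extend_add)
 qed
qed

text \<open>The extension of \<open>f\<close> to the free groups maps relations into relations, so
  the image of a coset, enlarged by the relations of the target, is exactly one coset.\<close>

lemma tensor_map_coset:
 assumes u: "u \<in> carrier A.F"
 shows "tensor_map R B M f (A.coset u) = B.coset (ext u)"
proof -
 interpret NA: subgroup A.N A.F by (rule A.N_subgroup)
 interpret N: subgroup B.N B.F by (rule B.N_subgroup)
 have "B.N <#>\<^bsub>B.F\<^esub> (ext ` A.coset u) = B.coset (ext u)"
 proof (intro equalityI subsetI)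
  fix z assume "z \<in> B.N <#>\<^bsub>B.F\<^esub> (ext ` A.coset u)"
  then obtain n m where nm: "n \<in> B.N" "m \<in> A.N" "z = n + ext (m + u)"
   by (auto simp: set_mult_def r_coset_def A.F_simps(2) B.F_simps(2))
  hence "z = (n + ext m) + ext u" by (simp add: frag_extend_add)
  moreover have "n + ext m \<in> B.N" using N.m_closed[OF nm(1) ext_N[OF nm(2)]] by (simp add: B.F_simps(2))
  ultimately show "z \<in> B.coset (ext u)" by (auto simp: r_coset_def B.F_simps(2))
 next
  fix z assume "z \<in> B.coset (ext u)"
  then obtain n where n: "n \<in> B.N" "z = n + ext u" by (auto simp: r_coset_def B.F_simps(2))
  moreover have "u \<in> A.coset u" using NA.one_closed by (auto simp: r_coset_def A.F_simps(2,3))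
  ultimately show "z \<in> B.N <#>\<^bsub>B.F\<^esub> (ext ` A.coset u)" by (auto simp: set_mult_def B.F_simps(2))
 qed
 thus ?thesis by (simp add: tensor_map_def)
qed

lemma tensor_map_addhom: "tensor_map R B M f \<in> addhom (tensor G R A M) (tensor G' R B M)"
proof (rule addhomI)
 fix u v assume "u \<in> carrier (tensor G R A M)" "v \<in> carrier (tensor G R A M)"
 then obtain a b where ab: "a \<in> carrier A.F" "b \<in> carrier A.F" "u = A.coset a" "v = A.coset b"
  by (auto simp: A.tensor_simps)
 thus "tensor_map R B M f (u \<oplus>\<^bsub>tensor G R A M\<^esub> v)
   = tensor_map R B M f u \<oplus>\<^bsub>tensor G' R B M\<^esub> tensor_map R B M f v"
  using tensor_map_coset A.coset_add[OF ab(1,2), of G] B.coset_add[OF ext_F[OF ab(1)] ext_F[OF ab(2)], of G']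
   A.F_add[OF ab(1,2)] by (simp add: frag_extend_add)
qed (auto simp: A.tensor_simps B.tensor_simps tensor_map_coset ext_F)

lemma tensor_map_pt: "[|x \<in> carrier A; y \<in> carrier M|] ==> tensor_map R B M f (A.pt x y) = B.pt (f x) y"
 using tensor_map_coset[OF A.frag_F] by (simp add: A.pt_eq B.pt_eq)

end

lemma (in abelian_group) sum_of_family_single:
 assumes "i \<in> I" "x \<in> B i" "B i \<subseteq> carrier G"
 shows "x \<in> sum_of_family G I B"
 by (rule sum_of_familyI[where F = "{i}" and c = "\<lambda>_. x"]) (use assms in auto)

lemma (in abelian_group) sum_of_family_add:
 assumes B: "\<And>i. i \<in> I ==> additive_subgroup (B i) G"
  and "x \<in> sum_of_family G I B" "y \<in> sum_of_family G I B"
 shows "x \<oplus> y \<in> sum_of_family G I B"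
proof -
 obtain F c where F: "finite F" "F \<subseteq> I" "\<And>i. i \<in> F ==> c i \<in> B i" "x = finsum G c F"
  using assms(2) by (auto simp: sum_of_family_def)
 obtain E d where E: "finite E" "E \<subseteq> I" "\<And>i. i \<in> E ==> d i \<in> B i" "y = finsum G d E"
  using assms(3) by (auto simp: sum_of_family_def)
 let ?c = "\<lambda>i. if i \<in> F then c i else \<zero>" and ?d = "\<lambda>i. if i \<in> E then d i else \<zero>"
 have B0: "\<zero> \<in> B i" if "i \<in> I" for i using additive_subgroup.zero_closed[OF B[OF that]] .
 have cd: "?c i \<in> B i" "?d i \<in> B i" if "i \<in> F \<union> E" for i using that F E B0 by auto
 have carr: "?c i \<in> carrier G" "?d i \<in> carrier G" if "i \<in> F \<union> E" for i
  using cd[OF that] additive_subgroup.a_Hcarr[OF B] that F(2) E(2) by blast+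
 have carr': "c i \<in> carrier G" if "i \<in> F" for i using carr(1)[of i] that by simp
 have carr'': "d i \<in> carrier G" if "i \<in> E" for i using carr(2)[of i] that by simp
 have "finsum G c F = finsum G ?c (F \<union> E)"
  by (rule add.finprod_mono_neutral_cong_left) (use F(1) E(1) carr' carr'' in auto)
 moreover have "finsum G d E = finsum G ?d (F \<union> E)"
  by (rule add.finprod_mono_neutral_cong_left) (use F(1) E(1) carr' carr'' in auto)
 moreover have "finsum G (\<lambda>i. ?c i \<oplus> ?d i) (F \<union> E) = finsum G ?c (F \<union> E) \<oplus> finsum G ?d (F \<union> E)"
  by (rule finsum_addf) (use carr in blast)+
 ultimately have xy: "x \<oplus> y = finsum G (\<lambda>i. ?c i \<oplus> ?d i) (F \<union> E)" using F(4) E(4) by simp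
 show ?thesis
 proof (rule sum_of_familyI[OF _ _ _ xy])
  show "?c i \<oplus> ?d i \<in> B i" if "i \<in> F \<union> E" for i
   using additive_subgroup.a_closed[OF B cd[OF that]] that F(2) E(2) by blast
 qed (use F E in auto)
qed

section \<open>Module structure and exchange of the factors\<close>

context tensor_modules
begin

lemma smult_hom: "r \<in> carrier R ==> tensor_hom R A A M (\<lambda>x. r \<odot>\<^sub>A x)"
 by (intro tensor_hom.intro tensor_hom_axioms.intro tensor_modules_axioms addhomI)
  (auto simp: A.smult_r_distr A.smult_assoc1[symmetric] A.R.m_comm)

lemma tensor_smult_addhom: "r \<in> carrier R ==> (\<lambda>z. r \<odot>\<^bsub>tensor G R A M\<^esub> z) \<in> addhom (tensor G R A M) (tensor G R A M)"
 unfolding tensor_simps(4) using tensor_hom.tensor_map_addhom[OF smult_hom] .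

lemma tensor_smult_pt:
 "[|r \<in> carrier R; x \<in> carrier A; y \<in> carrier M|] ==> r \<odot>\<^bsub>tensor G R A M\<^esub> pt x y = pt (r \<odot>\<^sub>A x) y"
 unfolding tensor_simps(4) using tensor_hom.tensor_map_pt[OF smult_hom] .

lemma tensor_module: "module R (tensor G R A M)"
proof -
 let ?T = "tensor G R A M"
 interpret T: abelian_group ?T by (rule tensor_abelian)
 note sa = tensor_smult_addhom[where G = G] and sp = tensor_smult_pt[where G = G]
 have sc: "r \<odot>\<^bsub>?T\<^esub> z \<in> carrier ?T" if "r \<in> carrier R" "z \<in> carrier ?T" for r z
  using addhom_closed[OF sa] that by blast
 show ?thesis
 proof (rule moduleI[OF A.R.is_cring T.abelian_group_axioms sc])
  fix a b z assume ab: "a \<in> carrier R" "b \<in> carrier R" and z: "z \<in> carrier ?T"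
  have ad: "(\<lambda>z. a \<odot>\<^bsub>?T\<^esub> z \<oplus>\<^bsub>?T\<^esub> b \<odot>\<^bsub>?T\<^esub> z) \<in> addhom ?T ?T"
   by (rule addhomI) (use ab sc addhom_add[OF sa] in \<open>simp_all add: T.a_ac\<close>)
  show "(a \<oplus>\<^sub>R b) \<odot>\<^bsub>?T\<^esub> z = a \<odot>\<^bsub>?T\<^esub> z \<oplus>\<^bsub>?T\<^esub> b \<odot>\<^bsub>?T\<^esub> z"
   by (rule tensor_addhom_eqI[OF T.abelian_group_axioms sa ad _ z])
    (use ab in \<open>simp_all add: sp A.smult_l_distr pt_add_left[where G = G]\<close>)
  show "(a \<otimes>\<^sub>R b) \<odot>\<^bsub>?T\<^esub> z = a \<odot>\<^bsub>?T\<^esub> (b \<odot>\<^bsub>?T\<^esub> z)"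
   by (rule tensor_addhom_eqI[OF T.abelian_group_axioms sa addhom_comp[OF sa sa] _ z])
    (use ab in \<open>simp_all add: sp A.smult_assoc1\<close>)
 next
  fix a y z assume "a \<in> carrier R" "y \<in> carrier ?T" "z \<in> carrier ?T"
  thus "a \<odot>\<^bsub>?T\<^esub> (y \<oplus>\<^bsub>?T\<^esub> z) = a \<odot>\<^bsub>?T\<^esub> y \<oplus>\<^bsub>?T\<^esub> a \<odot>\<^bsub>?T\<^esub> z" using addhom_add[OF sa] by blast
 next
  fix z assume z: "z \<in> carrier ?T"
  have id: "(\<lambda>z. z) \<in> addhom ?T ?T" by (rule addhomI; simp)
  show "\<one>\<^sub>R \<odot>\<^bsub>?T\<^esub> z = z"
   by (rule tensor_addhom_eqI[OF T.abelian_group_axioms sa id _ z]) (simp_all add: sp)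
 qed
qed

lemma T_inv: "inv\<^bsub>F Mod N\<^esub> z = \<ominus>\<^bsub>tensor G R A M\<^esub> z"
 by (simp add: a_inv_def m_inv_def tensor_simps carrier_FactGroup)

lemma tensor_swap_exists:
 obtains s where "s \<in> addhom (tensor G R A M) (tensor G' R M A)"
  "\<And>x y. [|x \<in> carrier A; y \<in> carrier M|] ==> s (pt x y) = pure_tensor R M A y x"
proof -
 interpret S: tensor_modules R M A ..
 show ?thesis
  by (rule tensor_universal[where G = G, OF S.tensor_abelian[where G = G'], of "\<lambda>x y. pure_tensor R M A y x"])
   (simp_all add: that S.pt_closed S.pt_add_left[where G = G'] S.pt_add_right[where G = G'] S.pt_smult)
qed

end

lemma tensor_right_exists:
 fixes M :: "('g,'r,'m) gmodule" and M' :: "('g,'r,'n) gmodule"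
 assumes AM: "tensor_modules R A M" and AM': "tensor_modules R A M'" and g: "g \<in> addhom M M'"
  and gs: "\<And>r x. [|r \<in> carrier R; x \<in> carrier M|] ==> g (r \<odot>\<^sub>M x) = r \<odot>\<^bsub>M'\<^esub> g x"
 obtains t where "t \<in> addhom (tensor G R A M) (tensor G' R A M')"
  "\<And>x y. [|x \<in> carrier A; y \<in> carrier M|] ==> t (pure_tensor R A M x y) = pure_tensor R A M' x (g y)"
proof -
 interpret X: tensor_modules R A M by fact
 interpret Y: tensor_modules R A M' by fact
 show ?thesis
  by (rule X.tensor_universal[where G = G, OF Y.tensor_abelian[where G = G'], of "\<lambda>x y. pure_tensor R A M' x (g y)"])
   (simp_all add: that addhom_closed[OF g] addhom_add[OF g] gs Y.pt_closed Y.pt_add_left[where G = G']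
    Y.pt_add_right[where G = G'] Y.pt_smult)
qed

lemma tensor_modulesI: "gmod G R A ==> gmod H R M ==> tensor_modules R A M"
 by (intro tensor_modules.intro graded_module.axioms(2))

section \<open>Graduation of the tensor product\<close>

context
 fixes G :: "('g,'x) monoid_scheme" and R :: "('g,'r) gring"
  and A :: "('g,'r,'a) gmodule" and M :: "('g,'r,'m) gmodule"
 assumes A: "gmod G R A" and M: "gmod G R M"
begin

interpretation A: graded_module G R A by fact
interpretation M: graded_module G R M by fact
interpretation X: tensor_modules R A M by (rule tensor_modulesI[OF A M])

lemma tensor_pt_mcomp:
 "[|h \<in> carrier G; k \<in> carrier G; x \<in> mcomp A h; y \<in> mcomp M k|] ==> X.pt x y \<in> mcomp (tensor G R A M) (h \<otimes>\<^sub>G k)"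
 unfolding X.tensor_simps by (rule generate.incl) blast

lemma tensor_mcomp_induct [consumes 1, case_names zero pure minus add]:
 assumes "z \<in> mcomp (tensor G R A M) g" "P \<zero>\<^bsub>tensor G R A M\<^esub>"
  and pure: "\<And>x y h k. [|h \<in> carrier G; k \<in> carrier G; h \<otimes>\<^sub>G k = g; x \<in> mcomp A h; y \<in> mcomp M k|] ==> P (X.pt x y)"
  and minus: "\<And>u. [|u \<in> carrier (tensor G R A M); P u|] ==> P (\<ominus>\<^bsub>tensor G R A M\<^esub> u)"
  and add: "\<And>u v. [|u \<in> carrier (tensor G R A M); v \<in> carrier (tensor G R A M); P u; P v|] ==> P (u \<oplus>\<^bsub>tensor G R A M\<^esub> v)"
 shows "z \<in> carrier (tensor G R A M) \<and> P z"
proof -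
 interpret T: abelian_group "tensor G R A M" by (rule X.tensor_abelian)
 have gen: "X.pt x y \<in> carrier (tensor G R A M) \<and> P (X.pt x y)"
  if "h \<in> carrier G" "k \<in> carrier G" "h \<otimes>\<^sub>G k = g" "x \<in> mcomp A h" "y \<in> mcomp M k" for x y h k
  using pure[OF that] X.pt_closed[OF A.MD.B_carr[OF that(4,1)] M.MD.B_carr[OF that(5,2)]] by simp
 from assms(1) show ?thesis
  unfolding X.tensor_simps(5)
 proof (induction rule: generate.induct)
  case one
  thus ?case using assms(2) T.zero_closed by (simp add: X.tensor_simps(3))
 next
  case (incl z)
  thus ?case using gen by blast
 next
  case (inv z)
  hence "z \<in> carrier (tensor G R A M) \<and> P z" using gen by blast
  thus ?case using minus T.a_inv_closed unfolding X.T_inv[where G = G] by blast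
 next
  case (eng u v)
  thus ?case using add[of u v] T.a_closed[of u v] by (simp add: X.tensor_simps(2))
 qed
qed

lemma tensor_graded: "gmod G R (tensor G R A M)"
proof -
 let ?T = "tensor G R A M"
 interpret T: module R ?T by (rule X.tensor_module)
 note abT = X.tensor_abelian[where G = G]
 \<comment> \<open>The projection to degree \<open>g\<close>: the component of \<open>x\<close> of
   degree \<open>h\<close> is paired with the component of \<open>y\<close> in the complementary
   degree. It is balanced because moving a scalar of degree \<open>s\<close> across shifts both
   degrees consistently.\<close>
 define \<beta> where "\<beta> g x y = A.MD.hsum ?T (\<lambda>h a. X.pt a (gc G M y (inv\<^bsub>G\<^esub> h \<otimes>\<^sub>G g))) x" for g x y
 have \<beta>: "(\<lambda>x. \<beta> g x y) \<in> addhom A ?T" "\<And>h x. [|h \<in> carrier G; x \<in> mcomp A h|] ==> \<beta> g x y = X.pt x (gc G M y (inv\<^bsub>G\<^esub> h \<otimes>\<^sub>G g))"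
  if "y \<in> carrier M" for y g
  unfolding \<beta>_def
  by (rule A.MD.hsum_props[OF abT];
    use that A.MD.B_carr X.pt_closed[where G = G] X.pt_add_left[where G = G] M.MD.dcomp_closed in auto)+
 have \<beta>c: "\<beta> g x y \<in> carrier ?T" if "x \<in> carrier A" "y \<in> carrier M" for g x y
  by (rule addhom_closed[OF \<beta>(1)[OF that(2)] that(1)])
 have \<beta>r: "\<beta> g x (y \<oplus>\<^sub>M y') = \<beta> g x y \<oplus>\<^bsub>?T\<^esub> \<beta> g x y'" if x: "x \<in> carrier A" and y: "y \<in> carrier M" "y' \<in> carrier M" for g x y y'
 proof (rule A.MD.addhom_eqI[OF abT \<beta>(1) _ _ x])
  show "(\<lambda>x. \<beta> g x y \<oplus>\<^bsub>?T\<^esub> \<beta> g x y') \<in> addhom A ?T"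
   by (rule addhomI) (use \<beta>c y addhom_add[OF \<beta>(1)] in \<open>simp_all add: T.M.a_ac\<close>)
  fix h x assume h: "h \<in> carrier G" "x \<in> mcomp A h"
  thus "\<beta> g x (y \<oplus>\<^sub>M y') = \<beta> g x y \<oplus>\<^bsub>?T\<^esub> \<beta> g x y'"
   using y A.MD.B_carr[OF h(2,1)] by (simp add: \<beta>(2) M.MD.dcomp_add X.pt_add_right[where G = G])
 qed (use y in simp)
 have \<beta>r': "(\<lambda>y. \<beta> g x y) \<in> addhom M ?T" if "x \<in> carrier A" for g x
  by (rule addhomI) (use that \<beta>c \<beta>r in auto)
 have bal: "\<beta> g (r \<odot>\<^sub>A x) y = \<beta> g x (r \<odot>\<^sub>M y)"
  if g: "g \<in> carrier G" and r: "r \<in> carrier R" and x: "x \<in> carrier A" and y: "y \<in> carrier M" for g r x y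
 proof (rule A.RD.addhom_eqI[OF abT addhom_comp[OF A.smult_addhom_left[OF x] \<beta>(1)[OF y]]
    addhom_comp[OF M.smult_addhom_left[OF y] \<beta>r'[OF x]] _ r])
  fix s r assume s: "s \<in> carrier G" and r: "r \<in> rcomp R s"
  have rR: "r \<in> carrier R" by (rule A.RD.B_carr[OF r s])
  show "\<beta> g (r \<odot>\<^sub>A x) y = \<beta> g x (r \<odot>\<^sub>M y)"
  proof (rule A.MD.addhom_eqI[OF abT addhom_comp[OF A.smult_addhom[OF rR] \<beta>(1)[OF y]] \<beta>(1) _ x])
   fix h x assume h: "h \<in> carrier G" and x: "x \<in> mcomp A h"
   have xA: "x \<in> carrier A" by (rule A.MD.B_carr[OF x h])
   have "inv\<^bsub>G\<^esub> (s \<otimes>\<^sub>G h) \<otimes>\<^sub>G g = inv\<^bsub>G\<^esub> s \<otimes>\<^sub>G (inv\<^bsub>G\<^esub> h \<otimes>\<^sub>G g)"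
    using s h g by (simp add: A.G.inv_mult A.G.m_assoc)
   hence "\<beta> g (r \<odot>\<^sub>A x) y = X.pt (r \<odot>\<^sub>A x) (gc G M y (inv\<^bsub>G\<^esub> s \<otimes>\<^sub>G (inv\<^bsub>G\<^esub> h \<otimes>\<^sub>G g)))"
    using \<beta>(2)[OF y _ A.mcomp_smult[OF s h r x]] s h by simp
   also have "\<dots> = X.pt x (gc G M (r \<odot>\<^sub>M y) (inv\<^bsub>G\<^esub> h \<otimes>\<^sub>G g))"
    using X.pt_smult[OF rR xA] M.gc_smult'[OF r s y] h g y by simp
   finally show "\<beta> g (r \<odot>\<^sub>A x) y = \<beta> g x (r \<odot>\<^sub>M y)" using \<beta>(2)[OF _ h x] y rR by simp
  qed (use y rR in simp)
 qed
 have "\<exists>p. p \<in> addhom ?T ?T \<and> (\<forall>x\<in>carrier A. \<forall>y\<in>carrier M. p (X.pt x y) = \<beta> g x y)" if g: "g \<in> carrier G" for g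
  by (rule X.tensor_universal[OF abT, of "\<beta> g"])
   (use \<beta>c \<beta>r bal[OF g] addhom_add[OF \<beta>(1)] in auto)
 then obtain p where p: "\<And>g. g \<in> carrier G ==> p g \<in> addhom ?T ?T"
  "\<And>g x y. [|g \<in> carrier G; x \<in> carrier A; y \<in> carrier M|] ==> p g (X.pt x y) = \<beta> g x y" by metis
 have pp: "p g (X.pt x y) = (if g = h \<otimes>\<^sub>G k then X.pt x y else \<zero>\<^bsub>?T\<^esub>)"
  if g: "g \<in> carrier G" and h: "h \<in> carrier G" "k \<in> carrier G" and x: "x \<in> mcomp A h" "y \<in> mcomp M k" for g h k x y
 proof -
  have c: "x \<in> carrier A" "y \<in> carrier M" using A.MD.B_carr M.MD.B_carr h x by auto
  have "inv\<^bsub>G\<^esub> h \<otimes>\<^sub>G g = k \<longleftrightarrow> g = h \<otimes>\<^sub>G k"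
   using g h by (auto simp: A.G.m_assoc[symmetric])
  thus ?thesis
   using p(2)[OF g c] \<beta>(2)[OF c(2) h(1) x(1), of g] M.MD.dcomp_hom'[OF x(2) h(2)] X.pt_zero_right[where G = G, OF c(1)] by simp
 qed
 have Bc: "mcomp ?T g \<subseteq> carrier ?T" for g
 proof
  fix z assume "z \<in> mcomp ?T g"
  thus "z \<in> carrier ?T" by (rule tensor_mcomp_induct[where P = "\<lambda>_. True", THEN conjunct1]) simp_all
 qed
 have rels: "{X.pt x y |x y h k. h \<in> carrier G \<and> k \<in> carrier G \<and> h \<otimes>\<^sub>G k = g \<and> x \<in> mcomp A h \<and> y \<in> mcomp M k}
   \<subseteq> carrier (X.F Mod X.N)" for g
  using X.pt_closed[where G = G] A.MD.B_carr M.MD.B_carr by (auto simp: X.tensor_simps carrier_FactGroup)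
 have subg: "subgroup (mcomp ?T g) (X.F Mod X.N)" for g
  unfolding X.tensor_simps(5)
  by (rule group.generate_is_subgroup[OF comm_group.axioms(2)[OF X.T_comm] rels])
 have B0: "\<zero>\<^bsub>?T\<^esub> \<in> mcomp ?T g" for g using subgroup.one_closed[OF subg] by (simp add: X.tensor_simps(3))
 have Badd: "u \<oplus>\<^bsub>?T\<^esub> v \<in> mcomp ?T g" if "u \<in> mcomp ?T g" "v \<in> mcomp ?T g" for u v g
  using subgroup.m_closed[OF subg that] by (simp add: X.tensor_simps(2))
 have Bminus: "\<ominus>\<^bsub>?T\<^esub> u \<in> mcomp ?T g" if "u \<in> mcomp ?T g" for u g
  using subgroup.m_inv_closed[OF subg that] by (simp add: X.T_inv[where G = G])
 have sub: "additive_subgroup (mcomp ?T g) ?T" for g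
  by (rule additive_subgroupI'[OF abT Bc B0 Badd Bminus])
 have sm: "r \<odot>\<^bsub>?T\<^esub> z \<in> mcomp ?T (s \<otimes>\<^sub>G g)"
  if s: "s \<in> carrier G" and g: "g \<in> carrier G" and r: "r \<in> rcomp R s" and z: "z \<in> mcomp ?T g" for s g r z
 proof -
  have rR: "r \<in> carrier R" by (rule A.RD.B_carr[OF r s])
  from z have "z \<in> carrier ?T \<and> r \<odot>\<^bsub>?T\<^esub> z \<in> mcomp ?T (s \<otimes>\<^sub>G g)"
  proof (rule tensor_mcomp_induct)
   show "r \<odot>\<^bsub>?T\<^esub> \<zero>\<^bsub>?T\<^esub> \<in> mcomp ?T (s \<otimes>\<^sub>G g)" using rR B0 by simp
   show "r \<odot>\<^bsub>?T\<^esub> X.pt x y \<in> mcomp ?T (s \<otimes>\<^sub>G g)"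
    if *: "h \<in> carrier G" "k \<in> carrier G" "h \<otimes>\<^sub>G k = g" "x \<in> mcomp A h" "y \<in> mcomp M k" for x y h k
   proof -
    have "X.pt (r \<odot>\<^sub>A x) y \<in> mcomp ?T ((s \<otimes>\<^sub>G h) \<otimes>\<^sub>G k)"
     using * s A.mcomp_smult[OF s *(1) r *(4)] by (intro tensor_pt_mcomp) auto
    thus ?thesis
     using * s X.tensor_smult_pt[where G = G, OF rR A.MD.B_carr M.MD.B_carr, OF *(4,1,5,2)] by (simp add: A.G.m_assoc)
   qed
   show "r \<odot>\<^bsub>?T\<^esub> (\<ominus>\<^bsub>?T\<^esub> u) \<in> mcomp ?T (s \<otimes>\<^sub>G g)" if "u \<in> carrier ?T" "r \<odot>\<^bsub>?T\<^esub> u \<in> mcomp ?T (s \<otimes>\<^sub>G g)" for u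
    using that rR T.smult_r_minus Bminus by simp
   show "r \<odot>\<^bsub>?T\<^esub> (u \<oplus>\<^bsub>?T\<^esub> v) \<in> mcomp ?T (s \<otimes>\<^sub>G g)"
    if "u \<in> carrier ?T" "v \<in> carrier ?T" "r \<odot>\<^bsub>?T\<^esub> u \<in> mcomp ?T (s \<otimes>\<^sub>G g)" "r \<odot>\<^bsub>?T\<^esub> v \<in> mcomp ?T (s \<otimes>\<^sub>G g)" for u v
    using that rR T.smult_r_distr Badd by simp
  qed
  thus ?thesis by simp
 qed
 have pid: "p k z = (if k = g then z else \<zero>\<^bsub>?T\<^esub>)" if k: "k \<in> carrier G" and z: "z \<in> mcomp ?T g" for k g z
 proof -
  note p0 = addhom_zero[OF abT abT p(1)[OF k]]
  from z have "z \<in> carrier ?T \<and> p k z = (if k = g then z else \<zero>\<^bsub>?T\<^esub>)"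
  proof (rule tensor_mcomp_induct)
   show "p k (X.pt x y) = (if k = g then X.pt x y else \<zero>\<^bsub>?T\<^esub>)"
    if "h \<in> carrier G" "k' \<in> carrier G" "h \<otimes>\<^sub>G k' = g" "x \<in> mcomp A h" "y \<in> mcomp M k'" for x y h k'
    using pp[OF k that(1,2,4,5)] that(3) by simp
   show "p k (\<ominus>\<^bsub>?T\<^esub> u) = (if k = g then \<ominus>\<^bsub>?T\<^esub> u else \<zero>\<^bsub>?T\<^esub>)"
    if "u \<in> carrier ?T" "p k u = (if k = g then u else \<zero>\<^bsub>?T\<^esub>)" for u
    using addhom_minus[OF abT abT p(1)[OF k] that(1)] that(2) by simp
   show "p k (u \<oplus>\<^bsub>?T\<^esub> v) = (if k = g then u \<oplus>\<^bsub>?T\<^esub> v else \<zero>\<^bsub>?T\<^esub>)"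
    if "u \<in> carrier ?T" "v \<in> carrier ?T" "p k u = (if k = g then u else \<zero>\<^bsub>?T\<^esub>)" "p k v = (if k = g then v else \<zero>\<^bsub>?T\<^esub>)" for u v
    using addhom_add[OF p(1)[OF k] that(1,2)] that(3,4) by simp
  qed (simp add: p0)
  thus ?thesis by simp
 qed
 let ?S = "sum_of_family ?T (carrier G) (mcomp ?T)"
 have S0: "\<zero>\<^bsub>?T\<^esub> \<in> ?S" by (rule T.M.sum_of_family_single[of "\<one>\<^sub>G"]) (use B0 Bc in auto)
 have Sadd: "u \<oplus>\<^bsub>?T\<^esub> v \<in> ?S" if "u \<in> ?S" "v \<in> ?S" for u v
  by (rule T.M.sum_of_family_add[OF sub that])
 have "X.pt x y \<in> ?S" if x: "x \<in> carrier A" and y: "y \<in> carrier M" for x y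
  using x
 proof (induction rule: A.MD.sum_induct)
  case zero
  thus ?case using X.pt_zero_left[where G = G, OF y] S0 by simp
 next
  case (hom h x)
  have xA: "x \<in> carrier A" by (rule A.MD.B_carr[OF hom(2,1)])
  show ?case using y
  proof (induction rule: M.MD.sum_induct)
   case zero
   thus ?case using X.pt_zero_right[where G = G, OF xA] S0 by simp
  next
   case (hom k y)
   thus ?case
    using tensor_pt_mcomp[OF \<open>h \<in> carrier G\<close> hom(1) \<open>x \<in> mcomp A h\<close> hom(2)] Bc \<open>h \<in> carrier G\<close>
    by (intro T.M.sum_of_family_single[of "h \<otimes>\<^sub>G k"]) auto
  next
   case (add y y')
   thus ?case using Sadd X.pt_add_right[where G = G, OF xA] by simp
  qed
 next
  case (add x x')
  thus ?case using Sadd X.pt_add_left[where G = G, OF _ _ y] by simp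
 qed
 hence span: "carrier ?T \<subseteq> ?S"
 proof (intro subsetI)
  fix z assume "z \<in> carrier ?T"
  thus "z \<in> ?S"
   by (induction rule: X.tensor_induct) (use S0 Sadd \<open>\<And>x y. _ ==> _ ==> X.pt x y \<in> ?S\<close> in auto)
 qed
 show ?thesis
 proof (intro graded_module.intro graded_module_axioms.intro A.graded_ring_axioms X.tensor_module)
  show "is_direct_sum ?T (carrier G) (mcomp ?T)"
   by (rule direct_sum.ds[OF direct_sum_projI(1)[where p = p, OF abT sub p(1) pid span]])
 qed (use sm in auto)
qed

end

lemma tensor_homI:
 assumes "gmod G R A" "gmod G R B" "gmod G R M" "f \<in> ghom G R A B"
 shows "tensor_hom R A B M f"
 by (intro tensor_hom.intro tensor_hom_axioms.intro tensor_modulesI[OF assms(1,3)] tensor_modulesI[OF assms(2,3)]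
   gh_addhom[OF assms(4)] gh_smult[OF assms(4)])

lemma tensor_map_hom:
 assumes A: "gmod G R A" and B: "gmod G R B" and M: "gmod G R M"
  and f: "f \<in> ghom G R A B"
 shows "tensor_map R B M f \<in> ghom G R (tensor G R A M) (tensor G R B M)"
proof -
 interpret T: tensor_hom R A B M f by (rule tensor_homI[OF assms])
 interpret A: graded_module G R A by fact
 interpret M: graded_module G R M by fact
 interpret TA: graded_module G R "tensor G R A M" by (rule tensor_graded[OF A M])
 interpret TB: graded_module G R "tensor G R B M" by (rule tensor_graded[OF B M])
 let ?f = "tensor_map R B M f"
 have fa: "?f \<in> addhom (tensor G R A M) (tensor G R B M)" by (rule T.tensor_map_addhom)
 show ?thesis
 proof (rule graded_homI0)
  fix r x assume r: "r \<in> carrier R" and x: "x \<in> carrier (tensor G R A M)"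
  show "?f (r \<odot>\<^bsub>tensor G R A M\<^esub> x) = r \<odot>\<^bsub>tensor G R B M\<^esub> ?f x"
   by (rule T.A.tensor_addhom_eqI[OF TB.M.abelian_group_axioms addhom_comp[OF T.A.tensor_smult_addhom[OF r] fa]
      addhom_comp[OF fa T.B.tensor_smult_addhom[OF r]] _ x])
    (use r gh_closed[OF f] gh_smult[OF f] in \<open>simp add: T.A.tensor_smult_pt T.B.tensor_smult_pt T.tensor_map_pt\<close>)
 next
  fix g x assume g: "g \<in> carrier G" and x: "x \<in> mcomp (tensor G R A M) g"
  from x have "x \<in> carrier (tensor G R A M) \<and> ?f x \<in> mcomp (tensor G R B M) g"
  proof (rule tensor_mcomp_induct[OF A M])
   show "?f \<zero>\<^bsub>tensor G R A M\<^esub> \<in> mcomp (tensor G R B M) g"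
    using addhom_zero[OF TA.M.abelian_group_axioms TB.M.abelian_group_axioms fa] TB.MD.B_zero[OF g] by simp
   show "?f (T.A.pt x y) \<in> mcomp (tensor G R B M) g"
    if *: "h \<in> carrier G" "k \<in> carrier G" "h \<otimes>\<^sub>G k = g" "x \<in> mcomp A h" "y \<in> mcomp M k" for x y h k
    using T.tensor_map_pt[OF A.MD.B_carr[OF *(4,1)] M.MD.B_carr[OF *(5,2)]]
     tensor_pt_mcomp[OF B M *(1,2) gh_mcomp[OF f *(1,4)] *(5)] *(3) by simp
   show "?f (\<ominus>\<^bsub>tensor G R A M\<^esub> u) \<in> mcomp (tensor G R B M) g"
    if "u \<in> carrier (tensor G R A M)" "?f u \<in> mcomp (tensor G R B M) g" for u
    using addhom_minus[OF TA.M.abelian_group_axioms TB.M.abelian_group_axioms fa that(1)] TB.MD.B_minus[OF that(2) g] by simp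
   show "?f (u \<oplus>\<^bsub>tensor G R A M\<^esub> v) \<in> mcomp (tensor G R B M) g"
    if "u \<in> carrier (tensor G R A M)" "v \<in> carrier (tensor G R A M)"
     "?f u \<in> mcomp (tensor G R B M) g" "?f v \<in> mcomp (tensor G R B M) g" for u v
    using addhom_add[OF fa that(1,2)] TB.MD.B_add[OF that(3,4) g] by simp
  qed
  thus "?f x \<in> mcomp (tensor G R B M) g" by simp
 qed (use addhom_closed[OF fa] addhom_add[OF fa] in auto)
qed

section \<open>Composition, surjectivity and right exactness\<close>

lemma tensor_map_comp:
 assumes A: "gmod G R A" and B: "gmod G R B" and C: "gmod G R C" and M: "gmod G R M"
  and f: "f \<in> ghom G R A B" and g: "g \<in> ghom G R B C" and z: "z \<in> carrier (tensor G R A M)"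
 shows "tensor_map R C M g (tensor_map R B M f z) = tensor_map R C M (\<lambda>x. g (f x)) z"
proof -
 interpret F: tensor_hom R A B M f by (rule tensor_homI[OF A B M f])
 interpret S: tensor_hom R B C M g by (rule tensor_homI[OF B C M g])
 interpret H: tensor_hom R A C M "\<lambda>x. g (f x)" by (rule tensor_homI[OF A C M gh_comp[OF f g]])
 show ?thesis
  by (rule F.A.tensor_addhom_eqI[OF S.B.tensor_abelian[where G = G]
     addhom_comp[OF F.tensor_map_addhom[where G = G and G' = G] S.tensor_map_addhom] H.tensor_map_addhom _ z])
   (use gh_closed[OF f] in \<open>simp add: F.tensor_map_pt S.tensor_map_pt H.tensor_map_pt\<close>)
qed

lemma tensor_map_ident:
 assumes A: "gmod G R A" and M: "gmod G R M" and f: "f \<in> ghom G R A A"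
  and id: "\<And>x. x \<in> carrier A ==> f x = x" and z: "z \<in> carrier (tensor G R A M)"
 shows "tensor_map R A M f z = z"
proof -
 interpret F: tensor_hom R A A M f by (rule tensor_homI[OF A A M f])
 have i: "(\<lambda>z. z) \<in> addhom (tensor G R A M) (tensor G R A M)" by (rule addhomI; simp)
 show ?thesis
  by (rule F.A.tensor_addhom_eqI[OF F.A.tensor_abelian[where G = G] F.tensor_map_addhom i _ z])
   (simp add: F.tensor_map_pt id)
qed

lemma tensor_map_surj:
 assumes A: "gmod G R A" and B: "gmod G R B" and M: "gmod G R M"
  and f: "f \<in> ghom G R A B" "f ` carrier A = carrier B" and z: "z \<in> carrier (tensor G R B M)"
 shows "\<exists>w\<in>carrier (tensor G R A M). tensor_map R B M f w = z"
proof -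
 interpret T: tensor_hom R A B M f by (rule tensor_homI[OF A B M f(1)])
 note fa = T.tensor_map_addhom[where G = G and G' = G]
 interpret TA: abelian_group "tensor G R A M" by (rule T.A.tensor_abelian)
 from z show ?thesis
 proof (induction rule: T.B.tensor_induct)
  case zero
  thus ?case
   using addhom_zero[OF T.A.tensor_abelian T.B.tensor_abelian fa] TA.zero_closed by blast
 next
  case (pure x y)
  then obtain a where "a \<in> carrier A" "f a = x" using f(2) by (metis imageE)
  thus ?case using T.tensor_map_pt[of a y] T.A.pt_closed[where G = G] pure by metis
 next
  case (add u v)
  then obtain a b where "a \<in> carrier (tensor G R A M)" "tensor_map R B M f a = u"
   "b \<in> carrier (tensor G R A M)" "tensor_map R B M f b = v" by blast
  thus ?case using addhom_add[OF fa] TA.a_closed by metis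
 qed
qed

text \<open>Let \<open>Y\<close> be the quotient of the middle tensor product by the image of the
  left one. Lifting elements of \<open>C\<close> to \<open>B\<close> defines a map from the right
  tensor product to \<open>Y\<close> through which the quotient map \<open>q\<close> factors; hence
  whatever dies on the right dies in \<open>Y\<close>.\<close>

lemma tensor_right_exact:
 fixes B :: "('g,'r,'b) gmodule" and M :: "('g,'r,'m) gmodule"
 assumes e: "short_exact G R A B C f g" and M: "gmod G R M"
  and z: "z \<in> carrier (tensor G R B M)" "tensor_map R C M g z = \<zero>\<^bsub>tensor G R C M\<^esub>"
 shows "\<exists>w\<in>carrier (tensor G R A M). tensor_map R B M f w = z"
proof -
 note e = short_exactD[OF e]
 interpret B: graded_module G R B by (rule e)
 interpret C: graded_module G R C by (rule e)
 interpret F: tensor_hom R A B M f by (rule tensor_homI[OF e(1,2) M e(4)])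
 interpret S: tensor_hom R B C M g by (rule tensor_homI[OF e(2,3) M e(5)])
 note gT = tensor_graded[OF e(1) M] tensor_graded[OF e(2) M]
 note fh = tensor_map_hom[OF e(1,2) M e(4)]
 obtain q and Y :: "('g,'r,('b \<times> 'm \<Rightarrow>\<^sub>0 int) set) gmodule" where Y: "gmod G R Y" "q \<in> ghom G R (tensor G R B M) Y"
  "a_kernel (tensor G R B M) Y q = tensor_map R B M f ` carrier (tensor G R A M)"
  using cokernel_exists[OF gT fh] by metis
 interpret Y: graded_module G R Y by (rule Y)
 have qf: "q (tensor_map R B M f w) = \<zero>\<^sub>Y" if "w \<in> carrier (tensor G R A M)" for w
  using Y(3) that a_kernel_iff by (metis imageI)
 define l where "l c = (SOME b. b \<in> carrier B \<and> g b = c)" for c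
 have l: "l c \<in> carrier B \<and> g (l c) = c" if "c \<in> carrier C" for c
 proof -
  have "c \<in> g ` carrier B" using that by (simp only: e(8))
  thus ?thesis
  proof (rule imageE)
   fix b assume "c = g b" "b \<in> carrier B"
   hence "b \<in> carrier B \<and> g b = c" by (intro conjI sym[of c])
   thus ?thesis unfolding l_def by (rule someI)
  qed
 qed
 \<comment> \<open>Two lifts of the same element differ by an element from \<open>A\<close>, which
   \<open>q\<close> kills after tensoring. So the choice of lifts does not matter, and additivity
   and balancing follow.\<close>
 have ql: "q (F.B.pt b y) = q (F.B.pt b' y)" if "b \<in> carrier B" "b' \<in> carrier B" "g b = g b'" "y \<in> carrier M" for b b' y
 proof -
  have "g (b \<ominus>\<^sub>B b') = \<zero>\<^sub>C"
   using gh_diff[OF e(2,3,5) that(1,2)] that(3) gh_closed[OF e(5) that(2)] C.M.diff_zero_iff by simp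
  moreover have "b \<ominus>\<^sub>B b' \<in> carrier B" by (rule B.M.minus_closed[OF that(1,2)])
  ultimately obtain a where a: "a \<in> carrier A" "f a = b \<ominus>\<^sub>B b'" using e(10) by blast
  have "q (F.B.pt (b \<ominus>\<^sub>B b') y) = \<zero>\<^sub>Y"
   using qf[OF F.A.pt_closed[OF a(1) that(4)]] F.tensor_map_pt[OF a(1) that(4)] a(2) by simp
  hence "q (F.B.pt b y) \<ominus>\<^sub>Y q (F.B.pt b' y) = \<zero>\<^sub>Y"
   using addhom_diff[OF B.M.abelian_group_axioms F.B.tensor_abelian F.B.pt_addhom_left[where G = G, OF that(4)] that(1,2)]
    gh_diff[OF gT(2) Y(1,2) F.B.pt_closed[OF that(1,4)] F.B.pt_closed[OF that(2,4)]] by simp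
  thus ?thesis
   using Y.M.diff_zero_iff gh_closed[OF Y(2) F.B.pt_closed] that by simp
 qed
 note qa = gh_add[OF Y(2)] and qc = gh_closed[OF Y(2)]
 obtain h where h: "h \<in> addhom (tensor G R C M) Y" "\<And>c y. [|c \<in> carrier C; y \<in> carrier M|] ==> h (S.B.pt c y) = q (F.B.pt (l c) y)"
 proof (rule S.B.tensor_universal[where G = G, OF Y.M.abelian_group_axioms, of "\<lambda>c y. q (F.B.pt (l c) y)"])
  show "q (F.B.pt (l (x \<oplus>\<^sub>C x')) y) = q (F.B.pt (l x) y) \<oplus>\<^sub>Y q (F.B.pt (l x') y)"
   if "x \<in> carrier C" "x' \<in> carrier C" "y \<in> carrier M" for x x' y
  proof -
   note lx = l[OF that(1)] l[OF that(2)] l[OF C.M.a_closed[OF that(1,2)]]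
   have "q (F.B.pt (l (x \<oplus>\<^sub>C x')) y) = q (F.B.pt (l x \<oplus>\<^sub>B l x') y)"
    by (rule ql) (use lx that gh_add[OF e(5), of "l x" "l x'"] in auto)
   thus ?thesis
    using lx that qa[OF F.B.pt_closed F.B.pt_closed, of "l x" y "l x'" y] F.B.pt_add_left[where G = G, of "l x" "l x'" y] by simp
  qed
  show "q (F.B.pt (l x) (y \<oplus>\<^sub>M y')) = q (F.B.pt (l x) y) \<oplus>\<^sub>Y q (F.B.pt (l x) y')"
   if "x \<in> carrier C" "y \<in> carrier M" "y' \<in> carrier M" for x y y'
   using l[OF that(1)] that qa[OF F.B.pt_closed F.B.pt_closed, of "l x" y "l x" y'] F.B.pt_add_right[where G = G, of "l x" y y'] by simp
  show "q (F.B.pt (l (r \<odot>\<^sub>C x)) y) = q (F.B.pt (l x) (r \<odot>\<^sub>M y))"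
   if "r \<in> carrier R" "x \<in> carrier C" "y \<in> carrier M" for r x y
  proof -
   note lx = l[OF that(2)] l[OF C.smult_closed[OF that(1,2)]]
   have "q (F.B.pt (l (r \<odot>\<^sub>C x)) y) = q (F.B.pt (r \<odot>\<^sub>B l x) y)"
    by (rule ql) (use lx that gh_smult[OF e(5), of r "l x"] in auto)
   thus ?thesis using lx that F.B.pt_smult[of r "l x" y] by simp
  qed
 next
  show "q (F.B.pt (l x) y) \<in> carrier Y" if "x \<in> carrier C" "y \<in> carrier M" for x y
   using qc[OF F.B.pt_closed] l[OF that(1)] that(2) by blast
 qed (use that in blast)
 have "h (tensor_map R C M g z) = q z"
  by (rule F.B.tensor_addhom_eqI[OF Y.M.abelian_group_axioms addhom_comp[OF S.tensor_map_addhom h(1)] gh_addhom[OF Y(2)] _ z(1)])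
   (simp add: S.tensor_map_pt h(2) gh_closed[OF e(5)] ql[OF conjunct1[OF l] _ conjunct2[OF l]])
 hence "q z = \<zero>\<^sub>Y"
  using z(2) addhom_zero[OF S.B.tensor_abelian Y.M.abelian_group_axioms h(1)] by simp
 hence "z \<in> a_kernel (tensor G R B M) Y q" using z(1) by (simp add: a_kernel_iff)
 thus ?thesis unfolding Y(3) by blast
qed

section \<open>Flat graded modules\<close>

lemma flat_graded: "flat G R M ==> gmod G R M"
 by (simp add: flat_def)

text \<open>The remaining conditions of exactness hold for every graded module by right
  exactness.\<close>

lemma flatI:
 fixes M :: "('g,'r,'u) gmodule"
 assumes M: "gmod G R M"
  and inj: "\<And>(A :: ('g,'r,'u) gmodule) (B :: ('g,'r,'u) gmodule) f.
   [|gmod G R A; gmod G R B; f \<in> ghom G R A B; inj_on f (carrier A)|]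
   ==> inj_on (tensor_map R B M f) (carrier (tensor G R A M))"
 shows "flat G R M"
 unfolding flat_def
proof (intro conjI allI impI M)
 fix A B C :: "('g,'r,'u) gmodule" and f g
 assume s: "short_exact G R A B C f g"
 note e = short_exactD[OF s]
 note gT = tensor_graded[OF e(1) M] tensor_graded[OF e(2) M] tensor_graded[OF e(3) M]
 note fh = tensor_map_hom[OF e(1,2) M e(4)] and gh = tensor_map_hom[OF e(2,3) M e(5)]
 interpret H: tensor_hom R A C M "\<lambda>x. g (f x)" by (rule tensor_homI[OF e(1,3) M gh_comp[OF e(4,5)]])
 show "short_exact G R (tensor G R A M) (tensor G R B M) (tensor G R C M) (tensor_map R B M f) (tensor_map R C M g)"
 proof (rule short_exactI[OF gT fh gh inj[OF e(1,2,4,6)]])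
  fix z assume z: "z \<in> carrier (tensor G R A M)"
  have 0: "(\<lambda>z. \<zero>\<^bsub>tensor G R C M\<^esub>) \<in> addhom (tensor G R A M) (tensor G R C M)"
   by (rule gh_addhom[OF graded_hom_zero[OF gT(1,3)]])
  have "tensor_map R C M (\<lambda>x. g (f x)) z = \<zero>\<^bsub>tensor G R C M\<^esub>"
   by (rule H.A.tensor_addhom_eqI[OF H.B.tensor_abelian[where G = G] H.tensor_map_addhom 0 _ z])
    (simp add: H.tensor_map_pt e(9) H.B.pt_zero_left[where G = G])
  thus "tensor_map R C M g (tensor_map R B M f z) = \<zero>\<^bsub>tensor G R C M\<^esub>"
   using tensor_map_comp[OF e(1-3) M e(4,5) z] by simp
 next
  show "\<exists>x\<in>carrier (tensor G R A M). tensor_map R B M f x = y"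
   if "y \<in> carrier (tensor G R B M)" "tensor_map R C M g y = \<zero>\<^bsub>tensor G R C M\<^esub>" for y
   by (rule tensor_right_exact[OF s M that])
  show "tensor_map R C M g ` carrier (tensor G R B M) = carrier (tensor G R C M)"
   using tensor_map_surj[OF e(2,3) M e(5,8)] gh_closed[OF gh] by blast
 qed
qed

text \<open>Injectivity after tensoring, in terms of elements, and for modules of other element
  types that embed into \<open>'u\<close>. It is applied in particular to modules of
  families.\<close>

lemma flatD:
 fixes M :: "('g,'r,'u) gmodule" and A :: "('g,'r,'a) gmodule" and B :: "('g,'r,'b) gmodule"
 assumes fl: "flat G R M" and A: "gmod G R A" and B: "gmod G R B"
  and f: "f \<in> ghom G R A B" "inj_on f (carrier A)"
  and a: "inj_on (\<alpha> :: 'a => 'u) (carrier A)" and b: "inj_on (\<beta> :: 'b => 'u) (carrier B)"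
  and z: "z \<in> carrier (tensor G R A M)" "tensor_map R B M f z = \<zero>\<^bsub>tensor G R B M\<^esub>"
 shows "z = \<zero>\<^bsub>tensor G R A M\<^esub>"
proof -
 note M = flat_graded[OF fl]
 obtain A' :: "('g,'r,'u) gmodule" and v where A': "gmod G R A'" "giso G R A A' \<alpha> v"
  using transport[OF A a] by blast
 obtain B' :: "('g,'r,'u) gmodule" and v' where B': "gmod G R B'" "giso G R B B' \<beta> v'"
  using transport[OF B b] by blast
 note i = gisoD[OF A'(2)] and i' = gisoD[OF B'(2)]
 let ?f = "\<lambda>x. \<beta> (f (v x))"
 have f': "?f \<in> ghom G R A' B'" by (rule gh_comp[OF gh_comp[OF i(2) f(1)] i'(1)])
 have "inj_on ?f (carrier A')"
 proof (rule inj_onI)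
  fix x y assume xy: "x \<in> carrier A'" "y \<in> carrier A'" "\<beta> (f (v x)) = \<beta> (f (v y))"
  have c: "v x \<in> carrier A" "v y \<in> carrier A" using gh_closed[OF i(2)] xy by auto
  have "f (v x) = f (v y)" by (rule inj_onD[OF i'(5) xy(3)]) (use c gh_closed[OF f(1)] in auto)
  hence "v x = v y" by (rule inj_onD[OF f(2) _ c])
  thus "x = y" using i(4) xy by metis
 qed
 \<comment> \<open>Flatness is stated for short exact sequences, so the injection is first completed
   by its cokernel.\<close>
 then obtain Y :: "('g,'r,'u) gmodule" and q where se: "short_exact G R A' B' Y ?f q"
  using short_exact_of_mono[OF A'(1) B'(1) f'] by blast
 hence inj: "inj_on (tensor_map R B' M ?f) (carrier (tensor G R A' M))"
  using fl unfolding flat_def short_exact_def by blast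
 let ?w = "tensor_map R A' M \<alpha> z"
 note gT = tensor_graded[OF A M] tensor_graded[OF B M] tensor_graded[OF A'(1) M] tensor_graded[OF B'(1) M]
 have w: "?w \<in> carrier (tensor G R A' M)" by (rule gh_closed[OF tensor_map_hom[OF A A'(1) M i(1)] z(1)])
 have "tensor_map R B' M ?f ?w = tensor_map R B' M (\<lambda>x. ?f (\<alpha> x)) z"
  by (rule tensor_map_comp[OF A A'(1) B'(1) M i(1) f' z(1)])
 also have "\<dots> = tensor_map R B' M (\<lambda>x. \<beta> (f x)) z"
 proof -
  interpret P: tensor_hom R A B' M "\<lambda>x. ?f (\<alpha> x)" by (rule tensor_homI[OF A B'(1) M gh_comp[OF i(1) f']])
  interpret Q: tensor_hom R A B' M "\<lambda>x. \<beta> (f x)" by (rule tensor_homI[OF A B'(1) M gh_comp[OF f(1) i'(1)]])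
  show ?thesis
   by (rule P.A.tensor_addhom_eqI[OF P.B.tensor_abelian[where G = G] P.tensor_map_addhom Q.tensor_map_addhom _ z(1)])
    (simp add: P.tensor_map_pt Q.tensor_map_pt i(3))
 qed
 also have "\<dots> = tensor_map R B' M \<beta> (tensor_map R B M f z)"
  by (rule tensor_map_comp[OF A B B'(1) M f(1) i'(1) z(1), symmetric])
 also have "\<dots> = \<zero>\<^bsub>tensor G R B' M\<^esub>"
  using z(2) gh_zero[OF gT(2,4) tensor_map_hom[OF B B'(1) M i'(1)]] by simp
 finally have "?w = \<zero>\<^bsub>tensor G R A' M\<^esub>"
  using gh_inj_zero[OF gT(3,4) tensor_map_hom[OF A'(1) B'(1) M f'] inj w] by simp
 hence "tensor_map R A M v ?w = \<zero>\<^bsub>tensor G R A M\<^esub>"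
  using gh_zero[OF gT(3,1) tensor_map_hom[OF A'(1) A M i(2)]] by simp
 moreover have "tensor_map R A M v ?w = tensor_map R A M (\<lambda>x. v (\<alpha> x)) z"
  by (rule tensor_map_comp[OF A A'(1) A M i(1,2) z(1)])
 moreover have "\<dots> = z"
  by (rule tensor_map_ident[OF A M gh_comp[OF i(1,2)] i(3) z(1)])
 ultimately show ?thesis by simp
qed

section \<open>Closure properties of flat modules\<close>

text \<open>Homomorphisms in the right factor have no explicit formula so far; a map is selected
  among those given by the universal property, and it is determined on the tensor product by its
  values on pure tensors.\<close>

definition rmap :: "('g,'x) monoid_scheme => ('g,'r) gring => ('g,'r,'a) gmodule => ('g,'r,'m) gmodule
  => ('g,'r,'n) gmodule => ('m => 'n) => ('a \<times> 'm \<Rightarrow>\<^sub>0 int) set => ('a \<times> 'n \<Rightarrow>\<^sub>0 int) set" where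
 "rmap G R A M N g = (SOME t. t \<in> addhom (tensor G R A M) (tensor G R A N) \<and>
   (\<forall>x\<in>carrier A. \<forall>y\<in>carrier M. t (pure_tensor R A M x y) = pure_tensor R A N x (g y)))"

text \<open>Exchanging the factors carries right exactness and flatness, which are stated for the
  left factor, over to the right factor.\<close>

definition swap :: "('g,'x) monoid_scheme => ('g,'r) gring => ('g,'r,'a) gmodule => ('g,'r,'m) gmodule
  => ('a \<times> 'm \<Rightarrow>\<^sub>0 int) set => ('m \<times> 'a \<Rightarrow>\<^sub>0 int) set" where
 "swap G R A M = (SOME t. t \<in> addhom (tensor G R A M) (tensor G R M A) \<and>
   (\<forall>x\<in>carrier A. \<forall>y\<in>carrier M. t (pure_tensor R A M x y) = pure_tensor R M A y x))"

lemma rmap_props: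
 assumes A: "gmod G R A" and M: "gmod G R M" and N: "gmod G R N"
  and g: "g \<in> ghom G R M N"
 shows "rmap G R A M N g \<in> addhom (tensor G R A M) (tensor G R A N)"
  "\<And>x y. [|x \<in> carrier A; y \<in> carrier M|] ==> rmap G R A M N g (pure_tensor R A M x y) = pure_tensor R A N x (g y)"
proof -
 have "\<exists>t. t \<in> addhom (tensor G R A M) (tensor G R A N) \<and>
   (\<forall>x\<in>carrier A. \<forall>y\<in>carrier M. t (pure_tensor R A M x y) = pure_tensor R A N x (g y))"
  by (rule tensor_right_exists[where G = G and G' = G, OF tensor_modulesI[OF A M] tensor_modulesI[OF A N]
     gh_addhom[OF g] gh_smult[OF g]]) auto
 from someI_ex[OF this] show "rmap G R A M N g \<in> addhom (tensor G R A M) (tensor G R A N)"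
  "\<And>x y. [|x \<in> carrier A; y \<in> carrier M|] ==> rmap G R A M N g (pure_tensor R A M x y) = pure_tensor R A N x (g y)"
  unfolding rmap_def by auto
qed

lemma swap_props:
 assumes A: "gmod G R A" and M: "gmod G R M"
 shows "swap G R A M \<in> addhom (tensor G R A M) (tensor G R M A)"
  "\<And>x y. [|x \<in> carrier A; y \<in> carrier M|] ==> swap G R A M (pure_tensor R A M x y) = pure_tensor R M A y x"
proof -
 have "\<exists>t. t \<in> addhom (tensor G R A M) (tensor G R M A) \<and>
   (\<forall>x\<in>carrier A. \<forall>y\<in>carrier M. t (pure_tensor R A M x y) = pure_tensor R M A y x)"
  by (rule tensor_modules.tensor_swap_exists[where G = G and G' = G, OF tensor_modulesI[OF A M]]) auto
 from someI_ex[OF this] show "swap G R A M \<in> addhom (tensor G R A M) (tensor G R M A)"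
  "\<And>x y. [|x \<in> carrier A; y \<in> carrier M|] ==> swap G R A M (pure_tensor R A M x y) = pure_tensor R M A y x"
  unfolding swap_def by auto
qed

lemma tensor_ag: "[|gmod G R A; gmod G R M|] ==> abelian_group (tensor G R A M)"
 by (rule tensor_modules.tensor_abelian[OF tensor_modulesI])

lemma tensor_ext:
 assumes A: "gmod G R A" and M: "gmod G R M" and X: "abelian_group X"
  and "f \<in> addhom (tensor G R A M) X" "g \<in> addhom (tensor G R A M) X"
  and "\<And>x y. [|x \<in> carrier A; y \<in> carrier M|] ==> f (pure_tensor R A M x y) = g (pure_tensor R A M x y)"
  and "z \<in> carrier (tensor G R A M)"
 shows "f z = g z"
 by (rule tensor_modules.tensor_addhom_eqI[OF tensor_modulesI[OF A M] assms(3-7)])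

lemma tensor_map_addhom':
 assumes "gmod G R A" "gmod G R B" "gmod G R M" "f \<in> ghom G R A B"
 shows "tensor_map R B M f \<in> addhom (tensor G R A M) (tensor G R B M)"
 by (rule tensor_hom.tensor_map_addhom[OF tensor_homI[OF assms]])

lemma tensor_map_pt':
 assumes "gmod G R A" "gmod G R B" "gmod G R M" "f \<in> ghom G R A B"
  "x \<in> carrier A" "y \<in> carrier M"
 shows "tensor_map R B M f (pure_tensor R A M x y) = pure_tensor R B M (f x) y"
 by (rule tensor_hom.tensor_map_pt[OF tensor_homI[OF assms(1-4)] assms(5,6)])

lemma map_rmap:
 assumes A: "gmod G R A" and B: "gmod G R B" and M: "gmod G R M" and N: "gmod G R N"
  and f: "f \<in> ghom G R A B" and g: "g \<in> ghom G R M N" and z: "z \<in> carrier (tensor G R A M)"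
 shows "tensor_map R B N f (rmap G R A M N g z) = rmap G R B M N g (tensor_map R B M f z)"
 by (rule tensor_ext[OF A M tensor_ag[OF B N]
    addhom_comp[OF rmap_props(1)[OF A M N g] tensor_map_addhom'[OF A B N f]]
    addhom_comp[OF tensor_map_addhom'[OF A B M f] rmap_props(1)[OF B M N g]] _ z])
  (simp add: rmap_props(2)[OF A M N g] rmap_props(2)[OF B M N g] tensor_map_pt'[OF A B M f] tensor_map_pt'[OF A B N f]
   gh_closed[OF f] gh_closed[OF g])

lemma rmap_comp:
 assumes A: "gmod G R A" and M: "gmod G R M" and N: "gmod G R N" and P: "gmod G R P"
  and g: "g \<in> ghom G R M N" and h: "h \<in> ghom G R N P" and z: "z \<in> carrier (tensor G R A M)"
 shows "rmap G R A N P h (rmap G R A M N g z) = rmap G R A M P (\<lambda>x. h (g x)) z"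
 by (rule tensor_ext[OF A M tensor_ag[OF A P]
    addhom_comp[OF rmap_props(1)[OF A M N g] rmap_props(1)[OF A N P h]]
    rmap_props(1)[OF A M P gh_comp[OF g h]] _ z])
  (simp add: rmap_props(2)[OF A M N g] rmap_props(2)[OF A N P h] rmap_props(2)[OF A M P gh_comp[OF g h]]
   gh_closed[OF g])

lemma rmap_ident:
 assumes A: "gmod G R A" and M: "gmod G R M" and g: "g \<in> ghom G R M M"
  and id: "\<And>x. x \<in> carrier M ==> g x = x" and z: "z \<in> carrier (tensor G R A M)"
 shows "rmap G R A M M g z = z"
proof -
 have i: "(\<lambda>z. z) \<in> addhom (tensor G R A M) (tensor G R A M)" by (rule addhomI; simp)
 show ?thesis
  by (rule tensor_ext[OF A M tensor_ag[OF A M] rmap_props(1)[OF A M M g] i _ z])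
   (simp add: rmap_props(2)[OF A M M g] id)
qed

lemma rmap_null:
 assumes A: "gmod G R A" and M: "gmod G R M" and N: "gmod G R N"
  and g: "g \<in> ghom G R M N" and 0: "\<And>x. x \<in> carrier M ==> g x = \<zero>\<^sub>N" and z: "z \<in> carrier (tensor G R A M)"
 shows "rmap G R A M N g z = \<zero>\<^bsub>tensor G R A N\<^esub>"
 by (rule tensor_ext[OF A M tensor_ag[OF A N] rmap_props(1)[OF A M N g]
    gh_addhom[OF graded_hom_zero[OF tensor_graded[OF A M] tensor_graded[OF A N]]] _ z])
  (simp add: rmap_props(2)[OF A M N g] 0 tensor_modules.pt_zero_right[OF tensor_modulesI[OF A N], where G = G])

lemma swap_swap:
 assumes A: "gmod G R A" and M: "gmod G R M" and z: "z \<in> carrier (tensor G R A M)"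
 shows "swap G R M A (swap G R A M z) = z"
proof -
 have i: "(\<lambda>z. z) \<in> addhom (tensor G R A M) (tensor G R A M)" by (rule addhomI; simp)
 show ?thesis
  by (rule tensor_ext[OF A M tensor_ag[OF A M] addhom_comp[OF swap_props(1)[OF A M] swap_props(1)[OF M A]] i _ z])
   (simp add: swap_props(2)[OF A M] swap_props(2)[OF M A])
qed

lemma swap_rmap:
 assumes A: "gmod G R A" and M: "gmod G R M" and N: "gmod G R N"
  and g: "g \<in> ghom G R M N" and z: "z \<in> carrier (tensor G R A M)"
 shows "swap G R A N (rmap G R A M N g z) = tensor_map R N A g (swap G R A M z)"
 by (rule tensor_ext[OF A M tensor_ag[OF N A]
    addhom_comp[OF rmap_props(1)[OF A M N g] swap_props(1)[OF A N]]
    addhom_comp[OF swap_props(1)[OF A M] tensor_map_addhom'[OF M N A g]] _ z])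
  (simp add: rmap_props(2)[OF A M N g] swap_props(2)[OF A M] swap_props(2)[OF A N] tensor_map_pt'[OF M N A g]
   gh_closed[OF g])

lemma rmap_exact:
 assumes e: "short_exact G R Z Q P i p" and N: "gmod G R N"
  and n: "n \<in> carrier (tensor G R N Q)" "rmap G R N Q P p n = \<zero>\<^bsub>tensor G R N P\<^esub>"
 shows "\<exists>m\<in>carrier (tensor G R N Z). rmap G R N Z Q i m = n"
proof -
 note s = short_exactD[OF e]
 let ?n = "swap G R N Q n"
 have c: "?n \<in> carrier (tensor G R Q N)" by (rule addhom_closed[OF swap_props(1)[OF N s(2)] n(1)])
 have "tensor_map R P N p ?n = swap G R N P \<zero>\<^bsub>tensor G R N P\<^esub>"
  using swap_rmap[OF N s(2,3,5) n(1)] n(2) by simp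
 also have "\<dots> = \<zero>\<^bsub>tensor G R P N\<^esub>"
  by (rule addhom_zero[OF tensor_ag[OF N s(3)] tensor_ag[OF s(3) N] swap_props(1)[OF N s(3)]])
 finally obtain w where w: "w \<in> carrier (tensor G R Z N)" "tensor_map R Q N i w = ?n"
  using tensor_right_exact[OF e N c] by blast
 let ?m = "swap G R Z N w"
 have m: "?m \<in> carrier (tensor G R N Z)" by (rule addhom_closed[OF swap_props(1)[OF s(1) N] w(1)])
 have "swap G R N Q (rmap G R N Z Q i ?m) = ?n"
  using swap_rmap[OF N s(1,2,4) m] swap_swap[OF s(1) N w(1)] w(2) by simp
 hence "rmap G R N Z Q i ?m = n"
  using swap_swap[OF N s(2) addhom_closed[OF rmap_props(1)[OF N s(1,2,4)] m]] swap_swap[OF N s(2) n(1)] by metis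
 thus ?thesis using m by blast
qed

lemma rmap_inj_flat:
 fixes L Z Q :: "('g,'r,'u) gmodule"
 assumes L: "flat G R L" and Z: "gmod G R Z" and Q: "gmod G R Q"
  and i: "i \<in> ghom G R Z Q" "inj_on i (carrier Z)"
  and d: "d \<in> carrier (tensor G R L Z)" "rmap G R L Z Q i d = \<zero>\<^bsub>tensor G R L Q\<^esub>"
 shows "d = \<zero>\<^bsub>tensor G R L Z\<^esub>"
proof -
 note gL = flat_graded[OF L]
 have "tensor_map R Q L i (swap G R L Z d) = \<zero>\<^bsub>tensor G R Q L\<^esub>"
  using swap_rmap[OF gL Z Q i(1) d(1)] d(2)
   addhom_zero[OF tensor_ag[OF gL Q] tensor_ag[OF Q gL] swap_props(1)[OF gL Q]] by simp
 hence "swap G R L Z d = \<zero>\<^bsub>tensor G R Z L\<^esub>"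
  by (rule flatD[OF L Z Q i inj_on_id inj_on_id addhom_closed[OF swap_props(1)[OF gL Z] d(1)]])
 thus ?thesis
  using swap_swap[OF gL Z d(1)] addhom_zero[OF tensor_ag[OF Z gL] tensor_ag[OF gL Z] swap_props(1)[OF Z gL]] by simp
qed

lemma flat_retract:
 fixes Y Z :: "('g,'r,'u) gmodule"
 assumes Y: "flat G R Y" and Z: "gmod G R Z"
  and i: "i \<in> ghom G R Z Y" and r: "r \<in> ghom G R Y Z" and ri: "\<And>z. z \<in> carrier Z ==> r (i z) = z"
 shows "flat G R Z"
proof (rule flatI[OF Z])
 note gY = flat_graded[OF Y]
 fix A B :: "('g,'r,'u) gmodule" and f
 assume A: "gmod G R A" and B: "gmod G R B" and f: "f \<in> ghom G R A B" "inj_on f (carrier A)"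
 show "inj_on (tensor_map R B Z f) (carrier (tensor G R A Z))"
  unfolding gh_inj_iff[OF tensor_graded[OF A Z] tensor_graded[OF B Z] tensor_map_hom[OF A B Z f(1)]]
 proof (intro ballI impI)
  fix z assume z: "z \<in> carrier (tensor G R A Z)" "tensor_map R B Z f z = \<zero>\<^bsub>tensor G R B Z\<^esub>"
  let ?w = "rmap G R A Z Y i z"
  have w: "?w \<in> carrier (tensor G R A Y)" by (rule addhom_closed[OF rmap_props(1)[OF A Z gY i] z(1)])
  have "tensor_map R B Y f ?w = \<zero>\<^bsub>tensor G R B Y\<^esub>"
   using map_rmap[OF A B Z gY f(1) i z(1)] z(2)
    addhom_zero[OF tensor_ag[OF B Z] tensor_ag[OF B gY] rmap_props(1)[OF B Z gY i]] by simp
  hence "?w = \<zero>\<^bsub>tensor G R A Y\<^esub>" by (rule flatD[OF Y A B f inj_on_id inj_on_id w])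
  hence "rmap G R A Y Z r ?w = \<zero>\<^bsub>tensor G R A Z\<^esub>"
   using addhom_zero[OF tensor_ag[OF A gY] tensor_ag[OF A Z] rmap_props(1)[OF A gY Z r]] by simp
  moreover have "rmap G R A Y Z r ?w = z"
   using rmap_comp[OF A Z gY Z i r z(1)] rmap_ident[OF A Z gh_comp[OF i r] ri z(1)] by simp
  ultimately show "z = \<zero>\<^bsub>tensor G R A Z\<^esub>" by simp
 qed
qed

text \<open>A tensor with the sum is the sum of what its two projections contribute, and each of
  these is detected by a flat summand.\<close>

lemma flat_sum:
 fixes P Q X :: "('g,'r,'u) gmodule"
 assumes P: "flat G R P" and Q: "flat G R Q"
  and X: "gmod G R X" "giso G R (prodm P Q) X u v"
 shows "flat G R X"
proof (rule flatI[OF X(1)])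
 note g = flat_graded[OF P] flat_graded[OF Q] note i = gisoD[OF X(2)]
 interpret X: graded_module G R X by (rule X)
 fix A B :: "('g,'r,'u) gmodule" and f
 assume A: "gmod G R A" and B: "gmod G R B" and f: "f \<in> ghom G R A B" "inj_on f (carrier A)"
 let ?r1 = "\<lambda>x. fst (v x)" and ?r2 = "\<lambda>x. snd (v x)" and ?i1 = "\<lambda>x. u (x, \<zero>\<^sub>Q)" and ?i2 = "\<lambda>x. u (\<zero>\<^sub>P, x)"
 have r: "?r1 \<in> ghom G R X P" "?r2 \<in> ghom G R X Q"
  by (rule gh_comp[OF i(2) fst_hom[OF g]] gh_comp[OF i(2) snd_hom[OF g]])+
 have j: "?i1 \<in> ghom G R P X" "?i2 \<in> ghom G R Q X"
  by (rule gh_comp[OF inl_hom[OF g] i(1)] gh_comp[OF inr_hom[OF g] i(1)])+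
 have k: "tensor_map R B Y f (rmap G R A X Y s z) = \<zero>\<^bsub>tensor G R B Y\<^esub>"
  if "gmod G R Y" "s \<in> ghom G R X Y" "z \<in> carrier (tensor G R A X)" "tensor_map R B X f z = \<zero>\<^bsub>tensor G R B X\<^esub>"
  for Y :: "('g,'r,'u) gmodule" and s z
  using map_rmap[OF A B X(1) that(1) f(1) that(2,3)] that(4)
    addhom_zero[OF tensor_ag[OF B X(1)] tensor_ag[OF B that(1)] rmap_props(1)[OF B X(1) that(1,2)]] by simp
 interpret TX: abelian_group "tensor G R A X" by (rule tensor_ag[OF A X(1)])
 show "inj_on (tensor_map R B X f) (carrier (tensor G R A X))"
  unfolding gh_inj_iff[OF tensor_graded[OF A X(1)] tensor_graded[OF B X(1)] tensor_map_hom[OF A B X(1) f(1)]]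
 proof (intro ballI impI)
  fix z assume z: "z \<in> carrier (tensor G R A X)" "tensor_map R B X f z = \<zero>\<^bsub>tensor G R B X\<^esub>"
  have z1: "rmap G R A X P ?r1 z = \<zero>\<^bsub>tensor G R A P\<^esub>"
   by (rule flatD[OF P A B f inj_on_id inj_on_id addhom_closed[OF rmap_props(1)[OF A X(1) g(1) r(1)] z(1)] k[OF g(1) r(1) z]])
  have z2: "rmap G R A X Q ?r2 z = \<zero>\<^bsub>tensor G R A Q\<^esub>"
   by (rule flatD[OF Q A B f inj_on_id inj_on_id addhom_closed[OF rmap_props(1)[OF A X(1) g(2) r(2)] z(1)] k[OF g(2) r(2) z]])
  have y1: "rmap G R A X X (\<lambda>x. ?i1 (?r1 x)) z = \<zero>\<^bsub>tensor G R A X\<^esub>"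
   using rmap_comp[OF A X(1) g(1) X(1) r(1) j(1) z(1)] z1
    addhom_zero[OF tensor_ag[OF A g(1)] tensor_ag[OF A X(1)] rmap_props(1)[OF A g(1) X(1) j(1)]] by simp
  have y2: "rmap G R A X X (\<lambda>x. ?i2 (?r2 x)) z = \<zero>\<^bsub>tensor G R A X\<^esub>"
   using rmap_comp[OF A X(1) g(2) X(1) r(2) j(2) z(1)] z2
    addhom_zero[OF tensor_ag[OF A g(2)] tensor_ag[OF A X(1)] rmap_props(1)[OF A g(2) X(1) j(2)]] by simp
  note h1 = gh_comp[OF r(1) j(1)] and h2 = gh_comp[OF r(2) j(2)]
  note R1 = rmap_props[OF A X(1) X(1) h1] and R2 = rmap_props[OF A X(1) X(1) h2]
  have dec: "?i1 (?r1 x) \<oplus>\<^sub>X ?i2 (?r2 x) = x" if x: "x \<in> carrier X" for x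
  proof -
   obtain a b where ab: "v x = (a, b)" "a \<in> carrier P" "b \<in> carrier Q" using gh_closed[OF i(2) x] by auto
   interpret P: graded_module G R P by (rule g)
   interpret Q: graded_module G R Q by (rule g)
   have "?i1 (?r1 x) \<oplus>\<^sub>X ?i2 (?r2 x) = u ((a, \<zero>\<^sub>Q) \<oplus>\<^bsub>prodm P Q\<^esub> (\<zero>\<^sub>P, b))"
    using ab gh_add[OF i(1), of "(a, \<zero>\<^sub>Q)" "(\<zero>\<^sub>P, b)"] by (simp del: prodm_simps(3))
   also have "\<dots> = x" using ab i(4)[OF x] by simp
   finally show ?thesis .
  qed
  have i': "(\<lambda>z. z) \<in> addhom (tensor G R A X) (tensor G R A X)" by (rule addhomI; simp)
  have s: "(\<lambda>z. rmap G R A X X (\<lambda>x. ?i1 (?r1 x)) z \<oplus>\<^bsub>tensor G R A X\<^esub> rmap G R A X X (\<lambda>x. ?i2 (?r2 x)) z)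
    \<in> addhom (tensor G R A X) (tensor G R A X)"
   by (rule addhomI) (use addhom_closed[OF R1(1)] addhom_closed[OF R2(1)] addhom_add[OF R1(1)] addhom_add[OF R2(1)]
     in \<open>simp_all add: TX.a_ac\<close>)
  have "z = rmap G R A X X (\<lambda>x. ?i1 (?r1 x)) z \<oplus>\<^bsub>tensor G R A X\<^esub> rmap G R A X X (\<lambda>x. ?i2 (?r2 x)) z"
  proof (rule tensor_ext[OF A X(1) tensor_ag[OF A X(1)] i' s _ z(1)])
   fix x y assume xy: "x \<in> carrier A" "y \<in> carrier X"
   show "pure_tensor R A X x y = rmap G R A X X (\<lambda>x. ?i1 (?r1 x)) (pure_tensor R A X x y)
     \<oplus>\<^bsub>tensor G R A X\<^esub> rmap G R A X X (\<lambda>x. ?i2 (?r2 x)) (pure_tensor R A X x y)"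
    using R1(2)[OF xy] R2(2)[OF xy] dec[OF xy(2)] gh_closed[OF h1 xy(2)] gh_closed[OF h2 xy(2)]
     tensor_modules.pt_add_right[OF tensor_modulesI[OF A X(1)], where G = G, OF xy(1)] by metis
  qed
  thus "z = \<zero>\<^bsub>tensor G R A X\<^esub>" using y1 y2 by simp
 qed
qed

text \<open>
  As \<open>P\<close> is flat, \<open>Z \<rightarrow> Q\<close> stays injective after tensoring with any \<open>A\<close>: chase the diagram obtained
  from a presentation \<open>0 \<rightarrow> N \<rightarrow> L \<rightarrow> A \<rightarrow> 0\<close> with \<open>L\<close> flat.
\<close>

lemma flat_kernel:
 fixes Z Q P :: "('g,'r,'u) gmodule"
 assumes e: "short_exact G R Z Q P i p" and Q: "flat G R Q" and P: "flat G R P"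
  and cover: "\<And>A :: ('g,'r,'u) gmodule. gmod G R A ==>
   \<exists>(L :: ('g,'r,'u) gmodule) q. flat G R L \<and> q \<in> ghom G R L A \<and> q ` carrier L = carrier A"
 shows "flat G R Z"
proof -
 note s = short_exactD[OF e]
 have pure: "w = \<zero>\<^bsub>tensor G R A Z\<^esub>"
  if A: "gmod G R A" and w: "w \<in> carrier (tensor G R A Z)" "rmap G R A Z Q i w = \<zero>\<^bsub>tensor G R A Q\<^esub>"
  for A :: "('g,'r,'u) gmodule" and w
 proof -
  obtain L :: "('g,'r,'u) gmodule" and q where L: "flat G R L" "q \<in> ghom G R L A" "q ` carrier L = carrier A"
   using cover[OF A] by blast
  note gL = flat_graded[OF L(1)]
  let ?N = "submod L (a_kernel L A q)"
  have se: "short_exact G R ?N L A (\<lambda>x. x) q" by (rule short_exact_of_epi[OF gL A L(2,3)])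
  note n = short_exactD[OF se]
  obtain l where l: "l \<in> carrier (tensor G R L Z)" "tensor_map R A Z q l = w"
   using tensor_map_surj[OF gL A s(1) L(2,3) w(1)] by blast
  let ?m = "rmap G R L Z Q i l"
  have m: "?m \<in> carrier (tensor G R L Q)" by (rule addhom_closed[OF rmap_props(1)[OF gL s(1,2,4)] l(1)])
  have "tensor_map R A Q q ?m = \<zero>\<^bsub>tensor G R A Q\<^esub>"
   using map_rmap[OF gL A s(1,2) L(2) s(4) l(1)] l(2) w(2) by simp
  then obtain t where t: "t \<in> carrier (tensor G R ?N Q)" "tensor_map R L Q (\<lambda>x. x) t = ?m"
   using tensor_right_exact[OF se s(2) m] by blast
  have "tensor_map R L P (\<lambda>x. x) (rmap G R ?N Q P p t) = rmap G R L Q P p ?m"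
   using map_rmap[OF n(1,2) s(2,3) n(4) s(5) t(1)] t(2) by simp
  also have "\<dots> = rmap G R L Z P (\<lambda>x. p (i x)) l" by (rule rmap_comp[OF gL s(1,2,3,4,5) l(1)])
  also have "\<dots> = \<zero>\<^bsub>tensor G R L P\<^esub>" by (rule rmap_null[OF gL s(1,3) gh_comp[OF s(4,5)] s(9) l(1)])
  \<comment> \<open>The image of \<open>t\<close> in the tensor product of \<open>L\<close> and
    \<open>P\<close> is zero; flatness of \<open>P\<close> brings this back to \<open>?N\<close>, so
    \<open>t\<close> comes from \<open>Z\<close>.\<close>
  finally have "rmap G R ?N Q P p t = \<zero>\<^bsub>tensor G R ?N P\<^esub>"
   by (rule flatD[OF P n(1,2,4,6) inj_on_id inj_on_id addhom_closed[OF rmap_props(1)[OF n(1) s(2,3,5)] t(1)]])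
  then obtain t' where t': "t' \<in> carrier (tensor G R ?N Z)" "rmap G R ?N Z Q i t' = t"
   using rmap_exact[OF e n(1) t(1)] by blast
  let ?k = "tensor_map R L Z (\<lambda>x. x) t'"
  have k: "?k \<in> carrier (tensor G R L Z)" by (rule addhom_closed[OF tensor_map_addhom'[OF n(1,2) s(1) n(4)] t'(1)])
  interpret TL: abelian_group "tensor G R L Z" by (rule tensor_ag[OF gL s(1)])
  interpret TQ: abelian_group "tensor G R L Q" by (rule tensor_ag[OF gL s(2)])
  \<comment> \<open>Both \<open>l\<close> and \<open>?k\<close> have the image \<open>?m\<close>, so
    they agree by flatness of \<open>L\<close>. But \<open>?k\<close> comes from the kernel
    \<open>?N\<close> of \<open>q\<close>, so it dies over \<open>A\<close>, and with it
    \<open>w\<close>.\<close>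
  have "rmap G R L Z Q i ?k = ?m"
   using map_rmap[OF n(1,2) s(1,2) n(4) s(4) t'(1)] t'(2) t(2) by simp
  hence "rmap G R L Z Q i (l \<ominus>\<^bsub>tensor G R L Z\<^esub> ?k) = \<zero>\<^bsub>tensor G R L Q\<^esub>"
   using addhom_diff[OF TL.abelian_group_axioms TQ.abelian_group_axioms rmap_props(1)[OF gL s(1,2,4)] l(1) k]
    TQ.diff_zero_iff[OF m m] by simp
  hence "l \<ominus>\<^bsub>tensor G R L Z\<^esub> ?k = \<zero>\<^bsub>tensor G R L Z\<^esub>"
   by (rule rmap_inj_flat[OF L(1) s(1,2,4,6) TL.minus_closed[OF l(1) k]])
  hence "l = ?k" using TL.diff_zero_iff[OF l(1) k] by simp
  hence "w = tensor_map R A Z q ?k" using l(2) by simp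
  also have "\<dots> = tensor_map R A Z (\<lambda>x. q x) t'" by (rule tensor_map_comp[OF n(1,2,3) s(1) n(4,5) t'(1)])
  also have "\<dots> = \<zero>\<^bsub>tensor G R A Z\<^esub>"
  proof -
   have qN: "q \<in> ghom G R ?N A" using gh_comp[OF n(4,5)] by simp
   show ?thesis
    by (rule tensor_ext[OF n(1) s(1) tensor_ag[OF A s(1)] tensor_map_addhom'[OF n(1) A s(1) qN]
       gh_addhom[OF graded_hom_zero[OF tensor_graded[OF n(1) s(1)] tensor_graded[OF A s(1)]]] _ t'(1)])
     (simp add: tensor_map_pt'[OF n(1) A s(1) qN] n(9) tensor_modules.pt_zero_left[OF tensor_modulesI[OF A s(1)], where G = G])
  qed
  finally show ?thesis .
 qed
 show ?thesis
 proof (rule flatI[OF s(1)])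
  fix A B :: "('g,'r,'u) gmodule" and f
  assume A: "gmod G R A" and B: "gmod G R B" and f: "f \<in> ghom G R A B" "inj_on f (carrier A)"
  show "inj_on (tensor_map R B Z f) (carrier (tensor G R A Z))"
   unfolding gh_inj_iff[OF tensor_graded[OF A s(1)] tensor_graded[OF B s(1)] tensor_map_hom[OF A B s(1) f(1)]]
  proof (intro ballI impI)
   fix z assume z: "z \<in> carrier (tensor G R A Z)" "tensor_map R B Z f z = \<zero>\<^bsub>tensor G R B Z\<^esub>"
   let ?w = "rmap G R A Z Q i z"
   have w: "?w \<in> carrier (tensor G R A Q)" by (rule addhom_closed[OF rmap_props(1)[OF A s(1,2,4)] z(1)])
   have "tensor_map R B Q f ?w = \<zero>\<^bsub>tensor G R B Q\<^esub>"
    using map_rmap[OF A B s(1,2) f(1) s(4) z(1)] z(2)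
     addhom_zero[OF tensor_ag[OF B s(1)] tensor_ag[OF B s(2)] rmap_props(1)[OF B s(1,2,4)]] by simp
   hence "?w = \<zero>\<^bsub>tensor G R A Q\<^esub>" by (rule flatD[OF Q A B f inj_on_id inj_on_id w])
   thus "z = \<zero>\<^bsub>tensor G R A Z\<^esub>" by (rule pure[OF A z(1)])
  qed
 qed
qed

lemma flat_zero:
 fixes X :: "('g,'r,'u) gmodule"
 assumes X: "gmod G R X" "carrier X = {\<zero>\<^sub>X}"
 shows "flat G R X"
proof (rule flatI[OF X(1)])
 fix A B :: "('g,'r,'u) gmodule" and f
 assume A: "gmod G R A" and B: "gmod G R B" and f: "f \<in> ghom G R A B" "inj_on f (carrier A)"
 interpret X: tensor_modules R A X by (rule tensor_modulesI[OF A X(1)])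
 interpret T: abelian_group "tensor G R A X" by (rule X.tensor_abelian)
 have "z = \<zero>\<^bsub>tensor G R A X\<^esub>" if "z \<in> carrier (tensor G R A X)" for z
  using that
 proof (induction rule: X.tensor_induct)
  case (pure x y)
  thus ?case using X.pt_zero_right[where G = G] X(2) by simp
 qed simp_all
 thus "inj_on (tensor_map R B X f) (carrier (tensor G R A X))" by (intro inj_onI) metis
qed

lemma module_class_flat: "module_class G R (flat G R :: ('g,'r,'u) gmodule => bool)"
proof (rule module_class.intro)
 show "flat G R Y" if "flat G R X" "gmod G R Y" "giso G R X Y u v"
  for X Y :: "('g,'r,'u) gmodule" and u v
  by (rule flat_retract[OF that(1,2) gisoD(2,1,4)[OF that(3)]])
qed (auto simp: flat_graded flat_zero)

section \<open>Free graded modules\<close>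

text \<open>A direct sum of shifted copies of the ring, the basis element of index \<open>i\<close>
  having degree \<open>d i\<close>. Functions vanish off \<open>I\<close>, so the type of indices
  may be larger than \<open>I\<close>.\<close>

definition freem :: "('g,'x) monoid_scheme => ('g,'r) gring => 'i set => ('i => 'g) => ('g,'r,'i => 'r) gmodule" where
 "freem G R I d = (let C = {l. finite {i. l i \<noteq> \<zero>\<^sub>R} \<and> (\<forall>i. l i \<in> carrier R) \<and> (\<forall>i. i \<notin> I \<longrightarrow> l i = \<zero>\<^sub>R)} in
   \<lparr>carrier = C, monoid.mult = undefined, monoid.one = undefined,
   ring.zero = (\<lambda>_. \<zero>\<^sub>R), ring.add = (\<lambda>l m i. l i \<oplus>\<^sub>R m i),
   module.smult = (\<lambda>r l i. r \<otimes>\<^sub>R l i),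
   mcomp = (\<lambda>g. {l \<in> C. \<forall>i\<in>I. l i \<in> rcomp R (inv\<^bsub>G\<^esub> d i \<otimes>\<^sub>G g)})\<rparr>)"

lemma freem_simps:
 "carrier (freem G R I d) = {l. finite {i. l i \<noteq> \<zero>\<^sub>R} \<and> (\<forall>i. l i \<in> carrier R) \<and> (\<forall>i. i \<notin> I \<longrightarrow> l i = \<zero>\<^sub>R)}"
 "\<zero>\<^bsub>freem G R I d\<^esub> = (\<lambda>_. \<zero>\<^sub>R)" "l \<oplus>\<^bsub>freem G R I d\<^esub> m = (\<lambda>i. l i \<oplus>\<^sub>R m i)"
 "r \<odot>\<^bsub>freem G R I d\<^esub> l = (\<lambda>i. r \<otimes>\<^sub>R l i)"
 "mcomp (freem G R I d) g = {l \<in> carrier (freem G R I d). \<forall>i\<in>I. l i \<in> rcomp R (inv\<^bsub>G\<^esub> d i \<otimes>\<^sub>G g)}"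
 by (simp_all add: freem_def Let_def)

context graded_ring
begin

definition basis :: "'i => 'i => 'r" where
 "basis i = (\<lambda>j. if j = i then \<one>\<^sub>R else \<zero>\<^sub>R)"

context
 fixes I :: "'i set" and d :: "'i => 'g"
 assumes d: "\<And>i. i \<in> I ==> d i \<in> carrier G"
begin

abbreviation "L \<equiv> freem G R I d"

lemma freem_closed:
 "(\<lambda>_. \<zero>\<^sub>R) \<in> carrier L"
 "[|l \<in> carrier L; m \<in> carrier L|] ==> (\<lambda>i. l i \<oplus>\<^sub>R m i) \<in> carrier L"
 "[|r \<in> carrier R; l \<in> carrier L|] ==> (\<lambda>i. r \<otimes>\<^sub>R l i) \<in> carrier L"
 "l \<in> carrier L ==> (\<lambda>i. \<ominus>\<^sub>R l i) \<in> carrier L"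
proof -
 show "(\<lambda>_. \<zero>\<^sub>R) \<in> carrier L" by (simp add: freem_simps)
 show "(\<lambda>i. l i \<oplus>\<^sub>R m i) \<in> carrier L" if "l \<in> carrier L" "m \<in> carrier L"
 proof -
  have "{i. l i \<oplus>\<^sub>R m i \<noteq> \<zero>\<^sub>R} \<subseteq> {i. l i \<noteq> \<zero>\<^sub>R} \<union> {i. m i \<noteq> \<zero>\<^sub>R}" by auto
  moreover have "finite ({i. l i \<noteq> \<zero>\<^sub>R} \<union> {i. m i \<noteq> \<zero>\<^sub>R})" using that by (simp add: freem_simps(1))
  ultimately have "finite {i. l i \<oplus>\<^sub>R m i \<noteq> \<zero>\<^sub>R}" by (rule finite_subset)
  thus ?thesis using that by (simp add: freem_simps(1))
 qed
 show "(\<lambda>i. r \<otimes>\<^sub>R l i) \<in> carrier L" if "r \<in> carrier R" "l \<in> carrier L"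
 proof -
  have "{i. r \<otimes>\<^sub>R l i \<noteq> \<zero>\<^sub>R} \<subseteq> {i. l i \<noteq> \<zero>\<^sub>R}" using that(1) by auto
  moreover have "finite {i. l i \<noteq> \<zero>\<^sub>R}" using that by (simp add: freem_simps(1))
  ultimately have "finite {i. r \<otimes>\<^sub>R l i \<noteq> \<zero>\<^sub>R}" by (rule finite_subset)
  thus ?thesis using that by (simp add: freem_simps(1))
 qed
 show "(\<lambda>i. \<ominus>\<^sub>R l i) \<in> carrier L" if "l \<in> carrier L"
 proof -
  have "{i. \<ominus>\<^sub>R l i \<noteq> \<zero>\<^sub>R} \<subseteq> {i. l i \<noteq> \<zero>\<^sub>R}" by auto
  moreover have "finite {i. l i \<noteq> \<zero>\<^sub>R}" using that by (simp add: freem_simps(1))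
  ultimately have "finite {i. \<ominus>\<^sub>R l i \<noteq> \<zero>\<^sub>R}" by (rule finite_subset)
  thus ?thesis using that by (simp add: freem_simps(1))
 qed
qed

lemma freem_val: "l \<in> carrier L ==> l i \<in> carrier R"
 by (simp add: freem_simps(1))

lemma freem_module: "module R L"
proof (rule moduleI[OF R.is_cring])
 show "abelian_group L"
 proof (rule abelian_groupI)
  fix x assume x: "x \<in> carrier L"
  thus "\<exists>y\<in>carrier L. y \<oplus>\<^sub>L x = \<zero>\<^sub>L"
   using freem_closed(4)[OF x] freem_val[OF x] by (intro bexI[of _ "\<lambda>i. \<ominus>\<^sub>R x i"]) (auto simp: freem_simps(2,3) R.l_neg)
 qed (auto simp: freem_closed freem_simps(2,3) freem_val R.a_assoc intro!: ext R.a_comm)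
qed (auto simp: freem_closed freem_simps(3,4) freem_val R.l_distr R.r_distr R.m_assoc)

lemma freem_graded: "gmod G R L"
proof -
 let ?p = "\<lambda>g l i. if i \<in> I then rc G R (l i) (inv\<^bsub>G\<^esub> d i \<otimes>\<^sub>G g) else \<zero>\<^sub>R"
 have dg: "inv\<^bsub>G\<^esub> d i \<otimes>\<^sub>G g \<in> carrier G" if "i \<in> I" "g \<in> carrier G" for i g using d that by simp
 have pB: "?p g l \<in> mcomp L g" if g: "g \<in> carrier G" and l: "l \<in> carrier L" for g l
 proof -
  have "{i. ?p g l i \<noteq> \<zero>\<^sub>R} \<subseteq> {i. l i \<noteq> \<zero>\<^sub>R}" using RD.dcomp_zero by auto
  moreover have "finite {i. l i \<noteq> \<zero>\<^sub>R}" using l by (simp add: freem_simps(1))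
  ultimately have "finite {i. ?p g l i \<noteq> \<zero>\<^sub>R}" by (rule finite_subset)
  thus ?thesis using RD.dcomp_in dg g freem_val[OF l] by (simp add: freem_simps(5,1))
 qed
 show ?thesis
 proof (rule graded_moduleI(1)[OF graded_ring_axioms freem_module, where p = ?p])
  show "?p g \<in> addhom L L" if "g \<in> carrier G" for g
  proof (rule addhomI)
   fix x y assume "x \<in> carrier L" "y \<in> carrier L"
   thus "?p g (x \<oplus>\<^sub>L y) = ?p g x \<oplus>\<^sub>L ?p g y" by (auto simp: freem_simps(3) RD.dcomp_add freem_val)
  qed (use pB that in \<open>simp add: freem_simps(5)\<close>)
  show "?p h x = (if h = g then x else \<zero>\<^sub>L)"
   if g: "g \<in> carrier G" and h: "h \<in> carrier G" and x: "x \<in> mcomp L g" for g h x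
  proof
   fix i
   show "?p h x i = (if h = g then x else \<zero>\<^sub>L) i"
   proof (cases "i \<in> I")
    case True
    have "x i \<in> rcomp R (inv\<^bsub>G\<^esub> d i \<otimes>\<^sub>G g)" using x True by (simp add: freem_simps(5))
    moreover have "inv\<^bsub>G\<^esub> d i \<otimes>\<^sub>G h = inv\<^bsub>G\<^esub> d i \<otimes>\<^sub>G g \<longleftrightarrow> h = g" using d[OF True] g h by simp
    ultimately show ?thesis using RD.dcomp_hom'[OF _ dg[OF True g]] True by (simp add: freem_simps(2))
   qed (use x in \<open>simp add: freem_simps(1,2,5)\<close>)
  qed
  show "finite {g \<in> carrier G. ?p g x \<noteq> \<zero>\<^sub>L}" if x: "x \<in> carrier L" for x
  proof (rule finite_subset)
   let ?F = "\<Union>i\<in>{i. x i \<noteq> \<zero>\<^sub>R}. (\<otimes>\<^bsub>G\<^esub>) (d i) ` {s. rc G R (x i) s \<noteq> \<zero>\<^sub>R}"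
   show "finite ?F" using x RD.dcomp_finite[OF freem_val[OF x]] by (simp add: freem_simps(1))
   show "{g \<in> carrier G. ?p g x \<noteq> \<zero>\<^sub>L} \<subseteq> ?F"
   proof
    fix g assume g: "g \<in> {g \<in> carrier G. ?p g x \<noteq> \<zero>\<^sub>L}"
    then obtain i where i: "?p g x i \<noteq> \<zero>\<^sub>R" by (force simp: freem_simps(2))
    hence i': "i \<in> I" "rc G R (x i) (inv\<^bsub>G\<^esub> d i \<otimes>\<^sub>G g) \<noteq> \<zero>\<^sub>R" by (auto split: if_splits)
    hence "x i \<noteq> \<zero>\<^sub>R" using RD.dcomp_zero by auto
    moreover have "g = d i \<otimes>\<^sub>G (inv\<^bsub>G\<^esub> d i \<otimes>\<^sub>G g)" using d[OF i'(1)] g by (simp add: G.m_assoc[symmetric])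
    ultimately show "g \<in> ?F" using i'(2) by blast
   qed
  qed
  show "x = \<zero>\<^sub>L" if x: "x \<in> carrier L" and 0: "\<And>g. g \<in> carrier G ==> ?p g x = \<zero>\<^sub>L" for x
  proof
   fix i
   show "x i = \<zero>\<^sub>L i"
   proof (cases "i \<in> I")
    case True
    have "x i = \<zero>\<^sub>R"
    proof (rule RD.dcomp_ext[OF freem_val[OF x] R.zero_closed])
     fix s assume s: "s \<in> carrier G"
     have "inv\<^bsub>G\<^esub> d i \<otimes>\<^sub>G (d i \<otimes>\<^sub>G s) = s" using d[OF True] s by (simp add: G.m_assoc[symmetric])
     thus "rc G R (x i) s = rc G R \<zero>\<^sub>R s"
      using fun_cong[OF 0[of "d i \<otimes>\<^sub>G s"], of i] d[OF True] s True by (simp add: freem_simps(2) RD.dcomp_zero)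
    qed
    thus ?thesis by (simp add: freem_simps(2))
   qed (use x in \<open>simp add: freem_simps(1,2)\<close>)
  qed
  show "r \<odot>\<^sub>L x \<in> mcomp L (s \<otimes>\<^sub>G g)"
   if s: "s \<in> carrier G" and g: "g \<in> carrier G" and r: "r \<in> rcomp R s" and x: "x \<in> mcomp L g" for s g r x
  proof -
   have xL: "x \<in> carrier L" using x by (simp add: freem_simps(5))
   have "r \<otimes>\<^sub>R x i \<in> rcomp R (inv\<^bsub>G\<^esub> d i \<otimes>\<^sub>G (s \<otimes>\<^sub>G g))" if i: "i \<in> I" for i
   proof -
    have "r \<otimes>\<^sub>R x i \<in> rcomp R (s \<otimes>\<^sub>G (inv\<^bsub>G\<^esub> d i \<otimes>\<^sub>G g))"
     using rcomp_mult[OF s dg[OF i g] r] x i by (simp add: freem_simps(5))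
    thus ?thesis using s g d[OF i] by (simp add: G.m_ac)
   qed
   thus ?thesis using freem_closed(3)[OF RD.B_carr[OF r s] xL] by (simp add: freem_simps(4,5))
  qed
  show "mcomp L g \<subseteq> carrier L" for g by (auto simp: freem_simps(5))
  show "\<zero>\<^sub>L \<in> mcomp L g" if "g \<in> carrier G" for g
   using freem_closed(1) RD.B_zero dg that by (simp add: freem_simps(2,5))
  show "x \<oplus>\<^sub>L y \<in> mcomp L g" if "g \<in> carrier G" "x \<in> mcomp L g" "y \<in> mcomp L g" for g x y
   using that freem_closed(2) RD.B_add dg by (simp add: freem_simps(3,5))
 qed (rule pB)
qed

lemma basis_mem: "i \<in> I ==> basis i \<in> mcomp L (d i)"
proof -
 assume i: "i \<in> I"
 have "finite {j. basis i j \<noteq> \<zero>\<^sub>R}" by (rule finite_subset[of _ "{i}"]) (auto simp: basis_def)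
 hence "basis i \<in> carrier L" using i by (auto simp: freem_simps(1) basis_def)
 moreover have "basis i j \<in> rcomp R (inv\<^bsub>G\<^esub> d j \<otimes>\<^sub>G d i)" if "j \<in> I" for j
  using d[OF i] d[OF that] one_homogeneous RD.B_zero by (auto simp: basis_def)
 ultimately show ?thesis by (simp add: freem_simps(5))
qed

lemma basis_carrier: "i \<in> I ==> basis i \<in> carrier L"
 using basis_mem by (simp add: freem_simps(5))

lemma freem_induct [consumes 1, case_names zero basis add]:
 assumes l: "l \<in> carrier L" and z: "P \<zero>\<^sub>L" and b: "\<And>r i. [|r \<in> carrier R; i \<in> I|] ==> P (r \<odot>\<^sub>L basis i)"
  and a: "\<And>l m. [|l \<in> carrier L; m \<in> carrier L; P l; P m|] ==> P (l \<oplus>\<^sub>L m)"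
 shows "P l"
proof -
 have "P l" if "finite F" "{i. l i \<noteq> \<zero>\<^sub>R} \<subseteq> F" "l \<in> carrier L" for F l
  using that
 proof (induction F arbitrary: l)
  case empty
  hence "l = \<zero>\<^sub>L" by (auto simp: freem_simps(2))
  thus ?case using z by simp
 next
  case (insert i F)
  let ?m = "\<lambda>j. if j = i then \<zero>\<^sub>R else l j"
  show ?case
  proof (cases "i \<in> I")
   case True
   have "{j. ?m j \<noteq> \<zero>\<^sub>R} \<subseteq> {j. l j \<noteq> \<zero>\<^sub>R}" by auto
   moreover have "finite {j. l j \<noteq> \<zero>\<^sub>R}" using insert.prems by (simp add: freem_simps(1))
   ultimately have "finite {j. ?m j \<noteq> \<zero>\<^sub>R}" by (rule finite_subset)
   hence m: "?m \<in> carrier L" using insert.prems by (simp add: freem_simps(1))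
   have "{j. ?m j \<noteq> \<zero>\<^sub>R} \<subseteq> F" using insert.prems by auto
   hence Pm: "P ?m" by (rule insert.IH[OF _ m])
   have li: "l i \<in> carrier R" using freem_val insert.prems by blast
   have l_eq: "l = (l i \<odot>\<^sub>L basis i) \<oplus>\<^sub>L ?m"
    using freem_val[OF insert.prems(2)] by (auto simp: freem_simps(3,4) basis_def)
   have "l i \<odot>\<^sub>L basis i \<in> carrier L"
    using freem_closed(3)[OF li basis_carrier[OF True]] by (simp add: freem_simps(4))
   hence "P ((l i \<odot>\<^sub>L basis i) \<oplus>\<^sub>L ?m)" by (rule a[OF _ m b[OF li True] Pm])
   thus ?thesis by (simp only: l_eq[symmetric])
  next
   case False
   hence "l i = \<zero>\<^sub>R" using insert.prems by (simp add: freem_simps(1))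
   hence "{j. l j \<noteq> \<zero>\<^sub>R} \<subseteq> F" using insert.prems by auto
   thus ?thesis using insert.IH insert.prems by blast
  qed
 qed
 thus ?thesis using l by (auto simp: freem_simps(1))
qed

lemma freem_universal:
 assumes A: "gmod G R A" and a: "\<And>i. i \<in> I ==> a i \<in> mcomp A (d i)"
 obtains w where "w \<in> ghom G R L A" "\<And>i. i \<in> I ==> w (basis i) = a i"
proof -
 interpret A: graded_module G R A by fact
 define b where "b i = (if i \<in> I then a i else \<zero>\<^sub>A)" for i
 have b: "b i \<in> carrier A" for i using A.MD.B_carr[OF a d] by (simp add: b_def)
 define w where "w l = finsum A (\<lambda>i. l i \<odot>\<^sub>A b i) {i. l i \<noteq> \<zero>\<^sub>R}" for l
 have wF: "w l = finsum A (\<lambda>i. l i \<odot>\<^sub>A b i) F" if "l \<in> carrier L" "finite F" "{i. l i \<noteq> \<zero>\<^sub>R} \<subseteq> F" for l F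
  unfolding w_def
  by (rule A.M.add.finprod_mono_neutral_cong_left) (use that b freem_val[OF that(1)] in auto)
 have fin: "finite {i. l i \<noteq> \<zero>\<^sub>R}" if "l \<in> carrier L" for l using that by (simp add: freem_simps(1))
 have wc: "w l \<in> carrier A" if "l \<in> carrier L" for l
  unfolding w_def by (rule A.M.finsum_closed) (use b freem_val[OF that] in auto)
 have w: "w \<in> ghom G R L A"
 proof (rule graded_homI0)
  fix l m assume l: "l \<in> carrier L" and m: "m \<in> carrier L"
  let ?F = "{i. l i \<noteq> \<zero>\<^sub>R} \<union> {i. m i \<noteq> \<zero>\<^sub>R}"
  have F: "finite ?F" using fin l m by simp
  have "w (l \<oplus>\<^sub>L m) = finsum A (\<lambda>i. (l \<oplus>\<^sub>L m) i \<odot>\<^sub>A b i) ?F"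
   by (rule wF) (use freem_closed(2)[OF l m] F in \<open>auto simp: freem_simps(3)\<close>)
  also have "\<dots> = finsum A (\<lambda>i. l i \<odot>\<^sub>A b i \<oplus>\<^sub>A m i \<odot>\<^sub>A b i) ?F"
   by (rule A.M.finsum_cong') (use b freem_val[OF l] freem_val[OF m] in \<open>auto simp: freem_simps(3) A.smult_l_distr\<close>)
  also have "\<dots> = finsum A (\<lambda>i. l i \<odot>\<^sub>A b i) ?F \<oplus>\<^sub>A finsum A (\<lambda>i. m i \<odot>\<^sub>A b i) ?F"
   by (rule A.M.finsum_addf) (use b freem_val[OF l] freem_val[OF m] in auto)
  also have "\<dots> = w l \<oplus>\<^sub>A w m" using wF[OF l F] wF[OF m F] by simp
  finally show "w (l \<oplus>\<^sub>L m) = w l \<oplus>\<^sub>A w m" .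
 next
  fix r l assume r: "r \<in> carrier R" and l: "l \<in> carrier L"
  have "w (r \<odot>\<^sub>L l) = finsum A (\<lambda>i. (r \<odot>\<^sub>L l) i \<odot>\<^sub>A b i) {i. l i \<noteq> \<zero>\<^sub>R}"
   by (rule wF) (use freem_closed(3)[OF r l] fin[OF l] r in \<open>auto simp: freem_simps(4)\<close>)
  also have "\<dots> = finsum A (\<lambda>i. r \<odot>\<^sub>A (l i \<odot>\<^sub>A b i)) {i. l i \<noteq> \<zero>\<^sub>R}"
   by (rule A.M.finsum_cong') (use b freem_val[OF l] r in \<open>auto simp: freem_simps(4) A.smult_assoc1\<close>)
  also have "\<dots> = r \<odot>\<^sub>A w l"
   unfolding w_def
   by (rule addhom_finsum[OF A.M.abelian_group_axioms A.M.abelian_group_axioms A.smult_addhom[OF r], symmetric])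
    (use b freem_val[OF l] in auto)
  finally show "w (r \<odot>\<^sub>L l) = r \<odot>\<^sub>A w l" .
 next
  fix g l assume g: "g \<in> carrier G" and l: "l \<in> mcomp L g"
  have lL: "l \<in> carrier L" using l by (simp add: freem_simps(5))
  have t: "l i \<odot>\<^sub>A b i \<in> mcomp A g" for i
  proof (cases "i \<in> I")
   case True
   have "l i \<odot>\<^sub>A b i \<in> mcomp A ((inv\<^bsub>G\<^esub> d i \<otimes>\<^sub>G g) \<otimes>\<^sub>G d i)"
    using A.mcomp_smult[of "inv\<^bsub>G\<^esub> d i \<otimes>\<^sub>G g" "d i" "l i" "b i"] l a[OF True] d[OF True] g True
    by (simp add: freem_simps(5) b_def)
   moreover have "(inv\<^bsub>G\<^esub> d i \<otimes>\<^sub>G g) \<otimes>\<^sub>G d i = g" using d[OF True] g by (simp add: G.m_ac)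
   ultimately show ?thesis by simp
  next
   case False
   thus ?thesis using A.MD.B_zero[OF g] freem_val[OF lL, of i] by (simp add: b_def)
  qed
  have "finsum A (\<lambda>i. l i \<odot>\<^sub>A b i) F \<in> mcomp A g" if "finite F" for F
   using that
  proof (induction F)
   case empty
   thus ?case using A.MD.B_zero[OF g] by simp
  next
   case (insert i F)
   thus ?case using A.MD.B_add[OF t _ g] b freem_val[OF lL] by simp
  qed
  thus "w l \<in> mcomp A g" unfolding w_def using fin[OF lL] by blast
 qed (rule wc)
 have "w (basis i) = a i" if i: "i \<in> I" for i
 proof -
  have "w (basis i) = finsum A (\<lambda>j. basis i j \<odot>\<^sub>A b j) {i}"
   by (rule wF[OF basis_carrier[OF i]]) (auto simp: basis_def)
  also have "\<dots> = a i" using i b[of i] by (simp add: basis_def b_def)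
  finally show ?thesis .
 qed
 thus ?thesis using that w by blast
qed

lemma freem_hom_eqI:
 assumes A: "gmod G R A" and f: "f \<in> ghom G R L A" and g: "g \<in> ghom G R L A"
  and eq: "\<And>i. i \<in> I ==> f (basis i) = g (basis i)" and l: "l \<in> carrier L"
 shows "f l = g l"
 using l
proof (induction rule: freem_induct)
 case zero
 thus ?case using gh_zero[OF freem_graded A f] gh_zero[OF freem_graded A g] by simp
next
 case (basis r i)
 thus ?case using gh_smult[OF f] gh_smult[OF g] basis_carrier eq by simp
next
 case (add l m)
 thus ?case using gh_add[OF f add(1,2)] gh_add[OF g add(1,2)] by simp
qed

text \<open>Surjections are surjective in each degree, so images of basis elements lift to elements
  of the same degrees, which extend to a graded homomorphism.\<close>

lemma freem_projective:
 fixes F :: "('g,'r,'u) gmodule"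
 assumes F: "gmod G R F" "giso G R L F u v"
 shows "projective G R F"
 unfolding projective_def
proof (intro conjI allI ballI impI F)
 note i = gisoD[OF F(2)]
 fix A B :: "('g,'r,'u) gmodule" and p f
 assume p: "p \<in> ghom G R A B" and f: "f \<in> ghom G R F B" and A: "gmod G R A"
  and B: "gmod G R B" and surj: "p ` carrier A = carrier B"
 have fu: "(\<lambda>l. f (u l)) \<in> ghom G R L B" by (rule gh_comp[OF i(1) f])
 have "\<exists>a. a \<in> mcomp A (d j) \<and> p a = f (u (basis j))" if j: "j \<in> I" for j
 proof (rule gh_homogeneous_preimage[OF A B p])
  show "f (u (basis j)) \<in> mcomp B (d j)" using gh_mcomp[OF fu d[OF j] basis_mem[OF j]] .
  show "f (u (basis j)) \<in> p ` carrier A" unfolding surj using gh_closed[OF fu basis_carrier[OF j]] .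
  show "d j \<in> carrier G" by (rule d[OF j])
 qed blast
 then obtain a where a: "\<And>j. j \<in> I ==> a j \<in> mcomp A (d j) \<and> p (a j) = f (u (basis j))" by metis
 obtain w where w: "w \<in> ghom G R L A" "\<And>j. j \<in> I ==> w (basis j) = a j"
  using freem_universal[OF A, of a] a by blast
 have "p (w l) = f (u l)" if "l \<in> carrier L" for l
  by (rule freem_hom_eqI[OF B gh_comp[OF w(1) p] fu _ that]) (simp add: w(2) a)
 thus "\<exists>w\<in>ghom G R F A. \<forall>x\<in>carrier F. p (w x) = f x"
  using i(4) gh_closed[OF i(2)] by (intro bexI[OF _ gh_comp[OF i(2) w(1)]]) simp
qed

text \<open>A tensor with a free module is the sum of its coordinates, elements of the other factor,
  tensored with basis elements. The coordinates are natural in that factor, so an injection does not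
  lose any of them.\<close>

lemma freem_tensor_inj:
 assumes A: "gmod G R A" and B: "gmod G R B" and f: "f \<in> ghom G R A B" "inj_on f (carrier A)"
  and z: "z \<in> carrier (tensor G R A L)" "tensor_map R B L f z = \<zero>\<^bsub>tensor G R B L\<^esub>"
 shows "z = \<zero>\<^bsub>tensor G R A L\<^esub>"
proof -
 note gL = freem_graded
 interpret A: graded_module G R A by fact
 interpret B: graded_module G R B by fact
 interpret TA: tensor_modules R A L by (rule tensor_modulesI[OF A gL])
 interpret TB: tensor_modules R B L by (rule tensor_modulesI[OF B gL])
 interpret T: abelian_group "tensor G R A L" by (rule TA.tensor_abelian)
 have "\<exists>t. t \<in> addhom (tensor G R A L) A \<and> (\<forall>x\<in>carrier A. \<forall>l\<in>carrier L. t (TA.pt x l) = l i \<odot>\<^sub>A x)" for i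
  by (rule TA.tensor_universal[where G = G, OF A.M.abelian_group_axioms, of "\<lambda>x l. l i \<odot>\<^sub>A x"])
   (auto simp: freem_val A.smult_r_distr A.smult_l_distr freem_simps(3,4) A.smult_assoc1[symmetric] R.m_comm)
 then obtain t where t: "\<And>i. t i \<in> addhom (tensor G R A L) A"
  "\<And>i x l. [|x \<in> carrier A; l \<in> carrier L|] ==> t i (TA.pt x l) = l i \<odot>\<^sub>A x" by metis
 have "\<exists>t. t \<in> addhom (tensor G R B L) B \<and> (\<forall>x\<in>carrier B. \<forall>l\<in>carrier L. t (TB.pt x l) = l i \<odot>\<^sub>B x)" for i
  by (rule TB.tensor_universal[where G = G, OF B.M.abelian_group_axioms, of "\<lambda>x l. l i \<odot>\<^sub>B x"])
   (auto simp: freem_val B.smult_r_distr B.smult_l_distr freem_simps(3,4) B.smult_assoc1[symmetric] R.m_comm)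
 then obtain t' where t': "\<And>i. t' i \<in> addhom (tensor G R B L) B"
  "\<And>i x l. [|x \<in> carrier B; l \<in> carrier L|] ==> t' i (TB.pt x l) = l i \<odot>\<^sub>B x" by metis
 have ft: "t' i (tensor_map R B L f z) = f (t i z)" for i
  by (rule TA.tensor_addhom_eqI[OF B.M.abelian_group_axioms addhom_comp[OF tensor_map_addhom'[OF A B gL f(1)] t'(1)]
     addhom_comp[OF t(1) gh_addhom[OF f(1)]] _ z(1)])
   (simp add: tensor_map_pt'[OF A B gL f(1)] t(2) t'(2) gh_closed[OF f(1)] gh_smult[OF f(1)] freem_val)
 have tz: "t i z = \<zero>\<^sub>A" for i
 proof -
  have "f (t i z) = \<zero>\<^sub>B"
   using ft[of i] z(2) addhom_zero[OF TB.tensor_abelian B.M.abelian_group_axioms t'(1)] by simp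
  thus ?thesis using gh_inj_zero[OF A B f addhom_closed[OF t(1) z(1)]] by simp
 qed
 let ?s = "\<lambda>z F. finsum (tensor G R A L) (\<lambda>i. TA.pt (t i z) (basis i)) F"
 \<comment> \<open>The expansion is required over every larger finite set as well, so that two
   tensors can be expanded over a common one when they are added.\<close>
 let ?P = "\<lambda>z. \<exists>F. finite F \<and> F \<subseteq> I \<and> (\<forall>F'. finite F' \<longrightarrow> F \<subseteq> F' \<longrightarrow> F' \<subseteq> I \<longrightarrow> z = ?s z F')"
 have ptc: "TA.pt (t i z) (basis i) \<in> carrier (tensor G R A L)" if "i \<in> I" "z \<in> carrier (tensor G R A L)" for i z
  by (rule TA.pt_closed[OF addhom_closed[OF t(1) that(2)] basis_carrier[OF that(1)]])
 have t0: "t i \<zero>\<^bsub>tensor G R A L\<^esub> = \<zero>\<^sub>A" for i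
  by (rule addhom_zero[OF TA.tensor_abelian A.M.abelian_group_axioms t(1)])
 have s0: "?s \<zero>\<^bsub>tensor G R A L\<^esub> F = \<zero>\<^bsub>tensor G R A L\<^esub>" if "F \<subseteq> I" for F
 proof -
  have "?s \<zero>\<^bsub>tensor G R A L\<^esub> F = finsum (tensor G R A L) (\<lambda>i. \<zero>\<^bsub>tensor G R A L\<^esub>) F"
   by (rule T.finsum_cong') (use that basis_carrier t0 TA.pt_zero_left[where G = G] in auto)
  thus ?thesis by simp
 qed
 have P0: "?P \<zero>\<^bsub>tensor G R A L\<^esub>" using s0 by (intro exI[of _ "{}"]) simp
 have Padd: "?P (u \<oplus>\<^bsub>tensor G R A L\<^esub> v)"
  if u: "u \<in> carrier (tensor G R A L)" "?P u" and v: "v \<in> carrier (tensor G R A L)" "?P v" for u v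
 proof -
  obtain F where F: "finite F" "F \<subseteq> I" "\<And>F'. [|finite F'; F \<subseteq> F'; F' \<subseteq> I|] ==> u = ?s u F'" using u(2) by blast
  obtain E where E: "finite E" "E \<subseteq> I" "\<And>F'. [|finite F'; E \<subseteq> F'; F' \<subseteq> I|] ==> v = ?s v F'" using v(2) by blast
  have "u \<oplus>\<^bsub>tensor G R A L\<^esub> v = ?s (u \<oplus>\<^bsub>tensor G R A L\<^esub> v) F'" if F': "finite F'" "F \<union> E \<subseteq> F'" "F' \<subseteq> I" for F'
  proof -
   have "?s (u \<oplus>\<^bsub>tensor G R A L\<^esub> v) F' = finsum (tensor G R A L)
     (\<lambda>i. TA.pt (t i u) (basis i) \<oplus>\<^bsub>tensor G R A L\<^esub> TA.pt (t i v) (basis i)) F'"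
   proof (rule T.finsum_cong')
    fix i assume "i \<in> F'"
    hence i: "i \<in> I" using F' by blast
    show "TA.pt (t i (u \<oplus>\<^bsub>tensor G R A L\<^esub> v)) (basis i) = TA.pt (t i u) (basis i) \<oplus>\<^bsub>tensor G R A L\<^esub> TA.pt (t i v) (basis i)"
     using addhom_add[OF t(1) u(1) v(1), of i]
      TA.pt_add_left[where G = G, OF addhom_closed[OF t(1) u(1)] addhom_closed[OF t(1) v(1)] basis_carrier[OF i], of i i] by simp
   qed (use ptc u(1) v(1) F'(3) in auto)
   also have "\<dots> = ?s u F' \<oplus>\<^bsub>tensor G R A L\<^esub> ?s v F'"
    by (rule T.finsum_addf) (use ptc u(1) v(1) F'(3) in auto)
   also have "\<dots> = u \<oplus>\<^bsub>tensor G R A L\<^esub> v" using F(3)[of F'] E(3)[of F'] F' by simp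
   finally show ?thesis by simp
  qed
  thus ?thesis using F(1,2) E(1,2) by (intro exI[of _ "F \<union> E"]) auto
 qed
 have "?P z"
  using z(1)
 proof (induction rule: TA.tensor_induct)
  case zero
  show ?case by (rule P0)
 next
  case (pure x l)
  from pure(2) show ?case
  proof (induction rule: freem_induct)
   case zero
   thus ?case using P0 TA.pt_zero_right[where G = G, OF pure(1)] by simp
  next
   case (basis r j)
   have rb: "r \<odot>\<^sub>L basis j \<in> carrier L" using freem_closed(3)[OF basis(1) basis_carrier[OF basis(2)]] by (simp add: freem_simps(4))
   have e: "TA.pt x (r \<odot>\<^sub>L basis j) = TA.pt (r \<odot>\<^sub>A x) (basis j)"
    by (rule TA.pt_smult[symmetric, OF basis(1) pure(1) basis_carrier[OF basis(2)]])
   have ti: "t i (TA.pt x (r \<odot>\<^sub>L basis j)) = (if i = j then r \<odot>\<^sub>A x else \<zero>\<^sub>A)" for i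
    using t(2)[OF pure(1) rb, of i] basis(1) pure(1) by (simp add: freem_simps(4) basis_def)
   have "TA.pt x (r \<odot>\<^sub>L basis j) = ?s (TA.pt x (r \<odot>\<^sub>L basis j)) F'" if F': "finite F'" "{j} \<subseteq> F'" "F' \<subseteq> I" for F'
   proof -
    have "?s (TA.pt x (r \<odot>\<^sub>L basis j)) F' = finsum (tensor G R A L) (\<lambda>i. if j = i then TA.pt (r \<odot>\<^sub>A x) (basis i) else \<zero>\<^bsub>tensor G R A L\<^esub>) F'"
     by (rule T.finsum_cong')
      (use F' ti basis(1) pure(1) basis_carrier TA.pt_closed[where G = G] TA.pt_zero_left[where G = G] in \<open>auto simp: subset_iff\<close>)
    also have "\<dots> = TA.pt (r \<odot>\<^sub>A x) (basis j)"
     by (rule T.add.finprod_singleton) (use F' basis(1) pure(1) basis_carrier TA.pt_closed[where G = G] in \<open>auto simp: subset_iff\<close>)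
    finally show ?thesis using e by simp
   qed
   thus ?case using basis(2) by (intro exI[of _ "{j}"]) simp
  next
   case (add l m)
   thus ?case
    using Padd[OF TA.pt_closed[OF pure(1) add(1)] add(3) TA.pt_closed[OF pure(1) add(2)] add(4)]
     TA.pt_add_right[where G = G, OF pure(1) add(1,2)] by simp
  qed
 next
  case (add u v)
  show ?case by (rule Padd[OF add(1,3,2,4)])
 qed
 then obtain F where "finite F \<and> F \<subseteq> I \<and> (\<forall>F'. finite F' \<longrightarrow> F \<subseteq> F' \<longrightarrow> F' \<subseteq> I \<longrightarrow> z = ?s z F')" by (rule exE)
 hence F: "F \<subseteq> I" "z = ?s z F" by simp_all
 have "?s z F = ?s \<zero>\<^bsub>tensor G R A L\<^esub> F" using tz t0 by simp
 thus ?thesis using F s0 by simp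
qed

lemma freem_flat:
 fixes F :: "('g,'r,'u) gmodule"
 assumes F: "gmod G R F" "giso G R L F u v"
 shows "flat G R F"
proof (rule flatI[OF F(1)])
 note i = gisoD[OF F(2)] and gL = freem_graded
 fix A B :: "('g,'r,'u) gmodule" and f
 assume A: "gmod G R A" and B: "gmod G R B" and f: "f \<in> ghom G R A B" "inj_on f (carrier A)"
 show "inj_on (tensor_map R B F f) (carrier (tensor G R A F))"
  unfolding gh_inj_iff[OF tensor_graded[OF A F(1)] tensor_graded[OF B F(1)] tensor_map_hom[OF A B F(1) f(1)]]
 proof (intro ballI impI)
  fix z assume z: "z \<in> carrier (tensor G R A F)" "tensor_map R B F f z = \<zero>\<^bsub>tensor G R B F\<^esub>"
  let ?w = "rmap G R A F L v z"
  have w: "?w \<in> carrier (tensor G R A L)" by (rule addhom_closed[OF rmap_props(1)[OF A F(1) gL i(2)] z(1)])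
  have "tensor_map R B L f ?w = \<zero>\<^bsub>tensor G R B L\<^esub>"
   using map_rmap[OF A B F(1) gL f(1) i(2) z(1)] z(2)
    addhom_zero[OF tensor_ag[OF B F(1)] tensor_ag[OF B gL] rmap_props(1)[OF B F(1) gL i(2)]] by simp
  hence "?w = \<zero>\<^bsub>tensor G R A L\<^esub>" by (rule freem_tensor_inj[OF A B f w])
  hence "rmap G R A L F u ?w = \<zero>\<^bsub>tensor G R A F\<^esub>"
   using addhom_zero[OF tensor_ag[OF A gL] tensor_ag[OF A F(1)] rmap_props(1)[OF A gL F(1) i(1)]] by simp
  moreover have "rmap G R A L F u ?w = z"
   using rmap_comp[OF A F(1) gL F(1) i(2,1) z(1)] rmap_ident[OF A F(1) gh_comp[OF i(2,1)] i(4) z(1)] by simp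
  ultimately show "z = \<zero>\<^bsub>tensor G R A F\<^esub>" by simp
 qed
qed

end

text \<open>One cover serves both classes, being projective and flat at once. It has a basis element
  for every nonzero homogeneous element of \<open>X\<close>.\<close>

lemma free_cover:
 fixes X :: "('g,'r,'u) gmodule" and le :: "'u list => 'u" and \<rho> :: "'r => 'u"
 assumes le: "inj le" and \<rho>: "inj \<rho>" and X: "gmod G R X"
 obtains F :: "('g,'r,'u) gmodule" and p where "projective G R F" "flat G R F" "p \<in> ghom G R F X"
  "p ` carrier F = carrier X"
proof -
 interpret X: graded_module G R X by fact
 \<comment> \<open>A nonzero homogeneous element determines its degree, so the second projection
   embeds the index set into \<open>'u\<close> whatever the size of \<open>'g\<close>.\<close>
 let ?I = "{(g, x). g \<in> carrier G \<and> x \<in> mcomp X g \<and> x \<noteq> \<zero>\<^sub>X}"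
 have d: "fst i \<in> carrier G" if "i \<in> ?I" for i using that by auto
 let ?L = "freem G R ?I fst"
 have snd_inj: "inj_on snd ?I"
 proof (rule inj_onI)
  fix p q assume pq: "p \<in> ?I" "q \<in> ?I" "snd p = snd q"
  hence *: "snd p \<in> mcomp X (fst p)" "snd p \<in> mcomp X (fst q)" "snd p \<noteq> \<zero>\<^sub>X" "fst p \<in> carrier G" "fst q \<in> carrier G" by auto
  have "fst p = fst q"
   using X.MD.dcomp_hom'[OF *(1,4), of "fst q"] X.MD.dcomp_hom'[OF *(2,5), of "fst q"] *(3) by metis
  thus "p = q" using pq(3) by (simp add: prod_eq_iff)
 qed
 have "\<exists>\<phi> :: ('g \<times> 'u => 'r) => 'u. inj_on \<phi> (carrier ?L)"
  by (rule finsupp_small[where z = "\<zero>\<^sub>R", OF le snd_inj \<rho>]) (auto simp: freem_simps(1))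
 then obtain \<phi> :: "('g \<times> 'u => 'r) => 'u" where \<phi>: "inj_on \<phi> (carrier ?L)" by blast
 obtain F :: "('g,'r,'u) gmodule" and v where F: "gmod G R F" "giso G R ?L F \<phi> v"
  using transport[OF freem_graded[OF d] \<phi>] by blast
 note i = gisoD[OF F(2)]
 obtain w where w: "w \<in> ghom G R ?L X" "\<And>i. i \<in> ?I ==> w (basis i) = snd i"
 proof (rule freem_universal[where I = ?I and d = fst and a = snd, OF _ X])
  show "snd i \<in> mcomp X (fst i)" if "i \<in> ?I" for i using that by auto
 qed (use d that in blast)+
 have z0: "\<zero>\<^sub>X \<in> w ` carrier ?L"
 proof (rule image_eqI)
  show "\<zero>\<^bsub>?L\<^esub> \<in> carrier ?L" unfolding freem_simps(2) by (rule freem_closed(1)[OF d])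
  show "\<zero>\<^sub>X = w \<zero>\<^bsub>?L\<^esub>" by (rule gh_zero[OF freem_graded[OF d] X w(1), symmetric])
 qed
 have surj: "x \<in> w ` carrier ?L" if "x \<in> carrier X" for x
  using that
 proof (induction rule: X.MD.sum_induct)
  case zero
  thus ?case using z0 by simp
 next
  case (hom g x)
  show ?case
  proof (cases "x = \<zero>\<^sub>X")
   case True
   thus ?thesis using z0 by simp
  next
   case False
   hence "(g, x) \<in> ?I" using hom by simp
   hence "x = w (basis (g, x))" "basis (g, x) \<in> carrier ?L"
    using w(2)[of "(g, x)"] basis_carrier[where I = ?I and d = fst and i = "(g, x)", OF d] by simp_all
   thus ?thesis by (rule image_eqI)
  qed
 next
  case (add x y)
  then obtain l m where lm: "l \<in> carrier ?L" "x = w l" "m \<in> carrier ?L" "y = w m" by blast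
  have "l \<oplus>\<^bsub>?L\<^esub> m \<in> carrier ?L" using freem_closed(2)[OF d lm(1,3)] by (simp add: freem_simps(3))
  thus ?case using gh_add[OF w(1) lm(1,3)] lm(2,4) by (intro image_eqI[of _ w "l \<oplus>\<^bsub>?L\<^esub> m"]) simp_all
 qed
 show ?thesis
 proof (rule that[of F "\<lambda>x. w (v x)"])
  show "projective G R F" by (rule freem_projective[OF d F])
  show "flat G R F" by (rule freem_flat[OF d F])
  show "(\<lambda>x. w (v x)) \<in> ghom G R F X" by (rule gh_comp[OF i(2) w(1)])
  have "v ` carrier F = carrier ?L" using gisoD(6)[OF giso_sym[OF F(2)]] .
  moreover have "w ` carrier ?L = carrier X" using surj gh_closed[OF w(1)] by blast
  ultimately show "(\<lambda>x. w (v x)) ` carrier F = carrier X" by (metis image_image)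
 qed
qed

end

section \<open>Coarsening of flat modules\<close>

context coarsening
begin

lemma tensor_free_coarsen: "tensor_free (cM A) (cM M) = tensor_free A M"
 by (simp add: tensor_free_def)

text \<open>The group underlying a tensor product does not involve graduations, so coarsening both
  factors leaves relations, cosets and induced maps literally unchanged.\<close>

lemma tensor_rel_coarsen: "tensor_rel cR (cM A) (cM M) = tensor_rel R A M"
 by (simp add: tensor_rel_def tensor_free_coarsen)

lemma tensor_coarsen:
 "carrier (tensor H cR (cM A) (cM M)) = carrier (tensor G R A M)"
 "\<zero>\<^bsub>tensor H cR (cM A) (cM M)\<^esub> = \<zero>\<^bsub>tensor G R A M\<^esub>"
 "tensor_map cR (cM B) (cM M) f = tensor_map R B M f"
proof -
 show "carrier (tensor H cR (cM A) (cM M)) = carrier (tensor G R A M)"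
  "\<zero>\<^bsub>tensor H cR (cM A) (cM M)\<^esub> = \<zero>\<^bsub>tensor G R A M\<^esub>"
  by (simp_all add: tensor_def Let_def tensor_free_coarsen tensor_rel_coarsen)
 show "tensor_map cR (cM B) (cM M) f = tensor_map R B M f"
  by (rule ext) (simp add: tensor_map_def tensor_free_coarsen tensor_rel_coarsen)
qed

lemma flat_reflect:
 fixes M :: "('g,'r,'u) gmodule"
 assumes M: "gmod G R M" and fl: "flat H cR (cM M)"
 shows "flat G R M"
proof (rule flatI[OF M])
 fix A B :: "('g,'r,'u) gmodule" and f
 assume A: "gmod G R A" and B: "gmod G R B" and f: "f \<in> ghom G R A B" "inj_on f (carrier A)"
 show "inj_on (tensor_map R B M f) (carrier (tensor G R A M))"
  unfolding gh_inj_iff[OF tensor_graded[OF A M] tensor_graded[OF B M] tensor_map_hom[OF A B M f(1)]]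
 proof (intro ballI impI)
  fix z assume z: "z \<in> carrier (tensor G R A M)" "tensor_map R B M f z = \<zero>\<^bsub>tensor G R B M\<^esub>"
  have "z = \<zero>\<^bsub>tensor H cR (cM A) (cM M)\<^esub>"
   by (rule flatD[OF fl cM_graded(1)[OF A] cM_graded(1)[OF B] hom_cM[OF A B f(1)] _ inj_on_id inj_on_id])
    (use f(2) z in \<open>simp_all add: tensor_coarsen\<close>)
  thus "z = \<zero>\<^bsub>tensor G R A M\<^esub>" by (simp add: tensor_coarsen)
 qed
qed

text \<open>
  For an \<open>H\<close>-graded module \<open>A\<close> and a \<open>G\<close>-graded module \<open>M\<close>, the component of degree \<open>\<psi> g\<close> of the
  tensor product of \<open>A\<close> with the coarsening of \<open>M\<close> is a retract of the tensor product of \<open>cind S A\<close> and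
  \<open>M\<close>: a tensor of \<open>a\<close> with \<open>y\<close> of degree \<open>k\<close> is sent to that of the component of degree
  \<open>\<psi> (g - k)\<close> of \<open>a\<close>, placed in degree \<open>g - k\<close>, with \<open>y\<close>.
\<close>

context
 fixes S :: "'g set" and g :: 'g and M :: "('g,'r,'m) gmodule"
 assumes S: "stable S" "subgroup S G" "g \<in> S" and M: "gmod G R M"
  and supp: "\<And>k. [|k \<in> carrier G; k \<notin> S|] ==> mcomp M k = {\<zero>\<^sub>M}"
begin

interpretation M: graded_module G R M by (rule M)

abbreviation "TH A \<equiv> tensor H cR A (cM M)"
abbreviation "TG A \<equiv> tensor G R (cind S A) M"
abbreviation "ptH A \<equiv> pure_tensor cR A (cM M)"
abbreviation "ptG A \<equiv> pure_tensor R (cind S A) M"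
abbreviation "piece A a k \<equiv> single A (g \<otimes>\<^sub>G inv\<^bsub>G\<^esub> k) (gc H A a (\<psi> (g \<otimes>\<^sub>G inv\<^bsub>G\<^esub> k)))"

lemma gS: "g \<in> carrier G"
 by (rule subgroup.mem_carrier[OF S(2,3)])

text \<open>Here \<open>S\<close> has to be a subgroup and not just stable: it must contain the
  degree complementary to any degree of \<open>M\<close> within \<open>g\<close>.\<close>

lemma shift_S: "k \<in> S ==> g \<otimes>\<^sub>G inv\<^bsub>G\<^esub> k \<in> S"
 using subgroup.m_closed[OF S(2,3) subgroup.m_inv_closed[OF S(2)]] .

lemma piece_mem:
 assumes A: "gmod H cR A" and k: "k \<in> S" and a: "a \<in> carrier A"
 shows "gc H A a (\<psi> (g \<otimes>\<^sub>G inv\<^bsub>G\<^esub> k)) \<in> mcomp A (\<psi> (g \<otimes>\<^sub>G inv\<^bsub>G\<^esub> k))"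
  "piece A a k \<in> mcomp (cind S A) (g \<otimes>\<^sub>G inv\<^bsub>G\<^esub> k)" "piece A a k \<in> carrier (cind S A)"
proof -
 interpret A: graded_module H cR A by fact
 have kG: "k \<in> carrier G" by (rule subgroup.mem_carrier[OF S(2) k])
 show 1: "gc H A a (\<psi> (g \<otimes>\<^sub>G inv\<^bsub>G\<^esub> k)) \<in> mcomp A (\<psi> (g \<otimes>\<^sub>G inv\<^bsub>G\<^esub> k))"
  using A.MD.dcomp_in[OF a] gS kG by simp
 show "piece A a k \<in> mcomp (cind S A) (g \<otimes>\<^sub>G inv\<^bsub>G\<^esub> k)"
  by (rule single_mem[OF S(1) A shift_S[OF k] 1])
 thus "piece A a k \<in> carrier (cind S A)" by (simp add: cind_simps(5))
qed

lemma tensor_split: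
 assumes A: "gmod H cR A"
 obtains \<theta> where "\<theta> \<in> addhom (TH A) (TG A)"
  "\<And>a k y. [|a \<in> carrier A; k \<in> carrier G; k \<in> S; y \<in> mcomp M k|] ==> \<theta> (ptH A a y) = ptG A (piece A a k) y"
proof -
 interpret A: graded_module H cR A by fact
 interpret cM: graded_module H cR "cM M" by (rule cM_graded(1)[OF M])
 have gU: "gmod G R (cind S A)" by (rule cind_graded[OF S(1) A])
 interpret X: tensor_modules cR A "cM M" by (intro tensor_modules.intro A.module_axioms cM.module_axioms)
 interpret Y: tensor_modules R "cind S A" M by (rule tensor_modulesI[OF gU M])
 note abG = Y.tensor_abelian[where G = G]
 interpret T: abelian_group "TG A" by (rule abG)
 \<comment> \<open>Outside \<open>S\<close> the components of \<open>M\<close> are zero, so the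
   value zero there is the one that additivity dictates.\<close>
 define \<beta> where "\<beta> a y = M.MD.hsum (TG A) (\<lambda>k y. if k \<in> S then ptG A (piece A a k) y else \<zero>\<^bsub>TG A\<^esub>) y" for a y
 have \<beta>: "\<beta> a \<in> addhom M (TG A)"
  "\<And>k y. [|k \<in> carrier G; y \<in> mcomp M k|] ==> \<beta> a y = (if k \<in> S then ptG A (piece A a k) y else \<zero>\<^bsub>TG A\<^esub>)"
  if a: "a \<in> carrier A" for a
 proof -
  have c: "(if k \<in> S then ptG A (piece A a k) y else \<zero>\<^bsub>TG A\<^esub>) \<in> carrier (TG A)" if "k \<in> carrier G" "y \<in> mcomp M k" for k y
   using Y.pt_closed[where G = G, OF piece_mem(3)[OF A _ a] M.MD.B_carr[OF that(2,1)]] by simp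
  have d: "(if k \<in> S then ptG A (piece A a k) (x \<oplus>\<^sub>M y) else \<zero>\<^bsub>TG A\<^esub>)
   = (if k \<in> S then ptG A (piece A a k) x else \<zero>\<^bsub>TG A\<^esub>) \<oplus>\<^bsub>TG A\<^esub> (if k \<in> S then ptG A (piece A a k) y else \<zero>\<^bsub>TG A\<^esub>)"
   if "k \<in> carrier G" "x \<in> mcomp M k" "y \<in> mcomp M k" for k x y
   using Y.pt_add_right[where G = G, OF piece_mem(3)[OF A _ a] M.MD.B_carr[OF that(2,1)] M.MD.B_carr[OF that(3,1)]] by simp
  show "\<beta> a \<in> addhom M (TG A)"
   "\<And>k y. [|k \<in> carrier G; y \<in> mcomp M k|] ==> \<beta> a y = (if k \<in> S then ptG A (piece A a k) y else \<zero>\<^bsub>TG A\<^esub>)"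
   unfolding \<beta>_def by (rule M.MD.hsum_props[OF abG]; (erule (1) c | erule (2) d | assumption))+
 qed
 have \<beta>c: "\<beta> a y \<in> carrier (TG A)" if "a \<in> carrier A" "y \<in> carrier M" for a y
  by (rule addhom_closed[OF \<beta>(1)[OF that(1)] that(2)])
 have \<beta>l: "\<beta> (a \<oplus>\<^sub>A b) y = \<beta> a y \<oplus>\<^bsub>TG A\<^esub> \<beta> b y" if a: "a \<in> carrier A" "b \<in> carrier A" and y: "y \<in> carrier M" for a b y
 proof (rule M.MD.addhom_eqI[OF abG \<beta>(1) _ _ y])
  show "(\<lambda>y. \<beta> a y \<oplus>\<^bsub>TG A\<^esub> \<beta> b y) \<in> addhom M (TG A)"
   by (rule addhomI) (use \<beta>c a addhom_add[OF \<beta>(1)] in \<open>simp_all add: T.a_ac\<close>)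
  fix k y assume k: "k \<in> carrier G" and y: "y \<in> mcomp M k"
  have ab: "a \<oplus>\<^sub>A b \<in> carrier A" using a by simp
  show "\<beta> (a \<oplus>\<^sub>A b) y = \<beta> a y \<oplus>\<^bsub>TG A\<^esub> \<beta> b y"
  proof (cases "k \<in> S")
   case True
   have "piece A (a \<oplus>\<^sub>A b) k = piece A a k \<oplus>\<^bsub>cind S A\<^esub> piece A b k"
    using single_add[OF S(1) A] A.MD.dcomp_add[OF a] by simp
   thus ?thesis
    using \<beta>(2)[OF ab k y] \<beta>(2)[OF a(1) k y] \<beta>(2)[OF a(2) k y] True
     Y.pt_add_left[where G = G, OF piece_mem(3)[OF A True a(1)] piece_mem(3)[OF A True a(2)] M.MD.B_carr[OF y k]] by simp
  next
   case False
   thus ?thesis using \<beta>(2)[OF ab k y] \<beta>(2)[OF a(1) k y] \<beta>(2)[OF a(2) k y] by simp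
  qed
 qed (use a in simp)
 have \<beta>l': "(\<lambda>a. \<beta> a y) \<in> addhom A (TG A)" if "y \<in> carrier M" for y
  by (rule addhomI) (use that \<beta>c \<beta>l in auto)
 have bal: "\<beta> (r \<odot>\<^sub>A a) y = \<beta> a (r \<odot>\<^sub>M y)" if r: "r \<in> carrier R" and a: "a \<in> carrier A" and y: "y \<in> carrier M" for r a y
 proof -
  have smA: "(\<lambda>r. r \<odot>\<^sub>A a) \<in> addhom R A"
   by (rule addhomI) (use a A.smult_l_distr[of _ _ a] A.smult_closed[of _ a] in simp_all)
  show ?thesis
  proof (rule RD.addhom_eqI[OF abG addhom_comp[OF smA \<beta>l'[OF y]] addhom_comp[OF M.smult_addhom_left[OF y] \<beta>(1)[OF a]] _ r])
   fix s r assume s: "s \<in> carrier G" and r: "r \<in> rcomp R s"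
   have rR: "r \<in> carrier R" by (rule RD.B_carr[OF r s])
   have ra: "r \<odot>\<^sub>A a \<in> carrier A" using rR a A.smult_closed[of r a] by simp
   show "\<beta> (r \<odot>\<^sub>A a) y = \<beta> a (r \<odot>\<^sub>M y)"
   proof (rule M.MD.addhom_eqI[OF abG \<beta>(1)[OF ra] addhom_comp[OF M.smult_addhom[OF rR] \<beta>(1)[OF a]] _ y])
    fix k y assume k: "k \<in> carrier G" and y: "y \<in> mcomp M k"
    have yM: "y \<in> carrier M" by (rule M.MD.B_carr[OF y k])
    have ry: "r \<odot>\<^sub>M y \<in> mcomp M (s \<otimes>\<^sub>G k)" by (rule M.mcomp_smult[OF s k r y])
    show "\<beta> (r \<odot>\<^sub>A a) y = \<beta> a (r \<odot>\<^sub>M y)"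
    proof (cases "r = \<zero>\<^sub>R \<or> y = \<zero>\<^sub>M")
     case True
     have "\<beta> a \<zero>\<^sub>M = \<zero>\<^bsub>TG A\<^esub>" if "a \<in> carrier A" for a
      by (rule addhom_zero[OF M.M.abelian_group_axioms abG \<beta>(1)[OF that]])
     moreover have "\<beta> \<zero>\<^sub>A y = \<zero>\<^bsub>TG A\<^esub>"
      by (rule addhom_zero[OF A.M.abelian_group_axioms abG \<beta>l'[OF yM]])
     moreover have "\<zero>\<^sub>R \<odot>\<^sub>A a = \<zero>\<^sub>A" using A.smult_l_null[OF a] by simp
     ultimately show ?thesis using True a yM ra rR by auto
    next
     case False
     \<comment> \<open>A nonzero \<open>y\<close> forces its degree \<open>k\<close> into
       \<open>S\<close>. Stability applied to the neutral element puts the degree of a nonzero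
       \<open>r\<close> into \<open>S\<close>, and then the degree of the product is there
       too.\<close>
     hence kS: "k \<in> S" using supp[OF k] y by blast
     have "s \<otimes>\<^sub>G \<one>\<^sub>G \<in> S" using stableD[OF S(1) s subgroup.one_closed[OF S(2)] r] False by simp
     hence sS: "s \<in> S" using s by simp
     have skS: "s \<otimes>\<^sub>G k \<in> S" by (rule subgroup.m_closed[OF S(2) sS kS])
     \<comment> \<open>The degree in which the piece of \<open>a\<close> sits once \<open>r\<close>
       has been moved to the other factor; multiplying by \<open>s\<close> leads back to the degree
       of the piece before.\<close>
     let ?e = "g \<otimes>\<^sub>G inv\<^bsub>G\<^esub> (s \<otimes>\<^sub>G k)"
     have kG: "inv\<^bsub>G\<^esub> s \<in> carrier G" "inv\<^bsub>G\<^esub> k \<in> carrier G" using s k by simp_all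
     have "s \<otimes>\<^sub>G (inv\<^bsub>G\<^esub> s \<otimes>\<^sub>G inv\<^bsub>G\<^esub> k) = inv\<^bsub>G\<^esub> k"
      using s kG by (simp add: G.m_assoc[symmetric])
     hence e: "s \<otimes>\<^sub>G ?e = g \<otimes>\<^sub>G inv\<^bsub>G\<^esub> k"
      using s k gS kG G.m_lcomm[OF s gS G.m_closed[OF kG]] by (simp add: G.inv_mult)
     have eG: "?e \<in> carrier G" using s k gS by simp
     have "gc H A (r \<odot>\<^sub>A a) (\<psi> s \<otimes>\<^sub>H \<psi> ?e) = r \<odot>\<^sub>A gc H A a (\<psi> ?e)"
      by (rule A.gc_smult[OF rcomp_cR[OF r s] _ a]) (use s eG in simp_all)
     hence "piece A (r \<odot>\<^sub>A a) k = single A (s \<otimes>\<^sub>G ?e) (r \<odot>\<^sub>A gc H A a (\<psi> ?e))"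
      using e psi_mult[OF s eG] by simp
     also have "\<dots> = r \<odot>\<^bsub>cind S A\<^esub> piece A a (s \<otimes>\<^sub>G k)"
      by (rule single_smult[OF S(1) A r s shift_S[OF skS] piece_mem(1)[OF A skS a], symmetric])
     finally have "\<beta> (r \<odot>\<^sub>A a) y = ptG A (r \<odot>\<^bsub>cind S A\<^esub> piece A a (s \<otimes>\<^sub>G k)) y"
      using \<beta>(2)[OF ra k y] kS by simp
     also have "\<dots> = ptG A (piece A a (s \<otimes>\<^sub>G k)) (r \<odot>\<^sub>M y)"
      by (rule Y.pt_smult[OF rR piece_mem(3)[OF A skS a] yM])
     also have "\<dots> = \<beta> a (r \<odot>\<^sub>M y)" using \<beta>(2)[OF a _ ry] skS s k by simp
     finally show ?thesis .
    qed
   qed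
  qed
 qed
 obtain \<theta> where "\<theta> \<in> addhom (TH A) (TG A)" "\<And>a y. [|a \<in> carrier A; y \<in> carrier (cM M)|] ==> \<theta> (ptH A a y) = \<beta> a y"
 proof (rule X.tensor_universal[where G = H, OF abG, of \<beta>])
  show "\<beta> x (y \<oplus>\<^bsub>cM M\<^esub> y') = \<beta> x y \<oplus>\<^bsub>TG A\<^esub> \<beta> x y'" if "x \<in> carrier A" "y \<in> carrier (cM M)" "y' \<in> carrier (cM M)" for x y y'
   using addhom_add[OF \<beta>(1)[OF that(1)], of y y'] that by simp
  show "\<beta> (r \<odot>\<^sub>A x) y = \<beta> x (r \<odot>\<^bsub>cM M\<^esub> y)" if "r \<in> carrier cR" "x \<in> carrier A" "y \<in> carrier (cM M)" for r x y
   using bal[of r x y] that by simp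
 qed (use \<beta>c \<beta>l in simp_all)
 thus ?thesis using that \<beta>(2) M.MD.B_carr by simp
qed

text \<open>The splitting \<open>\<theta>\<close> is natural, so it maps \<open>z\<close> to a
  tensor killed by the induced map over \<open>G\<close>, which vanishes by \<open>inj\<close>. The
  map \<open>\<chi>\<close> induced by the counit turns \<open>\<theta> z\<close> into the component
  of \<open>z\<close> in question.\<close>

lemma flat_test_coarsen:
 assumes A: "gmod H cR A" and B: "gmod H cR B" and f: "f \<in> ghom H cR A B"
  and inj: "\<And>z. [|z \<in> carrier (TG A); tensor_map R (cind S B) M (\<lambda>x k. f (x k)) z = \<zero>\<^bsub>TG B\<^esub>|] ==> z = \<zero>\<^bsub>TG A\<^esub>"
  and z: "z \<in> carrier (TH A)" "tensor_map cR B (cM M) f z = \<zero>\<^bsub>TH B\<^esub>"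
 shows "gc H (TH A) z (\<psi> g) = \<zero>\<^bsub>TH A\<^esub>"
proof -
 interpret A: graded_module H cR A by fact
 interpret B: graded_module H cR B by fact
 note gM = cM_graded(1)[OF M]
 interpret cM: graded_module H cR "cM M" by (rule gM)
 note gU = cind_graded[OF S(1) A] cind_graded[OF S(1) B] and uf = cind_map[OF S(1) A B f]
 interpret TH: graded_module H cR "TH A" by (rule tensor_graded[OF A gM])
 note abA = tensor_ag[OF A gM] tensor_ag[OF B gM] tensor_ag[OF gU(1) M] tensor_ag[OF gU(2) M]
 obtain \<theta> where \<theta>: "\<theta> \<in> addhom (TH A) (TG A)"
  "\<And>a k y. [|a \<in> carrier A; k \<in> carrier G; k \<in> S; y \<in> mcomp M k|] ==> \<theta> (ptH A a y) = ptG A (piece A a k) y"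
  using tensor_split[OF A] by blast
 obtain \<theta>' where \<theta>': "\<theta>' \<in> addhom (TH B) (TG B)"
  "\<And>a k y. [|a \<in> carrier B; k \<in> carrier G; k \<in> S; y \<in> mcomp M k|] ==> \<theta>' (ptH B a y) = ptG B (piece B a k) y"
  using tensor_split[OF B] by blast
 have eqI: "u z = v z" if X: "abelian_group X" and u: "u \<in> addhom (TH A) X" and v: "v \<in> addhom (TH A) X"
  and eq: "\<And>a k y. [|a \<in> carrier A; k \<in> carrier G; k \<in> S; y \<in> mcomp M k|] ==> u (ptH A a y) = v (ptH A a y)"
  for X :: "('z,'w) ring_scheme" and u v
 proof (rule tensor_ext[OF A gM X u v _ z(1)])
  fix a y assume a: "a \<in> carrier A" and y: "y \<in> carrier (cM M)"
  have p: "(\<lambda>y. ptH A a y) \<in> addhom M (TH A)"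
   using tensor_modules.pt_addhom_right[OF tensor_modulesI[OF A gM] a, where G = H] by (simp add: addhom_def)
  show "u (ptH A a y) = v (ptH A a y)"
  proof (rule M.MD.addhom_eqI[OF X addhom_comp[OF p u] addhom_comp[OF p v]])
   fix k y assume k: "k \<in> carrier G" and y: "y \<in> mcomp M k"
   show "u (ptH A a y) = v (ptH A a y)"
   proof (cases "k \<in> S")
    case True
    thus ?thesis using eq a k y by blast
   next
    case False
    hence "y = \<zero>\<^sub>M" using supp[OF k] y by blast
    hence "ptH A a y = \<zero>\<^bsub>TH A\<^esub>"
     using tensor_modules.pt_zero_right[OF tensor_modulesI[OF A gM] a, where G = H] by simp
    thus ?thesis using addhom_zero[OF abA(1) X u] addhom_zero[OF abA(1) X v] by simp
   qed
  qed (use y in simp)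
 qed
 have nat: "tensor_map R (cind S B) M (\<lambda>x k. f (x k)) (\<theta> z) = \<theta>' (tensor_map cR B (cM M) f z)"
 proof (rule eqI[OF abA(4) addhom_comp[OF \<theta>(1) tensor_map_addhom'[OF gU M uf]]
    addhom_comp[OF tensor_map_addhom'[OF A B gM f] \<theta>'(1)]])
  fix a k y assume *: "a \<in> carrier A" "k \<in> carrier G" "k \<in> S" "y \<in> mcomp M k"
  have yM: "y \<in> carrier M" by (rule M.MD.B_carr[OF *(4,2)])
  have kg: "\<psi> (g \<otimes>\<^sub>G inv\<^bsub>G\<^esub> k) \<in> carrier H" using gS *(2) by simp
  have "(\<lambda>j. f (piece A a k j)) = piece B (f a) k"
   using gh_zero[OF A B f] gh_gc[OF A B f *(1) kg] by (auto simp: single_def)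
  thus "tensor_map R (cind S B) M (\<lambda>x k. f (x k)) (\<theta> (ptH A a y)) = \<theta>' (tensor_map cR B (cM M) f (ptH A a y))"
   using \<theta>(2)[OF *] \<theta>'(2)[OF gh_closed[OF f *(1)] *(2-4)] tensor_map_pt'[OF gU M uf piece_mem(3)[OF A *(3,1)] yM]
    tensor_map_pt'[OF A B gM f *(1), of y] yM by simp
 qed
 hence "tensor_map R (cind S B) M (\<lambda>x k. f (x k)) (\<theta> z) = \<zero>\<^bsub>TG B\<^esub>"
  using z(2) addhom_zero[OF abA(2,4) \<theta>'(1)] by simp
 hence \<theta>z: "\<theta> z = \<zero>\<^bsub>TG A\<^esub>" by (rule inj[OF addhom_closed[OF \<theta>(1) z(1)]])
 obtain c where c: "c \<in> ghom H cR (cM (cind S A)) A"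
  "\<And>g x. [|g \<in> carrier G; x \<in> mcomp (cind S A) g|] ==> c x = x g"
  using counit_exists[OF S(1) A] by blast
 interpret X: tensor_modules cR A "cM M" by (rule tensor_modulesI[OF A gM])
 interpret Y: tensor_modules R "cind S A" M by (rule tensor_modulesI[OF gU(1) M])
 have cc: "c x \<in> carrier A" if "x \<in> carrier (cind S A)" for x using gh_closed[OF c(1)] that by simp
 obtain \<chi> where \<chi>: "\<chi> \<in> addhom (TG A) (TH A)"
  "\<And>x y. [|x \<in> carrier (cind S A); y \<in> carrier M|] ==> \<chi> (ptG A x y) = ptH A (c x) y"
 proof (rule Y.tensor_universal[where G = G, OF abA(1), of "\<lambda>x y. ptH A (c x) y"])
  show "ptH A (c (x \<oplus>\<^bsub>cind S A\<^esub> x')) y = ptH A (c x) y \<oplus>\<^bsub>TH A\<^esub> ptH A (c x') y"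
   if "x \<in> carrier (cind S A)" "x' \<in> carrier (cind S A)" "y \<in> carrier M" for x x' y
   using gh_add[OF c(1), of x x'] X.pt_add_left[where G = H, OF cc[OF that(1)] cc[OF that(2)], of y] that by simp
  show "ptH A (c x) (y \<oplus>\<^sub>M y') = ptH A (c x) y \<oplus>\<^bsub>TH A\<^esub> ptH A (c x) y'"
   if "x \<in> carrier (cind S A)" "y \<in> carrier M" "y' \<in> carrier M" for x y y'
   using X.pt_add_right[where G = H, OF cc[OF that(1)], of y y'] that by simp
  show "ptH A (c (r \<odot>\<^bsub>cind S A\<^esub> x)) y = ptH A (c x) (r \<odot>\<^sub>M y)"
   if "r \<in> carrier R" "x \<in> carrier (cind S A)" "y \<in> carrier M" for r x y
   using gh_smult[OF c(1), of r x] X.pt_smult[of r "c x" y] cc[OF that(2)] that by simp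
  show "ptH A (c x) y \<in> carrier (TH A)" if "x \<in> carrier (cind S A)" "y \<in> carrier M" for x y
   using X.pt_closed[where G = H, OF cc[OF that(1)], of y] that by simp
 qed (use that in blast)
 \<comment> \<open>For \<open>y\<close> of degree \<open>k\<close>, both sides keep the same
   component of \<open>a\<close>: the one whose degree times \<open>\<psi> k\<close> is
   \<open>\<psi> g\<close>.\<close>
 have "\<chi> (\<theta> z) = gc H (TH A) z (\<psi> g)"
 proof (rule eqI[OF abA(1) addhom_comp[OF \<theta>(1) \<chi>(1)] TH.MD.dcomp_addhom])
  fix a k y assume *: "a \<in> carrier A" "k \<in> carrier G" "k \<in> S" "y \<in> mcomp M k"
  have yM: "y \<in> carrier M" by (rule M.MD.B_carr[OF *(4,2)])
  have yc: "y \<in> mcomp (cM M) (\<psi> k)" by (rule mcomp_cM[OF M *(4,2)])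
  let ?j = "g \<otimes>\<^sub>G inv\<^bsub>G\<^esub> k"
  have j: "?j \<in> carrier G" "\<psi> ?j \<in> carrier H" using gS *(2) by simp_all
  have jk: "\<psi> ?j \<otimes>\<^sub>H \<psi> k = \<psi> g"
   using psi_mult[OF j(1) *(2)] gS *(2) by (simp add: G.m_assoc)
  have "\<chi> (\<theta> (ptH A a y)) = ptH A (gc H A a (\<psi> ?j)) y"
   using \<theta>(2)[OF *] \<chi>(2)[OF piece_mem(3)[OF A *(3,1)] yM] c(2)[OF j(1) piece_mem(2)[OF A *(3,1)]]
   by (simp add: single_def)
  also have "\<dots> = gc H (TH A) (ptH A a y) (\<psi> g)"
  proof -
   have l: "(\<lambda>a. ptH A a y) \<in> addhom A (TH A)"
    by (rule X.pt_addhom_left) (use yM in simp)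
   show ?thesis
   proof (rule A.MD.addhom_eqI[OF abA(1) addhom_comp[OF A.MD.dcomp_addhom l] addhom_comp[OF l TH.MD.dcomp_addhom] _ *(1)])
    fix h a assume h: "h \<in> carrier H" and a: "a \<in> mcomp A h"
    have m: "ptH A a y \<in> mcomp (TH A) (h \<otimes>\<^sub>H \<psi> k)"
     using tensor_pt_mcomp[OF A gM h _ a yc] *(2) by simp
    have "h \<otimes>\<^sub>H \<psi> k = \<psi> g \<longleftrightarrow> h = \<psi> ?j"
     using H.right_cancel[OF psi_closed[OF *(2)] h j(2)] jk by metis
    thus "ptH A (gc H A a (\<psi> ?j)) y = gc H (TH A) (ptH A a y) (\<psi> g)"
     using TH.MD.dcomp_hom'[OF m, of "\<psi> g"] A.MD.dcomp_hom'[OF a h, of "\<psi> ?j"] h *(2)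
      X.pt_zero_left[where G = H, of y] yM by auto
   qed
  qed
  finally show "\<chi> (\<theta> (ptH A a y)) = gc H (TH A) (ptH A a y) (\<psi> g)" .
 qed
 thus ?thesis using \<theta>z addhom_zero[OF abA(3,1) \<chi>(1)] by simp
qed

end

lemma flat_coarsen:
 fixes M :: "('g,'r,'u) gmodule" and le :: "'u list => 'u" and \<rho> :: "'r => 'u"
 assumes le: "inj le" and \<rho>: "inj \<rho>" and fl: "flat G R M"
 shows "flat H cR (cM M)"
proof (rule flatI)
 note M = flat_graded[OF fl]
 note gM = cM_graded(1)[OF M]
 show "gmod H cR (cM M)" by (rule gM)
 fix A B :: "('h,'r,'u) gmodule" and f
 assume A: "gmod H cR A" and B: "gmod H cR B" and f: "f \<in> ghom H cR A B" "inj_on f (carrier A)"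
 interpret T: graded_module H cR "tensor H cR A (cM M)" by (rule tensor_graded[OF A gM])
 show "inj_on (tensor_map cR B (cM M) f) (carrier (tensor H cR A (cM M)))"
  unfolding gh_inj_iff[OF tensor_graded[OF A gM] tensor_graded[OF B gM] tensor_map_hom[OF A B gM f(1)]]
 proof (intro ballI impI)
  fix z assume z: "z \<in> carrier (tensor H cR A (cM M))" "tensor_map cR B (cM M) f z = \<zero>\<^bsub>tensor H cR B (cM M)\<^esub>"
  show "z = \<zero>\<^bsub>tensor H cR A (cM M)\<^esub>"
  proof (rule T.MD.dcomp_ext[OF z(1) T.M.zero_closed])
   fix h assume "h \<in> carrier H"
   then obtain g where g: "g \<in> carrier G" "\<psi> g = h" using psi_surj by blast
   \<comment> \<open>The set of degrees is chosen anew for each \<open>g\<close>, so that it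
     contains \<open>g\<close> and still embeds into \<open>'u\<close>.\<close>
   obtain S and \<kappa> :: "'g => 'u" where S: "stable S" "subgroup S G" "g \<in> S" "inj_on \<kappa> S"
    "\<And>k. [|k \<in> carrier G; k \<notin> S|] ==> mcomp M k = {\<zero>\<^sub>M}"
    using stable_small_exists[OF le \<rho> M g(1)] by blast
   have sm: "\<exists>\<phi> :: ('g => 'u) => 'u. inj_on \<phi> (carrier (cind S C))" if "gmod H cR C" for C :: "('h,'r,'u) gmodule"
    by (rule cind_small[OF le S(1) that inj_on_subset[OF S(4)]]) blast
   obtain \<alpha> :: "('g => 'u) => 'u" where \<alpha>: "inj_on \<alpha> (carrier (cind S A))" using sm[OF A] by blast
   obtain \<beta> :: "('g => 'u) => 'u" where \<beta>: "inj_on \<beta> (carrier (cind S B))" using sm[OF B] by blast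
   have "gc H (tensor H cR A (cM M)) z (\<psi> g) = \<zero>\<^bsub>tensor H cR A (cM M)\<^esub>"
    by (rule flat_test_coarsen[OF S(1-3) M S(5) A B f(1)
       flatD[OF fl cind_graded[OF S(1) A] cind_graded[OF S(1) B] cind_map[OF S(1) A B f(1)]
        cind_map_inj[OF S(1) A f(2)] \<alpha> \<beta>] z])
   thus "gc H (tensor H cR A (cM M)) z h = gc H (tensor H cR A (cM M)) \<zero>\<^bsub>tensor H cR A (cM M)\<^esub> h"
    using g T.MD.dcomp_zero by simp
  qed
 qed
qed

end

section \<open>A coarsening that does not preserve injectivity\<close>

text \<open>
  Over the ring of finite or cofinite sets of natural numbers, placed in degree \<open>0\<close>, the ideal of
  finite sets is not injective: its inclusion into the ring does not extend to the ring. Spread over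
  pairwise distinct degrees it becomes injective, as extensions are constructed degree by degree.
\<close>

definition fincofin :: "nat set set" where
 "fincofin = {x. finite x \<or> finite (- x)}"

lemma fincofin_mem [simp]:
 "{} \<in> fincofin" "UNIV \<in> fincofin" "finite x ==> x \<in> fincofin"
 "[|x \<in> fincofin; y \<in> fincofin|] ==> x \<inter> y \<in> fincofin"
 "[|x \<in> fincofin; y \<in> fincofin|] ==> (x - y) \<union> (y - x) \<in> fincofin"
proof -
 assume x: "x \<in> fincofin" and y: "y \<in> fincofin"
 show "x \<inter> y \<in> fincofin" using x y by (auto simp: fincofin_def)
 have *: "(x - y) \<union> (y - x) \<subseteq> x \<union> y" "- ((x - y) \<union> (y - x)) \<subseteq> x \<union> - y" "- ((x - y) \<union> (y - x)) \<subseteq> - x \<union> y"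
  "(x - y) \<union> (y - x) \<subseteq> - x \<union> - y" by auto
 show "(x - y) \<union> (y - x) \<in> fincofin"
  using x y finite_subset[OF *(1)] finite_subset[OF *(2)] finite_subset[OF *(3)] finite_subset[OF *(4)]
  unfolding fincofin_def mem_Collect_eq finite_Un by argo
qed (auto simp: fincofin_def)

text \<open>The Boolean ring is countable, since its elements are the finite sets of natural numbers
  and their complements; so it can be realized in any infinite type.\<close>

lemma fincofin_embedding:
 assumes "infinite (UNIV :: 'a set)"
 obtains e :: "nat set => 'a" where "inj_on e fincofin"
proof -
 have "fincofin = Collect finite \<union> uminus ` Collect finite"
  unfolding fincofin_def by (auto simp: image_iff)
 hence "countable fincofin" by (metis countable_Un countable_image countable_Collect_finite)
 then obtain t :: "nat set => nat" where t: "inj_on t fincofin" by (auto simp: countable_def)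
 obtain f :: "nat => 'a" where "inj f" using infinite_countable_subset[OF assms] by blast
 hence "inj_on (f \<circ> t) fincofin" using t by (meson comp_inj_on inj_on_subset subset_UNIV)
 thus ?thesis by (rule that)
qed

text \<open>The Boolean ring with symmetric difference as addition and intersection as
  multiplication, its elements renamed by \<open>e\<close> to fit the type prescribed for the
  ring.\<close>

definition bring :: "('g,'x) monoid_scheme => (nat set => 'r) => ('g,'r) gring" where
 "bring G e = (let d = inv_into fincofin e in
   \<lparr>carrier = e ` fincofin, monoid.mult = (\<lambda>a b. e (d a \<inter> d b)), monoid.one = e UNIV,
   ring.zero = e {}, ring.add = (\<lambda>a b. e ((d a - d b) \<union> (d b - d a))),
   rcomp = (\<lambda>g. if g = \<one>\<^sub>G then e ` fincofin else {e {}})\<rparr>)"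

text \<open>The singleton of \<open>n\<close> has degree \<open>\<kappa> n\<close>. For injective
  \<open>\<kappa>\<close> each nonzero component has order two.\<close>

definition bmod :: "(nat set => 'r) => (nat set => 'm) => (nat => 'g) => ('g,'r,'m) gmodule" where
 "bmod e e' \<kappa> = (let d = inv_into fincofin e; d' = inv_into fincofin e' in
   \<lparr>carrier = e' ` {x. finite x}, monoid.mult = undefined, monoid.one = undefined,
   ring.zero = e' {}, ring.add = (\<lambda>a b. e' ((d' a - d' b) \<union> (d' b - d' a))),
   module.smult = (\<lambda>r a. e' (d r \<inter> d' a)),
   mcomp = (\<lambda>g. e' ` {x. finite x \<and> x \<subseteq> {n. \<kappa> n = g}})\<rparr>)"

text \<open>Homomorphisms to the group of order two, written as predicates, extend from
  \<open>D\<close> to \<open>C\<close>. By Zorn there is a maximal subgroup of \<open>C\<close> that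
  contains the kernel of \<open>\<chi>\<close> and avoids some \<open>b\<close> with
  \<open>\<chi> b\<close>; it has index two, and its complement is the extension.\<close>

lemma exponent_two_extend:
 fixes B (structure)
 assumes B: "abelian_group B" and C: "C \<subseteq> carrier B" "\<And>x y. [|x \<in> C; y \<in> C|] ==> x \<oplus> y \<in> C"
  and two: "\<And>x. x \<in> C ==> x \<oplus> x = \<zero>"
  and D: "D \<subseteq> C" "\<zero> \<in> D" "\<And>x y. [|x \<in> D; y \<in> D|] ==> x \<oplus> y \<in> D"
  and \<chi>: "\<And>x y. [|x \<in> D; y \<in> D|] ==> \<chi> (x \<oplus> y) \<longleftrightarrow> \<chi> x \<noteq> \<chi> y"
 obtains \<chi>' where "\<And>x. x \<in> D ==> \<chi>' x = \<chi> x" "\<And>x y. [|x \<in> C; y \<in> C|] ==> \<chi>' (x \<oplus> y) \<longleftrightarrow> \<chi>' x \<noteq> \<chi>' y"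
proof (cases "\<exists>b\<in>D. \<chi> b")
 case False
 thus ?thesis using that[of "\<lambda>_. False"] by blast
next
 case True
 interpret abelian_group B by fact
 obtain b where b: "b \<in> D" "\<chi> b" using True by blast
 have [simp]: "x \<in> carrier B" if "x \<in> C" for x using C(1) that by blast
 have cancel: "(x \<oplus> y) \<oplus> y = x" if "x \<in> C" "y \<in> C" for x y
  using that two[of y] by (simp add: a_assoc)
 have bC: "b \<in> C" using D b by blast
 let ?K = "{x \<in> D. \<not> \<chi> x}"
 define S where "S = {W. W \<subseteq> C \<and> ?K \<subseteq> W \<and> (\<forall>x\<in>W. \<forall>y\<in>W. x \<oplus> y \<in> W) \<and> b \<notin> W}"
 have "\<exists>W\<in>S. \<forall>V\<in>S. W \<subseteq> V \<longrightarrow> V = W"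
 proof (rule subset_Zorn_nonempty)
  show "S \<noteq> {}" using D \<chi> b by (auto simp: S_def intro!: exI[of _ ?K])
  fix \<C> assume \<C>: "\<C> \<noteq> {}" "subset.chain S \<C>"
  have "x \<oplus> y \<in> \<Union>\<C>" if xy: "x \<in> \<Union>\<C>" "y \<in> \<Union>\<C>" for x y
  proof -
   obtain V W where VW: "V \<in> \<C>" "x \<in> V" "W \<in> \<C>" "y \<in> W" using xy by blast
   hence "V \<subseteq> W \<or> W \<subseteq> V" "V \<in> S" "W \<in> S" using \<C>(2) by (auto simp: subset.chain_def)
   thus ?thesis using VW unfolding S_def by blast
  qed
  moreover have "\<C> \<subseteq> S" using \<C>(2) by (auto simp: subset.chain_def)
  ultimately show "\<Union>\<C> \<in> S" using \<C>(1) unfolding S_def by blast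
 qed
 then obtain W where W: "W \<in> S" and max: "\<And>V. [|V \<in> S; W \<subseteq> V|] ==> V = W" by blast
 have WC: "W \<subseteq> C" "?K \<subseteq> W" "b \<notin> W" and Wa: "\<And>x y. [|x \<in> W; y \<in> W|] ==> x \<oplus> y \<in> W"
  using W by (auto simp: S_def)
 \<comment> \<open>Maximality: the subgroup generated by \<open>W\<close> and \<open>x\<close> must
   contain \<open>b\<close>, so \<open>b\<close> is the sum of \<open>x\<close> and an element of
   \<open>W\<close>.\<close>
 have shift: "x \<oplus> b \<in> W" if x: "x \<in> C" "x \<notin> W" for x
 proof -
  have z: "\<zero> \<in> W" using WC(2) D \<chi>[of \<zero> \<zero>] by auto
  let ?V = "W \<union> (\<lambda>w. w \<oplus> x) ` W"
  have *: "w \<oplus> x \<oplus> w' = w \<oplus> w' \<oplus> x" "w \<oplus> (w' \<oplus> x) = w \<oplus> w' \<oplus> x" "w \<oplus> x \<oplus> (w' \<oplus> x) = w \<oplus> w'"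
   if "w \<in> W" "w' \<in> W" for w w'
  proof -
   have c: "w \<in> carrier B" "w' \<in> carrier B" using that WC(1) by auto
   show "w \<oplus> x \<oplus> w' = w \<oplus> w' \<oplus> x" "w \<oplus> (w' \<oplus> x) = w \<oplus> w' \<oplus> x" using c x(1) by (simp_all add: a_ac)
   thus "w \<oplus> x \<oplus> (w' \<oplus> x) = w \<oplus> w'"
    using cancel[of "w \<oplus> w'" x] c x(1) C(2) WC(1) that by (simp add: a_assoc[symmetric] subset_iff)
  qed
  have V: "?V \<subseteq> C" "\<forall>u\<in>?V. \<forall>v\<in>?V. u \<oplus> v \<in> ?V"
   using WC(1) C(2) x(1) Wa * by auto
  have xV: "x \<in> ?V" using image_eqI[OF _ z, of x "\<lambda>w. w \<oplus> x"] x(1) by simp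
  have "?V \<notin> S" using max[of ?V] x(2) xV by blast
  hence "b \<in> ?V" using V WC(2) by (auto simp: S_def)
  then obtain w where w: "w \<in> W" "b = w \<oplus> x" using WC(3) by blast
  hence "x \<oplus> b = w" using cancel[of w x] WC(1) x(1) a_comm[of x b] bC by auto
  thus ?thesis using w by simp
 qed
 have out: "x \<notin> W" if x: "x \<in> C" "x \<oplus> b \<in> W" for x
 proof
  assume "x \<in> W"
  hence "x \<oplus> (x \<oplus> b) \<in> W" using Wa x by blast
  moreover have "x \<oplus> (x \<oplus> b) = b" using x bC two[OF x(1)] a_assoc[of x x b] by simp
  ultimately show False using WC(3) by simp
 qed
 show ?thesis
 proof (rule that[of "\<lambda>x. x \<notin> W"])
  fix x assume x: "x \<in> D"
  show "(x \<notin> W) = \<chi> x"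
  proof (cases "\<chi> x")
   case True
   hence "x \<oplus> b \<in> W" using WC(2) D(3) \<chi> x b by blast
   thus ?thesis using out D(1) x True by blast
  next
   case False
   thus ?thesis using WC(2) x by blast
  qed
 next
  fix x y assume x: "x \<in> C" and y: "y \<in> C"
  show "(x \<oplus> y \<notin> W) = ((x \<notin> W) \<noteq> (y \<notin> W))"
  proof (cases "x \<in> W")
   case xW: True
   have "y \<in> W" if "x \<oplus> y \<in> W"
   proof -
    have "y = (x \<oplus> y) \<oplus> x" using cancel[of y x] x y a_comm[of x y] by simp
    thus ?thesis using Wa[OF that xW] by simp
   qed
   thus ?thesis using xW Wa by blast
  next
   case xW: False
   note xb = shift[OF x xW]
   show ?thesis
   proof (cases "y \<in> W")
    case True
    have "(x \<oplus> y) \<oplus> b = (x \<oplus> b) \<oplus> y" using x y bC by (simp add: a_ac)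
    hence "x \<oplus> y \<notin> W" using out[OF C(2)[OF x y]] Wa[OF xb True] by simp
    thus ?thesis using xW True by blast
   next
    case False
    have "(x \<oplus> b) \<oplus> (y \<oplus> b) = (x \<oplus> y) \<oplus> b \<oplus> b" using x y bC by (simp add: a_ac)
    hence "x \<oplus> y \<in> W" using Wa[OF xb shift[OF y False]] cancel[OF C(2)[OF x y] bC] by simp
    thus ?thesis using xW False by blast
   qed
  qed
 qed
qed

section \<open>The Boolean ring and its spread-out ideal of finite sets\<close>

context
 fixes G :: "('g,'x) monoid_scheme" and e :: "nat set => 'r"
 assumes G: "comm_group G" and e: "inj_on e fincofin"
begin

lemma bring_simps:
 "carrier (bring G e) = e ` fincofin" "\<one>\<^bsub>bring G e\<^esub> = e UNIV" "\<zero>\<^bsub>bring G e\<^esub> = e {}"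
 "rcomp (bring G e) g = (if g = \<one>\<^sub>G then e ` fincofin else {e {}})"
 "[|x \<in> fincofin; y \<in> fincofin|] ==> e x \<otimes>\<^bsub>bring G e\<^esub> e y = e (x \<inter> y)"
 "[|x \<in> fincofin; y \<in> fincofin|] ==> e x \<oplus>\<^bsub>bring G e\<^esub> e y = e ((x - y) \<union> (y - x))"
 by (simp_all add: bring_def Let_def inv_into_f_f[OF e])

lemma bring_graded: "graded_ring G (bring G e)"
proof -
 interpret G: comm_group G by (rule G)
 have ag: "abelian_group (bring G e)"
 proof (rule abelian_groupI)
  fix a assume "a \<in> carrier (bring G e)"
  thus "\<exists>b\<in>carrier (bring G e). b \<oplus>\<^bsub>bring G e\<^esub> a = \<zero>\<^bsub>bring G e\<^esub>"
   by (intro bexI[of _ a]) (auto simp: bring_simps)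
 qed (auto simp: bring_simps intro!: arg_cong[where f = e])
 have cr: "cring (bring G e)"
  by (rule cringI[OF ag comm_monoidI]) (auto simp: bring_simps intro!: arg_cong[where f = e])
 interpret cring "bring G e" by (rule cr)
 have "direct_sum (bring G e) (carrier G) (rcomp (bring G e))"
 proof (rule direct_sum_sepI(1)[where p = "\<lambda>g a. if g = \<one>\<^sub>G then a else \<zero>\<^bsub>bring G e\<^esub>"])
  fix a assume "a \<in> carrier (bring G e)" "\<And>g. g \<in> carrier G ==> (if g = \<one>\<^sub>G then a else \<zero>\<^bsub>bring G e\<^esub>) = \<zero>\<^bsub>bring G e\<^esub>"
  thus "a = \<zero>\<^bsub>bring G e\<^esub>" using G.one_closed by metis
 next
  fix g show "additive_subgroup (rcomp (bring G e) g) (bring G e)"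
  proof (cases "g = \<one>\<^sub>G")
   case True
   hence "rcomp (bring G e) g = carrier (bring G e)" by (simp add: bring_simps)
   thus ?thesis using add.subgroup_self by (simp add: additive_subgroup_def)
  next
   case False
   hence "rcomp (bring G e) g = {\<zero>\<^bsub>bring G e\<^esub>}" by (simp add: bring_simps)
   thus ?thesis using add.triv_subgroup by (simp add: additive_subgroup_def)
  qed
 qed (auto simp: ag addhom_def bring_simps(1,3,4) split: if_splits)
 thus ?thesis
  by (intro graded_ring.intro graded_ring_axioms.intro G cr)
   (auto simp: direct_sum.ds bring_simps split: if_splits)
qed

context
 fixes e' :: "nat set => 'm" and \<kappa> :: "nat => 'g"
 assumes e': "inj_on e' fincofin" and \<kappa>: "\<And>n. \<kappa> n \<in> carrier G" "inj \<kappa>"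
begin

lemma bmod_simps:
 "carrier (bmod e e' \<kappa>) = e' ` {x. finite x}" "\<zero>\<^bsub>bmod e e' \<kappa>\<^esub> = e' {}"
 "mcomp (bmod e e' \<kappa>) g = e' ` {x. finite x \<and> x \<subseteq> {n. \<kappa> n = g}}"
 "[|x \<in> fincofin; finite y|] ==> e x \<odot>\<^bsub>bmod e e' \<kappa>\<^esub> e' y = e' (x \<inter> y)"
 "[|finite x; finite y|] ==> e' x \<oplus>\<^bsub>bmod e e' \<kappa>\<^esub> e' y = e' ((x - y) \<union> (y - x))"
 by (simp_all add: bmod_def Let_def inv_into_f_f[OF e] inv_into_f_f[OF e'])

lemma e'_eq: "[|finite x; finite y|] ==> e' x = e' y \<longleftrightarrow> x = y"
 using e' by (simp add: inj_on_eq_iff)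

lemma bmod_graded: "gmod G (bring G e) (bmod e e' \<kappa>)"
 and bmod_gc: "[|finite x; g \<in> carrier G|] ==> gc G (bmod e e' \<kappa>) (e' x) g = e' (x \<inter> {n. \<kappa> n = g})"
proof -
 let ?M = "bmod e e' \<kappa>" and ?d = "inv_into fincofin e'"
 interpret R: graded_ring G "bring G e" by (rule bring_graded)
 have ag: "abelian_group ?M"
 proof (rule abelian_groupI)
  fix a assume "a \<in> carrier ?M"
  thus "\<exists>b\<in>carrier ?M. b \<oplus>\<^bsub>?M\<^esub> a = \<zero>\<^bsub>?M\<^esub>"
   by (intro bexI[of _ a]) (auto simp: bmod_simps)
 qed (auto simp: bmod_simps intro!: arg_cong[where f = e'])
 have M: "module (bring G e) ?M"
  by (rule moduleI[OF R.R.is_cring ag])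
   (auto simp: bmod_simps bring_simps intro!: arg_cong[where f = e'])
 define p where "p g a = e' (?d a \<inter> {n. \<kappa> n = g})" for g a
 have p: "p g (e' x) = e' (x \<inter> {n. \<kappa> n = g})" if "finite x" for g x
  using that by (simp add: p_def inv_into_f_f[OF e'])
 note * = graded_moduleI[where p = p, OF bring_graded M]
 have a: "p g \<in> addhom ?M ?M" for g
  by (rule addhomI) (auto simp: bmod_simps p intro!: arg_cong[where f = e'])
 have fin: "finite {g \<in> carrier G. p g a \<noteq> \<zero>\<^bsub>?M\<^esub>}" if a: "a \<in> carrier ?M" for a
 proof -
  obtain x where x: "finite x" "a = e' x" using a by (auto simp: bmod_simps)
  have "{g \<in> carrier G. p g a \<noteq> \<zero>\<^bsub>?M\<^esub>} \<subseteq> \<kappa> ` x"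
  proof
   fix g assume g: "g \<in> {g \<in> carrier G. p g a \<noteq> \<zero>\<^bsub>?M\<^esub>}"
   have "x \<inter> {n. \<kappa> n = g} \<noteq> {}"
   proof
    assume "x \<inter> {n. \<kappa> n = g} = {}"
    with g show False using x(1) by (simp add: bmod_simps(2) x(2) p)
   qed
   thus "g \<in> \<kappa> ` x" by blast
  qed
  thus ?thesis using x finite_subset by blast
 qed
 have sep: "a = \<zero>\<^bsub>?M\<^esub>" if a: "a \<in> carrier ?M" "\<And>g. g \<in> carrier G ==> p g a = \<zero>\<^bsub>?M\<^esub>" for a
 proof -
  obtain x where x: "finite x" "a = e' x" using a by (auto simp: bmod_simps)
  have "n \<notin> x" for n using a(2)[OF \<kappa>(1)[of n]] x by (auto simp: bmod_simps p e'_eq)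
  hence "x = {}" by blast
  thus ?thesis using x by (simp add: bmod_simps)
 qed
 have pid: "p h a = (if h = g then a else \<zero>\<^bsub>?M\<^esub>)" if a: "a \<in> mcomp ?M g" for g h a
 proof -
  obtain x where x: "finite x" "x \<subseteq> {n. \<kappa> n = g}" "a = e' x" using a by (auto simp: bmod_simps)
  have "x \<inter> {n. \<kappa> n = h} = (if h = g then x else {})" using x by auto
  thus ?thesis using x by (simp add: p bmod_simps)
 qed
 have sm: "r \<odot>\<^bsub>?M\<^esub> a \<in> mcomp ?M (s \<otimes>\<^sub>G g)"
  if "s \<in> carrier G" "g \<in> carrier G" "r \<in> rcomp (bring G e) s" "a \<in> mcomp ?M g" for s g r a
  using that by (auto simp: bring_simps bmod_simps split: if_splits)
 have "p g a \<in> mcomp ?M g" if "a \<in> carrier ?M" for g a using that by (auto simp: bmod_simps p)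
 note ** = *[OF _ _ _ a pid this fin sep sm]
 show "gmod G (bring G e) ?M"
  by (rule **(1)) (auto simp: bmod_simps)
 show "gc G ?M (e' x) g = e' (x \<inter> {n. \<kappa> n = g})" if "finite x" "g \<in> carrier G"
  by (subst **(2)) (use that p in \<open>auto simp: bmod_simps\<close>)
qed

text \<open>Membership of \<open>n\<close> in \<open>f a\<close> is a homomorphism from the degree
  \<open>\<kappa> n\<close> part of \<open>A\<close> to the group of order two. It is extended to
  \<open>B\<close> for each \<open>n\<close> separately, and the extensions assemble because a
  homogeneous element meets at most one \<open>n\<close>.\<close>

lemma bmod_injective:
 fixes J :: "('g,'r,'u) gmodule"
 assumes J: "gmod G (bring G e) J" "giso G (bring G e) (bmod e e' \<kappa>) J u v"
 shows "injective G (bring G e) J"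
proof -
 let ?R = "bring G e" let ?M = "bmod e e' \<kappa>"
 note uv = gisoD[OF J(2)]
 interpret M: graded_module G ?R ?M by (rule bmod_graded)
 have e1: "e {n} \<in> rcomp ?R \<one>\<^sub>G" "e {n} \<in> carrier ?R" for n by (simp_all add: bring_simps)
 have "\<exists>w\<in>ghom G ?R B J. \<forall>x\<in>carrier A. w (j x) = f x"
  if j: "j \<in> ghom G ?R A B" "inj_on j (carrier A)" and f: "f \<in> ghom G ?R A J"
   and A: "gmod G ?R A" and B: "gmod G ?R B" for A B :: "('g,'r,'u) gmodule" and j f
 proof -
  interpret A: graded_module G ?R A by fact
  interpret B: graded_module G ?R B by fact
  define F where "F a = inv_into fincofin e' (v (f a))" for a
  have F: "finite (F a)" "f a = u (e' (F a))" if "a \<in> carrier A" for a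
  proof -
   have "v (f a) \<in> e' ` {x. finite x}"
    using gh_closed[OF uv(2) gh_closed[OF f that]] by (simp add: bmod_simps)
   then obtain x where x: "finite x" "v (f a) = e' x" by blast
   thus "finite (F a)" "f a = u (e' (F a))"
    using uv(4)[OF gh_closed[OF f that]] by (simp_all add: F_def inv_into_f_f[OF e'])
  qed
  have vF: "v (f a) = e' (F a)" if "a \<in> carrier A" for a
   using F[OF that] uv(3) by (simp add: bmod_simps)
  have F_add: "F (a \<oplus>\<^sub>A b) = (F a - F b) \<union> (F b - F a)" if "a \<in> carrier A" "b \<in> carrier A" for a b
  proof -
   have "e' (F (a \<oplus>\<^sub>A b)) = e' ((F a - F b) \<union> (F b - F a))"
    using that F(1) vF[OF A.M.a_closed[OF that]] vF[OF that(1)] vF[OF that(2)] gh_add[OF f that] gh_add[OF uv(2) gh_closed[OF f that(1)] gh_closed[OF f that(2)]]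
     bmod_simps(5)[OF F(1)[OF that(1)] F(1)[OF that(2)]] by simp
   thus ?thesis using F(1) that by (simp add: e'_eq)
  qed
  have F_smult: "F (e r \<odot>\<^sub>A a) = r \<inter> F a" if "a \<in> carrier A" "r \<in> fincofin" for a r
  proof -
   have r: "e r \<in> carrier ?R" using that by (simp add: bring_simps)
   have "e' (F (e r \<odot>\<^sub>A a)) = e' (r \<inter> F a)"
    using that F vF gh_smult[OF f r that(1)] gh_smult[OF uv(2) r gh_closed[OF f that(1)]]
     bmod_simps(4)[OF that(2) F(1)[OF that(1)]] A.smult_closed[OF r that(1)] vF[OF A.smult_closed[OF r that(1)]] by simp
   thus ?thesis using F(1) A.smult_closed[OF r that(1)] that by (simp add: e'_eq)
  qed
  have "\<exists>\<chi>. (\<forall>a\<in>mcomp A (\<kappa> n). \<chi> (j a) \<longleftrightarrow> n \<in> F a) \<and>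
    (\<forall>x\<in>mcomp B (\<kappa> n). \<forall>y\<in>mcomp B (\<kappa> n). \<chi> (x \<oplus>\<^sub>B y) \<longleftrightarrow> \<chi> x \<noteq> \<chi> y) \<and>
    (\<forall>r\<in>fincofin. \<forall>y\<in>mcomp B (\<kappa> n). \<chi> (e r \<odot>\<^sub>B y) \<longleftrightarrow> n \<in> r \<and> \<chi> y)" for n
  proof -
   let ?C = "mcomp B (\<kappa> n)" and ?D = "j ` mcomp A (\<kappa> n)"
   note carr = A.MD.B_carr[OF _ \<kappa>(1)[of n]] B.MD.B_carr[OF _ \<kappa>(1)[of n]]
   let ?\<chi> = "\<lambda>b. n \<in> F (inv_into (carrier A) j b)"
   have \<chi>j: "?\<chi> (j a) \<longleftrightarrow> n \<in> F a" if "a \<in> carrier A" for a using that by (simp add: inv_into_f_f[OF j(2)])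
   have two: "x \<oplus>\<^sub>B x = \<zero>\<^sub>B" if "x \<in> carrier B" for x
   proof -
    have "x \<oplus>\<^sub>B x = (\<one>\<^bsub>?R\<^esub> \<oplus>\<^bsub>?R\<^esub> \<one>\<^bsub>?R\<^esub>) \<odot>\<^sub>B x" using that by (simp add: B.smult_l_distr)
    also have "\<one>\<^bsub>?R\<^esub> \<oplus>\<^bsub>?R\<^esub> \<one>\<^bsub>?R\<^esub> = \<zero>\<^bsub>?R\<^esub>" by (simp add: bring_simps)
    finally show ?thesis using that by simp
   qed
   obtain \<chi> where \<chi>: "\<And>x. x \<in> ?D ==> \<chi> x = ?\<chi> x" "\<And>x y. [|x \<in> ?C; y \<in> ?C|] ==> \<chi> (x \<oplus>\<^sub>B y) \<longleftrightarrow> \<chi> x \<noteq> \<chi> y"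
   proof (rule exponent_two_extend[of B ?C ?D ?\<chi>])
    show "?D \<subseteq> ?C" using gh_mcomp[OF j(1) \<kappa>(1)] by blast
    show "\<zero>\<^sub>B \<in> ?D" using gh_zero[OF A B j(1)] A.MD.B_zero[OF \<kappa>(1)] by (metis image_eqI)
    fix x y assume "x \<in> ?D" "y \<in> ?D"
    then obtain a b where ab: "a \<in> mcomp A (\<kappa> n)" "x = j a" "b \<in> mcomp A (\<kappa> n)" "y = j b" by blast
    have s: "x \<oplus>\<^sub>B y = j (a \<oplus>\<^sub>A b)" using gh_add[OF j(1)] ab carr by simp
    thus "x \<oplus>\<^sub>B y \<in> ?D" using A.MD.B_add[OF ab(1,3) \<kappa>(1)] by simp
    show "?\<chi> (x \<oplus>\<^sub>B y) \<longleftrightarrow> ?\<chi> x \<noteq> ?\<chi> y"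
     unfolding s using carr(1)[OF ab(1)] carr(1)[OF ab(3)] F_add \<chi>j[of "a \<oplus>\<^sub>A b"] \<chi>j[of a] \<chi>j[of b] ab(2,4)
     by auto
   qed (use B.MD.B_add \<kappa>(1) carr two B.M.abelian_group_axioms in auto)
   have en: "e {n} \<odot>\<^sub>B y \<in> ?C" "e {n} \<odot>\<^sub>A a \<in> mcomp A (\<kappa> n)" if "y \<in> ?C" "a \<in> mcomp A (\<kappa> n)" for y a
    using B.mcomp_smult[OF _ \<kappa>(1) e1(1)] A.mcomp_smult[OF _ \<kappa>(1) e1(1)] that \<kappa>(1) by force+
   have zB: "\<zero>\<^sub>B \<in> ?C" "\<zero>\<^sub>A \<in> mcomp A (\<kappa> n)" using B.MD.B_zero A.MD.B_zero \<kappa>(1) by auto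
   show ?thesis
   \<comment> \<open>An additive extension need not be linear. Multiplying by the idempotent
     \<open>e {n}\<close> beforehand makes it so, because a scalar \<open>e r\<close> times
     \<open>e {n}\<close> is \<open>e {n}\<close> or zero.\<close>
   proof (intro exI[of _ "\<lambda>y. \<chi> (e {n} \<odot>\<^sub>B y)"] conjI ballI)
    fix a assume a: "a \<in> mcomp A (\<kappa> n)"
    have "e {n} \<odot>\<^sub>B j a = j (e {n} \<odot>\<^sub>A a)" using gh_smult[OF j(1) e1(2)] carr a by simp
    thus "\<chi> (e {n} \<odot>\<^sub>B j a) \<longleftrightarrow> n \<in> F a"
     using \<chi>(1)[OF imageI[OF en(2)[OF zB(1) a], of j]] \<chi>j[OF carr(1)[OF en(2)[OF zB(1) a]]] F_smult[of a "{n}"] carr a by simp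
   next
    fix x y assume "x \<in> ?C" "y \<in> ?C"
    thus "\<chi> (e {n} \<odot>\<^sub>B (x \<oplus>\<^sub>B y)) \<longleftrightarrow> \<chi> (e {n} \<odot>\<^sub>B x) \<noteq> \<chi> (e {n} \<odot>\<^sub>B y)"
     using \<chi>(2) en(1)[OF _ zB(2)] e1(2) carr by (simp add: B.smult_r_distr)
   next
    fix r y assume r: "r \<in> fincofin" and y: "y \<in> ?C"
    have yB: "y \<in> carrier B" "e r \<in> carrier ?R" using carr y r by (simp_all add: bring_simps)
    have "e {n} \<odot>\<^sub>B (e r \<odot>\<^sub>B y) = e ({n} \<inter> r) \<odot>\<^sub>B y"
     using B.smult_assoc1[OF e1(2) yB(2,1), symmetric] r by (simp add: bring_simps)
    moreover have "e {} \<odot>\<^sub>B y = \<zero>\<^sub>B" using B.smult_l_null[OF yB(1)] by (simp add: bring_simps)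
    moreover have "\<not> \<chi> \<zero>\<^sub>B" using \<chi>(2)[OF zB(1) zB(1)] by simp
    ultimately show "\<chi> (e {n} \<odot>\<^sub>B (e r \<odot>\<^sub>B y)) \<longleftrightarrow> n \<in> r \<and> \<chi> (e {n} \<odot>\<^sub>B y)"
     by (cases "n \<in> r") simp_all
   qed
  qed
  from choice[OF allI[OF this]] obtain \<chi> where \<chi>: "\<forall>n. (\<forall>a\<in>mcomp A (\<kappa> n). \<chi> n (j a) \<longleftrightarrow> n \<in> F a) \<and>
    (\<forall>x\<in>mcomp B (\<kappa> n). \<forall>y\<in>mcomp B (\<kappa> n). \<chi> n (x \<oplus>\<^sub>B y) \<longleftrightarrow> \<chi> n x \<noteq> \<chi> n y) \<and>
    (\<forall>r\<in>fincofin. \<forall>y\<in>mcomp B (\<kappa> n). \<chi> n (e r \<odot>\<^sub>B y) \<longleftrightarrow> n \<in> r \<and> \<chi> n y)" ..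
  have \<chi>: "a \<in> mcomp A (\<kappa> n) ==> \<chi> n (j a) \<longleftrightarrow> n \<in> F a"
    "[|x \<in> mcomp B (\<kappa> n); y \<in> mcomp B (\<kappa> n)|] ==> \<chi> n (x \<oplus>\<^sub>B y) \<longleftrightarrow> \<chi> n x \<noteq> \<chi> n y"
    "[|r \<in> fincofin; y \<in> mcomp B (\<kappa> n)|] ==> \<chi> n (e r \<odot>\<^sub>B y) \<longleftrightarrow> n \<in> r \<and> \<chi> n y" for n a x y r
   using \<chi>[rule_format, of n] by simp_all
  let ?X = "\<lambda>g b. {n. \<kappa> n = g \<and> \<chi> n b}"
  \<comment> \<open>By injectivity of \<open>\<kappa>\<close> at most one \<open>n\<close> has
    degree \<open>g\<close>, so the extended values are finite sets. Without spreading over distinct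
    degrees this would fail.\<close>
  have fin: "finite (?X g b)" for g b
   using finite_vimageI[OF _ \<kappa>(2), of "{g}"] by (rule finite_subset[rotated]) auto
  have M: "e' (?X g b) \<in> carrier ?M" "e' (?X g b) \<in> mcomp ?M g" for g b
   using fin[of g b] by (auto simp: bmod_simps)
  obtain w where w: "w \<in> ghom G ?R B J" "\<And>g b. [|g \<in> carrier G; b \<in> mcomp B g|] ==> w b = u (e' (?X g b))"
  proof (rule gh_glue[OF B J(1), of "\<lambda>g b. u (e' (?X g b))"])
   fix g b assume "g \<in> carrier G" "b \<in> mcomp B g"
   thus "u (e' (?X g b)) \<in> mcomp J g" using gh_mcomp[OF uv(1)] M(2) by blast
  next
   fix g x y assume g: "g \<in> carrier G" and x: "x \<in> mcomp B g" and y: "y \<in> mcomp B g"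
   have "?X g (x \<oplus>\<^sub>B y) = (?X g x - ?X g y) \<union> (?X g y - ?X g x)"
   proof (rule Set.set_eqI)
    fix n show "n \<in> ?X g (x \<oplus>\<^sub>B y) \<longleftrightarrow> n \<in> (?X g x - ?X g y) \<union> (?X g y - ?X g x)"
     using \<chi>(2)[of x n y] x y by (cases "\<kappa> n = g") auto
   qed
   hence "e' (?X g (x \<oplus>\<^sub>B y)) = e' (?X g x) \<oplus>\<^bsub>?M\<^esub> e' (?X g y)"
    by (simp only: bmod_simps(5)[OF fin fin])
   thus "u (e' (?X g (x \<oplus>\<^sub>B y))) = u (e' (?X g x)) \<oplus>\<^sub>J u (e' (?X g y))"
    by (simp only: gh_add[OF uv(1) M(1) M(1)])
  next
   fix s g r y assume s: "s \<in> carrier G" and g: "g \<in> carrier G" and r: "r \<in> rcomp ?R s" and y: "y \<in> mcomp B g"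
   obtain r' where r': "r' \<in> fincofin" "r = e r'" "s \<noteq> \<one>\<^sub>G ==> r' = {}"
    using r by (auto simp: bring_simps split: if_splits)
   have rR: "r \<in> carrier ?R" using r' by (simp add: bring_simps)
   have "?X (s \<otimes>\<^sub>G g) (r \<odot>\<^sub>B y) = r' \<inter> ?X g y"
   proof (cases "s = \<one>\<^sub>G")
    case True
    thus ?thesis using \<chi>(3)[OF r'(1)] y r'(2) g by auto
   next
    case False
    have "r \<odot>\<^sub>B y = \<zero>\<^sub>B" using B.smult_l_null[OF B.MD.B_carr[OF y g]] r'(2) r'(3)[OF False] by (simp add: bring_simps)
    moreover have "\<not> \<chi> n \<zero>\<^sub>B" for n
     using \<chi>(2)[OF B.MD.B_zero[OF \<kappa>(1)] B.MD.B_zero[OF \<kappa>(1)], of n] by simp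
    ultimately show ?thesis using r'(3)[OF False] by simp
   qed
   hence "e' (?X (s \<otimes>\<^sub>G g) (r \<odot>\<^sub>B y)) = r \<odot>\<^bsub>?M\<^esub> e' (?X g y)"
    by (simp only: r'(2) bmod_simps(4)[OF r'(1) fin])
   thus "u (e' (?X (s \<otimes>\<^sub>G g) (r \<odot>\<^sub>B y))) = r \<odot>\<^sub>J u (e' (?X g y))"
    by (simp only: gh_smult[OF uv(1) rR M(1)])
  qed (use that in blast)
  have "w (j a) = f a" if a: "a \<in> carrier A" for a
  proof (rule A.MD.addhom_eqI[OF _ _ _ _ a])
   show "abelian_group J" using J(1) by (simp add: graded_module_def module_def)
   show "(\<lambda>a. w (j a)) \<in> addhom A J" "f \<in> addhom A J"
    using gh_comp[OF j(1) w(1)] f by (auto simp: graded_hom_def addhom_def)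
   fix g a assume g: "g \<in> carrier G" and a: "a \<in> mcomp A g"
   have aA: "a \<in> carrier A" using A.MD.B_carr[OF a g] .
   have "e' (F a) \<in> mcomp ?M g" using gh_mcomp[OF uv(2) g gh_mcomp[OF f g a]] vF[OF aA] by simp
   hence "F a \<subseteq> {n. \<kappa> n = g}" using F(1)[OF aA] by (auto simp: bmod_simps e'_eq)
   hence "?X g (j a) = F a" using \<chi>(1) a by auto
   thus "w (j a) = f a" using w(2)[OF g gh_mcomp[OF j(1) g a]] F(2)[OF aA] by simp
  qed
  thus ?thesis using w(1) by blast
 qed
 thus ?thesis unfolding injective_def using J(1) by blast
qed

end

end

text \<open>All degrees lie in the kernel, so after coarsening the inclusion of the ideal into the
  ring is homogeneous. An extension of the identity of the ideal would send one to a finite set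
  \<open>x\<close>; multiplying by the singleton of some \<open>n\<close> outside \<open>x\<close>
  gives a contradiction.\<close>

lemma (in coarsening) bmod_coarsen_not_injective:
 fixes J :: "('g,'r,'u) gmodule" and e :: "nat set => 'r" and e' :: "nat set => 'm"
 assumes R: "R = bring G e" and e: "inj_on e fincofin" and e': "inj_on e' fincofin"
  and \<kappa>: "\<And>n. \<kappa> n \<in> kernel G H \<psi>" "inj \<kappa>"
  and J: "gmod G R J" "giso G R (bmod e e' \<kappa>) J u v"
  and a: "inj (\<alpha> :: 'm => 'u)" and b: "inj (\<beta> :: (unit => 'r) => 'u)"
 shows "\<not> injective H cR (cM J)"
proof
 assume inj: "injective H cR (cM J)"
 let ?M = "bmod e e' \<kappa>"
 have \<kappa>G: "\<kappa> n \<in> carrier G" "\<psi> (\<kappa> n) = \<one>\<^sub>H" for n using \<kappa>(1)[of n] by (auto simp: kernel_def)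
 note G = G.comm_group_axioms
 note ms = bmod_simps[OF G e e' \<kappa>G(1) \<kappa>(2)] and rs = bring_simps[OF G e, folded R]
 have M: "gmod G R ?M" unfolding R by (rule bmod_graded[OF G e e' \<kappa>G(1) \<kappa>(2)])
 note eq = e'_eq[OF G e e' \<kappa>G(1) \<kappa>(2)]
 interpret HR: graded_ring H cR by (rule cR_graded)
 have d: "(\<one>\<^sub>H :: 'h) \<in> carrier H" by simp
 \<comment> \<open>The free module with one basis element in degree zero stands for the ring as a
   graded module over itself.\<close>
 let ?L = "freem H cR (UNIV :: unit set) (\<lambda>_. \<one>\<^sub>H)"
 have L: "gmod H cR ?L" by (rule HR.freem_graded) simp
 note uv = gisoD[OF giso_cM[OF M J]]
 define D where "D a = inv_into fincofin e' a" for a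
 have D: "D (e' x) = x" if "finite x" for x using that by (simp add: D_def inv_into_f_f[OF e'])
 let ?j = "\<lambda>a (_ :: unit). e (D a)"
 have sm: "r \<odot>\<^bsub>?L\<^esub> l = (\<lambda>i. r \<otimes>\<^sub>R l i)" for r l by (simp add: freem_simps(4))
 have j: "?j \<in> ghom H cR (cM ?M) ?L"
 proof (rule graded_homI0)
  fix h a assume h: "h \<in> carrier H" and a: "a \<in> mcomp (cM ?M) h"
  have a': "a \<in> carrier ?M" "\<And>g. [|g \<in> carrier G; \<psi> g \<noteq> h|] ==> gc G ?M a g = e' {}"
   using a unfolding cM_iff[OF M] by (simp_all add: ms(2))
  then obtain x where x: "finite x" "a = e' x" by (auto simp: ms(1))
  have "e x \<in> rcomp cR h"
  proof (cases "h = \<one>\<^sub>H")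
   case True
   have "e x \<in> rcomp R \<one>\<^sub>G" using x by (simp add: rs(4))
   thus ?thesis using rcomp_cR[of "e x" "\<one>\<^sub>G"] True psi_one by simp
  next
   case False
   have "n \<notin> x" for n
    using a'(2)[OF \<kappa>G(1)[of n]] False x bmod_gc[OF G e e' \<kappa>G(1) \<kappa>(2) x(1) \<kappa>G(1)] \<kappa>G(2) eq[of "x \<inter> {m. \<kappa> m = \<kappa> n}" "{}"]
    by auto
   hence "x = {}" by blast
   thus ?thesis using HR.RD.B_zero[OF h] by (simp add: rs(3))
  qed
  thus "?j a \<in> mcomp ?L h" using x h D by (simp add: freem_simps rs(1))
 qed (auto simp: ms rs D freem_simps)
 have j_inj: "inj_on ?j (carrier (cM ?M))"
  by (auto simp: ms D fun_eq_iff inj_on_eq_iff[OF e] intro!: inj_onI)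
 obtain w where w: "w \<in> ghom H cR ?L (cM J)" "\<And>x. x \<in> carrier (cM ?M) ==> w (?j x) = u x"
  using injective_extend[OF inj cM_graded(1)[OF M] L j j_inj uv(1) inj_on_subset[OF a subset_UNIV]
   inj_on_subset[OF b subset_UNIV]] by blast
 let ?one = "\<lambda>_::unit. e UNIV"
 have one: "?one \<in> carrier ?L" by (simp add: freem_simps rs(1))
 have "v (w ?one) \<in> carrier ?M" using gh_closed[OF uv(2) gh_closed[OF w(1) one]] by simp
 then obtain x where x: "finite x" "v (w ?one) = e' x" by (auto simp: ms(1))
 obtain n where n: "n \<notin> x" using ex_new_if_finite[OF infinite_UNIV_nat x(1)] by blast
 have r: "e {n} \<in> carrier cR" by (simp add: rs(1))
 have "?j (e' {n}) = e {n} \<odot>\<^bsub>?L\<^esub> ?one" by (simp add: sm D rs)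
 hence "w (?j (e' {n})) = e {n} \<odot>\<^bsub>cM J\<^esub> w ?one" using gh_smult[OF w(1) r one] by simp
 moreover have n': "e' {n} \<in> carrier (cM ?M)" by (simp add: ms(1))
 ultimately have "u (e' {n}) = e {n} \<odot>\<^bsub>cM J\<^esub> w ?one" using w(2) by simp
 hence "e' {n} = e {n} \<odot>\<^bsub>?M\<^esub> e' x"
  using uv(3)[OF n'] gh_smult[OF uv(2) r gh_closed[OF w(1) one]] x by simp
 thus False using n x eq[of "{n}" "{}"] by (simp add: ms)
qed

section \<open>Comparison of dimensions\<close>

context module_class
begin

lemma has_lres_ldim:
 fixes X :: "('g,'r,'u) gmodule"
 assumes M: "gmod G R M" and X: "gmod G R X" and i: "giso G R M X u v"
 shows "has_lres n M \<longleftrightarrow> ldim G R Q n X"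
 using has_lres_giso[OF M X i] has_lres_giso[OF X M giso_sym[OF i]] has_lres_iff[OF X] by blast

lemma has_rres_rdim:
 fixes X :: "('g,'r,'u) gmodule"
 assumes M: "gmod G R M" and X: "gmod G R X" and i: "giso G R M X u v"
 shows "has_rres n M \<longleftrightarrow> rdim G R Q n X"
 using has_rres_giso[OF M X i] has_rres_giso[OF X M giso_sym[OF i]] has_rres_iff[OF X] by blast

end

lemma inj_pair: "inj l ==> inj (\<lambda>(a, b). l [a, b])"
 by (auto intro!: injI dest: injD)

context coarsening
begin

text \<open>A resolution of the coarsened module need not descend. Instead, \<open>X\<close> is
  covered by a module whose coarsening is projective; dimension shifting over \<open>H\<close>
  lowers the bound for the coarsened kernel, and the induction hypothesis applies to the kernel
  itself.\<close>

lemma ldim_coarsen: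
 fixes X :: "('g,'r,'u) gmodule" and Q :: "('g,'r,'u) gmodule => bool" and Q' :: "('h,'r,'u) gmodule => bool"
 assumes Q': "left_class H cR Q' en"
  and pres: "\<And>X. Q X ==> Q' (cM X)" and refl: "\<And>X. [|gmod G R X; Q' (cM X)|] ==> Q X"
  and cover: "\<And>X :: ('g,'r,'u) gmodule. gmod G R X ==> \<exists>F p.
   Q F \<and> gmod G R F \<and> projective H cR (cM F) \<and>
   p \<in> ghom G R F X \<and> p ` carrier F = carrier X"
  and X: "gmod G R X"
 shows "ldim G R Q n X \<longleftrightarrow> ldim H cR Q' n (cM X)"
 using X
proof (induction n arbitrary: X)
 case 0
 thus ?case using pres refl by auto
next
 case (Suc n)
 show ?case
 proof
  assume "ldim G R Q (Suc n) X"
  then obtain K P f p where e: "short_exact G R K P X f p" "Q P" "ldim G R Q n K" by auto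
  hence "ldim H cR Q' n (cM K)" using Suc.IH[OF short_exactD(1)[OF e(1)]] by blast
  thus "ldim H cR Q' (Suc n) (cM X)" using short_exact_cM[OF e(1)] pres[OF e(2)] by auto
 next
  assume d: "ldim H cR Q' (Suc n) (cM X)"
  obtain F p where F: "Q F" "gmod G R F" "projective H cR (cM F)"
   "p \<in> ghom G R F X" "p ` carrier F = carrier X" using cover[OF Suc.prems] by blast
  let ?Z = "submod F (a_kernel F X p)"
  have e: "short_exact G R ?Z F X (\<lambda>x. x) p" by (rule short_exact_of_epi[OF F(2) Suc.prems F(4,5)])
  have "ldim H cR Q' n (cM ?Z)"
   by (rule left_class.ldim_shift[OF Q' short_exact_cM[OF e] pres[OF F(1)] F(3) d])
  hence "ldim G R Q n ?Z" using Suc.IH[OF short_exactD(1)[OF e]] by blast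
  thus "ldim G R Q (Suc n) X" using e F(1) by auto
 qed
qed

lemma has_lres_coarsen:
 fixes M :: "('g,'r,'m) gmodule" and Q :: "('g,'r,'u) gmodule => bool" and Q' :: "('h,'r,'u) gmodule => bool"
 assumes Q: "module_class G R Q" and Q': "left_class H cR Q' en"
  and pres: "\<And>X. Q X ==> Q' (cM X)" and refl: "\<And>X. [|gmod G R X; Q' (cM X)|] ==> Q X"
  and cover: "\<And>X :: ('g,'r,'u) gmodule. gmod G R X ==> \<exists>F p.
   Q F \<and> gmod G R F \<and> projective H cR (cM F) \<and>
   p \<in> ghom G R F X \<and> p ` carrier F = carrier X"
  and M: "gmod G R M" and \<iota>: "inj (\<iota> :: 'm => 'u)"
 shows "module_class.has_lres G R Q n M \<longleftrightarrow> module_class.has_lres H cR Q' n (cM M)"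
proof -
 have \<iota>': "inj_on \<iota> (carrier M)" using inj_on_subset[OF \<iota>] by blast
 obtain X :: "('g,'r,'u) gmodule" and v where X: "gmod G R X" "giso G R M X \<iota> v"
  using transport[OF M \<iota>'] by blast
 have Qc: "module_class H cR Q'" using Q' by (simp add: left_class_def)
 show ?thesis
  unfolding module_class.has_lres_ldim[OF Q M X]
   module_class.has_lres_ldim[OF Qc cM_graded(1)[OF M] cM_graded(1)[OF X(1)] giso_cM[OF M X]]
  by (rule ldim_coarsen[OF Q' pres refl cover X(1)])
qed

context
 fixes le :: "'u list => 'u" and \<rho> :: "'r => 'u"
 assumes le: "inj le" and \<rho>: "inj \<rho>"
begin

lemma projective_coarsen_any:
 fixes P :: "('g,'r,'u) gmodule"
 assumes P: "projective G R P"
 shows "projective H cR (cM P)"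
proof -
 obtain S and \<kappa> :: "'g => 'u" where S: "stable S" "inj_on \<kappa> S" "\<And>g. [|g \<in> carrier G; g \<notin> S|] ==> mcomp P g = {\<zero>\<^sub>P}"
  using stable_small_exists[OF le \<rho> projective_graded[OF P] G.one_closed] by metis
 show ?thesis
 proof (rule projective_coarsen[OF P S(1,3)])
  fix A :: "('h,'r,'u) gmodule" assume "gmod H cR A"
  thus "\<exists>\<phi> :: ('g => 'u) => 'u. inj_on \<phi> (carrier (cind S A))"
   by (rule cind_small[OF le S(1) _ inj_on_subset[OF S(2)]]) blast
 qed
qed

lemma left_class_projective: "left_class G R (projective G R :: ('g,'r,'u) gmodule => bool) (\<lambda>(a, b). le [a, b])"
 by (intro left_class.intro left_class_axioms.intro module_class_projective inj_pair le)
  (erule (3) projective_sum projective_kernel | erule (2) projective_kernel)+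

lemma left_class_flat: "left_class G R (flat G R :: ('g,'r,'u) gmodule => bool) (\<lambda>(a, b). le [a, b])"
proof (intro left_class.intro left_class_axioms.intro module_class_flat inj_pair le)
 fix Z P P' :: "('g,'r,'u) gmodule" and f g
 assume *: "short_exact G R Z P P' f g" "flat G R P" "flat G R P'"
 show "flat G R Z"
 proof (rule flat_kernel[OF *])
  fix A :: "('g,'r,'u) gmodule" assume "gmod G R A"
  thus "\<exists>(L :: ('g,'r,'u) gmodule) q. flat G R L \<and> q \<in> ghom G R L A \<and> q ` carrier L = carrier A"
   using free_cover[OF le \<rho>] by metis
 qed
qed (erule (3) flat_sum)

end

lemma rdim_coarsen:
 fixes X :: "('g,'r,'u) gmodule" and le :: "'u list => 'u"
 assumes le: "inj le" and fib: "\<And>h. finite {g \<in> carrier G. \<psi> g = h}"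
 shows "rdim G R (injective G R) n X ==> rdim H cR (injective H cR) n (cM X)"
proof (induction n arbitrary: X)
 case 0
 thus ?case using injective_coarsen[OF _ fib cind_small_finite[OF le fib]] by simp
next
 case (Suc n)
 from Suc.prems(1) obtain J Y :: "('g,'r,'u) gmodule" and f p where e: "short_exact G R X J Y f p" "injective G R J" "rdim G R (injective G R) n Y" by auto
 have "injective H cR (cM J)" by (rule injective_coarsen[OF e(2) fib cind_small_finite[OF le fib]])
 thus ?case using short_exact_cM[OF e(1)] Suc.IH[OF e(3)] by auto
qed

text \<open>The adjoint is exact and preserves injectives, so it maps a right resolution to one of
  the same length. Each module of families is copied into \<open>'u\<close> separately, hence the
  isomorphism in the statement.\<close>

lemma rdim_cind:
 fixes X :: "('g,'r,'u) gmodule" and N :: "('h,'r,'u) gmodule" and le :: "'u list => 'u"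
 assumes le: "inj le" and fib: "\<And>h. finite {g \<in> carrier G. \<psi> g = h}"
 shows "[|rdim H cR (injective H cR) n N; gmod G R X; giso G R (cind (carrier G) N) X u v|]
  ==> rdim G R (injective G R) n X"
proof (induction n arbitrary: N X u v)
 case 0
 thus ?case using injective_cind by auto
next
 case (Suc n)
 from Suc.prems(1) obtain J Y :: "('h,'r,'u) gmodule" and f p where e: "short_exact H cR N J Y f p" "injective H cR J" "rdim H cR (injective H cR) n Y" by auto
 have tr: "\<exists>(Z :: ('g,'r,'u) gmodule) \<phi> v. gmod G R Z \<and> giso G R (cind (carrier G) C) Z \<phi> v"
  if C: "gmod H cR C" for C :: "('h,'r,'u) gmodule"
 proof -
  obtain \<phi> :: "('g => 'u) => 'u" where "inj_on \<phi> (carrier (cind (carrier G) C))"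
   using cind_small_finite[OF le fib C] by blast
  from transport[OF cind_graded[OF stable_UNIV C] this] show ?thesis by blast
 qed
 obtain J' :: "('g,'r,'u) gmodule" and \<phi> v where J': "gmod G R J'" "giso G R (cind (carrier G) J) J' \<phi> v"
  using tr[OF short_exactD(2)[OF e(1)]] by blast
 obtain Y' :: "('g,'r,'u) gmodule" and \<phi>' v' where Y': "gmod G R Y'" "giso G R (cind (carrier G) Y) Y' \<phi>' v'"
  using tr[OF short_exactD(3)[OF e(1)]] by blast
 note short_exact_giso[OF cind_short_exact[OF stable_UNIV e(1)] Suc.prems(2,3) J' Y']
 thus ?case using injective_cind[OF e(2) J'] Suc.IH[OF e(3) Y'] by auto
qed

lemma has_rres_coarsen:
 fixes M :: "('g,'r,'m) gmodule" and le :: "'u list => 'u"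
 assumes le: "inj le" and fib: "\<And>h. finite {g \<in> carrier G. \<psi> g = h}"
  and M: "gmod G R M" and \<iota>: "inj (\<iota> :: 'm => 'u)"
 shows "module_class.has_rres G R (injective G R :: ('g,'r,'u) gmodule => bool) n M
  \<longleftrightarrow> module_class.has_rres H cR (injective H cR :: ('h,'r,'u) gmodule => bool) n (cM M)"
proof -
 have \<iota>': "inj_on \<iota> (carrier M)" using inj_on_subset[OF \<iota>] by blast
 obtain X :: "('g,'r,'u) gmodule" and v where X: "gmod G R X" "giso G R M X \<iota> v"
  using transport[OF M \<iota>'] by blast
 have "rdim G R (injective G R) n X" if d: "rdim H cR (injective H cR) n (cM X)"
 proof -
  obtain \<phi> :: "('g => 'u) => 'u" where \<phi>: "inj_on \<phi> (carrier (cind (carrier G) (cM X)))"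
   using cind_small_finite[OF le fib cM_graded(1)[OF X(1)]] by blast
  obtain Z :: "('g,'r,'u) gmodule" and v where Z: "gmod G R Z" "giso G R (cind (carrier G) (cM X)) Z \<phi> v"
   using transport[OF cind_graded[OF stable_UNIV cM_graded(1)[OF X(1)]] \<phi>] by blast
  obtain i r where ir: "i \<in> ghom G R X (cind (carrier G) (cM X))"
   "r \<in> ghom G R (cind (carrier G) (cM X)) X" "\<And>x. x \<in> carrier X ==> r (i x) = x"
   using coarsen_retract[OF X(1)] by blast
  show ?thesis
   by (rule rdim_retract[OF inj_pair[OF le] rdim_cind[OF le fib d Z] X(1)
      gh_comp[OF ir(1) gisoD(1)[OF Z(2)]] gh_comp[OF gisoD(2)[OF Z(2)] ir(2)]])
    (simp add: gisoD(3)[OF Z(2)] gh_closed[OF ir(1)] ir(3))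
 qed
 thus ?thesis
  unfolding module_class.has_rres_rdim[OF module_class_injective M X]
   module_class.has_rres_rdim[OF module_class_injective cM_graded(1)[OF M] cM_graded(1)[OF X(1)] giso_cM[OF M X]]
  using rdim_coarsen[OF le fib] by blast
qed

end

text \<open>The entry \<open>(undefined, prod_encode (0, length xs), undefined)\<close> records the length.\<close>

definition list_code :: "('r,'m) univ list => ('r,'m) univ" where
 "list_code xs = {(r, prod_encode (Suc i, n), m) | r i n m. i < length xs \<and> (r, n, m) \<in> xs ! i}
   \<union> {(undefined, prod_encode (0, length xs), undefined)}"

text \<open>Members of the list entry at \<open>i\<close> are tagged with \<open>Suc i\<close>,
  which leaves the tag zero for the length. Codes for lists are all that is needed to code pairs,
  words and finitely supported families.\<close>

lemma inj_list_code: "inj list_code"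
proof (rule injI)
 fix xs ys :: "('a,'b) univ list" assume eq: "list_code xs = list_code ys"
 have len: "(undefined, prod_encode (0, l), undefined) \<in> list_code xs \<longleftrightarrow> l = length xs"
  and ent: "(r, prod_encode (Suc i, n), m) \<in> list_code xs \<longleftrightarrow> i < length xs \<and> (r, n, m) \<in> xs ! i"
  for l r i n m and xs :: "('a,'b) univ list"
  by (auto simp: list_code_def)
 show "xs = ys"
 proof (rule nth_equalityI)
  show l: "length xs = length ys" using len[of _ xs] len[of _ ys] eq by metis
  fix i assume i: "i < length xs"
  have "(r, n, m) \<in> xs ! i \<longleftrightarrow> (r, n, m) \<in> ys ! i" for r n m
   using ent[of r i n m xs] ent[of r i n m ys] eq i l by simp
  thus "xs ! i = ys ! i" by auto
 qed
qed

section \<open>The dimensions of the statement\<close>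

lemma dimensions_has_res:
 "dp G R M = Inf {enat n | n. module_class.has_lres G R (projective G R :: ('g,'r,('r,'m) univ) gmodule => bool) n M}"
 "dpl G R M = Inf {enat n | n. module_class.has_lres G R (flat G R :: ('g,'r,('r,'m) univ) gmodule => bool) n M}"
 "di G R M = Inf {enat n | n. module_class.has_rres G R (injective G R :: ('g,'r,('r,'m) univ) gmodule => bool) n M}"
 for M :: "('g,'r,'m) gmodule"
 unfolding dp_def dpl_def di_def module_class.has_lres_def[OF module_class_projective]
  module_class.has_lres_def[OF module_class_flat] module_class.has_rres_def[OF module_class_injective] by (rule refl)+

lemma univ_embeddings:
 "inj (\<lambda>r. {(r, 0, undefined)} :: ('r,'m) univ)" "inj (\<lambda>m. {(undefined, 0, m)} :: ('r,'m) univ)"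
 by (auto intro: injI)

lemma (in coarsening) left_dimensions_coarsen:
 fixes M :: "('g,'r,'m) gmodule"
 assumes M: "gmod G R M"
 shows "dp G R M = dp H cR (cM M)" "dpl G R M = dpl H cR (cM M)"
proof -
 interpret HR: graded_ring H cR by (rule cR_graded)
 \<comment> \<open>Coarsening along the identity of \<open>H\<close> makes the closure properties,
   which are stated for the source of a coarsening, available for \<open>H\<close> and the coarsened
   ring.\<close>
 interpret HC: coarsening H cR H "\<lambda>h. h"
  by unfold_locales (auto simp: epi_def hom_def)
 note le = inj_list_code and \<rho> = univ_embeddings(1)
 have cover: "\<exists>(F :: ('g,'r,('r,'m) univ) gmodule) p. Q F \<and> gmod G R F \<and> projective H cR (cM F) \<and>
   p \<in> ghom G R F X \<and> p ` carrier F = carrier X"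
  if X: "gmod G R X" and Q: "Q = projective G R \<or> Q = flat G R"
  for X :: "('g,'r,('r,'m) univ) gmodule" and Q
 proof -
  obtain F :: "('g,'r,('r,'m) univ) gmodule" and p where F: "projective G R F" "flat G R F"
   "p \<in> ghom G R F X" "p ` carrier F = carrier X"
   using free_cover[OF le \<rho> X] by blast
  have "projective H cR (cM F)" by (rule projective_coarsen_any[OF le \<rho> F(1)])
  thus ?thesis using F Q projective_graded[OF F(1)] by blast
 qed
 have "module_class.has_lres G R (projective G R :: ('g,'r,('r,'m) univ) gmodule => bool) n M
   \<longleftrightarrow> module_class.has_lres H cR (projective H cR :: ('h,'r,('r,'m) univ) gmodule => bool) n (cM M)" for n
  by (rule has_lres_coarsen[OF module_class_projective HC.left_class_projective[OF le \<rho>]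
     projective_coarsen_any[OF le \<rho>] projective_reflect cover M univ_embeddings(2)]) simp_all
 thus "dp G R M = dp H cR (cM M)" by (simp only: dimensions_has_res)
 have "module_class.has_lres G R (flat G R :: ('g,'r,('r,'m) univ) gmodule => bool) n M
   \<longleftrightarrow> module_class.has_lres H cR (flat H cR :: ('h,'r,('r,'m) univ) gmodule => bool) n (cM M)" for n
  by (rule has_lres_coarsen[OF module_class_flat HC.left_class_flat[OF le \<rho>]
     flat_coarsen[OF le \<rho>] flat_reflect cover M univ_embeddings(2)]) simp_all
 thus "dpl G R M = dpl H cR (cM M)" by (simp only: dimensions_has_res)
qed

lemma (in coarsening) di_coarsen:
 fixes M :: "('g,'r,'m) gmodule"
 assumes M: "gmod G R M" and fin: "finite (kernel G H \<psi>)"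
 shows "di G R M = di H cR (cM M)"
proof -
 have fib: "finite {g \<in> carrier G. \<psi> g = h}" for h
 proof (cases "\<exists>k\<in>carrier G. \<psi> k = h")
  case True
  then obtain k where k: "k \<in> carrier G" "\<psi> k = h" by blast
  have "{g \<in> carrier G. \<psi> g = h} \<subseteq> (\<lambda>x. x \<otimes>\<^sub>G k) ` kernel G H \<psi>"
  proof
   fix g assume "g \<in> {g \<in> carrier G. \<psi> g = h}"
   hence g: "g \<in> carrier G" "\<psi> g = h" by auto
   have "g \<otimes>\<^sub>G inv\<^bsub>G\<^esub> k \<in> kernel G H \<psi>" using g k psi_closed[OF k(1)] by (simp add: kernel_def psi_mult psi_inv)
   moreover have "g = (g \<otimes>\<^sub>G inv\<^bsub>G\<^esub> k) \<otimes>\<^sub>G k" using g k by (simp add: G.m_assoc)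
   ultimately show "g \<in> (\<lambda>x. x \<otimes>\<^sub>G k) ` kernel G H \<psi>" by (rule image_eqI[rotated])
  qed
  thus ?thesis using fin finite_subset by blast
 next
  case False
  thus ?thesis by (metis (mono_tags, lifting) empty_Collect_eq finite.emptyI)
 qed
 have "module_class.has_rres G R (injective G R :: ('g,'r,('r,'m) univ) gmodule => bool) n M
   \<longleftrightarrow> module_class.has_rres H cR (injective H cR :: ('h,'r,('r,'m) univ) gmodule => bool) n (cM M)" for n
  by (rule has_rres_coarsen[OF inj_list_code fib M univ_embeddings(2)])
 thus ?thesis by (simp only: dimensions_has_res)
qed

lemma di_eq_0_iff:
 fixes X :: "('g,'r,('r,'m) univ) gmodule" and M :: "('g,'r,'m) gmodule"
 assumes M: "gmod G R M" and X: "gmod G R X" "giso G R M X u v"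
 shows "di G R M = 0 \<longleftrightarrow> injective G R X"
proof -
 let ?D = "{enat n | n. module_class.has_rres G R (injective G R :: ('g,'r,('r,'m) univ) gmodule => bool) n M}"
 have "di G R M = 0 \<longleftrightarrow> 0 \<in> ?D"
 proof
  assume 0: "di G R M = 0"
  \<comment> \<open>The infimum of the empty set is infinite, so the set is nonempty and the infimum
    is attained as its least element.\<close>
  hence "?D \<noteq> {}" unfolding dimensions_has_res by (auto simp: Inf_enat_def split: if_splits)
  then obtain n where "n \<in> ?D" by (meson ex_in_conv)
  hence "(LEAST x. x \<in> ?D) \<in> ?D" by (rule LeastI)
  hence "Inf ?D \<in> ?D" unfolding Inf_enat_def by (simp only: if_not_P[OF \<open>?D \<noteq> {}\<close>])
  thus "0 \<in> ?D" using 0 unfolding dimensions_has_res by simp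
 next
  assume "0 \<in> ?D"
  from Inf_lower[OF this] show "di G R M = 0" unfolding dimensions_has_res by (simp only: le_zero_eq)
 qed
 also have "\<dots> \<longleftrightarrow> module_class.has_rres G R (injective G R :: ('g,'r,('r,'m) univ) gmodule => bool) 0 M"
  by (auto simp: zero_enat_def)
 also have "\<dots> \<longleftrightarrow> injective G R X"
  using module_class.has_rres_rdim[OF module_class_injective M X] by simp
 finally show ?thesis .
qed

text \<open>The module is injective, so its injective dimension is zero, while that of its
  coarsening is not. The ring depends on neither \<open>H\<close> nor \<psi>; the kernel enters
  through the degrees \<open>\<kappa> n\<close>.\<close>

lemma di_coarsen_counterexample:
 fixes G :: "('g,'x) monoid_scheme" and H :: "('h,'y) monoid_scheme"
 assumes GH: "comm_group G" "comm_group H" "\<psi> \<in> epi G H" and inf: "infinite (kernel G H \<psi>)"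
  and r: "infinite (UNIV :: 'r set)" and m: "infinite (UNIV :: 'm set)"
 shows "\<exists>(R :: ('g,'r) gring) (M :: ('g,'r,'m) gmodule). graded_ring G R \<and> gmod G R M \<and>
  di G R M \<noteq> di H (coarsen_ring G \<psi> R) (coarsen_module G \<psi> M)"
proof -
 obtain e :: "nat set => 'r" where e: "inj_on e fincofin" using fincofin_embedding[OF r] by blast
 obtain e' :: "nat set => 'm" where e': "inj_on e' fincofin" using fincofin_embedding[OF m] by blast
 obtain \<kappa> :: "nat => 'g" where "inj \<kappa>" "range \<kappa> \<subseteq> kernel G H \<psi>"
  using infinite_countable_subset[OF inf] by blast
 hence \<kappa>: "\<And>n. \<kappa> n \<in> kernel G H \<psi>" "inj \<kappa>" by auto
 hence \<kappa>G: "\<And>n. \<kappa> n \<in> carrier G" by (auto simp: kernel_def)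
 let ?R = "bring G e" let ?M = "bmod e e' \<kappa>"
 note R = bring_graded[OF GH(1) e] and M = bmod_graded[OF GH(1) e e' \<kappa>G \<kappa>(2)]
 let ?\<iota> = "\<lambda>m. {(undefined, 0, m)} :: ('r,'m) univ"
 have \<iota>: "inj_on ?\<iota> (carrier ?M)" by (rule inj_on_subset[OF univ_embeddings(2) subset_UNIV])
 obtain J :: "('g,'r,('r,'m) univ) gmodule" and v where J: "gmod G ?R J" "giso G ?R ?M J ?\<iota> v"
  using transport[OF M \<iota>] by blast
 interpret coarsening G ?R H \<psi>
  by (intro coarsening.intro coarsening_axioms.intro R GH)
 have "di G ?R ?M = 0"
  using bmod_injective[OF GH(1) e e' \<kappa>G \<kappa>(2) J] di_eq_0_iff[OF M J] by blast
 \<comment> \<open>The ring as a free module on one generator consists of functions on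
   \<open>unit\<close>; this map makes it a test object.\<close>
 moreover have "inj (\<lambda>f :: unit => 'r. {(f (), 0, undefined)} :: ('r,'m) univ)" by (auto intro!: injI)
 from bmod_coarsen_not_injective[OF refl e e' \<kappa> J univ_embeddings(2) this]
 have "di H cR (cM ?M) \<noteq> 0"
  using di_eq_0_iff[OF cM_graded(1)[OF M] cM_graded(1)[OF J(1)] giso_cM[OF M J]] by blast
 ultimately have "di G ?R ?M \<noteq> di H cR (cM ?M)" by metis
 thus ?thesis using R M by blast
qed

text \<open>The infiniteness of \<open>'r\<close> and \<open>'m\<close> gives room for the countable
  counterexample. If \<open>'r\<close> had one element, all rings and modules in question would be
  zero and injective dimensions would agree for every kernel.\<close>

theorem mainTheorem13:
  fixes G :: "('g, 'x) monoid_scheme" and H :: "('h, 'y) monoid_scheme" and \<psi> :: "'g \<Rightarrow> 'h"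
  assumes "comm_group G" and "comm_group H" and "\<psi> \<in> epi G H"
  shows
    "(\<forall>(R :: ('g, 'r) gring) (M :: ('g, 'r, 'm) gmodule).
        graded_ring G R \<longrightarrow> graded_module G R M \<longrightarrow>
          dp G R M = dp H (coarsen_ring G \<psi> R) (coarsen_module G \<psi> M) \<and>
          dpl G R M = dpl H (coarsen_ring G \<psi> R) (coarsen_module G \<psi> M)) \<and>
     (infinite (UNIV :: 'r set) \<longrightarrow> infinite (UNIV :: 'm set) \<longrightarrow>
        (finite (kernel G H \<psi>) \<longleftrightarrow>
           (\<forall>(R :: ('g, 'r) gring) (M :: ('g, 'r, 'm) gmodule).
              graded_ring G R \<longrightarrow> graded_module G R M \<longrightarrow>
                di G R M = di H (coarsen_ring G \<psi> R) (coarsen_module G \<psi> M))))"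
proof -
 have c: "coarsening G R H \<psi>" if "graded_ring G R" for R :: "('g, 'r) gring"
  by (intro coarsening.intro coarsening_axioms.intro that assms)
 show ?thesis
  using coarsening.left_dimensions_coarsen[OF c] coarsening.di_coarsen[OF c] di_coarsen_counterexample[OF assms]
  by blast
qed

end
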